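(* Let $A$ be a central simple algebra of degree $d$ with center $C$, let $\sigma$ be an automorphism of $A$ of finite order $n$ modulo inner automorphisms such that $\sigma|_C$ has order $n$, let $F=C\cap{\rm Fix}(\sigma)$, and let $u\in A^\times$ satisfy $\sigma^n(z)=uzu^{-1}$ for all $z\in A$ and $\sigma(u)=u$. Put $R=A[t;\sigma]$ and $x=u^{-1}t^n$, and let $N$ be the reduced norm of the central simple $F(x)$-algebra $A(t;\sigma)$. Assume that $A$ has a subfield $E$ of degree $d$ over $C$. Then for every $f\in A[t;\sigma]$: (i) $N(f)\in F[x]$; (ii) $f$ divides $N(f)$ in $R$.
   Context: $A[t;\sigma]$ is the skew polynomial ring of polynomials $\sum a_it^i$, $a_i\in A$, with $ta=\sigma(a)t$ for $a\in A$. Its center is $F[x]$ with $x=u^{-1}t^n$ a commutative indeterminate over $A$. The ring of central quotients $A(t;\sigma)=\{f/g : f\in A[t;\sigma],\ 0\ne g\in F[x]\}$ is a central simple algebra of degree $dn$ over $F(x)$, and $N$ denotes its reduced norm (with values in $F(x)$). ${\rm Fix}(\sigma)=\{a\in A:\sigma(a)=a\}$. "$f$ divides $N(f)$ in $R$" means $N(f)=gf=fg$ for some $g\in R$. *)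

theory Defs
  imports "Jordan_Normal_Form.Matrix" "HOL-Combinatorics.Permutations" "HOL-Algebra.Algebra"
begin

definition ring_center :: "('a, 'm) ring_scheme \<Rightarrow> 'a set" where
  "ring_center A = {z \<in> carrier A. \<forall>a \<in> carrier A. z \<otimes>\<^bsub>A\<^esub> a = a \<otimes>\<^bsub>A\<^esub> z}"

definition simple_ring :: "('a, 'm) ring_scheme \<Rightarrow> bool" where
  "simple_ring A \<longleftrightarrow> ring A \<and> \<one>\<^bsub>A\<^esub> \<noteq> \<zero>\<^bsub>A\<^esub> \<and>
     (\<forall>I. ideal I A \<longrightarrow> I = {\<zero>\<^bsub>A\<^esub>} \<or> I = carrier A)"

text \<open>The degree of a central simple algebra is the square root of its dimension over its center.\<close>

definition central_simple_algebra :: "('a, 'm) ring_scheme \<Rightarrow> 'a set \<Rightarrow> nat \<Rightarrow> bool" where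
  "central_simple_algebra A C d \<longleftrightarrow>
     simple_ring A \<and> C = ring_center A \<and> subfield C A \<and> ring.dimension A (d ^ 2) C (carrier A)"

definition inner_on :: "('a, 'm) ring_scheme \<Rightarrow> ('a \<Rightarrow> 'a) \<Rightarrow> bool" where
  "inner_on A \<tau> \<longleftrightarrow>
     (\<exists>v \<in> Units A. \<forall>a \<in> carrier A. \<tau> a = v \<otimes>\<^bsub>A\<^esub> a \<otimes>\<^bsub>A\<^esub> inv\<^bsub>A\<^esub> v)"

definition least_positive :: "(nat \<Rightarrow> bool) \<Rightarrow> nat \<Rightarrow> bool" where
  "least_positive P n \<longleftrightarrow> 0 < n \<and> P n \<and> (\<forall>k. 0 < k \<and> k < n \<longrightarrow> \<not> P k)"

definition order_mod_inner :: "('a, 'm) ring_scheme \<Rightarrow> ('a \<Rightarrow> 'a) \<Rightarrow> nat \<Rightarrow> bool" where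
  "order_mod_inner A \<sigma> n \<longleftrightarrow> least_positive (\<lambda>k. inner_on A (\<sigma> ^^ k)) n"

definition order_on :: "'a set \<Rightarrow> ('a \<Rightarrow> 'a) \<Rightarrow> nat \<Rightarrow> bool" where
  "order_on C \<sigma> n \<longleftrightarrow> least_positive (\<lambda>k. \<forall>c \<in> C. (\<sigma> ^^ k) c = c) n"

definition Fix :: "('a, 'm) ring_scheme \<Rightarrow> ('a \<Rightarrow> 'a) \<Rightarrow> 'a set" where
  "Fix A \<sigma> = {a \<in> carrier A. \<sigma> a = a}"

text \<open>
  A skew polynomial is its coefficient function, coefficients standing to the left of powers
  of \<open>t\<close>.  The rule \<open>t a = \<sigma>(a) t\<close> gives
  \<open>(a t^i) (b t^j) = a \<sigma>^i(b) t^(i+j)\<close>.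
\<close>

definition skew_poly_ring :: "('a, 'm) ring_scheme \<Rightarrow> ('a \<Rightarrow> 'a) \<Rightarrow> (nat \<Rightarrow> 'a) ring" where
  "skew_poly_ring A \<sigma> = \<lparr>
     carrier = up A,
     monoid.mult = (\<lambda>f g k. \<Oplus>\<^bsub>A\<^esub>i \<in> {..k}. f i \<otimes>\<^bsub>A\<^esub> (\<sigma> ^^ i) (g (k - i))),
     one = (\<lambda>i. if i = 0 then \<one>\<^bsub>A\<^esub> else \<zero>\<^bsub>A\<^esub>),
     ring.zero = (\<lambda>i. \<zero>\<^bsub>A\<^esub>),
     add = (\<lambda>f g i. f i \<oplus>\<^bsub>A\<^esub> g i)\<rparr>"

text \<open>The skew polynomial \<open>a t^k\<close>.\<close>

definition skew_monom :: "('a, 'm) ring_scheme \<Rightarrow> 'a \<Rightarrow> nat \<Rightarrow> (nat \<Rightarrow> 'a)" where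
  "skew_monom A a k = (\<lambda>i. if i = k then a else \<zero>\<^bsub>A\<^esub>)"

text \<open>
  The ring of quotients \<open>f/g\<close> with \<open>f\<close> in \<open>R\<close> and \<open>g\<close> a nonzero element of \<open>Z\<close>.
  This is meant for a central subring \<open>Z\<close> whose nonzero elements are regular in \<open>R\<close> and
  closed under multiplication; then \<open>f/g = h/k\<close> iff \<open>f k = h g\<close>, all the sets united in the
  definitions of the two operations coincide, and \<open>f \<mapsto> f/1\<close> embeds \<open>R\<close>.
\<close>

definition quot :: "('r, 'm) ring_scheme \<Rightarrow> 'r set \<Rightarrow> 'r \<Rightarrow> 'r \<Rightarrow> ('r \<times> 'r) set" where
  "quot R Z f g = {(h, k). h \<in> carrier R \<and> k \<in> Z - {\<zero>\<^bsub>R\<^esub>} \<and> f \<otimes>\<^bsub>R\<^esub> k = h \<otimes>\<^bsub>R\<^esub> g}"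

definition central_quot_ring :: "('r, 'm) ring_scheme \<Rightarrow> 'r set \<Rightarrow> ('r \<times> 'r) set ring" where
  "central_quot_ring R Z = \<lparr>
     carrier = {quot R Z f g | f g. f \<in> carrier R \<and> g \<in> Z - {\<zero>\<^bsub>R\<^esub>}},
     monoid.mult = (\<lambda>U V. \<Union>(f, g) \<in> U. \<Union>(h, k) \<in> V. quot R Z (f \<otimes>\<^bsub>R\<^esub> h) (g \<otimes>\<^bsub>R\<^esub> k)),
     one = quot R Z \<one>\<^bsub>R\<^esub> \<one>\<^bsub>R\<^esub>,
     ring.zero = quot R Z \<zero>\<^bsub>R\<^esub> \<one>\<^bsub>R\<^esub>,
     add = (\<lambda>U V. \<Union>(f, g) \<in> U. \<Union>(h, k) \<in> V.
              quot R Z (f \<otimes>\<^bsub>R\<^esub> k \<oplus>\<^bsub>R\<^esub> h \<otimes>\<^bsub>R\<^esub> g) (g \<otimes>\<^bsub>R\<^esub> k))\<rparr>"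

definition central_quot_field :: "('r, 'm) ring_scheme \<Rightarrow> 'r set \<Rightarrow> ('r \<times> 'r) set set" where
  "central_quot_field R Z = {quot R Z p q | p q. p \<in> Z \<and> q \<in> Z - {\<zero>\<^bsub>R\<^esub>}}"

text \<open>
  Matrices over a ring given by a record: the type of matrices is the library's, but the library
  operations on it are tied to type classes.
\<close>

definition matrix_ring :: "('l, 'm) ring_scheme \<Rightarrow> nat \<Rightarrow> 'l mat ring" where
  "matrix_ring L m = \<lparr>
     carrier = {M \<in> carrier_mat m m. elements_mat M \<subseteq> carrier L},
     monoid.mult = (\<lambda>M N. mat m m (\<lambda>(i, j). \<Oplus>\<^bsub>L\<^esub>k \<in> {..<m}. M $$ (i, k) \<otimes>\<^bsub>L\<^esub> N $$ (k, j))),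
     one = mat m m (\<lambda>(i, j). if i = j then \<one>\<^bsub>L\<^esub> else \<zero>\<^bsub>L\<^esub>),
     ring.zero = mat m m (\<lambda>(i, j). \<zero>\<^bsub>L\<^esub>),
     add = (\<lambda>M N. mat m m (\<lambda>(i, j). M $$ (i, j) \<oplus>\<^bsub>L\<^esub> N $$ (i, j)))\<rparr>"

definition scalar_matrix :: "('l, 'm) ring_scheme \<Rightarrow> nat \<Rightarrow> 'l \<Rightarrow> 'l mat" where
  "scalar_matrix L m c = mat m m (\<lambda>(i, j). if i = j then c else \<zero>\<^bsub>L\<^esub>)"

definition determinant :: "('l, 'm) ring_scheme \<Rightarrow> nat \<Rightarrow> 'l mat \<Rightarrow> 'l" where
  "determinant L m M = (\<Oplus>\<^bsub>L\<^esub>p \<in> {p. p permutes {..<m}}.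
     (if evenperm p then (\<Otimes>\<^bsub>L\<^esub>i \<in> {..<m}. M $$ (i, p i))
      else \<ominus>\<^bsub>L\<^esub> (\<Otimes>\<^bsub>L\<^esub>i \<in> {..<m}. M $$ (i, p i))))"

definition ring_basis :: "('b, 'm) ring_scheme \<Rightarrow> 'b set \<Rightarrow> 'b list \<Rightarrow> bool" where
  "ring_basis B K bs \<longleftrightarrow>
     set bs \<subseteq> carrier B \<and> ring.independent B K bs \<and> ring.Span B K bs = carrier B"

text \<open>
  A splitting of a finite-dimensional \<open>K\<close>-algebra \<open>B\<close>: a field extension \<open>\<iota> : K \<rightarrow> L\<close> and a
  homomorphism \<open>\<phi>\<close> of \<open>K\<close>-algebras from \<open>B\<close> to the \<open>m \<times> m\<close> matrices over \<open>L\<close> whose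
  \<open>L\<close>-linear extension to the tensor product of \<open>B\<close> and \<open>L\<close> over \<open>K\<close> is bijective.  A
  \<open>K\<close>-basis \<open>bs\<close> of \<open>B\<close> is an \<open>L\<close>-basis of that tensor product, so bijectivity says that
  \<open>\<phi>\<close> maps \<open>bs\<close> to an \<open>L\<close>-basis of the matrix ring.
\<close>

definition is_splitting ::
  "('b, 'm) ring_scheme \<Rightarrow> 'b set \<Rightarrow> ('l, 'n) ring_scheme \<Rightarrow> nat \<Rightarrow> ('b \<Rightarrow> 'l) \<Rightarrow> ('b \<Rightarrow> 'l mat) \<Rightarrow> bool"
  where
  "is_splitting B K L m \<iota> \<phi> \<longleftrightarrow>
     field L \<and>
     \<iota> \<in> ring_hom (B\<lparr>carrier := K\<rparr>) L \<and>
     \<phi> \<in> ring_hom B (matrix_ring L m) \<and>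
     (\<forall>k \<in> K. \<phi> k = scalar_matrix L m (\<iota> k)) \<and>
     (\<exists>bs. ring_basis B K bs \<and>
           ring_basis (matrix_ring L m) (scalar_matrix L m ` carrier L) (map \<phi> bs))"

text \<open>
  The reduced norm of \<open>b\<close> is the element of \<open>K\<close> which becomes the determinant of \<open>b\<close> under a
  splitting.  The splitting fields range over the type of \<open>B\<close>, which loses nothing: a maximal
  subfield of the division algebra underlying a central simple algebra \<open>B\<close> splits \<open>B\<close> and embeds
  in \<open>B\<close>; and the value does not depend on the splitting.
\<close>

definition reduced_norm :: "('b, 'm) ring_scheme \<Rightarrow> 'b set \<Rightarrow> 'b \<Rightarrow> 'b" where
  "reduced_norm B K b = (THE c. c \<in> K \<and>
     (\<exists>(L :: 'b ring) m \<iota> \<phi>. is_splitting B K L m \<iota> \<phi> \<and> determinant L m (\<phi> b) = \<iota> c))"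

end

theory Submission
  imports Defs "HOL-Library.Poly_Mapping" "Jordan_Normal_Form.Determinant"
begin

text \<open>
  \<open>A(t;\<sigma>)\<close> is a left vector space of dimension \<open>dn\<close> over its subfield \<open>E(x)\<close>, and letting
  the algebra act by right multiplication splits it.  The elements of \<open>R\<close> act by matrices with
  entries in \<open>E[x]\<close>, because \<open>R\<close> is a free left module over \<open>E[x]\<close> with the same basis;
  so their determinants lie in \<open>E[x]\<close>.  The determinant \<open>\<delta>\<close> of \<open>f\<close> is central: compare the splitting
  with itself, as two representations over the commutative ring which the scalars and the
  matrices of \<open>E(x)\<close> generate in their double centralizer; a Skolem-Noether argument for determinants then
  shows that \<open>\<delta>\<close> acts as the scalar \<open>\<delta>\<close>.  The same argument shows that every other
  splitting gives the same value.  Hence \<open>\<delta> = N(f)\<close> lies in \<open>F[x]\<close>.  Finally, multiplying the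
  coordinates of \<open>1\<close> by the adjugate of the matrix of \<open>f\<close> produces \<open>g\<close> in \<open>R\<close> with
  \<open>g f = \<delta>\<close>.
\<close>

section \<open>Determinants over commutative ring records\<close>

text \<open>Two splitting fields of the quotient ring have a tensor product over \<open>F(x)\<close>
  that is merely a commutative ring, in general with zero divisors. This is why determinants are
  compared over arbitrary commutative rings, and why the Skolem-Noether argument must do without an
  invertible intertwiner: many possibly singular ones together replace it. That \<open>E(x)\<close>
  splits is a count. The quotient ring has dimension \<open>(dn)^2\<close> over \<open>F(x)\<close>,
  so the matrices of a basis \<open>b_k\<close> need only be independent over \<open>E(x)\<close>. A
  relation among them says that \<open>y \<mapsto> \<Sum> e_k y b_k\<close> vanishes on
  \<open>R\<close>; at \<open>y = v t^r\<close>, comparing coefficients leaves relations in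
  \<open>A\<close>, one for each \<open>v\<close> and each \<open>r < n\<close>. Simplicity of
  \<open>A\<close> resolves the dependence on \<open>v\<close>; that the powers of
  \<open>\<sigma>\<close> below \<open>n\<close> differ on \<open>C\<close> resolves the dependence
  on \<open>r\<close>. The field \<open>E(x)\<close> lies inside the quotient ring, hence in the
  type over which the definition of the reduced norm lets its splitting fields range.\<close>

lemma matrix_ring_carrier:
  "M \<in> carrier (matrix_ring L m) \<longleftrightarrow>
     M \<in> carrier_mat m m \<and> (\<forall>i<m. \<forall>j<m. M $$ (i, j) \<in> carrier L)"
  by (force simp: matrix_ring_def elements_mat_def)

text \<open>Multisets form the free commutative monoid, so products of ring elements extend to a
  homomorphism on monomials. The evaluation of the free commutative ring is built on it.\<close>

lemma (in cring) mult_eval_exists: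
  "\<exists>\<mu> :: 'a multiset \<Rightarrow> 'a. (\<forall>M. \<mu> M \<in> carrier R) \<and> \<mu> {#} = \<one> \<and>
     (\<forall>M N. \<mu> (M + N) = \<mu> M \<otimes> \<mu> N) \<and> (\<forall>a \<in> carrier R. \<mu> {#a#} = a)"
proof -
  \<comment> \<open>Elements outside the carrier count as one, and \<open>s\<close> does nothing
    outside the carrier. This makes \<open>s\<close> commute with itself on the whole type, as a
    fold over multisets demands.\<close>
  define c where "c x = (if x \<in> carrier R then x else \<one>)" for x
  define s where "s x y = (if y \<in> carrier R then c x \<otimes> y else y)" for x y
  have c: "c x \<in> carrier R" for x by (simp add: c_def)
  interpret comp_fun_commute s
    by standard (auto simp: fun_eq_iff s_def c m_lcomm)
  define \<mu> where "\<mu> M = fold_mset s \<one> M" for M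
  have 0: "\<mu> {#} = \<one>" by (simp add: \<mu>_def)
  have S: "\<mu> (add_mset x M) = s x (\<mu> M)" for x M by (simp add: \<mu>_def)
  have cl: "\<mu> M \<in> carrier R" for M
    by (induction M) (auto simp: 0 S s_def c)
  have S': "\<mu> (add_mset x M) = c x \<otimes> \<mu> M" for x M by (simp add: S s_def cl)
  have "\<mu> (M + N) = \<mu> M \<otimes> \<mu> N" for M N
    by (induction M) (auto simp: 0 S' cl c m_assoc)
  moreover have "\<mu> {#a#} = a" if "a \<in> carrier R" for a
    using that by (simp add: S' 0 c_def)
  ultimately show ?thesis using cl 0 by blast
qed

text \<open>
  Determinants in the library are tied to a type class.  Every commutative ring given by a record
  is a homomorphic image of the free commutative ring on its elements, whose polynomials are the
  finitely supported integer functions on multisets, and \<open>vr\<close> picks preimages; this carries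
  the library's determinant identities over to records.
\<close>

locale comm_ring_image = cring R for R (structure) +
  fixes h :: "'c :: comm_ring_1 \<Rightarrow> 'a" and vr :: "'a \<Rightarrow> 'c"
  assumes h_closed [simp]: "h p \<in> carrier R"
    and h_one [simp]: "h 1 = \<one>"
    and h_add: "h (p + q) = h p \<oplus> h q"
    and h_mult: "h (p * q) = h p \<otimes> h q"
    and h_vr [simp]: "a \<in> carrier R \<Longrightarrow> h (vr a) = a"

lemma (in cring) free_comm_ring_image:
  obtains h :: "('a multiset \<Rightarrow>\<^sub>0 int) \<Rightarrow> 'a" and vr where "comm_ring_image R h vr"
proof -
  obtain \<mu> :: "'a multiset \<Rightarrow> 'a" where \<mu>: "\<And>M. \<mu> M \<in> carrier R" "\<mu> {#} = \<one>"
    "\<And>M N. \<mu> (M + N) = \<mu> M \<otimes> \<mu> N" "\<And>a. a \<in> carrier R \<Longrightarrow> \<mu> {#a#} = a"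
    using mult_eval_exists by blast
  have cg: "comm_group (add_monoid R)" by (rule a_comm_group)
  \<comment> \<open>Additively the polynomial ring is the free abelian group on the monomials, so
    \<open>\<mu>\<close> extends to it. Multiplicativity remains: first for one monomial against
    everything, then in general.\<close>
  obtain h where h: "h \<in> hom (free_Abelian_group UNIV) (add_monoid R)"
    and hs: "\<And>x. h (frag_of x) = \<mu> x"
    using comm_group.free_Abelian_group_universal[OF cg, of \<mu> UNIV] \<mu>(1) by auto
  have cl: "h p \<in> carrier R" for p using h by (auto simp: hom_def)
  have add: "h (p + q) = h p \<oplus> h q" for p q using h by (auto simp: hom_def)
  have h0: "h 0 = \<zero>"
    using add[of 0 0] cl[of 0] by (metis add.r_cancel_one' add_0_right)
  have neg: "h (p - q) = h p \<ominus> h q" for p q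
    using add[of "p - q" q] cl
    by (simp add: a_minus_def) (metis abelian_group.minus_add abelian_group_axioms add.inv_closed add.m_assoc add.m_comm r_neg2)
  have m1: "h (frag_of x * q) = \<mu> x \<otimes> h q" for x q
  proof (induction q rule: frag_induction[OF subset_UNIV])
    case (2 y)
    have "frag_of x * frag_of y = frag_of (x + y)"
      by (simp add: mult_single)
    then show ?case by (simp add: hs \<mu>)
  next
    case (3 a b)
    then show ?case by (simp add: right_diff_distrib neg a_minus_def cl \<mu> r_distr r_minus)
  qed (auto simp: h0 \<mu>)
  have mult: "h (p * q) = h p \<otimes> h q" for p q
  proof (induction p rule: frag_induction[OF subset_UNIV])
    case (3 a b)
    then show ?case by (simp add: left_diff_distrib neg a_minus_def cl l_distr l_minus)
  qed (auto simp: h0 m1 hs cl)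
  have one: "h 1 = \<one>" using hs[of "{#}"] \<mu>(2) by (simp only: single_one)
  have "comm_ring_image R h (\<lambda>a. frag_of {#a#})"
    by unfold_locales (auto simp: cl add mult one hs \<mu>)
  then show ?thesis by (rule that)
qed

context comm_ring_image
begin

lemma h_zero [simp]: "h 0 = \<zero>"
  using h_add[of 0 0] h_closed[of 0] by (metis add.r_cancel_one' add_0_right)

lemma h_uminus: "h (- p) = \<ominus> h p"
  using h_add[of "- p" p] h_closed by (simp add: minus_equality)

lemma h_sum: "finite I \<Longrightarrow> h (sum f I) = (\<Oplus>i\<in>I. h (f i))"
  by (induction I rule: finite_induct) (auto simp: h_add)

lemma h_prod: "finite I \<Longrightarrow> h (prod f I) = (\<Otimes>i\<in>I. h (f i))"
  by (induction I rule: finite_induct) (auto simp: h_mult)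

lemma h_det:
  assumes "A \<in> carrier_mat m m"
  shows "h (det A) = determinant R m (map_mat h A)"
proof -
  have "h (signof p * (\<Prod>i = 0..<m. A $$ (i, p i))) =
     (if evenperm p then \<Otimes>i\<in>{..<m}. map_mat h A $$ (i, p i)
      else \<ominus> (\<Otimes>i\<in>{..<m}. map_mat h A $$ (i, p i)))" if "p permutes {..<m}" for p
  proof -
    have "(\<Otimes>i\<in>{..<m}. h (A $$ (i, p i))) = (\<Otimes>i\<in>{..<m}. map_mat h A $$ (i, p i))"
      using that assms permutes_in_image[OF that] by (intro finprod_cong') auto
    then show ?thesis
      by (simp add: sign_def h_uminus h_prod atLeast0LessThan)
  qed
  then show ?thesis
    using assms unfolding det_def'[OF assms] determinant_def
    by (subst h_sum) (auto simp: finite_permutations atLeast0LessThan intro!: finsum_cong')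
qed

lemma map_h_mult:
  assumes "A \<in> carrier_mat m m" "B \<in> carrier_mat m m"
  shows "map_mat h (A * B) = map_mat h A \<otimes>\<^bsub>matrix_ring R m\<^esub> map_mat h B"
  using assms
  by (intro eq_matI) (auto simp: matrix_ring_def scalar_prod_def h_sum h_mult atLeast0LessThan intro!: finsum_cong')

lemma map_h_add:
  assumes "A \<in> carrier_mat m m" "B \<in> carrier_mat m m"
  shows "map_mat h (A + B) = map_mat h A \<oplus>\<^bsub>matrix_ring R m\<^esub> map_mat h B"
  using assms by (intro eq_matI) (auto simp: matrix_ring_def h_add)

lemma map_h_one: "map_mat h (1\<^sub>m m) = \<one>\<^bsub>matrix_ring R m\<^esub>"
  by (intro eq_matI) (auto simp: matrix_ring_def)

lemma map_h_zero: "map_mat h (0\<^sub>m m m) = \<zero>\<^bsub>matrix_ring R m\<^esub>"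
  by (intro eq_matI) (auto simp: matrix_ring_def)

lemma map_h_scalar: "map_mat h (c \<cdot>\<^sub>m 1\<^sub>m m) = scalar_matrix R m (h c)"
  by (intro eq_matI) (auto simp: scalar_matrix_def)

lemma map_h_closed:
  "A \<in> carrier_mat m m \<Longrightarrow> map_mat h A \<in> carrier (matrix_ring R m)"
  by (auto simp: matrix_ring_carrier)

lemma map_h_lift:
  assumes "M \<in> carrier (matrix_ring R m)"
  shows "map_mat h (map_mat vr M) = M" "map_mat vr M \<in> carrier_mat m m"
proof -
  have M: "M \<in> carrier_mat m m" "\<And>i j. i < m \<Longrightarrow> j < m \<Longrightarrow> M $$ (i, j) \<in> carrier R"
    using assms by (simp_all add: matrix_ring_carrier)
  then show "map_mat vr M \<in> carrier_mat m m" by simp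
  show "map_mat h (map_mat vr M) = M"
    using M by (intro eq_matI) simp_all
qed

end

lemma matrix_ring_lift:
  assumes "M \<in> carrier (matrix_ring R m)" "comm_ring_image R h vr"
  obtains M' where "M' \<in> carrier_mat m m" "M = map_mat h M'"
  using comm_ring_image.map_h_lift[OF assms(2,1)] by metis

text \<open>Each matrix over the record is the entrywise image of a matrix over a type-class ring,
  and \<open>h\<close> respects the operations, so the axioms are inherited instead of being
  recomputed from sums.\<close>

lemma (in cring) matrix_ring_is_ring: "ring (matrix_ring R m)"
proof -
  obtain h :: "('a multiset \<Rightarrow>\<^sub>0 int) \<Rightarrow> 'a" and vr where "comm_ring_image R h vr"
    by (rule free_comm_ring_image)
  then interpret comm_ring_image R h vr .
  note L = matrix_ring_lift[OF _ comm_ring_image_axioms]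
  note S = map_h_mult[symmetric] map_h_add[symmetric] map_h_one[symmetric] map_h_zero[symmetric] map_h_closed
  show ?thesis
  proof (rule ringI)
    show "abelian_group (matrix_ring R m)"
    proof (rule abelian_groupI)
      fix x assume "x \<in> carrier (matrix_ring R m)"
      then obtain x' where "x' \<in> carrier_mat m m" "x = map_mat h x'" by (rule L)
      then show "\<exists>y\<in>carrier (matrix_ring R m). y \<oplus>\<^bsub>matrix_ring R m\<^esub> x = \<zero>\<^bsub>matrix_ring R m\<^esub>"
        by (intro bexI[of _ "map_mat h (- x')"]) (auto simp: S uminus_l_inv_mat)
    qed (auto elim!: L simp: S intro!: arg_cong[of _ _ "map_mat h"] comm_add_mat simp: assoc_add_mat)
    show "monoid (matrix_ring R m)"
      by (rule monoidI) (auto elim!: L simp: S assoc_mult_mat)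
  qed (auto elim!: L simp: S add_mult_distrib_mat mult_add_distrib_mat)
qed

lemma (in cring) determinant_closed:
  assumes "M \<in> carrier (matrix_ring R m)"
  shows "determinant R m M \<in> carrier R"
proof -
  obtain h :: "('a multiset \<Rightarrow>\<^sub>0 int) \<Rightarrow> 'a" and vr where "comm_ring_image R h vr"
    by (rule free_comm_ring_image)
  then interpret comm_ring_image R h vr .
  obtain M' where "M' \<in> carrier_mat m m" "M = map_mat h M'"
    by (rule matrix_ring_lift[OF assms comm_ring_image_axioms])
  then show ?thesis by (simp add: h_det[symmetric])
qed

lemma (in cring) determinant_mult:
  assumes "M \<in> carrier (matrix_ring R m)" "N \<in> carrier (matrix_ring R m)"
  shows "determinant R m (M \<otimes>\<^bsub>matrix_ring R m\<^esub> N) = determinant R m M \<otimes> determinant R m N"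
proof -
  obtain h :: "('a multiset \<Rightarrow>\<^sub>0 int) \<Rightarrow> 'a" and vr where "comm_ring_image R h vr"
    by (rule free_comm_ring_image)
  then interpret comm_ring_image R h vr .
  obtain M' N' where "M' \<in> carrier_mat m m" "M = map_mat h M'" "N' \<in> carrier_mat m m" "N = map_mat h N'"
    using matrix_ring_lift[OF _ comm_ring_image_axioms] assms by metis
  then show ?thesis
    by (simp add: h_det[symmetric] map_h_mult[symmetric] det_mult h_mult)
qed

lemma (in cring) determinant_scalar:
  assumes "c \<in> carrier R"
  shows "determinant R m (scalar_matrix R m c) = c [^] m"
proof -
  obtain h :: "('a multiset \<Rightarrow>\<^sub>0 int) \<Rightarrow> 'a" and vr where "comm_ring_image R h vr"
    by (rule free_comm_ring_image)
  then interpret comm_ring_image R h vr .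
  have "scalar_matrix R m c = map_mat h (vr c \<cdot>\<^sub>m 1\<^sub>m m)"
    using assms by (simp add: map_h_scalar)
  moreover have "h (a ^ k) = h a [^] k" for a and k :: nat
    by (induction k) (auto simp: h_mult m_comm)
  ultimately show ?thesis using assms by (simp add: h_det[symmetric])
qed

lemma (in cring) adjugate_exists:
  assumes "M \<in> carrier (matrix_ring R m)"
  obtains N where "N \<in> carrier (matrix_ring R m)"
    "M \<otimes>\<^bsub>matrix_ring R m\<^esub> N = scalar_matrix R m (determinant R m M)"
    "N \<otimes>\<^bsub>matrix_ring R m\<^esub> M = scalar_matrix R m (determinant R m M)"
proof -
  obtain h :: "('a multiset \<Rightarrow>\<^sub>0 int) \<Rightarrow> 'a" and vr where "comm_ring_image R h vr"
    by (rule free_comm_ring_image)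
  then interpret comm_ring_image R h vr .
  obtain M' where M': "M' \<in> carrier_mat m m" "M = map_mat h M'"
    by (rule matrix_ring_lift[OF assms comm_ring_image_axioms])
  note a = adj_mat[OF M'(1)]
  show ?thesis
    by (rule that[of "map_mat h (adj_mat M')"])
      (use a M' in \<open>simp_all add: map_h_closed map_h_mult[symmetric] h_det[symmetric] map_h_scalar\<close>)
qed

text \<open>The point is the order of the quantifiers: the cofactors of the last row depend on the
  other rows only, so the determinant is a fixed linear form in the last row, which can be chosen
  afterwards.\<close>

lemma (in cring) laplace_last_row:
  assumes M: "\<And>i j. i \<le> k \<Longrightarrow> j \<le> k \<Longrightarrow> M i j \<in> carrier R"
  obtains \<gamma> where "\<And>j. \<gamma> j \<in> carrier R" "\<gamma> k = determinant R k (mat k k (\<lambda>(i, j). M i j))"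
    "\<And>r. (\<And>j. j \<le> k \<Longrightarrow> r j \<in> carrier R) \<Longrightarrow>
       determinant R (Suc k) (mat (Suc k) (Suc k) (\<lambda>(i, j). if i = k then r j else M i j)) =
       (\<Oplus>j\<in>{..k}. r j \<otimes> \<gamma> j)"
proof -
  obtain h :: "('a multiset \<Rightarrow>\<^sub>0 int) \<Rightarrow> 'a" and vr where "comm_ring_image R h vr"
    by (rule free_comm_ring_image)
  then interpret comm_ring_image R h vr .
  define T where "T r = mat (Suc k) (Suc k) (\<lambda>(i, j). if i = k then vr (r j) else vr (M i j))" for r
  define \<gamma> where "\<gamma> r j = h (cofactor (T r) k j)" for r j
  \<comment> \<open>Deleting row \<open>k\<close> erases the only place where \<open>s\<close>
    enters. Any row may thus be used to compute the cofactors; below it is the zero row.\<close>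
  have ind: "cofactor (T s) k j = cofactor (T s') k j" for s s' j
    unfolding cofactor_def mat_delete_def
    by (intro arg_cong2[of _ _ _ _ "(*)"] refl arg_cong[of _ _ det] eq_matI) (auto simp: T_def)
  show ?thesis
  proof (rule that[of "\<gamma> (\<lambda>_. \<zero>)"])
    have "mat_delete (T r) k k = mat k k (\<lambda>(i, j). vr (M i j))" for r
      by (intro eq_matI) (auto simp: mat_delete_def T_def)
    moreover have "map_mat h (mat k k (\<lambda>(i, j). vr (M i j))) = mat k k (\<lambda>(i, j). M i j)"
      using M by (intro eq_matI) auto
    ultimately show "\<gamma> (\<lambda>_. \<zero>) k = determinant R k (mat k k (\<lambda>(i, j). M i j))"
      by (simp add: \<gamma>_def cofactor_def h_det[of _ k])
  next
    fix r assume r: "\<And>j. j \<le> k \<Longrightarrow> r j \<in> carrier R"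
    have T: "T r \<in> carrier_mat (Suc k) (Suc k)" by (simp add: T_def)
    have Tk: "T r $$ (k, j) = vr (r j)" if "j \<le> k" for j using that by (simp add: T_def)
    have "map_mat h (T r) = mat (Suc k) (Suc k) (\<lambda>(i, j). if i = k then r j else M i j)"
      using M r by (intro eq_matI) (auto simp: T_def)
    then have "determinant R (Suc k) (mat (Suc k) (Suc k) (\<lambda>(i, j). if i = k then r j else M i j))
       = h (det (T r))" by (simp add: h_det[OF T])
    also have "\<dots> = h (\<Sum>j<Suc k. T r $$ (k, j) * cofactor (T r) k j)"
      by (subst laplace_expansion_row[OF T, of k]) auto
    also have "\<dots> = (\<Oplus>j\<in>{..k}. r j \<otimes> \<gamma> (\<lambda>_. \<zero>) j)"
      unfolding lessThan_Suc_atMost using r Tk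
      by (subst h_sum) (auto simp: h_mult \<gamma>_def ind[of r _ "\<lambda>_. \<zero>"] intro!: finsum_cong')
    finally show "determinant R (Suc k) (mat (Suc k) (Suc k) (\<lambda>(i, j). if i = k then r j else M i j))
       = (\<Oplus>j\<in>{..k}. r j \<otimes> \<gamma> (\<lambda>_. \<zero>) j)" .
  qed (simp add: \<gamma>_def)
qed

section \<open>Transport along ring homomorphisms, matrix entries and scalar matrices\<close>

lemma ring_hom_finsum:
  assumes "ring R" "ring S" "f \<in> ring_hom R S" "\<And>x. x \<in> I \<Longrightarrow> g x \<in> carrier R"
  shows "f (\<Oplus>\<^bsub>R\<^esub>x\<in>I. g x) = (\<Oplus>\<^bsub>S\<^esub>x\<in>I. f (g x))"
proof -
  interpret ring_hom_ring R S f
    using assms by (intro ring_hom_ringI2)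
  have "f (\<Oplus>\<^bsub>R\<^esub>x\<in>I. g x) = (\<Oplus>\<^bsub>S\<^esub>x\<in>I. (f \<circ> g) x)"
    using assms(4) by (subst hom_finsum) (auto simp: comp_def)
  then show ?thesis by (simp add: comp_def)
qed

lemma ring_hom_finprod:
  assumes "cring R" "cring S" "f \<in> ring_hom R S" "\<And>x. x \<in> I \<Longrightarrow> g x \<in> carrier R"
  shows "f (\<Otimes>\<^bsub>R\<^esub>x\<in>I. g x) = (\<Otimes>\<^bsub>S\<^esub>x\<in>I. f (g x))"
proof -
  interpret ring_hom_cring R S f
    using assms by (simp add: ring_hom_cring_def ring_hom_cring_axioms_def)
  have "f (\<Otimes>\<^bsub>R\<^esub>x\<in>I. g x) = (\<Otimes>\<^bsub>S\<^esub>x\<in>I. (f \<circ> g) x)"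
    using assms(4) by (subst hom_finprod) (auto simp: comp_def)
  then show ?thesis by (simp add: comp_def)
qed

lemma ring_hom_a_inv:
  assumes "ring R" "ring S" "f \<in> ring_hom R S" "x \<in> carrier R"
  shows "f (\<ominus>\<^bsub>R\<^esub> x) = \<ominus>\<^bsub>S\<^esub> f x"
proof -
  interpret ring_hom_ring R S f
    using assms by (intro ring_hom_ringI2)
  show ?thesis using assms(4) by simp
qed

lemma determinant_hom:
  assumes L: "cring L" and S: "cring S" and f: "f \<in> ring_hom L S"
    and M: "M \<in> carrier (matrix_ring L m)"
  shows "f (determinant L m M) = determinant S m (map_mat f M)"
proof -
  interpret L: cring L by fact
  interpret S: cring S by fact
  note fc = ring_hom_closed[OF f]
  have M: "dim_row M = m" "dim_col M = m" "\<And>i j. i < m \<Longrightarrow> j < m \<Longrightarrow> M $$ (i, j) \<in> carrier L"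
    using M by (auto simp: matrix_ring_carrier)
  define t where "t p = (\<Otimes>\<^bsub>L\<^esub>i\<in>{..<m}. M $$ (i, p i))" for p
  define t' where "t' p = (\<Otimes>\<^bsub>S\<^esub>i\<in>{..<m}. map_mat f M $$ (i, p i))" for p
  have tc: "t p \<in> carrier L" if "p permutes {..<m}" for p
    unfolding t_def using M permutes_in_image[OF that] by (intro L.finprod_closed) auto
  have tt: "f (t p) = t' p" if "p permutes {..<m}" for p
  proof -
    note P = permutes_in_image[OF that]
    have "f (t p) = (\<Otimes>\<^bsub>S\<^esub>i\<in>{..<m}. f (M $$ (i, p i)))"
      unfolding t_def using M P by (intro ring_hom_finprod[OF L S f]) auto
    also have "\<dots> = t' p"
      unfolding t'_def using M P fc by (intro S.finprod_cong') auto
    finally show ?thesis .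
  qed
  have "f (determinant L m M) = (\<Oplus>\<^bsub>S\<^esub>p\<in>{p. p permutes {..<m}}. f (if evenperm p then t p else \<ominus>\<^bsub>L\<^esub> t p))"
    unfolding determinant_def t_def[symmetric]
    by (rule ring_hom_finsum[OF L.ring_axioms S.ring_axioms f]) (auto simp: tc)
  also have "\<dots> = (\<Oplus>\<^bsub>S\<^esub>p\<in>{p. p permutes {..<m}}. if evenperm p then t' p else \<ominus>\<^bsub>S\<^esub> t' p)"
    using fc[OF tc] by (intro S.finsum_cong')
      (auto simp: ring_hom_a_inv[OF L.ring_axioms S.ring_axioms f] tc simp flip: tt)
  finally show ?thesis unfolding t'_def determinant_def[of S] .
qed

lemma matrix_ring_mult_entry:
  "i < m \<Longrightarrow> j < m \<Longrightarrow>
     (M \<otimes>\<^bsub>matrix_ring L m\<^esub> N) $$ (i, j) = (\<Oplus>\<^bsub>L\<^esub>k\<in>{..<m}. M $$ (i, k) \<otimes>\<^bsub>L\<^esub> N $$ (k, j))"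
  by (simp add: matrix_ring_def)

lemma matrix_ring_entry:
  assumes "M \<in> carrier (matrix_ring L m)" "i < m" "j < m"
  shows "M $$ (i, j) \<in> carrier L"
  using assms by (simp add: matrix_ring_carrier)

lemma matrix_ring_eqI:
  assumes "M \<in> carrier (matrix_ring L m)" "N \<in> carrier (matrix_ring L m)"
    "\<And>i j. i < m \<Longrightarrow> j < m \<Longrightarrow> M $$ (i, j) = N $$ (i, j)"
  shows "M = N"
  using assms by (intro eq_matI) (auto simp: matrix_ring_carrier)

lemma matrix_ring_hom:
  assumes L: "ring L" and S: "ring S" and f: "f \<in> ring_hom L S"
  shows "map_mat f \<in> ring_hom (matrix_ring L m) (matrix_ring S m)"
proof -
  interpret L: ring L by fact
  interpret S: ring S by fact
  note fc = ring_hom_closed[OF f]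
  have f0: "f \<zero>\<^bsub>L\<^esub> = \<zero>\<^bsub>S\<^esub>" by (rule ring_hom_zero[OF f L S])
  show ?thesis
  proof (rule ring_hom_memI)
    fix M N assume MN: "M \<in> carrier (matrix_ring L m)" "N \<in> carrier (matrix_ring L m)"
    note e = matrix_ring_entry[OF MN(1)] matrix_ring_entry[OF MN(2)]
    have d: "dim_row M = m" "dim_col M = m" "dim_row N = m" "dim_col N = m"
      using MN by (auto simp: matrix_ring_carrier)
    show "map_mat f (M \<otimes>\<^bsub>matrix_ring L m\<^esub> N) = map_mat f M \<otimes>\<^bsub>matrix_ring S m\<^esub> map_mat f N"
    proof (rule eq_matI)
      fix i j assume "i < dim_row (map_mat f M \<otimes>\<^bsub>matrix_ring S m\<^esub> map_mat f N)"
        "j < dim_col (map_mat f M \<otimes>\<^bsub>matrix_ring S m\<^esub> map_mat f N)"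
      then have ij: "i < m" "j < m" by (simp_all add: matrix_ring_def)
      have "f (\<Oplus>\<^bsub>L\<^esub>k\<in>{..<m}. M $$ (i, k) \<otimes>\<^bsub>L\<^esub> N $$ (k, j)) =
        (\<Oplus>\<^bsub>S\<^esub>k\<in>{..<m}. f (M $$ (i, k) \<otimes>\<^bsub>L\<^esub> N $$ (k, j)))"
        using e ij by (intro ring_hom_finsum[OF L S f]) auto
      also have "\<dots> = (\<Oplus>\<^bsub>S\<^esub>k\<in>{..<m}. map_mat f M $$ (i, k) \<otimes>\<^bsub>S\<^esub> map_mat f N $$ (k, j))"
        using e ij fc d by (intro S.finsum_cong') (auto simp: ring_hom_mult[OF f])
      finally show "map_mat f (M \<otimes>\<^bsub>matrix_ring L m\<^esub> N) $$ (i, j) =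
          (map_mat f M \<otimes>\<^bsub>matrix_ring S m\<^esub> map_mat f N) $$ (i, j)"
        using ij by (simp add: matrix_ring_def)
    qed (auto simp: matrix_ring_def)
    show "map_mat f (M \<oplus>\<^bsub>matrix_ring L m\<^esub> N) = map_mat f M \<oplus>\<^bsub>matrix_ring S m\<^esub> map_mat f N"
      using e d by (intro eq_matI) (auto simp: matrix_ring_def ring_hom_add[OF f])
  qed (auto simp: matrix_ring_carrier fc, auto simp: matrix_ring_def f0 ring_hom_one[OF f])
qed

lemma scalar_matrix_entry:
  "i < m \<Longrightarrow> j < m \<Longrightarrow> scalar_matrix L m l $$ (i, j) = (if i = j then l else \<zero>\<^bsub>L\<^esub>)"
  by (simp add: scalar_matrix_def)

lemma matrix_ring_zero_entry: "i < m \<Longrightarrow> j < m \<Longrightarrow> \<zero>\<^bsub>matrix_ring L m\<^esub> $$ (i, j) = \<zero>\<^bsub>L\<^esub>"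
  by (simp add: matrix_ring_def)

lemma (in ring) scalar_matrix_closed:
  "l \<in> carrier R \<Longrightarrow> scalar_matrix R m l \<in> carrier (matrix_ring R m)"
  by (auto simp: scalar_matrix_def matrix_ring_carrier)

lemma (in ring) scalar_matrix_mult_entry:
  assumes "M \<in> carrier (matrix_ring R m)" "i < m" "j < m" "l \<in> carrier R"
  shows "(scalar_matrix R m l \<otimes>\<^bsub>matrix_ring R m\<^esub> M) $$ (i, j) = l \<otimes> M $$ (i, j)"
    "(M \<otimes>\<^bsub>matrix_ring R m\<^esub> scalar_matrix R m l) $$ (i, j) = M $$ (i, j) \<otimes> l"
proof -
  note e = matrix_ring_entry[OF assms(1)]
  have "(\<Oplus>k\<in>{..<m}. scalar_matrix R m l $$ (i, k) \<otimes> M $$ (k, j)) =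
      (\<Oplus>k\<in>{..<m}. if i = k then l \<otimes> M $$ (k, j) else \<zero>)"
    using e assms by (intro finsum_cong') (auto simp: scalar_matrix_def)
  also have "\<dots> = l \<otimes> M $$ (i, j)"
    using e assms by (intro add.finprod_singleton) auto
  finally show "(scalar_matrix R m l \<otimes>\<^bsub>matrix_ring R m\<^esub> M) $$ (i, j) = l \<otimes> M $$ (i, j)"
    using assms by (simp add: matrix_ring_mult_entry)
  have "(\<Oplus>k\<in>{..<m}. M $$ (i, k) \<otimes> scalar_matrix R m l $$ (k, j)) =
      (\<Oplus>k\<in>{..<m}. if j = k then M $$ (i, k) \<otimes> l else \<zero>)"
    using e assms by (intro finsum_cong') (auto simp: scalar_matrix_def)
  also have "\<dots> = M $$ (i, j) \<otimes> l"
    using e assms by (intro add.finprod_singleton) auto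
  finally show "(M \<otimes>\<^bsub>matrix_ring R m\<^esub> scalar_matrix R m l) $$ (i, j) = M $$ (i, j) \<otimes> l"
    using assms by (simp add: matrix_ring_mult_entry)
qed

lemma (in cring) scalar_matrix_commute:
  assumes "M \<in> carrier (matrix_ring R m)" "l \<in> carrier R"
  shows "scalar_matrix R m l \<otimes>\<^bsub>matrix_ring R m\<^esub> M = M \<otimes>\<^bsub>matrix_ring R m\<^esub> scalar_matrix R m l"
proof -
  interpret M: ring "matrix_ring R m" by (rule matrix_ring_is_ring)
  show ?thesis
    using assms matrix_ring_entry[OF assms(1)]
    by (intro matrix_ring_eqI[of _ R m])
      (auto simp: scalar_matrix_mult_entry m_comm scalar_matrix_closed)
qed

lemma (in cring) scalar_matrix_hom:
  "scalar_matrix R m \<in> ring_hom R (matrix_ring R m)"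
proof (rule ring_hom_memI)
  fix x y assume xy: "x \<in> carrier R" "y \<in> carrier R"
  interpret M: ring "matrix_ring R m" by (rule matrix_ring_is_ring)
  show "scalar_matrix R m (x \<otimes> y) = scalar_matrix R m x \<otimes>\<^bsub>matrix_ring R m\<^esub> scalar_matrix R m y"
    using xy by (intro matrix_ring_eqI[of _ R m])
      (auto simp: scalar_matrix_closed scalar_matrix_mult_entry scalar_matrix_entry)
  show "scalar_matrix R m (x \<oplus> y) = scalar_matrix R m x \<oplus>\<^bsub>matrix_ring R m\<^esub> scalar_matrix R m y"
    using xy by (intro eq_matI) (auto simp: scalar_matrix_def matrix_ring_def)
qed (auto simp: scalar_matrix_closed, auto simp: scalar_matrix_def matrix_ring_def)

lemma (in cring) matrix_finsum_entry:
  assumes "finite I" "\<And>a. a \<in> I \<Longrightarrow> f a \<in> carrier (matrix_ring R m)" "i < m" "j < m"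
  shows "(\<Oplus>\<^bsub>matrix_ring R m\<^esub>a\<in>I. f a) $$ (i, j) = (\<Oplus>a\<in>I. f a $$ (i, j))"
  using assms(1,2)
proof (induction I rule: finite_induct)
  interpret M: ring "matrix_ring R m" by (rule matrix_ring_is_ring)
  case empty
  then show ?case using assms by (simp add: matrix_ring_zero_entry)
next
  case (insert x F)
  interpret M: ring "matrix_ring R m" by (rule matrix_ring_is_ring)
  have "(A \<oplus>\<^bsub>matrix_ring R m\<^esub> B) $$ (i, j) = A $$ (i, j) \<oplus> B $$ (i, j)" for A B
    using assms by (simp add: matrix_ring_def)
  then show ?case
    using insert assms matrix_ring_entry[OF insert.prems] by simp
qed

text \<open>The hypothesis \<open>unit\<close> says that no nonzero element is annihilated by all
  \<open>g a\<close>, as when they generate the unit ideal. It passes to powers by lowering one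
  exponent at a time: \<open>s g_b\<close> satisfies the assumptions with \<open>e b - 1\<close> in
  place of \<open>e b\<close>, hence vanishes, for every \<open>b\<close>.\<close>

lemma (in cring) annihilator_of_powers:
  assumes I: "finite I" and g: "\<And>a. a \<in> I \<Longrightarrow> g a \<in> carrier R"
    and unit: "\<And>s. s \<in> carrier R \<Longrightarrow> (\<And>a. a \<in> I \<Longrightarrow> s \<otimes> g a = \<zero>) \<Longrightarrow> s = \<zero>"
    and s: "s \<in> carrier R" "\<And>a. a \<in> I \<Longrightarrow> s \<otimes> g a [^] (e a :: nat) = \<zero>"
  shows "s = \<zero>"
  using s
proof (induction "sum e I" arbitrary: e s rule: less_induct)
  case less
  show ?case
  proof (cases "\<exists>a\<in>I. e a = 0")
    case True
    then obtain a where "a \<in> I" "e a = 0" by blast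
    with less.prems(2)[of a] less.prems(1) show ?thesis by simp
  next
    case False
    have "s \<otimes> g b = \<zero>" if b: "b \<in> I" for b
    proof (rule less.hyps[of "e(b := e b - 1)"])
      show "sum (e(b := e b - 1)) I < sum e I"
        using I b False by (intro sum_strict_mono_ex1) (auto intro!: bexI[of _ b])
      show "s \<otimes> g b \<in> carrier R" using less.prems g b by simp
      fix a assume a: "a \<in> I"
      show "s \<otimes> g b \<otimes> g a [^] ((e(b := e b - 1)) a) = \<zero>"
      proof (cases "a = b")
        case True
        have "e b = Suc (e b - 1)" using False b by auto
        then have "s \<otimes> g b \<otimes> g b [^] (e b - 1) = s \<otimes> g b [^] e b"
          using less.prems g b by (metis m_assoc m_comm nat_pow_Suc nat_pow_closed)
        then show ?thesis using True less.prems b by simp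
      next
        case False
        have "s \<otimes> g b \<otimes> g a [^] e a = g b \<otimes> (s \<otimes> g a [^] e a)"
          using less.prems(1) g a b by (simp add: m_ac)
        also have "\<dots> = \<zero>" using less.prems(2)[OF a] g[OF b] by simp
        finally show ?thesis using False by simp
      qed
    qed
    then show ?thesis using unit less.prems by blast
  qed
qed

section \<open>Comparison of splittings\<close>

text \<open>
  A Skolem-Noether theorem at the level of determinants, over an arbitrary commutative ring.  The
  images \<open>G\<^sub>a\<^sub>b\<close> of the matrix units yield matrices \<open>P\<^sub>k\<close>, \<open>Q\<^sub>l\<close>
  with \<open>\<theta>(Z) P\<^sub>k = P\<^sub>k i(Z)\<close> and \<open>Q\<^sub>l P\<^sub>k = g\<^sub>l\<^sub>k 1\<close>, where \<open>g\<^sub>l\<^sub>k\<close> are the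
  entries of \<open>G\<^sub>0\<^sub>0\<close>.  Hence the difference of the two determinants is annihilated by the powers
  \<open>g\<^sub>l\<^sub>k^m\<close>, and the \<open>g\<^sub>l\<^sub>k\<close> generate the unit ideal.
\<close>

theorem determinant_matrix_ring_hom:
  fixes L :: "('l, 'm) ring_scheme" and S :: "('s, 'n) ring_scheme"
  assumes L: "cring L" and S: "cring S" and i: "i \<in> ring_hom L S"
    and \<theta>: "\<theta> \<in> ring_hom (matrix_ring L m) (matrix_ring S m)"
    and \<theta>i: "\<And>l. l \<in> carrier L \<Longrightarrow> \<theta> (scalar_matrix L m l) = scalar_matrix S m (i l)"
    and Z: "Z \<in> carrier (matrix_ring L m)" and m: "0 < m"
  shows "determinant S m (\<theta> Z) = i (determinant L m Z)"
proof -
  interpret L: cring L by fact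
  interpret S: cring S by fact
  define LL where "LL = matrix_ring L m"
  define SS where "SS = matrix_ring S m"
  interpret LL: ring LL unfolding LL_def by (rule L.matrix_ring_is_ring)
  interpret SS: ring SS unfolding SS_def by (rule S.matrix_ring_is_ring)
  note \<theta> = \<theta>[folded LL_def SS_def]
  note Z = Z[folded LL_def]
  note \<theta>c = ring_hom_closed[OF \<theta>] and ic = ring_hom_closed[OF i]
  note entL = matrix_ring_entry[of _ L m, folded LL_def]
  note entS = matrix_ring_entry[of _ S m, folded SS_def]
  note mulL = matrix_ring_mult_entry[of _ m _ L, folded LL_def]
  note mulS = matrix_ring_mult_entry[of _ m _ S, folded SS_def]
  note zS = matrix_ring_zero_entry[of _ m _ S, folded SS_def]
  note eqL = matrix_ring_eqI[of _ L m, folded LL_def]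
  note eqS = matrix_ring_eqI[of _ S m, folded SS_def]
  have \<theta>0: "\<theta> \<zero>\<^bsub>LL\<^esub> = \<zero>\<^bsub>SS\<^esub>"
    by (rule ring_hom_zero[OF \<theta> LL.ring_axioms SS.ring_axioms])
  define E where "E a b = mat m m (\<lambda>(r, c). if r = a \<and> c = b then \<one>\<^bsub>L\<^esub> else \<zero>\<^bsub>L\<^esub>)" for a b :: nat
  have Ec: "E a b \<in> carrier LL" for a b
    by (auto simp: E_def LL_def matrix_ring_carrier)
  have Ee: "E a b $$ (r, c) = (if r = a \<and> c = b then \<one>\<^bsub>L\<^esub> else \<zero>\<^bsub>L\<^esub>)" if "r < m" "c < m" for a b r c
    using that by (simp add: E_def)
  have EE: "E a b \<otimes>\<^bsub>LL\<^esub> E c e = (if b = c then E a e else \<zero>\<^bsub>LL\<^esub>)" if "b < m" for a b c e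
  proof (rule eqL)
    fix r s assume rs: "r < m" "s < m"
    have "(E a b \<otimes>\<^bsub>LL\<^esub> E c e) $$ (r, s) = (\<Oplus>\<^bsub>L\<^esub>k\<in>{..<m}. E a b $$ (r, k) \<otimes>\<^bsub>L\<^esub> E c e $$ (k, s))"
      using rs by (rule mulL)
    also have "\<dots> = (\<Oplus>\<^bsub>L\<^esub>k\<in>{..<m}. if b = k then E a b $$ (r, k) \<otimes>\<^bsub>L\<^esub> E c e $$ (k, s) else \<zero>\<^bsub>L\<^esub>)"
      using rs by (intro L.finsum_cong') (auto simp: Ee)
    also have "\<dots> = E a b $$ (r, b) \<otimes>\<^bsub>L\<^esub> E c e $$ (b, s)"
      using rs that by (intro L.add.finprod_singleton) (auto simp: Ee)
    also have "\<dots> = (if b = c then E a e else \<zero>\<^bsub>LL\<^esub>) $$ (r, s)"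
      using rs that by (auto simp: Ee LL_def matrix_ring_zero_entry)
    finally show "(E a b \<otimes>\<^bsub>LL\<^esub> E c e) $$ (r, s) = (if b = c then E a e else \<zero>\<^bsub>LL\<^esub>) $$ (r, s)" .
  qed (auto simp: Ec)
  define G where "G a b = \<theta> (E a b)" for a b
  have Gc: "G a b \<in> carrier SS" for a b by (simp add: G_def \<theta>c Ec)
  have GG: "G a b \<otimes>\<^bsub>SS\<^esub> G c e = (if b = c then G a e else \<zero>\<^bsub>SS\<^esub>)" if "b < m" for a b c e
    using EE[OF that, of a c e] ring_hom_mult[OF \<theta> Ec Ec, of a b c e] by (auto simp: G_def \<theta>0)
  have Ge: "G a b $$ (r, c) \<in> carrier S" if "r < m" "c < m" for a b r c
    using entS[OF Gc] that .
  \<comment> \<open>The matrices \<open>E a 0\<close> span the left ideal of matrices supported in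
    the first column, on which left multiplication by \<open>Z\<close> has the matrix
    \<open>Z\<close> itself. Its image under \<open>\<theta>\<close> becomes the intertwining
    relation.\<close>
  have ZE: "Z \<otimes>\<^bsub>LL\<^esub> E j 0 = (\<Oplus>\<^bsub>LL\<^esub>a\<in>{..<m}. scalar_matrix L m (Z $$ (a, j)) \<otimes>\<^bsub>LL\<^esub> E a 0)"
    if j: "j < m" for j
  proof (rule eqL)
    fix r s assume rs: "r < m" "s < m"
    have "(Z \<otimes>\<^bsub>LL\<^esub> E j 0) $$ (r, s) = (\<Oplus>\<^bsub>L\<^esub>k\<in>{..<m}. Z $$ (r, k) \<otimes>\<^bsub>L\<^esub> E j 0 $$ (k, s))"
      using rs by (rule mulL)
    also have "\<dots> = (\<Oplus>\<^bsub>L\<^esub>k\<in>{..<m}. if j = k then Z $$ (r, k) \<otimes>\<^bsub>L\<^esub> E j 0 $$ (k, s) else \<zero>\<^bsub>L\<^esub>)"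
      using rs entL[OF Z] by (intro L.finsum_cong') (auto simp: Ee)
    also have "\<dots> = Z $$ (r, j) \<otimes>\<^bsub>L\<^esub> E j 0 $$ (j, s)"
      using rs j entL[OF Z] by (intro L.add.finprod_singleton) (auto simp: Ee)
    also have "\<dots> = Z $$ (r, j) \<otimes>\<^bsub>L\<^esub> E r 0 $$ (r, s)"
      using rs j by (simp add: Ee)
    also have "\<dots> = (\<Oplus>\<^bsub>L\<^esub>a\<in>{..<m}. if r = a then Z $$ (a, j) \<otimes>\<^bsub>L\<^esub> E a 0 $$ (r, s) else \<zero>\<^bsub>L\<^esub>)"
      using rs j entL[OF Z] by (intro L.add.finprod_singleton[symmetric]) (auto simp: Ee)
    also have "\<dots> = (\<Oplus>\<^bsub>L\<^esub>a\<in>{..<m}. (scalar_matrix L m (Z $$ (a, j)) \<otimes>\<^bsub>LL\<^esub> E a 0) $$ (r, s))"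
      using rs j entL[OF Z] Ec unfolding LL_def
      by (intro L.finsum_cong') (auto simp: L.scalar_matrix_mult_entry Ee)
    also have "\<dots> = (\<Oplus>\<^bsub>LL\<^esub>a\<in>{..<m}. scalar_matrix L m (Z $$ (a, j)) \<otimes>\<^bsub>LL\<^esub> E a 0) $$ (r, s)"
      using rs j entL[OF Z] Ec L.scalar_matrix_closed[of _ m] unfolding LL_def
      by (intro L.matrix_finsum_entry[symmetric] L.matrix_ring_is_ring[THEN ring.ring_simprules(5)]) auto
    finally show "(Z \<otimes>\<^bsub>LL\<^esub> E j 0) $$ (r, s) =
      (\<Oplus>\<^bsub>LL\<^esub>a\<in>{..<m}. scalar_matrix L m (Z $$ (a, j)) \<otimes>\<^bsub>LL\<^esub> E a 0) $$ (r, s)" .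
  qed (use Z Ec j entL[OF Z] L.scalar_matrix_closed[of _ m] in \<open>auto simp: LL_def[symmetric] intro!: LL.finsum_closed\<close>)
  define Y where "Y = \<theta> Z"
  have Yc: "Y \<in> carrier SS" using Z by (simp add: Y_def \<theta>c)
  have sc: "scalar_matrix S m s \<in> carrier SS" if "s \<in> carrier S" for s
    unfolding SS_def using that by (rule S.scalar_matrix_closed)
  have scL: "scalar_matrix L m s \<in> carrier LL" if "s \<in> carrier L" for s
    unfolding LL_def using that by (rule L.scalar_matrix_closed)
  have YG: "Y \<otimes>\<^bsub>SS\<^esub> G j 0 = (\<Oplus>\<^bsub>SS\<^esub>a\<in>{..<m}. scalar_matrix S m (i (Z $$ (a, j))) \<otimes>\<^bsub>SS\<^esub> G a 0)"
    if j: "j < m" for j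
  proof -
    have "Y \<otimes>\<^bsub>SS\<^esub> G j 0 = \<theta> (Z \<otimes>\<^bsub>LL\<^esub> E j 0)"
      using Z Ec by (simp add: Y_def G_def ring_hom_mult[OF \<theta>])
    also have "\<dots> = (\<Oplus>\<^bsub>SS\<^esub>a\<in>{..<m}. \<theta> (scalar_matrix L m (Z $$ (a, j)) \<otimes>\<^bsub>LL\<^esub> E a 0))"
      unfolding ZE[OF j] using Ec scL entL[OF Z] j
      by (intro ring_hom_finsum[OF LL.ring_axioms SS.ring_axioms \<theta>]) auto
    also have "\<dots> = (\<Oplus>\<^bsub>SS\<^esub>a\<in>{..<m}. scalar_matrix S m (i (Z $$ (a, j))) \<otimes>\<^bsub>SS\<^esub> G a 0)"
      using Ec scL entL[OF Z] j Gc sc ic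
      by (intro SS.finsum_cong') (auto simp: ring_hom_mult[OF \<theta>] \<theta>i G_def)
    finally show ?thesis .
  qed
  define Z' where "Z' = map_mat i Z"
  have Z'c: "Z' \<in> carrier SS"
    unfolding Z'_def SS_def using Z
    by (intro ring_hom_closed[OF matrix_ring_hom[OF L.ring_axioms S.ring_axioms i]]) (simp add: LL_def)
  have Z'e: "Z' $$ (r, s) = i (Z $$ (r, s))" if "r < m" "s < m" for r s
    using Z that by (auto simp: Z'_def LL_def matrix_ring_carrier)
  \<comment> \<open>Column \<open>j\<close> of \<open>P k\<close> is column \<open>k\<close> of
    \<open>G j 0\<close>, and row \<open>r\<close> of \<open>Q l\<close> is row \<open>l\<close> of
    \<open>G 0 r\<close>. A single \<open>P k\<close> may be singular, so all choices of
    \<open>k\<close> and \<open>l\<close> are kept.\<close>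
  define P where "P k = mat m m (\<lambda>(r, j). G j 0 $$ (r, k))" for k
  define Q where "Q l = mat m m (\<lambda>(r, c). G 0 r $$ (l, c))" for l
  have Pc: "P k \<in> carrier SS" if "k < m" for k
    using Ge that by (simp add: P_def SS_def matrix_ring_carrier)
  have Qc: "Q l \<in> carrier SS" if "l < m" for l
    using Ge that by (simp add: Q_def SS_def matrix_ring_carrier)
  have YP: "Y \<otimes>\<^bsub>SS\<^esub> P k = P k \<otimes>\<^bsub>SS\<^esub> Z'" if k: "k < m" for k
  proof (rule eqS)
    fix r j assume rj: "r < m" "j < m"
    have "(Y \<otimes>\<^bsub>SS\<^esub> P k) $$ (r, j) = (Y \<otimes>\<^bsub>SS\<^esub> G j 0) $$ (r, k)"
      using rj k entS[OF Yc] Ge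
      by (simp add: mulS) (intro S.finsum_cong', auto simp: P_def)
    also have "\<dots> = (\<Oplus>\<^bsub>S\<^esub>a\<in>{..<m}. (scalar_matrix S m (i (Z $$ (a, j))) \<otimes>\<^bsub>SS\<^esub> G a 0) $$ (r, k))"
      unfolding YG[OF rj(2)] using rj k Gc sc entL[OF Z] ic
      by (intro S.matrix_finsum_entry[where m = m, folded SS_def]) auto
    also have "\<dots> = (\<Oplus>\<^bsub>S\<^esub>a\<in>{..<m}. P k $$ (r, a) \<otimes>\<^bsub>S\<^esub> Z' $$ (a, j))"
      using rj k Gc Ge entL[OF Z] ic unfolding SS_def
      by (intro S.finsum_cong') (auto simp: S.scalar_matrix_mult_entry P_def Z'e S.m_comm)
    also have "\<dots> = (P k \<otimes>\<^bsub>SS\<^esub> Z') $$ (r, j)"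
      using rj by (simp add: mulS)
    finally show "(Y \<otimes>\<^bsub>SS\<^esub> P k) $$ (r, j) = (P k \<otimes>\<^bsub>SS\<^esub> Z') $$ (r, j)" .
  qed (use Yc Pc Z'c that in auto)
  have QP: "Q l \<otimes>\<^bsub>SS\<^esub> P k = scalar_matrix S m (G 0 0 $$ (l, k))" if lk: "l < m" "k < m" for l k
  proof (rule eqS)
    fix r j assume rj: "r < m" "j < m"
    have "(Q l \<otimes>\<^bsub>SS\<^esub> P k) $$ (r, j) = (G 0 r \<otimes>\<^bsub>SS\<^esub> G j 0) $$ (l, k)"
      using rj lk Ge
      by (simp add: mulS) (intro S.finsum_cong', auto simp: P_def Q_def)
    also have "\<dots> = scalar_matrix S m (G 0 0 $$ (l, k)) $$ (r, j)"
      using rj lk by (auto simp: GG scalar_matrix_entry zS)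
    finally show "(Q l \<otimes>\<^bsub>SS\<^esub> P k) $$ (r, j) = scalar_matrix S m (G 0 0 $$ (l, k)) $$ (r, j)" .
  qed (use Qc Pc sc Ge lk in auto)
  define y x where "y = determinant S m Y" and "x = determinant S m Z'"
  have yx: "y \<in> carrier S" "x \<in> carrier S"
    using Yc Z'c by (simp_all add: y_def x_def S.determinant_closed SS_def)
  define \<delta> where "\<delta> = y \<ominus>\<^bsub>S\<^esub> x"
  have \<delta>: "\<delta> \<in> carrier S" using yx by (simp add: \<delta>_def)
  \<comment> \<open>By \<open>Y P_k = P_k Z'\<close> the difference of the determinants annihilates
    the determinant of \<open>P k\<close>, hence also its product with the determinant of
    \<open>Q l\<close>, which is the \<open>m\<close>-th power of an entry of
    \<open>G 0 0\<close>.\<close>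
  have kill: "\<delta> \<otimes>\<^bsub>S\<^esub> G 0 0 $$ (l, k) [^]\<^bsub>S\<^esub> m = \<zero>\<^bsub>S\<^esub>" if lk: "l < m" "k < m" for l k
  proof -
    define p q where "p = determinant S m (P k)" and "q = determinant S m (Q l)"
    have pq: "p \<in> carrier S" "q \<in> carrier S"
      using Pc Qc lk by (simp_all add: p_def q_def S.determinant_closed SS_def)
    have "y \<otimes>\<^bsub>S\<^esub> p = p \<otimes>\<^bsub>S\<^esub> x"
      using arg_cong[OF YP[OF lk(2)], of "determinant S m"] Yc Pc[OF lk(2)] Z'c
      by (simp add: SS_def S.determinant_mult y_def x_def p_def)
    moreover have "\<delta> \<otimes>\<^bsub>S\<^esub> p = y \<otimes>\<^bsub>S\<^esub> p \<oplus>\<^bsub>S\<^esub> \<ominus>\<^bsub>S\<^esub> (p \<otimes>\<^bsub>S\<^esub> x)"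
      using yx pq by (simp add: \<delta>_def a_minus_def S.l_distr S.l_minus S.m_comm[of x p])
    ultimately have \<delta>p: "\<delta> \<otimes>\<^bsub>S\<^esub> p = \<zero>\<^bsub>S\<^esub>"
      using yx pq by (simp add: S.r_neg)
    have "q \<otimes>\<^bsub>S\<^esub> p = G 0 0 $$ (l, k) [^]\<^bsub>S\<^esub> m"
      using arg_cong[OF QP[OF lk], of "determinant S m"] Pc[OF lk(2)] Qc[OF lk(1)] Ge lk
      by (simp add: SS_def S.determinant_mult q_def p_def S.determinant_scalar)
    then have "\<delta> \<otimes>\<^bsub>S\<^esub> G 0 0 $$ (l, k) [^]\<^bsub>S\<^esub> m = q \<otimes>\<^bsub>S\<^esub> (\<delta> \<otimes>\<^bsub>S\<^esub> p)"
      using \<delta> pq by (simp add: S.m_lcomm[of q \<delta> p])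
    then show ?thesis using \<delta>p pq by simp
  qed
  \<comment> \<open>An element that kills all entries of \<open>G 0 0\<close> kills every
    \<open>G a a\<close>, which factors as \<open>G a 0\<close>, \<open>G 0 0\<close>,
    \<open>G 0 a\<close>; and the \<open>G a a\<close> add up to the identity matrix.\<close>
  have unit: "s = \<zero>\<^bsub>S\<^esub>" if s: "s \<in> carrier S"
    and z: "\<And>a. a \<in> {..<m} \<times> {..<m} \<Longrightarrow> s \<otimes>\<^bsub>S\<^esub> G 0 0 $$ a = \<zero>\<^bsub>S\<^esub>" for s
  proof -
    define s' where "s' = scalar_matrix S m s"
    have s'c: "s' \<in> carrier SS" using s by (simp add: s'_def sc)
    have comm: "s' \<otimes>\<^bsub>SS\<^esub> M = M \<otimes>\<^bsub>SS\<^esub> s'" if "M \<in> carrier SS" for M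
      using that s unfolding s'_def SS_def by (rule S.scalar_matrix_commute)
    have s0: "s' \<otimes>\<^bsub>SS\<^esub> G 0 0 = \<zero>\<^bsub>SS\<^esub>"
    proof (rule eqS)
      fix r j assume "r < m" "j < m"
      then show "(s' \<otimes>\<^bsub>SS\<^esub> G 0 0) $$ (r, j) = \<zero>\<^bsub>SS\<^esub> $$ (r, j)"
        using z[of "(r, j)"] s Gc unfolding s'_def SS_def
        by (simp add: S.scalar_matrix_mult_entry matrix_ring_zero_entry)
    qed (use s'c Gc in auto)
    have sa: "s' \<otimes>\<^bsub>SS\<^esub> G a a = \<zero>\<^bsub>SS\<^esub>" for a
    proof -
      have "G a a = G a 0 \<otimes>\<^bsub>SS\<^esub> G 0 0 \<otimes>\<^bsub>SS\<^esub> G 0 a"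
        using m by (simp add: GG)
      then have "s' \<otimes>\<^bsub>SS\<^esub> G a a = s' \<otimes>\<^bsub>SS\<^esub> G a 0 \<otimes>\<^bsub>SS\<^esub> G 0 0 \<otimes>\<^bsub>SS\<^esub> G 0 a"
        using s'c Gc by (simp add: SS.m_assoc)
      also have "\<dots> = G a 0 \<otimes>\<^bsub>SS\<^esub> (s' \<otimes>\<^bsub>SS\<^esub> G 0 0) \<otimes>\<^bsub>SS\<^esub> G 0 a"
        using s'c Gc by (simp add: comm SS.m_assoc)
      finally show ?thesis using s0 Gc by simp
    qed
    have "\<one>\<^bsub>LL\<^esub> = (\<Oplus>\<^bsub>LL\<^esub>a\<in>{..<m}. E a a)"
    proof (rule eqL)
      fix r j assume rj: "r < m" "j < m"
      have "\<one>\<^bsub>LL\<^esub> $$ (r, j) = E r r $$ (r, j)"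
        using rj by (simp add: LL_def matrix_ring_def E_def)
      also have "\<dots> = (\<Oplus>\<^bsub>L\<^esub>a\<in>{..<m}. if r = a then E a a $$ (r, j) else \<zero>\<^bsub>L\<^esub>)"
        using rj by (intro L.add.finprod_singleton[symmetric]) (auto simp: Ee)
      also have "\<dots> = (\<Oplus>\<^bsub>L\<^esub>a\<in>{..<m}. E a a $$ (r, j))"
        using rj by (intro L.finsum_cong') (auto simp: Ee)
      also have "\<dots> = (\<Oplus>\<^bsub>LL\<^esub>a\<in>{..<m}. E a a) $$ (r, j)"
        using rj Ec unfolding LL_def by (intro L.matrix_finsum_entry[symmetric]) auto
      finally show "\<one>\<^bsub>LL\<^esub> $$ (r, j) = (\<Oplus>\<^bsub>LL\<^esub>a\<in>{..<m}. E a a) $$ (r, j)" .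
    qed (use Ec in auto)
    then have "\<one>\<^bsub>SS\<^esub> = \<theta> (\<Oplus>\<^bsub>LL\<^esub>a\<in>{..<m}. E a a)"
      using ring_hom_one[OF \<theta>] by simp
    also have "\<dots> = (\<Oplus>\<^bsub>SS\<^esub>a\<in>{..<m}. G a a)"
      unfolding G_def using Ec by (intro ring_hom_finsum[OF LL.ring_axioms SS.ring_axioms \<theta>]) auto
    finally have "s' = s' \<otimes>\<^bsub>SS\<^esub> (\<Oplus>\<^bsub>SS\<^esub>a\<in>{..<m}. G a a)"
      using SS.r_one[OF s'c] by metis
    also have "\<dots> = (\<Oplus>\<^bsub>SS\<^esub>a\<in>{..<m}. s' \<otimes>\<^bsub>SS\<^esub> G a a)"
      using s'c Gc by (intro SS.finsum_rdistr) auto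
    also have "\<dots> = \<zero>\<^bsub>SS\<^esub>" by (simp add: sa)
    finally have "s' $$ (0, 0) = \<zero>\<^bsub>S\<^esub>"
      using m by (simp add: SS_def matrix_ring_zero_entry)
    then show "s = \<zero>\<^bsub>S\<^esub>" using m by (simp add: s'_def scalar_matrix_entry)
  qed
  have "\<delta> = \<zero>\<^bsub>S\<^esub>"
    by (rule S.annihilator_of_powers[of "{..<m} \<times> {..<m}" "\<lambda>a. G 0 0 $$ a" _ "\<lambda>_. m"])
      (use unit \<delta> kill Ge in auto)
  then have "y = x" using yx by (simp add: \<delta>_def)
  then show ?thesis
    using determinant_hom[OF L S i Z[unfolded LL_def]] by (simp add: y_def x_def Y_def Z'_def)
qed

section \<open>Commutative subrings from double centralizers\<close>

definition centralizer :: "('a, 'm) ring_scheme \<Rightarrow> 'a set \<Rightarrow> 'a set" where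
  "centralizer R T = {x \<in> carrier R. \<forall>t \<in> T. x \<otimes>\<^bsub>R\<^esub> t = t \<otimes>\<^bsub>R\<^esub> x}"

lemma (in ring) centralizer_subring:
  assumes "T \<subseteq> carrier R"
  shows "subring (centralizer R T) R"
proof (rule subringI)
  fix x y assume "x \<in> centralizer R T" "y \<in> centralizer R T"
  then have x: "x \<in> carrier R" "\<And>t. t \<in> T \<Longrightarrow> x \<otimes> t = t \<otimes> x"
    and y: "y \<in> carrier R" "\<And>t. t \<in> T \<Longrightarrow> y \<otimes> t = t \<otimes> y"
    by (auto simp: centralizer_def)
  have T: "t \<in> carrier R" if "t \<in> T" for t using that assms by auto
  have "x \<otimes> y \<otimes> t = t \<otimes> (x \<otimes> y)" if t: "t \<in> T" for t
  proof -
    have "x \<otimes> y \<otimes> t = x \<otimes> t \<otimes> y" using x(1) y T[OF t] t by (simp add: m_assoc)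
    also have "\<dots> = t \<otimes> x \<otimes> y" using x t by simp
    finally show ?thesis using x y T[OF t] by (simp add: m_assoc)
  qed
  then show "x \<otimes> y \<in> centralizer R T" using x y by (simp add: centralizer_def)
  show "x \<oplus> y \<in> centralizer R T"
    using x y T by (simp add: centralizer_def l_distr r_distr)
  show "\<ominus> x \<in> centralizer R T"
    using x T by (simp add: centralizer_def l_minus r_minus)
qed (use assms in \<open>auto simp: centralizer_def\<close>)

text \<open>A set that commutes with itself lies in its centralizer. Passing to centralizers
  reverses inclusions, so the double centralizer lies in the centralizer of \<open>T\<close>, with
  all of whose elements it commutes.\<close>

lemma (in ring) double_centralizer_cring:
  assumes T: "T \<subseteq> carrier R" and comm: "\<And>s t. s \<in> T \<Longrightarrow> t \<in> T \<Longrightarrow> s \<otimes> t = t \<otimes> s"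
  defines "D \<equiv> centralizer R (centralizer R T)"
  shows "subring D R" "cring (R\<lparr>carrier := D\<rparr>)" "T \<subseteq> D"
proof -
  have CR: "centralizer R T \<subseteq> carrier R" by (auto simp: centralizer_def)
  show D: "subring D R" unfolding D_def by (rule centralizer_subring[OF CR])
  have "T \<subseteq> centralizer R T" using T comm by (auto simp: centralizer_def)
  then have "D \<subseteq> centralizer R T" unfolding D_def by (auto simp: centralizer_def)
  then have "x \<otimes> y = y \<otimes> x" if "x \<in> D" "y \<in> D" for x y
    using that unfolding D_def by (auto simp: centralizer_def[of R "centralizer R T"])
  then show "cring (R\<lparr>carrier := D\<rparr>)"
    using D by (intro subcring_iff[THEN iffD1] subcringI) (auto dest: subringE(1))
  show "T \<subseteq> D" using T unfolding D_def by (auto simp: centralizer_def)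
qed

text \<open>Only additivity is assumed: the map \<open>\<theta>\<close> of the comparison below is
  not yet known to be multiplicative when sums have to be pulled through it.\<close>

lemma additive_finsum:
  assumes "abelian_group R" "abelian_group S"
    and closed: "\<And>x. x \<in> carrier R \<Longrightarrow> f x \<in> carrier S"
    and add: "\<And>x y. x \<in> carrier R \<Longrightarrow> y \<in> carrier R \<Longrightarrow> f (x \<oplus>\<^bsub>R\<^esub> y) = f x \<oplus>\<^bsub>S\<^esub> f y"
    and g: "\<And>x. x \<in> I \<Longrightarrow> g x \<in> carrier R"
  shows "f (\<Oplus>\<^bsub>R\<^esub>x\<in>I. g x) = (\<Oplus>\<^bsub>S\<^esub>x\<in>I. f (g x))"
proof -
  interpret R: abelian_group R by fact
  interpret S: abelian_group S by fact
  have "f \<zero>\<^bsub>R\<^esub> \<oplus>\<^bsub>S\<^esub> f \<zero>\<^bsub>R\<^esub> = f \<zero>\<^bsub>R\<^esub>"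
    using add[of "\<zero>\<^bsub>R\<^esub>" "\<zero>\<^bsub>R\<^esub>"] by simp
  then have 0: "f \<zero>\<^bsub>R\<^esub> = \<zero>\<^bsub>S\<^esub>"
    using closed[of "\<zero>\<^bsub>R\<^esub>"] by simp
  show ?thesis using g
  proof (induction I rule: infinite_finite_induct)
    case (insert x F)
    then show ?case by (auto simp: add closed R.finsum_closed)
  qed (auto simp: 0)
qed

text \<open>
  Comparison of a splitting over a commutative subring \<open>L\<close> of \<open>B\<close> with any other matrix
  representation \<open>\<phi>'\<close> of \<open>B\<close>.  Both extend to the tensor product of \<open>L\<close> and \<open>L'\<close>, for which the
  double centralizer of \<open>\<phi>'(L)\<close> and the scalars in the \<open>m \<times> m\<close> matrices over \<open>L'\<close> is substituted.
\<close>

theorem splitting_determinant_comparison: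
  fixes B :: "('b, 'n) ring_scheme" and L' :: "('l, 'k) ring_scheme" and N :: nat
  assumes B: "ring B" and LC: "subring LC B" and L: "L = B\<lparr>carrier := LC\<rparr>" "cring L" and L': "cring L'"
    and KL: "K \<subseteq> LC"
    and \<phi>: "\<phi> \<in> ring_hom B (matrix_ring L m)" "\<And>k. k \<in> K \<Longrightarrow> \<phi> k = scalar_matrix L m k"
    and \<phi>': "\<phi>' \<in> ring_hom B (matrix_ring L' m)" "\<And>k. k \<in> K \<Longrightarrow> \<phi>' k = scalar_matrix L' m (\<iota>' k)"
      "\<And>k. k \<in> K \<Longrightarrow> \<iota>' k \<in> carrier L'"
    and b: "\<And>k. k < N \<Longrightarrow> b k \<in> carrier B"
    and bspan: "\<And>z. z \<in> carrier B \<Longrightarrow> \<exists>\<beta>. (\<forall>k<N. \<beta> k \<in> K) \<and> z = (\<Oplus>\<^bsub>B\<^esub>k\<in>{..<N}. \<beta> k \<otimes>\<^bsub>B\<^esub> b k)"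
    and mspan: "\<And>Z. Z \<in> carrier (matrix_ring L m) \<Longrightarrow> \<exists>c. (\<forall>k<N. c k \<in> LC) \<and>
      Z = (\<Oplus>\<^bsub>matrix_ring L m\<^esub>k\<in>{..<N}. scalar_matrix L m (c k) \<otimes>\<^bsub>matrix_ring L m\<^esub> \<phi> (b k))"
    and mindep: "\<And>c k. (\<And>k. k < N \<Longrightarrow> c k \<in> LC) \<Longrightarrow>
      (\<Oplus>\<^bsub>matrix_ring L m\<^esub>k\<in>{..<N}. scalar_matrix L m (c k) \<otimes>\<^bsub>matrix_ring L m\<^esub> \<phi> (b k)) = \<zero>\<^bsub>matrix_ring L m\<^esub> \<Longrightarrow>
      k < N \<Longrightarrow> c k = \<zero>\<^bsub>B\<^esub>"
    and z: "z \<in> carrier B" and m: "0 < m"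
  shows "\<phi>' (determinant L m (\<phi> z)) = scalar_matrix L' m (determinant L' m (\<phi>' z))"
proof -
  interpret B: ring B by fact
  interpret L: cring L by fact
  interpret L': cring L' by fact
  note LCB = subringE(1)[OF LC]
  have Lc [simp]: "carrier L = LC" and Lmul: "x \<otimes>\<^bsub>L\<^esub> y = x \<otimes>\<^bsub>B\<^esub> y" and Ladd: "x \<oplus>\<^bsub>L\<^esub> y = x \<oplus>\<^bsub>B\<^esub> y"
    and Lone: "\<one>\<^bsub>L\<^esub> = \<one>\<^bsub>B\<^esub>" and Lzero: "\<zero>\<^bsub>L\<^esub> = \<zero>\<^bsub>B\<^esub>" for x y
    by (simp_all add: L(1))
  define MM where "MM = matrix_ring L' m"
  interpret MM: ring MM unfolding MM_def by (rule L'.matrix_ring_is_ring)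
  \<comment> \<open>The elements \<open>\<phi>' l\<close> come from the commutative ring
    \<open>L\<close> and scalar matrices are central, so \<open>T\<close> commutes with
    itself.\<close>
  define T where "T = \<phi>' ` LC \<union> scalar_matrix L' m ` carrier L'"
  note \<phi>'h = \<phi>'(1)[folded MM_def]
  note \<phi>'c = ring_hom_closed[OF \<phi>'h]
  have sc': "scalar_matrix L' m l \<in> carrier MM" if "l \<in> carrier L'" for l
    using that unfolding MM_def by (rule L'.scalar_matrix_closed)
  have TM: "T \<subseteq> carrier MM"
    using LCB \<phi>'c sc' by (auto simp: T_def)
  have comm: "scalar_matrix L' m l \<otimes>\<^bsub>MM\<^esub> M = M \<otimes>\<^bsub>MM\<^esub> scalar_matrix L' m l"
    if "l \<in> carrier L'" "M \<in> carrier MM" for l M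
    using that L'.scalar_matrix_commute unfolding MM_def by blast
  have "s \<otimes>\<^bsub>MM\<^esub> t = t \<otimes>\<^bsub>MM\<^esub> s" if "s \<in> T" "t \<in> T" for s t
  proof -
    have c: "\<phi>' x \<otimes>\<^bsub>MM\<^esub> \<phi>' y = \<phi>' y \<otimes>\<^bsub>MM\<^esub> \<phi>' x" if xy: "x \<in> LC" "y \<in> LC" for x y
    proof -
      have "x \<otimes>\<^bsub>B\<^esub> y = y \<otimes>\<^bsub>B\<^esub> x"
        using L.m_comm[of x y] xy by (simp add: Lmul)
      then show ?thesis
        using ring_hom_mult[OF \<phi>'h, of x y] ring_hom_mult[OF \<phi>'h, of y x] xy LCB
        by (metis subsetD)
    qed
    have M: "s \<in> carrier MM" "t \<in> carrier MM" using that TM by auto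
    have "(\<exists>l\<in>carrier L'. s = scalar_matrix L' m l) \<or> (\<exists>l\<in>carrier L'. t = scalar_matrix L' m l) \<or>
      ((\<exists>x\<in>LC. s = \<phi>' x) \<and> (\<exists>y\<in>LC. t = \<phi>' y))"
      using that[unfolded T_def Un_iff image_iff] by argo
    then consider l where "l \<in> carrier L'" "s = scalar_matrix L' m l"
      | l where "l \<in> carrier L'" "t = scalar_matrix L' m l"
      | x y where "x \<in> LC" "y \<in> LC" "s = \<phi>' x" "t = \<phi>' y"
      by (elim disjE conjE bexE) blast+
    then show ?thesis
    proof cases
      case 1
      then show ?thesis using comm M(2) by blast
    next
      case 2
      then show ?thesis using comm[OF _ M(1)] by metis
    next
      case 3
      then show ?thesis using c by blast
    qed
  qed
  note D = MM.double_centralizer_cring[OF TM this]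
  define D where "D = centralizer MM (centralizer MM T)"
  define S where "S = MM\<lparr>carrier := D\<rparr>"
  note D = D[folded D_def]
  interpret S: cring S using D(2) by (simp add: S_def)
  have DM: "D \<subseteq> carrier MM" by (rule subringE(1)[OF D(1)])
  have sD: "scalar_matrix L' m l \<in> D" if "l \<in> carrier L'" for l
    using D(3) that by (auto simp: T_def)
  have \<phi>'D: "\<phi>' l \<in> D" if "l \<in> LC" for l
    using D(3) that by (auto simp: T_def)
  have i: "\<phi>' \<in> ring_hom L S"
    using \<phi>'D LCB by (intro ring_hom_memI)
      (auto simp: S_def Lmul Ladd Lone ring_hom_mult[OF \<phi>'h] ring_hom_add[OF \<phi>'h] ring_hom_one[OF \<phi>'h] subset_iff)
  have i': "scalar_matrix L' m \<in> ring_hom L' S"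
    using sD L'.scalar_matrix_hom[of m, folded MM_def]
    by (intro ring_hom_memI) (auto simp: S_def ring_hom_mult ring_hom_add ring_hom_one)
  define SS where "SS = matrix_ring S m"
  define LL where "LL = matrix_ring L m"
  interpret SS: ring SS unfolding SS_def by (rule S.matrix_ring_is_ring)
  interpret LL: ring LL unfolding LL_def by (rule L.matrix_ring_is_ring)
  \<comment> \<open>Each entry of \<open>\<phi>' x\<close> is replaced by the scalar matrix of that
    entry. The result is a matrix over the commutative ring \<open>S\<close>, whose elements are
    themselves matrices over \<open>L'\<close>.\<close>
  define j where "j x = map_mat (scalar_matrix L' m) (\<phi>' x)" for x
  have mj: "map_mat (scalar_matrix L' m) \<in> ring_hom MM SS"
    unfolding MM_def SS_def by (rule matrix_ring_hom[OF L'.ring_axioms S.ring_axioms i'])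
  have jh: "j \<in> ring_hom B SS"
    unfolding j_def using \<phi>'h mj
    by (intro ring_hom_memI) (auto simp: ring_hom_closed ring_hom_mult ring_hom_add ring_hom_one)
  note jc = ring_hom_closed[OF jh]
  define sS where "sS = scalar_matrix S m"
  define sL where "sL = scalar_matrix L m"
  have sSh: "sS \<in> ring_hom S SS" unfolding sS_def SS_def by (rule S.scalar_matrix_hom)
  have sLh: "sL \<in> ring_hom L LL" unfolding sL_def LL_def by (rule L.scalar_matrix_hom)
  have sSc: "sS x \<in> carrier SS" if "x \<in> carrier S" for x using ring_hom_closed[OF sSh that] .
  have sLc: "sL x \<in> carrier LL" if "x \<in> LC" for x using ring_hom_closed[OF sLh] that by simp
  have sScomm: "sS x \<otimes>\<^bsub>SS\<^esub> M = M \<otimes>\<^bsub>SS\<^esub> sS x" if "x \<in> carrier S" "M \<in> carrier SS" for x M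
    using that S.scalar_matrix_commute unfolding SS_def sS_def by blast
  have sLcomm: "sL x \<otimes>\<^bsub>LL\<^esub> M = M \<otimes>\<^bsub>LL\<^esub> sL x" if "x \<in> LC" "M \<in> carrier LL" for x M
    using that L.scalar_matrix_commute unfolding LL_def sL_def by simp
  \<comment> \<open>On \<open>K\<close> the two ways into the matrices over \<open>S\<close> agree:
    \<open>\<phi>' k\<close> is already the scalar matrix of \<open>\<iota>' k\<close>, so embedding
    its entries amounts to putting it on the diagonal. This lets \<open>\<theta>\<close> extend
    \<open>j\<close>.\<close>
  have jK: "j k = sS (\<phi>' k)" if k: "k \<in> K" for k
  proof (rule eq_matI)
    fix r s assume "r < dim_row (sS (\<phi>' k))" "s < dim_col (sS (\<phi>' k))"
    then have rs: "r < m" "s < m" by (simp_all add: sS_def scalar_matrix_def)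
    have "scalar_matrix L' m \<zero>\<^bsub>L'\<^esub> = \<zero>\<^bsub>S\<^esub>"
      by (rule ring_hom_zero[OF i' L'.ring_axioms S.ring_axioms])
    then show "j k $$ (r, s) = sS (\<phi>' k) $$ (r, s)"
      using rs \<phi>'(2)[OF k] unfolding j_def sS_def by (auto simp: scalar_matrix_def[of _ _ "\<iota>' k"] scalar_matrix_def[of S])
  qed (auto simp: j_def sS_def \<phi>'(2)[OF k] scalar_matrix_def)
  note \<phi>h = \<phi>(1)[folded LL_def]
  note \<phi>c = ring_hom_closed[OF \<phi>h]
  note mspan = mspan[folded LL_def sL_def] and mindep = mindep[folded LL_def sL_def]
  define comb where "comb c = (\<Oplus>\<^bsub>LL\<^esub>k\<in>{..<N}. sL (c k) \<otimes>\<^bsub>LL\<^esub> \<phi> (b k))" for c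
  have tc: "sL (c k) \<otimes>\<^bsub>LL\<^esub> \<phi> (b k) \<in> carrier LL" if "c k \<in> LC" "k < N" for c k
    using that sLc b \<phi>c by simp
  have combc: "comb c \<in> carrier LL" if "\<And>k. k < N \<Longrightarrow> c k \<in> LC" for c
    unfolding comb_def using that tc by (intro LL.finsum_closed) auto
  have LCadd: "x \<oplus>\<^bsub>B\<^esub> y \<in> LC" "x \<otimes>\<^bsub>B\<^esub> y \<in> LC" if "x \<in> LC" "y \<in> LC" for x y
    using subringE(6,7)[OF LC] that by auto
  have comb_add: "comb (\<lambda>k. c k \<oplus>\<^bsub>B\<^esub> e k) = comb c \<oplus>\<^bsub>LL\<^esub> comb e"
    if "\<And>k. k < N \<Longrightarrow> c k \<in> LC" "\<And>k. k < N \<Longrightarrow> e k \<in> LC" for c e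
  proof -
    have "comb (\<lambda>k. c k \<oplus>\<^bsub>B\<^esub> e k) =
      (\<Oplus>\<^bsub>LL\<^esub>k\<in>{..<N}. (sL (c k) \<otimes>\<^bsub>LL\<^esub> \<phi> (b k)) \<oplus>\<^bsub>LL\<^esub> (sL (e k) \<otimes>\<^bsub>LL\<^esub> \<phi> (b k)))"
      unfolding comb_def using that b \<phi>c sLc LCadd ring_hom_add[OF sLh]
      by (intro LL.finsum_cong') (auto simp: Ladd LL.l_distr)
    also have "\<dots> = comb c \<oplus>\<^bsub>LL\<^esub> comb e"
      unfolding comb_def using that tc by (intro LL.finsum_addf) auto
    finally show ?thesis .
  qed
  have comb_smult: "comb (\<lambda>k. l \<otimes>\<^bsub>B\<^esub> c k) = sL l \<otimes>\<^bsub>LL\<^esub> comb c"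
    if "\<And>k. k < N \<Longrightarrow> c k \<in> LC" "l \<in> LC" for c l
  proof -
    have "comb (\<lambda>k. l \<otimes>\<^bsub>B\<^esub> c k) = (\<Oplus>\<^bsub>LL\<^esub>k\<in>{..<N}. sL l \<otimes>\<^bsub>LL\<^esub> (sL (c k) \<otimes>\<^bsub>LL\<^esub> \<phi> (b k)))"
      unfolding comb_def using that b \<phi>c sLc LCadd ring_hom_mult[OF sLh]
      by (intro LL.finsum_cong') (auto simp: Lmul LL.m_assoc)
    also have "\<dots> = sL l \<otimes>\<^bsub>LL\<^esub> comb c"
      unfolding comb_def using that tc sLc by (intro LL.finsum_rdistr[symmetric]) auto
    finally show ?thesis .
  qed
  have unique: "c k = e k"
    if c: "\<And>k. k < N \<Longrightarrow> c k \<in> LC" and e: "\<And>k. k < N \<Longrightarrow> e k \<in> LC" and eq: "comb c = comb e" and k: "k < N" for c e k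
  proof -
    \<comment> \<open>The difference is written as \<open>c + (-1) e\<close>, so that closure of
      \<open>LC\<close> under sums and products covers it.\<close>
    have m1: "\<ominus>\<^bsub>B\<^esub> \<one>\<^bsub>B\<^esub> \<in> LC" using subringE(3,5)[OF LC] by auto
    have e': "\<ominus>\<^bsub>B\<^esub> \<one>\<^bsub>B\<^esub> \<otimes>\<^bsub>B\<^esub> e k \<in> LC" if "k < N" for k using LCadd m1 e that by auto
    have z: "comb (\<lambda>k. e k \<oplus>\<^bsub>B\<^esub> \<ominus>\<^bsub>B\<^esub> \<one>\<^bsub>B\<^esub> \<otimes>\<^bsub>B\<^esub> e k) = \<zero>\<^bsub>LL\<^esub>"
    proof -
      have "comb (\<lambda>k. e k \<oplus>\<^bsub>B\<^esub> \<ominus>\<^bsub>B\<^esub> \<one>\<^bsub>B\<^esub> \<otimes>\<^bsub>B\<^esub> e k) = (\<Oplus>\<^bsub>LL\<^esub>k\<in>{..<N}. \<zero>\<^bsub>LL\<^esub>)"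
        unfolding comb_def
      proof (intro LL.finsum_cong')
        fix k assume "k \<in> {..<N}"
        then have k: "k < N" by simp
        have "e k \<oplus>\<^bsub>B\<^esub> \<ominus>\<^bsub>B\<^esub> \<one>\<^bsub>B\<^esub> \<otimes>\<^bsub>B\<^esub> e k = \<zero>\<^bsub>L\<^esub>"
          using e[OF k] LCB by (simp add: B.l_minus B.r_neg Lzero subset_iff)
        moreover have "sL \<zero>\<^bsub>L\<^esub> = \<zero>\<^bsub>LL\<^esub>"
          by (rule ring_hom_zero[OF sLh L.ring_axioms LL.ring_axioms])
        ultimately show "sL (e k \<oplus>\<^bsub>B\<^esub> \<ominus>\<^bsub>B\<^esub> \<one>\<^bsub>B\<^esub> \<otimes>\<^bsub>B\<^esub> e k) \<otimes>\<^bsub>LL\<^esub> \<phi> (b k) = \<zero>\<^bsub>LL\<^esub>"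
          using b[OF k] \<phi>c by simp
      qed auto
      then show ?thesis by simp
    qed
    have "comb (\<lambda>k. c k \<oplus>\<^bsub>B\<^esub> \<ominus>\<^bsub>B\<^esub> \<one>\<^bsub>B\<^esub> \<otimes>\<^bsub>B\<^esub> e k) = comb (\<lambda>k. e k \<oplus>\<^bsub>B\<^esub> \<ominus>\<^bsub>B\<^esub> \<one>\<^bsub>B\<^esub> \<otimes>\<^bsub>B\<^esub> e k)"
      using c e e' eq by (simp add: comb_add)
    then have "c k \<oplus>\<^bsub>B\<^esub> \<ominus>\<^bsub>B\<^esub> \<one>\<^bsub>B\<^esub> \<otimes>\<^bsub>B\<^esub> e k = \<zero>\<^bsub>B\<^esub>"
      using mindep[of "\<lambda>k. c k \<oplus>\<^bsub>B\<^esub> \<ominus>\<^bsub>B\<^esub> \<one>\<^bsub>B\<^esub> \<otimes>\<^bsub>B\<^esub> e k" k] c e' k LCadd z by (simp add: comb_def)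
    moreover have ce: "c k \<in> carrier B" "e k \<in> carrier B" using c[OF k] e[OF k] LCB by auto
    ultimately have "c k \<ominus>\<^bsub>B\<^esub> e k = \<zero>\<^bsub>B\<^esub>" by (simp add: B.l_minus B.minus_eq)
    then show ?thesis using ce by simp
  qed
  define co where "co Z = (SOME c. (\<forall>k<N. c k \<in> LC) \<and> Z = comb c)" for Z
  have co: "co Z k \<in> LC" "comb (co Z) = Z" if Z: "Z \<in> carrier LL" "k < N" for Z k
    using someI_ex[OF mspan[OF Z(1), folded comb_def]] Z(2) unfolding co_def by auto
  have co2: "comb (co Z) = Z" if Z: "Z \<in> carrier LL" for Z
    using someI_ex[OF mspan[OF Z(1), folded comb_def]] unfolding co_def by auto
  have co_eq: "co (comb c) k = c k" if "\<And>k. k < N \<Longrightarrow> c k \<in> LC" "k < N" for c k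
    using that co[OF combc] co2[OF combc] by (intro unique) auto
  \<comment> \<open>The matrices over \<open>L\<close> play the part of the tensor product of
    \<open>L\<close> and \<open>B\<close> over \<open>K\<close>: in coordinates with respect to the
    \<open>\<phi> (b k)\<close>, the coefficients are mapped by \<open>\<phi>'\<close> and
    \<open>\<phi> (b k)\<close> is replaced by \<open>j (b k)\<close>.\<close>
  define \<theta> where "\<theta> Z = (\<Oplus>\<^bsub>SS\<^esub>k\<in>{..<N}. sS (\<phi>' (co Z k)) \<otimes>\<^bsub>SS\<^esub> j (b k))" for Z
  have ic: "\<phi>' l \<in> carrier S" if "l \<in> LC" for l using ring_hom_closed[OF i] that by simp
  have \<theta>t: "sS (\<phi>' l) \<otimes>\<^bsub>SS\<^esub> j (b k) \<in> carrier SS" if "l \<in> LC" "k < N" for l k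
    using that ic sSc jc b by simp
  have \<theta>c: "\<theta> Z \<in> carrier SS" if "Z \<in> carrier LL" for Z
    unfolding \<theta>_def using co that \<theta>t by (intro SS.finsum_closed) auto
  have \<theta>comb: "\<theta> (comb c) = (\<Oplus>\<^bsub>SS\<^esub>k\<in>{..<N}. sS (\<phi>' (c k)) \<otimes>\<^bsub>SS\<^esub> j (b k))"
    if "\<And>k. k < N \<Longrightarrow> c k \<in> LC" for c
    unfolding \<theta>_def using that \<theta>t co_eq by (intro SS.finsum_cong') auto
  have \<theta>add: "\<theta> (Z \<oplus>\<^bsub>LL\<^esub> W) = \<theta> Z \<oplus>\<^bsub>SS\<^esub> \<theta> W" if ZW: "Z \<in> carrier LL" "W \<in> carrier LL" for Z W
  proof -
    have "\<theta> (Z \<oplus>\<^bsub>LL\<^esub> W) = \<theta> (comb (\<lambda>k. co Z k \<oplus>\<^bsub>B\<^esub> co W k))"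
      using ZW co co2 by (subst comb_add) auto
    also have "\<dots> = (\<Oplus>\<^bsub>SS\<^esub>k\<in>{..<N}. sS (\<phi>' (co Z k \<oplus>\<^bsub>B\<^esub> co W k)) \<otimes>\<^bsub>SS\<^esub> j (b k))"
      using ZW co LCadd by (intro \<theta>comb) auto
    also have "\<dots> = (\<Oplus>\<^bsub>SS\<^esub>k\<in>{..<N}. (sS (\<phi>' (co Z k)) \<otimes>\<^bsub>SS\<^esub> j (b k)) \<oplus>\<^bsub>SS\<^esub> (sS (\<phi>' (co W k)) \<otimes>\<^bsub>SS\<^esub> j (b k)))"
      using ZW co LCadd ring_hom_add[OF i] ic ring_hom_add[OF sSh] sSc jc b
      by (intro SS.finsum_cong') (auto simp: SS.l_distr Ladd)
    also have "\<dots> = \<theta> Z \<oplus>\<^bsub>SS\<^esub> \<theta> W"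
      unfolding \<theta>_def using co ZW \<theta>t by (intro SS.finsum_addf) auto
    finally show ?thesis .
  qed
  have \<theta>smult: "\<theta> (sL l \<otimes>\<^bsub>LL\<^esub> Z) = sS (\<phi>' l) \<otimes>\<^bsub>SS\<^esub> \<theta> Z" if Z: "Z \<in> carrier LL" "l \<in> LC" for Z l
  proof -
    have "\<theta> (sL l \<otimes>\<^bsub>LL\<^esub> Z) = \<theta> (comb (\<lambda>k. l \<otimes>\<^bsub>B\<^esub> co Z k))"
      using Z co co2 by (subst comb_smult) auto
    also have "\<dots> = (\<Oplus>\<^bsub>SS\<^esub>k\<in>{..<N}. sS (\<phi>' (l \<otimes>\<^bsub>B\<^esub> co Z k)) \<otimes>\<^bsub>SS\<^esub> j (b k))"
      using Z co LCadd by (intro \<theta>comb) auto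
    also have "\<dots> = (\<Oplus>\<^bsub>SS\<^esub>k\<in>{..<N}. sS (\<phi>' l) \<otimes>\<^bsub>SS\<^esub> (sS (\<phi>' (co Z k)) \<otimes>\<^bsub>SS\<^esub> j (b k)))"
      using Z co LCadd ring_hom_mult[OF i] ic ring_hom_mult[OF sSh] sSc jc b
      by (intro SS.finsum_cong') (auto simp: SS.m_assoc Lmul)
    also have "\<dots> = sS (\<phi>' l) \<otimes>\<^bsub>SS\<^esub> \<theta> Z"
      unfolding \<theta>_def using co Z \<theta>t ic sSc by (intro SS.finsum_rdistr[symmetric]) auto
    finally show ?thesis .
  qed
  have \<theta>\<phi>: "\<theta> (\<phi> w) = j w" if w: "w \<in> carrier B" for w
  proof -
    obtain \<beta> where \<beta>: "\<And>k. k < N \<Longrightarrow> \<beta> k \<in> K" "w = (\<Oplus>\<^bsub>B\<^esub>k\<in>{..<N}. \<beta> k \<otimes>\<^bsub>B\<^esub> b k)"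
      using bspan[OF w] by blast
    have \<beta>L: "\<beta> k \<in> LC" "\<beta> k \<in> carrier B" if "k < N" for k using \<beta>(1)[OF that] KL LCB by auto
    have "\<phi> w = (\<Oplus>\<^bsub>LL\<^esub>k\<in>{..<N}. \<phi> (\<beta> k \<otimes>\<^bsub>B\<^esub> b k))"
      unfolding \<beta>(2) using \<beta>L b by (intro ring_hom_finsum[OF B LL.ring_axioms \<phi>h]) auto
    also have "\<dots> = comb \<beta>"
      unfolding comb_def using \<beta>L b \<beta>(1) tc
      by (intro LL.finsum_cong') (auto simp: ring_hom_mult[OF \<phi>h] \<phi>(2) sL_def)
    finally have "\<theta> (\<phi> w) = (\<Oplus>\<^bsub>SS\<^esub>k\<in>{..<N}. sS (\<phi>' (\<beta> k)) \<otimes>\<^bsub>SS\<^esub> j (b k))"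
      using \<theta>comb \<beta>L by simp
    also have "\<dots> = (\<Oplus>\<^bsub>SS\<^esub>k\<in>{..<N}. j (\<beta> k \<otimes>\<^bsub>B\<^esub> b k))"
      using \<beta>L b \<beta>(1) jc \<theta>t by (intro SS.finsum_cong') (auto simp: ring_hom_mult[OF jh] jK)
    also have "\<dots> = j w"
      unfolding \<beta>(2) using \<beta>L b by (intro ring_hom_finsum[OF B SS.ring_axioms jh, symmetric]) auto
    finally show ?thesis .
  qed
  have \<theta>sum: "\<theta> (\<Oplus>\<^bsub>LL\<^esub>k\<in>{..<N}. g k) = (\<Oplus>\<^bsub>SS\<^esub>k\<in>{..<N}. \<theta> (g k))"
    if "\<And>k. k < N \<Longrightarrow> g k \<in> carrier LL" for g
    using that \<theta>c \<theta>add
    by (intro additive_finsum[OF LL.abelian_group_axioms SS.abelian_group_axioms]) auto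
  \<comment> \<open>Multiplicativity is first checked against \<open>\<phi> w\<close>, where the
    products \<open>b k w\<close> stay inside \<open>B\<close>. General right factors follow because
    the scalars are central on both sides.\<close>
  have \<theta>mult1: "\<theta> (Z \<otimes>\<^bsub>LL\<^esub> \<phi> w) = \<theta> Z \<otimes>\<^bsub>SS\<^esub> j w" if Z: "Z \<in> carrier LL" "w \<in> carrier B" for Z w
  proof -
    have "Z \<otimes>\<^bsub>LL\<^esub> \<phi> w = (\<Oplus>\<^bsub>LL\<^esub>k\<in>{..<N}. sL (co Z k) \<otimes>\<^bsub>LL\<^esub> \<phi> (b k)) \<otimes>\<^bsub>LL\<^esub> \<phi> w"
      using co2[OF Z(1)] by (simp add: comb_def)
    also have "\<dots> = (\<Oplus>\<^bsub>LL\<^esub>k\<in>{..<N}. sL (co Z k) \<otimes>\<^bsub>LL\<^esub> \<phi> (b k) \<otimes>\<^bsub>LL\<^esub> \<phi> w)"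
      using tc co Z \<phi>c by (intro LL.finsum_ldistr) auto
    also have "\<dots> = (\<Oplus>\<^bsub>LL\<^esub>k\<in>{..<N}. sL (co Z k) \<otimes>\<^bsub>LL\<^esub> \<phi> (b k \<otimes>\<^bsub>B\<^esub> w))"
      using sLc co Z \<phi>c b by (intro LL.finsum_cong') (auto simp: LL.m_assoc ring_hom_mult[OF \<phi>h])
    finally have "\<theta> (Z \<otimes>\<^bsub>LL\<^esub> \<phi> w) = (\<Oplus>\<^bsub>SS\<^esub>k\<in>{..<N}. \<theta> (sL (co Z k) \<otimes>\<^bsub>LL\<^esub> \<phi> (b k \<otimes>\<^bsub>B\<^esub> w)))"
      using sLc co Z \<phi>c b by (simp add: \<theta>sum)
    also have "\<dots> = (\<Oplus>\<^bsub>SS\<^esub>k\<in>{..<N}. sS (\<phi>' (co Z k)) \<otimes>\<^bsub>SS\<^esub> j (b k) \<otimes>\<^bsub>SS\<^esub> j w)"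
      using sSc ic co Z \<phi>c b jc
      by (intro SS.finsum_cong') (auto simp: \<theta>smult \<theta>\<phi> SS.m_assoc ring_hom_mult[OF jh])
    also have "\<dots> = \<theta> Z \<otimes>\<^bsub>SS\<^esub> j w"
      unfolding \<theta>_def using \<theta>t co Z jc by (intro SS.finsum_ldistr[symmetric]) auto
    finally show ?thesis .
  qed
  have \<theta>mult: "\<theta> (Z \<otimes>\<^bsub>LL\<^esub> W) = \<theta> Z \<otimes>\<^bsub>SS\<^esub> \<theta> W" if Z: "Z \<in> carrier LL" "W \<in> carrier LL" for Z W
  proof -
    have "Z \<otimes>\<^bsub>LL\<^esub> W = Z \<otimes>\<^bsub>LL\<^esub> (\<Oplus>\<^bsub>LL\<^esub>k\<in>{..<N}. sL (co W k) \<otimes>\<^bsub>LL\<^esub> \<phi> (b k))"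
      using co2[OF Z(2)] by (simp add: comb_def)
    also have "\<dots> = (\<Oplus>\<^bsub>LL\<^esub>k\<in>{..<N}. Z \<otimes>\<^bsub>LL\<^esub> (sL (co W k) \<otimes>\<^bsub>LL\<^esub> \<phi> (b k)))"
      using tc co Z \<phi>c by (intro LL.finsum_rdistr) auto
    also have "\<dots> = (\<Oplus>\<^bsub>LL\<^esub>k\<in>{..<N}. sL (co W k) \<otimes>\<^bsub>LL\<^esub> (Z \<otimes>\<^bsub>LL\<^esub> \<phi> (b k)))"
    proof (rule LL.finsum_cong')
      fix k assume "k \<in> {..<N}"
      then show "Z \<otimes>\<^bsub>LL\<^esub> (sL (co W k) \<otimes>\<^bsub>LL\<^esub> \<phi> (b k)) = sL (co W k) \<otimes>\<^bsub>LL\<^esub> (Z \<otimes>\<^bsub>LL\<^esub> \<phi> (b k))"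
        using sLcomm[of "co W k" Z] sLc co Z \<phi>c b by (simp flip: LL.m_assoc)
    qed (use sLc co Z \<phi>c b in auto)
    finally have "\<theta> (Z \<otimes>\<^bsub>LL\<^esub> W) = (\<Oplus>\<^bsub>SS\<^esub>k\<in>{..<N}. \<theta> (sL (co W k) \<otimes>\<^bsub>LL\<^esub> (Z \<otimes>\<^bsub>LL\<^esub> \<phi> (b k))))"
      using sLc co Z \<phi>c b by (simp add: \<theta>sum)
    also have "\<dots> = (\<Oplus>\<^bsub>SS\<^esub>k\<in>{..<N}. \<theta> Z \<otimes>\<^bsub>SS\<^esub> (sS (\<phi>' (co W k)) \<otimes>\<^bsub>SS\<^esub> j (b k)))"
    proof (rule SS.finsum_cong')
      fix k assume "k \<in> {..<N}"
      then show "\<theta> (sL (co W k) \<otimes>\<^bsub>LL\<^esub> (Z \<otimes>\<^bsub>LL\<^esub> \<phi> (b k))) = \<theta> Z \<otimes>\<^bsub>SS\<^esub> (sS (\<phi>' (co W k)) \<otimes>\<^bsub>SS\<^esub> j (b k))"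
        using sScomm[of "\<phi>' (co W k)" "\<theta> Z"] sSc ic co Z \<phi>c b jc \<theta>c
        by (simp add: \<theta>smult \<theta>mult1 flip: SS.m_assoc)
    qed (use \<theta>t \<theta>c co Z in auto)
    also have "\<dots> = \<theta> Z \<otimes>\<^bsub>SS\<^esub> \<theta> W"
      unfolding \<theta>_def[of W] using \<theta>t \<theta>c co Z by (intro SS.finsum_rdistr[symmetric]) auto
    finally show ?thesis .
  qed
  have \<theta>one: "\<theta> \<one>\<^bsub>LL\<^esub> = \<one>\<^bsub>SS\<^esub>"
    using \<theta>\<phi>[of "\<one>\<^bsub>B\<^esub>"] ring_hom_one[OF \<phi>h] ring_hom_one[OF jh] by simp
  have \<theta>h: "\<theta> \<in> ring_hom (matrix_ring L m) (matrix_ring S m)"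
    unfolding LL_def[symmetric] SS_def[symmetric] using \<theta>c \<theta>mult \<theta>add \<theta>one by (intro ring_hom_memI)
  have \<theta>s: "\<theta> (scalar_matrix L m l) = scalar_matrix S m (\<phi>' l)" if "l \<in> carrier L" for l
    using \<theta>smult[of "\<one>\<^bsub>LL\<^esub>" l] that \<theta>one sLc sSc ic by (simp add: sL_def sS_def)
  \<comment> \<open>The matrix \<open>\<theta> (\<phi> z) = j z\<close> has its determinant computed
    twice: by the Skolem-Noether theorem along \<open>\<phi>'\<close>, and as the determinant of
    \<open>\<phi>' z\<close> with its entries embedded.\<close>
  have "determinant S m (\<theta> (\<phi> z)) = \<phi>' (determinant L m (\<phi> z))"
    using \<phi>c[OF z] by (intro determinant_matrix_ring_hom[OF L(2) S.is_cring i \<theta>h \<theta>s _ m]) (auto simp: LL_def)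
  moreover have "determinant S m (j z) = scalar_matrix L' m (determinant L' m (\<phi>' z))"
    unfolding j_def using \<phi>'c[OF z]
    by (intro determinant_hom[OF L' S.is_cring i', symmetric]) (simp add: MM_def)
  ultimately show ?thesis using \<theta>\<phi>[OF z] by simp
qed

section \<open>Free modules and the reduced norm\<close>

lemma (in abelian_monoid) finsum_swap:
  assumes "finite I" "finite J" "\<And>i j. i \<in> I \<Longrightarrow> j \<in> J \<Longrightarrow> f i j \<in> carrier G"
  shows "(\<Oplus>i\<in>I. \<Oplus>j\<in>J. f i j) = (\<Oplus>j\<in>J. \<Oplus>i\<in>I. f i j)"
  using assms(1,3)
proof (induction I rule: finite_induct)
  case empty
  then show ?case by simp
next
  case (insert x I)
  have "(\<Oplus>i\<in>insert x I. \<Oplus>j\<in>J. f i j) = (\<Oplus>j\<in>J. f x j) \<oplus> (\<Oplus>j\<in>J. \<Oplus>i\<in>I. f i j)"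
    using insert by (subst finsum_insert) (auto intro!: finsum_closed)
  also have "\<dots> = (\<Oplus>j\<in>J. f x j \<oplus> (\<Oplus>i\<in>I. f i j))"
    using insert.prems by (intro finsum_addf[symmetric]) (auto intro!: finsum_closed)
  also have "\<dots> = (\<Oplus>j\<in>J. \<Oplus>i\<in>insert x I. f i j)"
    using insert by (intro finsum_cong') (auto intro!: finsum_closed)
  finally show ?case .
qed

lemma (in ring) finsum_subring:
  assumes K: "subring K R" and f: "\<And>x. x \<in> I \<Longrightarrow> f x \<in> K"
  shows "(\<Oplus>\<^bsub>R\<lparr>carrier := K\<rparr>\<^esub>x\<in>I. f x) = (\<Oplus>x\<in>I. f x)" "(\<Oplus>x\<in>I. f x) \<in> K"
proof -
  interpret K: ring "R\<lparr>carrier := K\<rparr>" by (rule subring_is_ring[OF K])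
  have "(\<lambda>x. x) \<in> ring_hom (R\<lparr>carrier := K\<rparr>) R"
    using subringE(1)[OF K] by (intro ring_hom_memI) auto
  then show "(\<Oplus>\<^bsub>R\<lparr>carrier := K\<rparr>\<^esub>x\<in>I. f x) = (\<Oplus>x\<in>I. f x)"
    using f ring_hom_finsum[of "R\<lparr>carrier := K\<rparr>" R "\<lambda>x. x" I f] K.ring_axioms ring_axioms by auto
  then show "(\<Oplus>x\<in>I. f x) \<in> K"
    using K.finsum_closed[of f I] f by auto
qed

text \<open>The coefficients \<open>LC\<close> form an arbitrary subring, so that one interface
  serves \<open>E[x]\<close> inside \<open>R\<close>, \<open>E(x)\<close> inside the quotient ring,
  vector spaces over subfields of \<open>A\<close>, and matrices over their scalars.\<close>

locale left_basis = ring B for B (structure) +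
  fixes LC :: "'a set" and v :: "nat \<Rightarrow> 'a" and m :: nat
  assumes LC: "subring LC B"
    and v_closed: "j < m \<Longrightarrow> v j \<in> carrier B"
    and span: "z \<in> carrier B \<Longrightarrow> \<exists>c. (\<forall>j<m. c j \<in> LC) \<and> z = (\<Oplus>j\<in>{..<m}. c j \<otimes> v j)"
    and indep: "(\<And>j. j < m \<Longrightarrow> c j \<in> LC) \<Longrightarrow> (\<Oplus>j\<in>{..<m}. c j \<otimes> v j) = \<zero> \<Longrightarrow> k < m \<Longrightarrow> c k = \<zero>"
begin

lemma LC_closed: "x \<in> LC \<Longrightarrow> x \<in> carrier B"
  using subringE(1)[OF LC] by auto

lemma term_closed: "(\<And>j. j < m \<Longrightarrow> c j \<in> LC) \<Longrightarrow> j < m \<Longrightarrow> c j \<otimes> v j \<in> carrier B"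
  by (simp add: LC_closed v_closed)

lemma coords_unique:
  assumes c: "\<And>j. j < m \<Longrightarrow> c j \<in> LC" and e: "\<And>j. j < m \<Longrightarrow> e j \<in> LC"
    and eq: "(\<Oplus>j\<in>{..<m}. c j \<otimes> v j) = (\<Oplus>j\<in>{..<m}. e j \<otimes> v j)" and k: "k < m"
  shows "c k = e k"
proof -
  have d: "c j \<ominus> e j \<in> LC" if "j < m" for j
    using c[OF that] e[OF that] subringE(5,7)[OF LC] by (auto simp: a_minus_def)
  have "(\<Oplus>j\<in>{..<m}. c j \<otimes> v j) = (\<Oplus>j\<in>{..<m}. (c j \<ominus> e j) \<otimes> v j \<oplus> e j \<otimes> v j)"
    using c e d v_closed LC_closed
    by (intro finsum_cong') (auto simp: a_minus_def a_assoc l_neg simp flip: l_distr)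
  also have "\<dots> = (\<Oplus>j\<in>{..<m}. (c j \<ominus> e j) \<otimes> v j) \<oplus> (\<Oplus>j\<in>{..<m}. e j \<otimes> v j)"
    using c e d v_closed LC_closed by (intro finsum_addf) auto
  finally have "(\<Oplus>j\<in>{..<m}. (c j \<ominus> e j) \<otimes> v j) \<oplus> (\<Oplus>j\<in>{..<m}. e j \<otimes> v j) = (\<Oplus>j\<in>{..<m}. e j \<otimes> v j)"
    using eq by simp
  moreover have "(\<Oplus>j\<in>{..<m}. (c j \<ominus> e j) \<otimes> v j) \<in> carrier B" "(\<Oplus>j\<in>{..<m}. e j \<otimes> v j) \<in> carrier B"
    using e d term_closed[of e] term_closed[of "\<lambda>j. c j \<ominus> e j"] by (auto intro!: finsum_closed)
  ultimately have "(\<Oplus>j\<in>{..<m}. (c j \<ominus> e j) \<otimes> v j) = \<zero>" by simp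
  then have "c k \<ominus> e k = \<zero>" using indep[of "\<lambda>j. c j \<ominus> e j" k] d k by blast
  then show ?thesis using c[OF k] e[OF k] LC_closed by simp
qed

definition coord :: "'a \<Rightarrow> nat \<Rightarrow> 'a" where
  "coord z = (SOME c. (\<forall>j<m. c j \<in> LC) \<and> z = (\<Oplus>j\<in>{..<m}. c j \<otimes> v j))"

lemma coord:
  assumes "z \<in> carrier B"
  shows "j < m \<Longrightarrow> coord z j \<in> LC" "z = (\<Oplus>j\<in>{..<m}. coord z j \<otimes> v j)"
  using someI_ex[OF span[OF assms]] unfolding coord_def[symmetric] by blast+

lemma coord_eqI:
  assumes "\<And>j. j < m \<Longrightarrow> c j \<in> LC" "z = (\<Oplus>j\<in>{..<m}. c j \<otimes> v j)" "j < m"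
  shows "coord z j = c j"
proof -
  have z: "z \<in> carrier B"
    unfolding assms(2) using assms(1) term_closed[of c] by (intro finsum_closed) auto
  show ?thesis
    by (rule coords_unique[OF coord(1)[OF z] assms(1) trans[OF coord(2)[OF z, symmetric] assms(2)] assms(3)])
qed

text \<open>Right multiplication is linear for coefficients on the left, and with coordinates
  written as rows it preserves the order of products, so that no opposite ring appears.\<close>

definition row_rep :: "'a \<Rightarrow> 'a mat" where
  "row_rep z = mat m m (\<lambda>(i, j). coord (v i \<otimes> z) j)"

abbreviation L where "L \<equiv> B\<lparr>carrier := LC\<rparr>"

lemma row_rep:
  assumes "z \<in> carrier B" "i < m"
  shows "v i \<otimes> z = (\<Oplus>j\<in>{..<m}. row_rep z $$ (i, j) \<otimes> v j)"
proof -
  have z: "v i \<otimes> z \<in> carrier B" using assms v_closed by simp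
  have "(\<Oplus>j\<in>{..<m}. row_rep z $$ (i, j) \<otimes> v j) = (\<Oplus>j\<in>{..<m}. coord (v i \<otimes> z) j \<otimes> v j)"
    using assms coord(1)[OF z] v_closed LC_closed by (intro finsum_cong') (auto simp: row_rep_def)
  then show ?thesis using coord(2)[OF z] by simp
qed

lemma row_rep_entry:
  assumes "z \<in> carrier B" "i < m" "j < m"
  shows "row_rep z $$ (i, j) \<in> LC"
  using assms coord[of "v i \<otimes> z"] v_closed by (simp add: row_rep_def)

lemma row_rep_closed: "z \<in> carrier B \<Longrightarrow> row_rep z \<in> carrier (matrix_ring L m)"
  using row_rep_entry by (simp add: matrix_ring_carrier) (simp add: row_rep_def)

lemma row_rep_eqI:
  assumes M: "M \<in> carrier (matrix_ring L m)" and z: "z \<in> carrier B"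
    and "\<And>i. i < m \<Longrightarrow> v i \<otimes> z = (\<Oplus>j\<in>{..<m}. M $$ (i, j) \<otimes> v j)"
  shows "row_rep z = M"
proof (rule matrix_ring_eqI[OF row_rep_closed[OF z] M])
  fix i j assume "i < m" "j < m"
  then show "row_rep z $$ (i, j) = M $$ (i, j)"
    using M assms(3) by (simp add: row_rep_def) (rule coord_eqI, auto simp: matrix_ring_carrier)
qed

lemma combination_swap:
  assumes r: "\<And>i. i < m \<Longrightarrow> r i \<in> LC" and M: "M \<in> carrier (matrix_ring L m)"
  shows "(\<Oplus>i\<in>{..<m}. r i \<otimes> (\<Oplus>j\<in>{..<m}. M $$ (i, j) \<otimes> v j)) =
    (\<Oplus>j\<in>{..<m}. (\<Oplus>i\<in>{..<m}. r i \<otimes> M $$ (i, j)) \<otimes> v j)"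
proof -
  have Me: "M $$ (i, j) \<in> carrier B" if "i < m" "j < m" for i j
    using M that by (simp add: matrix_ring_carrier LC_closed)
  have rc: "r i \<in> carrier B" if "i < m" for i using r LC_closed that by simp
  have "(\<Oplus>i\<in>{..<m}. r i \<otimes> (\<Oplus>j\<in>{..<m}. M $$ (i, j) \<otimes> v j)) =
    (\<Oplus>i\<in>{..<m}. \<Oplus>j\<in>{..<m}. r i \<otimes> M $$ (i, j) \<otimes> v j)"
    using rc Me v_closed by (intro finsum_cong') (auto simp: finsum_rdistr m_assoc intro!: finsum_closed finsum_cong')
  also have "\<dots> = (\<Oplus>j\<in>{..<m}. \<Oplus>i\<in>{..<m}. r i \<otimes> M $$ (i, j) \<otimes> v j)"
    using rc Me v_closed by (intro finsum_swap) auto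
  also have "\<dots> = (\<Oplus>j\<in>{..<m}. (\<Oplus>i\<in>{..<m}. r i \<otimes> M $$ (i, j)) \<otimes> v j)"
    using rc Me v_closed by (intro finsum_cong') (auto simp: finsum_ldistr intro!: finsum_closed)
  finally show ?thesis .
qed

lemma row_rep_hom:
  shows "row_rep \<in> ring_hom B (matrix_ring L m)"
proof (rule ring_hom_memI)
  fix y z assume y: "y \<in> carrier B" and z: "z \<in> carrier B"
  interpret L: ring L by (rule subring_is_ring[OF LC])
  note ey = row_rep_entry[OF y] and ez = row_rep_entry[OF z]
  note LCp = subringE(6,7)[OF LC]
  show "row_rep (y \<oplus> z) = row_rep y \<oplus>\<^bsub>matrix_ring L m\<^esub> row_rep z"
  proof (rule row_rep_eqI)
    fix i assume i: "i < m"
    have "v i \<otimes> (y \<oplus> z) = (\<Oplus>j\<in>{..<m}. row_rep y $$ (i, j) \<otimes> v j) \<oplus> (\<Oplus>j\<in>{..<m}. row_rep z $$ (i, j) \<otimes> v j)"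
      using i y z v_closed by (simp add: r_distr row_rep[symmetric])
    also have "\<dots> = (\<Oplus>j\<in>{..<m}. row_rep y $$ (i, j) \<otimes> v j \<oplus> row_rep z $$ (i, j) \<otimes> v j)"
      using ey ez i v_closed LC_closed by (intro finsum_addf[symmetric]) auto
    also have "\<dots> = (\<Oplus>j\<in>{..<m}. (row_rep y \<oplus>\<^bsub>matrix_ring L m\<^esub> row_rep z) $$ (i, j) \<otimes> v j)"
      using ey ez i v_closed LC_closed
      by (intro finsum_cong') (auto simp: matrix_ring_def l_distr)
    finally show "v i \<otimes> (y \<oplus> z) = (\<Oplus>j\<in>{..<m}. (row_rep y \<oplus>\<^bsub>matrix_ring L m\<^esub> row_rep z) $$ (i, j) \<otimes> v j)" .
  qed (use y z ey ez LCp in \<open>auto simp: matrix_ring_carrier, auto simp: matrix_ring_def\<close>)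
  have prod: "(row_rep y \<otimes>\<^bsub>matrix_ring L m\<^esub> row_rep z) $$ (i, j) =
     (\<Oplus>k\<in>{..<m}. row_rep y $$ (i, k) \<otimes> row_rep z $$ (k, j))" if "i < m" "j < m" for i j
    using that ey ez LCp by (simp add: matrix_ring_mult_entry) (subst finsum_subring(1)[OF LC], auto)
  show "row_rep (y \<otimes> z) = row_rep y \<otimes>\<^bsub>matrix_ring L m\<^esub> row_rep z"
  proof (rule row_rep_eqI)
    show "row_rep y \<otimes>\<^bsub>matrix_ring L m\<^esub> row_rep z \<in> carrier (matrix_ring L m)"
      using L.finsum_closed[of "\<lambda>k. row_rep y $$ (_, k) \<otimes> row_rep z $$ (k, _)" "{..<m}"]
      by (auto simp: matrix_ring_carrier matrix_ring_mult_entry intro!: L.finsum_closed[simplified] LCp ey ez)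
        (auto simp: matrix_ring_def)
    fix i assume i: "i < m"
    have "v i \<otimes> (y \<otimes> z) = (\<Oplus>k\<in>{..<m}. row_rep y $$ (i, k) \<otimes> v k) \<otimes> z"
      using i y z v_closed by (simp add: row_rep[symmetric] m_assoc)
    also have "\<dots> = (\<Oplus>k\<in>{..<m}. row_rep y $$ (i, k) \<otimes> v k \<otimes> z)"
      using i y z v_closed ey LC_closed by (intro finsum_ldistr) auto
    also have "\<dots> = (\<Oplus>k\<in>{..<m}. row_rep y $$ (i, k) \<otimes> (\<Oplus>j\<in>{..<m}. row_rep z $$ (k, j) \<otimes> v j))"
      using i y z v_closed ey ez LC_closed
      by (intro finsum_cong') (auto simp: m_assoc row_rep intro!: finsum_closed m_closed)
    also have "\<dots> = (\<Oplus>j\<in>{..<m}. (\<Oplus>k\<in>{..<m}. row_rep y $$ (i, k) \<otimes> row_rep z $$ (k, j)) \<otimes> v j)"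
      using i ey row_rep_closed[OF z] by (intro combination_swap) auto
    also have "\<dots> = (\<Oplus>j\<in>{..<m}. (row_rep y \<otimes>\<^bsub>matrix_ring L m\<^esub> row_rep z) $$ (i, j) \<otimes> v j)"
      using i ey ez v_closed LC_closed by (intro finsum_cong') (auto simp: prod intro!: finsum_closed)
    finally show "v i \<otimes> (y \<otimes> z) = (\<Oplus>j\<in>{..<m}. (row_rep y \<otimes>\<^bsub>matrix_ring L m\<^esub> row_rep z) $$ (i, j) \<otimes> v j)" .
  qed (use y z in auto)
next
  show "row_rep \<one> = \<one>\<^bsub>matrix_ring L m\<^esub>"
  proof (rule row_rep_eqI)
    fix i assume i: "i < m"
    have "(\<Oplus>j\<in>{..<m}. \<one>\<^bsub>matrix_ring L m\<^esub> $$ (i, j) \<otimes> v j) = (\<Oplus>j\<in>{..<m}. if i = j then v j else \<zero>)"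
      using i v_closed by (intro finsum_cong') (auto simp: matrix_ring_def)
    also have "\<dots> = v i" using i v_closed by (intro add.finprod_singleton) auto
    finally show "v i \<otimes> \<one> = (\<Oplus>j\<in>{..<m}. \<one>\<^bsub>matrix_ring L m\<^esub> $$ (i, j) \<otimes> v j)"
      using i v_closed by simp
  qed (use subringE(2,3)[OF LC] in \<open>auto simp: matrix_ring_carrier, auto simp: matrix_ring_def\<close>)
qed (rule row_rep_closed)

lemma row_rep_central:
  assumes k: "k \<in> LC" "\<And>z. z \<in> carrier B \<Longrightarrow> k \<otimes> z = z \<otimes> k"
  shows "row_rep k = scalar_matrix L m k"
proof (rule row_rep_eqI)
  fix i assume i: "i < m"
  have "(\<Oplus>j\<in>{..<m}. scalar_matrix L m k $$ (i, j) \<otimes> v j) = (\<Oplus>j\<in>{..<m}. if i = j then k \<otimes> v j else \<zero>)"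
    using i v_closed k LC_closed by (intro finsum_cong') (auto simp: scalar_matrix_def)
  also have "\<dots> = k \<otimes> v i" using i v_closed k LC_closed by (intro add.finprod_singleton) auto
  finally show "v i \<otimes> k = (\<Oplus>j\<in>{..<m}. scalar_matrix L m k $$ (i, j) \<otimes> v j)"
    using k(2)[OF v_closed[OF i]] by simp
qed (use k subringE(2)[OF LC] LC_closed in \<open>auto simp: matrix_ring_carrier scalar_matrix_def\<close>)

end

lemma (in ring) left_basisI:
  assumes "subring LC R" "\<And>j. j < m \<Longrightarrow> v j \<in> carrier R"
    and "\<And>z. z \<in> carrier R \<Longrightarrow> \<exists>c. (\<forall>j<m. c j \<in> LC) \<and> z = (\<Oplus>j\<in>{..<m}. c j \<otimes> v j)"
    and "\<And>c k. (\<And>j. j < m \<Longrightarrow> c j \<in> LC) \<Longrightarrow> (\<Oplus>j\<in>{..<m}. c j \<otimes> v j) = \<zero> \<Longrightarrow> k < m \<Longrightarrow> c k = \<zero>"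
  shows "left_basis R LC v m"
  by (intro left_basis.intro left_basis_axioms.intro ring_axioms) (use assms in blast)+

section \<open>Bases given by lists, dimension and matrix units\<close>

lemma (in ring) combine_eq_finsum:
  assumes "set Us \<subseteq> carrier R" "set Ks \<subseteq> carrier R" "length Ks = length Us"
  shows "combine Ks Us = (\<Oplus>i\<in>{..<length Us}. Ks ! i \<otimes> Us ! i)"
  using assms(3,1,2)
proof (induction Ks Us rule: list_induct2)
  case (Cons k Ks u Us)
  have inj: "inj_on Suc {..<length Us}" by simp
  have "(\<Oplus>i\<in>{..<length (u # Us)}. (k # Ks) ! i \<otimes> (u # Us) ! i) =
    k \<otimes> u \<oplus> (\<Oplus>i\<in>Suc ` {..<length Us}. (k # Ks) ! i \<otimes> (u # Us) ! i)"
    using Cons.prems Cons.hyps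
    by (simp only: length_Cons lessThan_Suc_eq_insert_0, subst finsum_insert) (auto simp: subset_iff)
  also have "(\<Oplus>i\<in>Suc ` {..<length Us}. (k # Ks) ! i \<otimes> (u # Us) ! i) = (\<Oplus>i\<in>{..<length Us}. Ks ! i \<otimes> Us ! i)"
    using Cons.prems Cons.hyps by (subst finsum_reindex) (auto simp: subset_iff)
  finally show ?case using Cons by simp
qed simp

lemma (in ring) independentI:
  assumes K: "subfield K R" and bs: "set bs \<subseteq> carrier R" and n: "length bs = n"
    and ind: "\<And>c k. (\<And>j. j < n \<Longrightarrow> c j \<in> K) \<Longrightarrow> (\<Oplus>j\<in>{..<n}. c j \<otimes> bs ! j) = \<zero> \<Longrightarrow> k < n \<Longrightarrow> c k = \<zero>"
  shows "independent K bs"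
proof (rule trivial_combine_imp_independent[OF K bs])
  have sub: "subring K R" by (rule subfieldE(1)[OF K])
  fix Ks assume Ks: "set Ks \<subseteq> K" "combine Ks bs = \<zero>"
  \<comment> \<open>A coefficient list may be shorter or longer than \<open>bs\<close>. Cutting it
    and padding it with zeros changes neither its combination nor the claim about its
    entries.\<close>
  define Ks' where "Ks' = take n Ks @ replicate (n - length Ks) \<zero>"
  have Ks': "length Ks' = n" "set Ks' \<subseteq> K"
    using Ks subringE(2)[OF sub] by (auto simp: Ks'_def dest: in_set_takeD)
  have "combine Ks' bs = combine (take n Ks) bs"
    using bs unfolding Ks'_def by (rule combine_append_replicate)
  then have "combine Ks' bs = \<zero>" using Ks(2) combine_take[of bs Ks] n by simp
  then have "(\<Oplus>j\<in>{..<n}. Ks' ! j \<otimes> bs ! j) = \<zero>"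
    using combine_eq_finsum[OF bs, of Ks'] Ks' n subringE(1)[OF sub] by auto
  then have "Ks' ! k = \<zero>" if "k < n" for k
    using ind[of "(!) Ks'" k] Ks' that by (auto simp: subset_iff)
  then have "set Ks' \<subseteq> {\<zero>}" using Ks' by (auto simp: in_set_conv_nth)
  then show "set (take (length bs) Ks) \<subseteq> {\<zero>}" using n by (auto simp: Ks'_def)
qed

lemma (in ring) ring_basis_iff_left_basis:
  assumes K: "subfield K R" and n: "length bs = n"
  shows "ring_basis R K bs \<longleftrightarrow> left_basis R K ((!) bs) n"
proof
  have sub: "subring K R" by (rule subfieldE(1)[OF K])
  note KR = subringE(1)[OF sub]
  {
    assume b: "ring_basis R K bs"
    then have bs: "set bs \<subseteq> carrier R" "independent K bs" "Span K bs = carrier R"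
      by (auto simp: ring_basis_def)
    show "left_basis R K ((!) bs) n"
    proof (rule left_basisI)
      fix z assume "z \<in> carrier R"
      then obtain Ks where Ks: "set Ks \<subseteq> K" "length Ks = length bs" "z = combine Ks bs"
        using Span_mem_iff_length_version[OF K bs(1)] bs(3) by auto
      then have "z = (\<Oplus>j\<in>{..<n}. Ks ! j \<otimes> bs ! j)"
        using combine_eq_finsum[OF bs(1)] KR n by auto
      then show "\<exists>c. (\<forall>j<n. c j \<in> K) \<and> z = (\<Oplus>j\<in>{..<n}. c j \<otimes> bs ! j)"
        using Ks n by (intro exI[of _ "(!) Ks"]) auto
    next
      fix c k assume c: "\<And>j. j < n \<Longrightarrow> c j \<in> K" "(\<Oplus>j\<in>{..<n}. c j \<otimes> bs ! j) = \<zero>" "k < n"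
      have "combine (map c [0..<n]) bs = (\<Oplus>j\<in>{..<n}. map c [0..<n] ! j \<otimes> bs ! j)"
        using bs(1) c KR n by (subst combine_eq_finsum) auto
      also have "\<dots> = (\<Oplus>j\<in>{..<n}. c j \<otimes> bs ! j)"
        using bs(1) c KR n by (intro finsum_cong') (auto simp: subset_iff)
      finally have "set (take (length bs) (map c [0..<n])) \<subseteq> {\<zero>}"
        using c by (intro independent_imp_trivial_combine[OF K bs(2)]) auto
      then show "c k = \<zero>" using c(3) n by (auto simp: image_subset_iff)
    qed (use sub bs n in auto)
  }
  assume "left_basis R K ((!) bs) n"
  then interpret left_basis R K "(!) bs" n .
  have bs: "set bs \<subseteq> carrier R" using v_closed n by (auto simp: in_set_conv_nth)
  have "independent K bs"
    using K bs n indep by (rule independentI)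
  moreover have "Span K bs = carrier R"
  proof
    show "Span K bs \<subseteq> carrier R" using Span_in_carrier[OF KR bs] .
    show "carrier R \<subseteq> Span K bs"
    proof
      fix z assume z: "z \<in> carrier R"
      have "combine (map (coord z) [0..<n]) bs = (\<Oplus>j\<in>{..<n}. map (coord z) [0..<n] ! j \<otimes> bs ! j)"
        using coord(1)[OF z] n bs KR by (subst combine_eq_finsum) auto
      also have "\<dots> = (\<Oplus>j\<in>{..<n}. coord z j \<otimes> bs ! j)"
        using coord(1)[OF z] v_closed LC_closed by (intro finsum_cong') auto
      also have "\<dots> = z" by (rule coord(2)[OF z, symmetric])
      finally have "z = combine (map (coord z) [0..<n]) bs" ..
      then show "z \<in> Span K bs"
        using coord(1)[OF z] n unfolding Span_mem_iff_length_version[OF K bs]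
        by (intro exI[of _ "map (coord z) [0..<n]"]) auto
    qed
  qed
  ultimately show "ring_basis R K bs" using bs by (simp add: ring_basis_def)
qed

lemma (in ring) left_basis_dimension:
  assumes "subfield K R" "left_basis R K v n"
  shows "dimension n K (carrier R)"
proof -
  have "left_basis R K ((!) (map v [0..<n])) n"
  proof -
    interpret left_basis R K v n by fact
    have eq: "(\<Oplus>j\<in>{..<n}. c j \<otimes> map v [0..<n] ! j) = (\<Oplus>j\<in>{..<n}. c j \<otimes> v j)" if "\<And>j. j < n \<Longrightarrow> c j \<in> K" for c
      using that v_closed LC_closed by (intro finsum_cong') auto
    show ?thesis
    proof (rule left_basisI)
      fix z assume z: "z \<in> carrier R"
      show "\<exists>c. (\<forall>j<n. c j \<in> K) \<and> z = (\<Oplus>j\<in>{..<n}. c j \<otimes> map v [0..<n] ! j)"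
        using coord[OF z] eq[of "coord z"] by (intro exI[of _ "coord z"]) simp
    next
      fix c k
      assume "\<And>j. j < n \<Longrightarrow> c j \<in> K" "(\<Oplus>j\<in>{..<n}. c j \<otimes> map v [0..<n] ! j) = \<zero>" "k < n"
      then show "c k = \<zero>" using indep[of c k] eq[of c] by simp
    qed (simp_all add: LC v_closed)
  qed
  then have "ring_basis R K (map v [0..<n])"
    using ring_basis_iff_left_basis[OF assms(1)] by simp
  then show ?thesis
    using dimension_independent[of K "map v [0..<n]"] by (simp add: ring_basis_def)
qed

definition matrix_unit :: "('l, 'm) ring_scheme \<Rightarrow> nat \<Rightarrow> nat \<Rightarrow> nat \<Rightarrow> 'l mat" where
  "matrix_unit L m a b = mat m m (\<lambda>(r, c). if r = a \<and> c = b then \<one>\<^bsub>L\<^esub> else \<zero>\<^bsub>L\<^esub>)"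

lemma (in field) scalar_matrix_subfield:
  assumes "0 < m"
  shows "subfield (scalar_matrix R m ` carrier R) (matrix_ring R m)" "inj_on (scalar_matrix R m) (carrier R)"
proof -
  interpret M: ring "matrix_ring R m" by (rule matrix_ring_is_ring)
  interpret s: ring_hom_ring R "matrix_ring R m" "scalar_matrix R m"
    by (intro ring_hom_ringI2 ring_axioms M.ring_axioms scalar_matrix_hom)
  have "\<one>\<^bsub>matrix_ring R m\<^esub> $$ (0, 0) \<noteq> \<zero>\<^bsub>matrix_ring R m\<^esub> $$ (0, 0)"
    using assms one_not_zero by (simp add: matrix_ring_def)
  then have "\<one>\<^bsub>matrix_ring R m\<^esub> \<noteq> \<zero>\<^bsub>matrix_ring R m\<^esub>" by metis
  then show "subfield (scalar_matrix R m ` carrier R) (matrix_ring R m)" "inj_on (scalar_matrix R m) (carrier R)"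
    using s.img_is_subfield[OF carrier_is_subfield] by auto
qed

text \<open>The matrix unit in row \<open>r\<close> and column \<open>s\<close> has the index
  \<open>k = r m + s\<close>. The basis yields the dimension by which the sizes of different
  splittings are compared.\<close>

lemma (in field) matrix_units_left_basis:
  assumes m: "0 < m"
  shows "left_basis (matrix_ring R m) (scalar_matrix R m ` carrier R)
    (\<lambda>k. matrix_unit R m (k div m) (k mod m)) (m * m)"
proof -
  define MM where "MM = matrix_ring R m"
  interpret MM: ring MM unfolding MM_def by (rule matrix_ring_is_ring)
  define e where "e k = matrix_unit R m (k div m) (k mod m)" for k
  have ec: "e k \<in> carrier MM" for k
    by (auto simp: e_def MM_def matrix_unit_def matrix_ring_carrier)
  have sc: "scalar_matrix R m x \<in> carrier MM" if "x \<in> carrier R" for x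
    unfolding MM_def by (rule scalar_matrix_closed[OF that])
  have entry: "(\<Oplus>\<^bsub>MM\<^esub>k\<in>{..<m*m}. scalar_matrix R m (c k) \<otimes>\<^bsub>MM\<^esub> e k) $$ (r, s) = c (r * m + s)"
    if c: "\<And>k. k < m * m \<Longrightarrow> c k \<in> carrier R" and rs: "r < m" "s < m" for c r s
  proof -
    have "r * m + s < Suc r * m" using rs by simp
    also have "Suc r * m \<le> m * m" using rs by (intro mult_le_mono1) simp
    finally have lt: "r * m + s < m * m" .
    have "(\<Oplus>\<^bsub>MM\<^esub>k\<in>{..<m*m}. scalar_matrix R m (c k) \<otimes>\<^bsub>MM\<^esub> e k) $$ (r, s) =
      (\<Oplus>k\<in>{..<m*m}. (scalar_matrix R m (c k) \<otimes>\<^bsub>MM\<^esub> e k) $$ (r, s))"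
      using c sc ec rs by (intro matrix_finsum_entry[where m = m, folded MM_def]) auto
    also have "\<dots> = (\<Oplus>k\<in>{..<m*m}. if r * m + s = k then c k else \<zero>)"
    proof (rule finsum_cong')
      fix k assume k: "k \<in> {..<m*m}"
      have "(r = k div m \<and> s = k mod m) \<longleftrightarrow> r * m + s = k" using rs by auto
      then show "(scalar_matrix R m (c k) \<otimes>\<^bsub>MM\<^esub> e k) $$ (r, s) = (if r * m + s = k then c k else \<zero>)"
        using c k rs ec unfolding MM_def
        by (subst scalar_matrix_mult_entry) (auto simp: e_def matrix_unit_def)
    qed (use c in auto)
    also have "\<dots> = c (r * m + s)" using c lt by (intro add.finprod_singleton) auto
    finally show ?thesis .
  qed
  have "left_basis MM (scalar_matrix R m ` carrier R) e (m * m)"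
  proof (rule MM.left_basisI)
    show "subring (scalar_matrix R m ` carrier R) MM"
      using scalar_matrix_subfield(1)[OF m] unfolding MM_def by (rule subfieldE(1))
  next
    fix Z assume Z: "Z \<in> carrier MM"
    then have Ze: "Z $$ (i, j) \<in> carrier R" if "i < m" "j < m" for i j
      using that by (simp add: MM_def matrix_ring_carrier)
    define c where "c k = Z $$ (k div m, k mod m)" for k
    have c: "c k \<in> carrier R" if "k < m * m" for k
      using that m Ze by (simp add: c_def less_mult_imp_div_less)
    have "Z = (\<Oplus>\<^bsub>MM\<^esub>k\<in>{..<m*m}. scalar_matrix R m (c k) \<otimes>\<^bsub>MM\<^esub> e k)"
    proof (rule matrix_ring_eqI[of _ R m, folded MM_def])
      show "(\<Oplus>\<^bsub>MM\<^esub>k\<in>{..<m*m}. scalar_matrix R m (c k) \<otimes>\<^bsub>MM\<^esub> e k) \<in> carrier MM"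
        using c sc ec by (intro MM.finsum_closed) auto
    qed (use Z c in \<open>auto simp: entry, auto simp: c_def\<close>)
    then show "\<exists>c. (\<forall>k<m*m. c k \<in> scalar_matrix R m ` carrier R) \<and> Z = (\<Oplus>\<^bsub>MM\<^esub>k\<in>{..<m*m}. c k \<otimes>\<^bsub>MM\<^esub> e k)"
      using c by (intro exI[of _ "\<lambda>k. scalar_matrix R m (c k)"]) auto
  next
    fix c k assume c: "\<And>k. k < m * m \<Longrightarrow> c k \<in> scalar_matrix R m ` carrier R"
      and z: "(\<Oplus>\<^bsub>MM\<^esub>k\<in>{..<m*m}. c k \<otimes>\<^bsub>MM\<^esub> e k) = \<zero>\<^bsub>MM\<^esub>" and k: "k < m * m"
    from c have "\<forall>k. \<exists>x. k < m * m \<longrightarrow> x \<in> carrier R \<and> c k = scalar_matrix R m x" by blast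
    then obtain c' where c': "\<And>k. k < m * m \<Longrightarrow> c' k \<in> carrier R \<and> c k = scalar_matrix R m (c' k)" by metis
    have "(\<Oplus>\<^bsub>MM\<^esub>k\<in>{..<m*m}. c k \<otimes>\<^bsub>MM\<^esub> e k) = (\<Oplus>\<^bsub>MM\<^esub>k\<in>{..<m*m}. scalar_matrix R m (c' k) \<otimes>\<^bsub>MM\<^esub> e k)"
      using c' sc ec by (intro MM.finsum_cong') auto
    then have z': "(\<Oplus>\<^bsub>MM\<^esub>k\<in>{..<m*m}. scalar_matrix R m (c' k) \<otimes>\<^bsub>MM\<^esub> e k) = \<zero>\<^bsub>MM\<^esub>"
      using z by simp
    have "c' (k div m * m + k mod m) = \<zero>"
      using entry[of c' "k div m" "k mod m"] c' k m unfolding z'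
      by (simp add: less_mult_imp_div_less MM_def matrix_ring_zero_entry)
    then show "c k = \<zero>\<^bsub>MM\<^esub>" using c'[OF k] by (simp add: MM_def scalar_matrix_def matrix_ring_def)
  qed (rule ec)
  then show ?thesis by (simp add: MM_def e_def[abs_def])
qed

lemma (in field) matrix_ring_dimension:
  assumes "0 < m"
  shows "ring.dimension (matrix_ring R m) (m * m) (scalar_matrix R m ` carrier R) (carrier (matrix_ring R m))"
  by (rule ring.left_basis_dimension[OF matrix_ring_is_ring scalar_matrix_subfield(1)[OF assms] matrix_units_left_basis[OF assms]])

section \<open>Splittings and the value of the reduced norm\<close>

lemma splitting_bases:
  assumes B: "ring B" and K: "subfield K B" and s: "is_splitting B K L m \<iota> \<phi>"
  obtains b where "0 < m" "left_basis B K b (m * m)"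
    "left_basis (matrix_ring L m) (scalar_matrix L m ` carrier L) (\<lambda>k. \<phi> (b k)) (m * m)"
proof -
  interpret B: ring B by fact
  obtain bs where L: "field L" and bs: "ring_basis B K bs"
    and mbs: "ring_basis (matrix_ring L m) (scalar_matrix L m ` carrier L) (map \<phi> bs)"
    using s by (auto simp: is_splitting_def)
  interpret L: field L by fact
  interpret M: ring "matrix_ring L m" by (rule L.matrix_ring_is_ring)
  \<comment> \<open>For \<open>m = 0\<close> the matrix ring is zero and an independent list in it
    is empty. Then \<open>bs\<close> is empty and \<open>B\<close> is zero, although it contains a
    field.\<close>
  have m: "0 < m"
  proof (rule ccontr)
    assume "\<not> 0 < m"
    then have car: "carrier (matrix_ring L m) = {\<zero>\<^bsub>matrix_ring L m\<^esub>}"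
      by (auto simp: matrix_ring_def elements_mat_def intro!: eq_matI)
    have "Us = []" if "M.independent (scalar_matrix L m ` carrier L) Us" for Us
      using that
    proof (induction rule: M.independent.induct)
      case (li_Cons u K Us)
      then show ?case using car by simp
    qed simp
    then have "bs = []" using mbs by (auto simp: ring_basis_def)
    then have "carrier B = {\<zero>\<^bsub>B\<^esub>}" using bs by (simp add: ring_basis_def)
    then show False using subfieldE(6)[OF K] B.one_closed by auto
  qed
  note sub = L.scalar_matrix_subfield(1)[OF m]
  have "M.dimension (length bs) (scalar_matrix L m ` carrier L) (carrier (matrix_ring L m))"
    using mbs M.dimension_independent[where Us = "map \<phi> bs"]
    by (metis length_map ring_basis_def)
  then have len: "length bs = m * m"
    using M.dimension_is_inj[OF sub] L.matrix_ring_dimension[OF m] by blast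
  have "left_basis B K ((!) bs) (m * m)"
    using B.ring_basis_iff_left_basis[OF K len] bs by simp
  moreover have "left_basis (matrix_ring L m) (scalar_matrix L m ` carrier L) ((!) (map \<phi> bs)) (m * m)"
    using M.ring_basis_iff_left_basis[OF sub, of "map \<phi> bs" "m * m"] mbs len by simp
  then interpret mb: left_basis "matrix_ring L m" "scalar_matrix L m ` carrier L" "(!) (map \<phi> bs)" "m * m" .
  have "left_basis (matrix_ring L m) (scalar_matrix L m ` carrier L) (\<lambda>k. \<phi> (bs ! k)) (m * m)"
  proof (rule M.left_basisI)
    have eq: "(\<Oplus>\<^bsub>matrix_ring L m\<^esub>k\<in>{..<m*m}. c k \<otimes>\<^bsub>matrix_ring L m\<^esub> \<phi> (bs ! k)) =
      (\<Oplus>\<^bsub>matrix_ring L m\<^esub>k\<in>{..<m*m}. c k \<otimes>\<^bsub>matrix_ring L m\<^esub> map \<phi> bs ! k)"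
      if "\<And>k. k < m * m \<Longrightarrow> c k \<in> scalar_matrix L m ` carrier L" for c
      using that mb.v_closed mb.LC_closed len by (intro M.finsum_cong') auto
    {
      fix z assume z: "z \<in> carrier (matrix_ring L m)"
      show "\<exists>c. (\<forall>j<m*m. c j \<in> scalar_matrix L m ` carrier L) \<and>
        z = (\<Oplus>\<^bsub>matrix_ring L m\<^esub>j\<in>{..<m*m}. c j \<otimes>\<^bsub>matrix_ring L m\<^esub> \<phi> (bs ! j))"
        using mb.coord[OF z] eq[of "mb.coord z"] by (intro exI[of _ "mb.coord z"]) simp
    next
      fix c k
      assume "\<And>j. j < m * m \<Longrightarrow> c j \<in> scalar_matrix L m ` carrier L" "k < m * m"
        "(\<Oplus>\<^bsub>matrix_ring L m\<^esub>j\<in>{..<m*m}. c j \<otimes>\<^bsub>matrix_ring L m\<^esub> \<phi> (bs ! j)) = \<zero>\<^bsub>matrix_ring L m\<^esub>"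
      then show "c k = \<zero>\<^bsub>matrix_ring L m\<^esub>" using mb.indep[of c k] eq[of c] by simp
    next
      fix k assume "k < m * m"
      then show "\<phi> (bs ! k) \<in> carrier (matrix_ring L m)" using mb.v_closed[of k] len by simp
    }
  qed (rule mb.LC)
  ultimately show ?thesis using that m by blast
qed

text \<open>Injectivity comes from the basis: a \<open>K\<close>-combination of it goes to an
  \<open>L\<close>-combination of independent matrices with coefficients \<open>\<phi> k\<close>,
  and \<open>\<phi>\<close> is injective on the field \<open>K\<close>.\<close>

lemma splitting_inj:
  assumes B: "ring B" and K: "subfield K B" and s: "is_splitting B K L m \<iota> \<phi>"
  shows "inj_on \<phi> (carrier B)"
proof -
  interpret B: ring B by fact
  have L: "field L" and \<iota>: "\<iota> \<in> ring_hom (B\<lparr>carrier := K\<rparr>) L" and \<phi>: "\<phi> \<in> ring_hom B (matrix_ring L m)"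
    and \<phi>K: "\<And>k. k \<in> K \<Longrightarrow> \<phi> k = scalar_matrix L m (\<iota> k)"
    using s by (auto simp: is_splitting_def)
  interpret L: field L by fact
  interpret M: ring "matrix_ring L m" by (rule L.matrix_ring_is_ring)
  obtain b where m: "0 < m" and b: "left_basis B K b (m * m)"
    and mb: "left_basis (matrix_ring L m) (scalar_matrix L m ` carrier L) (\<lambda>k. \<phi> (b k)) (m * m)"
    by (rule splitting_bases[OF B K s])
  interpret b: left_basis B K b "m * m" by fact
  interpret mb: left_basis "matrix_ring L m" "scalar_matrix L m ` carrier L" "\<lambda>k. \<phi> (b k)" "m * m" by fact
  interpret \<phi>: ring_hom_ring B "matrix_ring L m" \<phi>
    by (intro ring_hom_ringI2 B M.ring_axioms \<phi>)
  have "z = \<zero>\<^bsub>B\<^esub>" if z: "z \<in> carrier B" "\<phi> z = \<zero>\<^bsub>matrix_ring L m\<^esub>" for z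
  proof -
    note c = b.coord[OF z(1)]
    have ck: "\<phi> (b.coord z k) \<in> scalar_matrix L m ` carrier L" if "k < m * m" for k
      using \<phi>K[OF c(1)[OF that]] ring_hom_closed[OF \<iota>, of "b.coord z k"] c(1)[OF that] by auto
    have "\<phi> z = (\<Oplus>\<^bsub>matrix_ring L m\<^esub>k\<in>{..<m*m}. \<phi> (b.coord z k \<otimes>\<^bsub>B\<^esub> b k))"
      using b.term_closed[of "b.coord z"] c(1)
      by (subst c(2)) (intro ring_hom_finsum[OF B M.ring_axioms \<phi>], auto)
    also have "\<dots> = (\<Oplus>\<^bsub>matrix_ring L m\<^esub>k\<in>{..<m*m}. \<phi> (b.coord z k) \<otimes>\<^bsub>matrix_ring L m\<^esub> \<phi> (b k))"
      using c(1) b.v_closed b.LC_closed by (intro M.finsum_cong') auto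
    finally have k0: "\<phi> (b.coord z k) = \<zero>\<^bsub>matrix_ring L m\<^esub>" if "k < m * m" for k
      using mb.indep[of "\<lambda>k. \<phi> (b.coord z k)" k] ck z(2) that by simp
    have "b.coord z k = \<zero>\<^bsub>B\<^esub>" if k: "k < m * m" for k
    proof -
      have one: "\<one>\<^bsub>matrix_ring L m\<^esub> \<noteq> \<zero>\<^bsub>matrix_ring L m\<^esub>"
        using subfieldE(6)[OF L.scalar_matrix_subfield(1)[OF m]] .
      show ?thesis
        using inj_onD[OF \<phi>.img_is_subfield(1)[OF K one], of "b.coord z k" "\<zero>\<^bsub>B\<^esub>"]
          k0[OF k] c(1)[OF k] subringE(2)[OF b.LC] by simp
    qed
    then have "z = (\<Oplus>\<^bsub>B\<^esub>k\<in>{..<m*m}. \<zero>\<^bsub>B\<^esub>)"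
      using b.v_closed by (subst c(2)) (intro B.finsum_cong', auto)
    then show ?thesis by simp
  qed
  then have z0: "\<And>z. z \<in> carrier B \<Longrightarrow> \<phi> z = \<zero>\<^bsub>matrix_ring L m\<^esub> \<Longrightarrow> z = \<zero>\<^bsub>B\<^esub>" .
  show ?thesis
  proof (rule inj_onI)
    fix x y assume xy: "x \<in> carrier B" "y \<in> carrier B" "\<phi> x = \<phi> y"
    then have "\<phi> (x \<ominus>\<^bsub>B\<^esub> y) = \<zero>\<^bsub>matrix_ring L m\<^esub>"
      by (simp add: a_minus_def M.r_neg)
    then have "x \<ominus>\<^bsub>B\<^esub> y = \<zero>\<^bsub>B\<^esub>" using xy z0[of "x \<ominus>\<^bsub>B\<^esub> y"] by simp
    then show "x = y" using xy by simp
  qed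
qed

text \<open>As the splitting field lies inside \<open>B\<close>, the determinant is itself an
  element of \<open>B\<close>, to which any other splitting can be applied. The hypothesis
  \<open>center\<close> then brings it from \<open>LC\<close> down to \<open>K\<close>.\<close>

theorem reduced_norm_eq:
  fixes B :: "'b ring"
  assumes B: "ring B" and K: "subfield K B"
    and LC: "subring LC B" and L: "L = B\<lparr>carrier := LC\<rparr>" and KL: "K \<subseteq> LC"
    and s: "is_splitting B K L m (\<lambda>k. k) \<phi>"
    and center: "\<And>l. l \<in> LC \<Longrightarrow> (\<And>y. y \<in> carrier B \<Longrightarrow> l \<otimes>\<^bsub>B\<^esub> y = y \<otimes>\<^bsub>B\<^esub> l) \<Longrightarrow> l \<in> K"
    and z: "z \<in> carrier B"
  shows "reduced_norm B K z = determinant L m (\<phi> z)" "determinant L m (\<phi> z) \<in> K"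
proof -
  interpret B: ring B by fact
  have Lf: "field L" and \<phi>: "\<phi> \<in> ring_hom B (matrix_ring L m)" "\<And>k. k \<in> K \<Longrightarrow> \<phi> k = scalar_matrix L m k"
    using s by (auto simp: is_splitting_def)
  interpret L: field L by fact
  interpret M: ring "matrix_ring L m" by (rule L.matrix_ring_is_ring)
  obtain b where m: "0 < m" and b: "left_basis B K b (m * m)"
    and mb: "left_basis (matrix_ring L m) (scalar_matrix L m ` carrier L) (\<lambda>k. \<phi> (b k)) (m * m)"
    by (rule splitting_bases[OF B K s])
  interpret b: left_basis B K b "m * m" by fact
  interpret mb: left_basis "matrix_ring L m" "scalar_matrix L m ` carrier L" "\<lambda>k. \<phi> (b k)" "m * m" by fact
  have Lc [simp]: "carrier L = LC" and L0: "\<zero>\<^bsub>L\<^esub> = \<zero>\<^bsub>B\<^esub>" by (simp_all add: L)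
  note inj = L.scalar_matrix_subfield(2)[OF m]
  define D where "D = determinant L m (\<phi> z)"
  have D: "D \<in> LC" using L.determinant_closed[OF ring_hom_closed[OF \<phi>(1) z]] by (simp add: D_def)
  have DB: "D \<in> carrier B" using D subringE(1)[OF LC] by auto
  have mspan: "\<exists>c. (\<forall>k<m*m. c k \<in> LC) \<and>
      Z = (\<Oplus>\<^bsub>matrix_ring L m\<^esub>k\<in>{..<m*m}. scalar_matrix L m (c k) \<otimes>\<^bsub>matrix_ring L m\<^esub> \<phi> (b k))"
    if Z: "Z \<in> carrier (matrix_ring L m)" for Z
  proof -
    have "\<forall>k. \<exists>x. k < m * m \<longrightarrow> x \<in> LC \<and> mb.coord Z k = scalar_matrix L m x"
      using mb.coord(1)[OF Z] by force
    then obtain c where c: "\<And>k. k < m * m \<Longrightarrow> c k \<in> LC \<and> mb.coord Z k = scalar_matrix L m (c k)" by metis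
    have "(\<Oplus>\<^bsub>matrix_ring L m\<^esub>k\<in>{..<m*m}. mb.coord Z k \<otimes>\<^bsub>matrix_ring L m\<^esub> \<phi> (b k)) =
      (\<Oplus>\<^bsub>matrix_ring L m\<^esub>k\<in>{..<m*m}. scalar_matrix L m (c k) \<otimes>\<^bsub>matrix_ring L m\<^esub> \<phi> (b k))"
      using c mb.v_closed L.scalar_matrix_closed[of _ m] by (intro M.finsum_cong') auto
    then show ?thesis using c mb.coord(2)[OF Z] by (intro exI[of _ c]) auto
  qed
  have mindep: "c k = \<zero>\<^bsub>B\<^esub>" if c: "\<And>k. k < m * m \<Longrightarrow> c k \<in> LC"
    "(\<Oplus>\<^bsub>matrix_ring L m\<^esub>k\<in>{..<m*m}. scalar_matrix L m (c k) \<otimes>\<^bsub>matrix_ring L m\<^esub> \<phi> (b k)) = \<zero>\<^bsub>matrix_ring L m\<^esub>"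
    "k < m * m" for c k
  proof -
    have "scalar_matrix L m (c k) = \<zero>\<^bsub>matrix_ring L m\<^esub>"
      using c by (intro mb.indep[of "\<lambda>k. scalar_matrix L m (c k)"]) auto
    also have "\<dots> = scalar_matrix L m \<zero>\<^bsub>L\<^esub>" by (simp add: scalar_matrix_def matrix_ring_def)
    finally show ?thesis using inj c(1)[OF c(3)] L.zero_closed by (auto simp: L0 dest!: inj_onD)
  qed
  \<comment> \<open>Applied to the given splitting this yields \<open>D \<in> K\<close>. Applied to
    any other one, it identifies the value which that splitting would assign to the norm.\<close>
  have main: "D \<in> K \<and> \<iota>' D = determinant L' m' (\<phi>' z)"
    if s': "is_splitting B K L' m' \<iota>' \<phi>'" for L' :: "'b ring" and m' \<iota>' \<phi>'
  proof -
    have L'f: "field L'" and \<iota>': "\<iota>' \<in> ring_hom (B\<lparr>carrier := K\<rparr>) L'"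
      and \<phi>': "\<phi>' \<in> ring_hom B (matrix_ring L' m')" "\<And>k. k \<in> K \<Longrightarrow> \<phi>' k = scalar_matrix L' m' (\<iota>' k)"
      using s' by (auto simp: is_splitting_def)
    interpret L': field L' by fact
    interpret M': ring "matrix_ring L' m'" by (rule L'.matrix_ring_is_ring)
    obtain b' where m': "0 < m'" and b': "left_basis B K b' (m' * m')"
      using splitting_bases[OF B K s'] by blast
    have "m * m = m' * m'"
      using B.dimension_is_inj[OF K B.left_basis_dimension[OF K b] B.left_basis_dimension[OF K b']] .
    then have mm: "m' = m" by (metis power2_eq_square power2_eq_iff_nonneg le0)
    have "\<phi>' D = scalar_matrix L' m (determinant L' m (\<phi>' z))"
      unfolding D_def
      by (rule splitting_determinant_comparison[where K = K and \<iota>' = \<iota>' and LC = LC and N = "m * m" and b = b])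
        (use B LC L L.is_cring L'.is_cring KL \<phi> \<phi>' mm ring_hom_closed[OF \<iota>'] b.v_closed b.span mspan mindep z m in auto)
    then have eq: "\<phi>' D = scalar_matrix L' m' (determinant L' m' (\<phi>' z))" by (simp add: mm)
    note injB = splitting_inj[OF B K s']
    have det: "determinant L' m' (\<phi>' z) \<in> carrier L'"
      by (rule L'.determinant_closed[OF ring_hom_closed[OF \<phi>'(1) z]])
    \<comment> \<open>The scalar matrix \<open>\<phi>' D\<close> commutes with every
      \<open>\<phi>' y\<close>, and \<open>\<phi>'\<close> is injective, so \<open>D\<close>
      commutes with all of \<open>B\<close>.\<close>
    have "D \<in> K"
    proof (rule center[OF D])
      fix y assume y: "y \<in> carrier B"
      have "\<phi>' (D \<otimes>\<^bsub>B\<^esub> y) = \<phi>' (y \<otimes>\<^bsub>B\<^esub> D)"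
        using L'.scalar_matrix_commute[OF ring_hom_closed[OF \<phi>'(1) y] det] eq DB y
        by (simp add: ring_hom_mult[OF \<phi>'(1)])
      then show "D \<otimes>\<^bsub>B\<^esub> y = y \<otimes>\<^bsub>B\<^esub> D" using injB DB y by (auto dest: inj_onD)
    qed
    moreover from this have "\<iota>' D = determinant L' m' (\<phi>' z)"
      using eq \<phi>'(2)[of D] det ring_hom_closed[OF \<iota>', of D] L'.scalar_matrix_subfield(2)[OF m']
      by (auto dest: inj_onD)
    ultimately show ?thesis by blast
  qed
  have DK: "D \<in> K" using main[OF s] ..
  then show "determinant L m (\<phi> z) \<in> K" by (simp add: D_def)
  have "reduced_norm B K z = D"
    unfolding reduced_norm_def
  proof (rule the_equality)
    show "D \<in> K \<and> (\<exists>(L :: 'b ring) m \<iota> \<phi>. is_splitting B K L m \<iota> \<phi> \<and> determinant L m (\<phi> z) = \<iota> D)"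
      using DK s D_def by blast
  next
    fix c assume "c \<in> K \<and> (\<exists>(L :: 'b ring) m \<iota> \<phi>. is_splitting B K L m \<iota> \<phi> \<and> determinant L m (\<phi> z) = \<iota> c)"
    then obtain L' :: "'b ring" and m' \<iota>' \<phi>' where c: "c \<in> K"
      and s': "is_splitting B K L' m' \<iota>' \<phi>'" and d: "determinant L' m' (\<phi>' z) = \<iota>' c" by blast
    have "\<phi>' c = \<phi>' D" using main[OF s'] d c s' by (simp add: is_splitting_def)
    then show "c = D" using splitting_inj[OF B K s'] c DK subfieldE(3)[OF K] by (auto dest: inj_onD)
  qed
  then show "reduced_norm B K z = determinant L m (\<phi> z)" by (simp add: D_def)
qed

section \<open>Skew polynomials\<close>

text \<open>For the associativity of the skew product: both sides run over the pairs of indices with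
  sum at most \<open>k\<close>.\<close>

lemma (in abelian_monoid) finsum_triangle:
  assumes "\<And>i j. T i j \<in> carrier G"
  shows "(\<Oplus>j\<in>{..k::nat}. \<Oplus>i\<in>{..j}. T i (j - i)) = (\<Oplus>j\<in>{..k}. \<Oplus>i\<in>{..k - j}. T j i)"
proof (induction k)
  case (Suc k)
  have "(\<Oplus>j\<in>{..k}. \<Oplus>i\<in>{..Suc k - j}. T j i) = (\<Oplus>j\<in>{..k}. T j (Suc k - j) \<oplus> (\<Oplus>i\<in>{..k - j}. T j i))"
    using assms by (intro finsum_cong') (auto simp: Suc_diff_le atMost_Suc)
  also have "\<dots> = (\<Oplus>j\<in>{..k}. T j (Suc k - j)) \<oplus> (\<Oplus>j\<in>{..k}. \<Oplus>i\<in>{..k - j}. T j i)"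
    using assms by (intro finsum_addf) auto
  finally have eq: "(\<Oplus>j\<in>{..k}. \<Oplus>i\<in>{..Suc k - j}. T j i) =
    (\<Oplus>j\<in>{..k}. T j (Suc k - j)) \<oplus> (\<Oplus>j\<in>{..k}. \<Oplus>i\<in>{..k - j}. T j i)" .
  have "(\<Oplus>j\<in>{..Suc k}. \<Oplus>i\<in>{..j}. T i (j - i)) =
      (\<Oplus>i\<in>{..Suc k}. T i (Suc k - i)) \<oplus> (\<Oplus>j\<in>{..k}. \<Oplus>i\<in>{..j}. T i (j - i))"
    using assms by (simp add: atMost_Suc[of k])
  also have "(\<Oplus>i\<in>{..Suc k}. T i (Suc k - i)) = T (Suc k) 0 \<oplus> (\<Oplus>i\<in>{..k}. T i (Suc k - i))"
    using assms by (simp add: atMost_Suc[of k])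
  also have "T (Suc k) 0 \<oplus> (\<Oplus>i\<in>{..k}. T i (Suc k - i)) \<oplus> (\<Oplus>j\<in>{..k}. \<Oplus>i\<in>{..j}. T i (j - i)) =
     T (Suc k) 0 \<oplus> (\<Oplus>j\<in>{..k}. \<Oplus>i\<in>{..Suc k - j}. T j i)"
    using assms by (simp add: eq Suc a_assoc)
  also have "\<dots> = (\<Oplus>j\<in>{..Suc k}. \<Oplus>i\<in>{..Suc k - j}. T j i)"
    using assms by (simp add: atMost_Suc[of k])
  finally show ?case .
qed (use assms in simp)

locale skew_poly = ring A for A (structure) +
  fixes \<sigma> :: "'a \<Rightarrow> 'a"
  assumes \<sigma>: "\<sigma> \<in> ring_hom A A"
begin

lemma pow_hom: "\<sigma> ^^ i \<in> ring_hom A A"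
  using \<sigma> by (induction i) (auto intro!: ring_hom_memI simp: ring_hom_closed ring_hom_mult ring_hom_add ring_hom_one)

lemma pow_closed [simp]: "a \<in> carrier A \<Longrightarrow> (\<sigma> ^^ i) a \<in> carrier A"
  using ring_hom_closed[OF pow_hom] .

lemmas pow_mult = ring_hom_mult[OF pow_hom]
  and pow_add = ring_hom_add[OF pow_hom]

lemma pow_one [simp]: "(\<sigma> ^^ i) \<one> = \<one>"
  by (rule ring_hom_one[OF pow_hom])

lemma pow_zero [simp]: "(\<sigma> ^^ i) \<zero> = \<zero>"
  by (rule ring_hom_zero[OF pow_hom ring_axioms ring_axioms])

lemma pow_pow: "(\<sigma> ^^ i) ((\<sigma> ^^ j) a) = (\<sigma> ^^ (i + j)) a"
  by (simp add: funpow_add)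

abbreviation "R \<equiv> skew_poly_ring A \<sigma>"

lemma carrier_R: "f \<in> carrier R \<longleftrightarrow> (\<forall>i. f i \<in> carrier A) \<and> (\<exists>k. \<forall>i>k. f i = \<zero>)"
  by (auto simp: skew_poly_ring_def up_def bound_def)

lemma coeff_closed [simp]: "f \<in> carrier R \<Longrightarrow> f i \<in> carrier A"
  by (simp add: carrier_R)

lemma mult_R: "(f \<otimes>\<^bsub>R\<^esub> g) k = (\<Oplus>i\<in>{..k}. f i \<otimes> (\<sigma> ^^ i) (g (k - i)))"
  by (simp add: skew_poly_ring_def)

lemma add_R: "(f \<oplus>\<^bsub>R\<^esub> g) k = f k \<oplus> g k"
  by (simp add: skew_poly_ring_def)

lemma one_R: "\<one>\<^bsub>R\<^esub> k = (if k = 0 then \<one> else \<zero>)"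
  by (simp add: skew_poly_ring_def)

lemma zero_R [simp]: "\<zero>\<^bsub>R\<^esub> k = \<zero>"
  by (simp add: skew_poly_ring_def)

lemma mult_closed_R:
  assumes f: "f \<in> carrier R" and g: "g \<in> carrier R"
  shows "f \<otimes>\<^bsub>R\<^esub> g \<in> carrier R"
proof -
  obtain a b where a: "\<And>i. i > a \<Longrightarrow> f i = \<zero>" and b: "\<And>i. i > b \<Longrightarrow> g i = \<zero>"
    using f g by (auto simp: carrier_R)
  have "(f \<otimes>\<^bsub>R\<^esub> g) k = \<zero>" if "k > a + b" for k
  proof -
    have "f i \<otimes> (\<sigma> ^^ i) (g (k - i)) = \<zero>" for i
      using a[of i] b[of "k - i"] that f g by (cases "i > a") auto
    then show ?thesis by (simp add: mult_R)
  qed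
  moreover have "(f \<otimes>\<^bsub>R\<^esub> g) k \<in> carrier A" for k
    unfolding mult_R using f g by (intro finsum_closed) auto
  ultimately show ?thesis by (auto simp: carrier_R)
qed

lemma ring_R: "ring R"
proof (rule ringI)
  have add_closed: "f \<oplus>\<^bsub>R\<^esub> g \<in> carrier R" if fg: "f \<in> carrier R" "g \<in> carrier R" for f g
  proof -
    obtain a b where "\<forall>i > a. f i = \<zero>" "\<forall>i > b. g i = \<zero>"
      using fg by (auto simp: carrier_R)
    then have "\<exists>k. \<forall>i > k. (f \<oplus>\<^bsub>R\<^esub> g) i = \<zero>"
      by (intro exI[of _ "max a b"]) (simp add: add_R)
    then show ?thesis using fg by (simp add: carrier_R add_R)
  qed
  show "abelian_group R"
  proof (rule abelian_groupI)
    fix f assume f: "f \<in> carrier R"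
    then show "\<exists>g\<in>carrier R. g \<oplus>\<^bsub>R\<^esub> f = \<zero>\<^bsub>R\<^esub>"
      by (intro bexI[of _ "\<lambda>i. \<ominus> f i"]) (auto simp: add_R l_neg carrier_R)
  qed (auto simp: fun_eq_iff add_R add_closed carrier_R[of "\<zero>\<^bsub>R\<^esub>"] a_ac)
  show "monoid R"
  proof (rule monoidI)
    fix f g h assume fgh: "f \<in> carrier R" "g \<in> carrier R" "h \<in> carrier R"
    show "f \<otimes>\<^bsub>R\<^esub> g \<otimes>\<^bsub>R\<^esub> h = f \<otimes>\<^bsub>R\<^esub> (g \<otimes>\<^bsub>R\<^esub> h)"
    proof
      fix k
      \<comment> \<open>The common term of both bracketings; the twist of \<open>h\<close> by
        \<open>\<sigma>^(i+j)\<close> arises as \<open>\<sigma>^i\<close> after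
        \<open>\<sigma>^j\<close>.\<close>
      define T where "T i j = f i \<otimes> (\<sigma> ^^ i) (g j) \<otimes> (\<sigma> ^^ (i + j)) (h (k - (i + j)))" for i j
      have T: "T i j \<in> carrier A" for i j using fgh by (simp add: T_def)
      have "(f \<otimes>\<^bsub>R\<^esub> g \<otimes>\<^bsub>R\<^esub> h) k = (\<Oplus>j\<in>{..k}. \<Oplus>i\<in>{..j}. T i (j - i))"
        unfolding mult_R
      proof (intro finsum_cong' refl)
        fix j assume "j \<in> {..k}"
        have "(\<Oplus>i\<in>{..j}. f i \<otimes> (\<sigma> ^^ i) (g (j - i))) \<otimes> (\<sigma> ^^ j) (h (k - j)) =
          (\<Oplus>i\<in>{..j}. f i \<otimes> (\<sigma> ^^ i) (g (j - i)) \<otimes> (\<sigma> ^^ j) (h (k - j)))"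
          using fgh by (intro finsum_ldistr) auto
        also have "\<dots> = (\<Oplus>i\<in>{..j}. T i (j - i))"
          using fgh by (intro finsum_cong') (auto simp: T_def)
        finally show "(\<Oplus>i\<in>{..j}. f i \<otimes> (\<sigma> ^^ i) (g (j - i))) \<otimes> (\<sigma> ^^ j) (h (k - j)) = (\<Oplus>i\<in>{..j}. T i (j - i))" .
      qed (use T in auto)
      also have "\<dots> = (\<Oplus>j\<in>{..k}. \<Oplus>i\<in>{..k - j}. T j i)" by (rule finsum_triangle[OF T])
      also have "\<dots> = (f \<otimes>\<^bsub>R\<^esub> (g \<otimes>\<^bsub>R\<^esub> h)) k"
        unfolding mult_R
      proof (intro finsum_cong' refl)
        fix i assume "i \<in> {..k}"
        have "(\<sigma> ^^ i) (\<Oplus>j\<in>{..k - i}. g j \<otimes> (\<sigma> ^^ j) (h (k - i - j))) =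
          (\<Oplus>j\<in>{..k - i}. (\<sigma> ^^ i) (g j \<otimes> (\<sigma> ^^ j) (h (k - i - j))))"
          using fgh by (intro ring_hom_finsum[OF ring_axioms ring_axioms pow_hom]) auto
        then have "f i \<otimes> (\<sigma> ^^ i) (\<Oplus>j\<in>{..k - i}. g j \<otimes> (\<sigma> ^^ j) (h (k - i - j))) =
          (\<Oplus>j\<in>{..k - i}. f i \<otimes> (\<sigma> ^^ i) (g j \<otimes> (\<sigma> ^^ j) (h (k - i - j))))"
          using fgh by (simp add: finsum_rdistr)
        also have "\<dots> = (\<Oplus>j\<in>{..k - i}. T i j)"
          using fgh by (intro finsum_cong') (auto simp: T_def pow_mult pow_pow m_assoc)
        finally show "(\<Oplus>j\<in>{..k - i}. T i j) = f i \<otimes> (\<sigma> ^^ i) (\<Oplus>j\<in>{..k - i}. g j \<otimes> (\<sigma> ^^ j) (h (k - i - j)))" ..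
      qed (use fgh T in \<open>auto intro!: finsum_closed\<close>)
      finally show "(f \<otimes>\<^bsub>R\<^esub> g \<otimes>\<^bsub>R\<^esub> h) k = (f \<otimes>\<^bsub>R\<^esub> (g \<otimes>\<^bsub>R\<^esub> h)) k" .
    qed
  next
    fix f assume f: "f \<in> carrier R"
    show "\<one>\<^bsub>R\<^esub> \<otimes>\<^bsub>R\<^esub> f = f"
    proof
      fix k
      have "(\<one>\<^bsub>R\<^esub> \<otimes>\<^bsub>R\<^esub> f) k = (\<Oplus>i\<in>{..k}. if 0 = i then f (k - i) else \<zero>)"
        unfolding mult_R using f by (intro finsum_cong') (auto simp: one_R)
      also have "\<dots> = f k" using f add.finprod_singleton[of 0 "{..k}" "\<lambda>i. f (k - i)"] by simp
      finally show "(\<one>\<^bsub>R\<^esub> \<otimes>\<^bsub>R\<^esub> f) k = f k" .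
    qed
    show "f \<otimes>\<^bsub>R\<^esub> \<one>\<^bsub>R\<^esub> = f"
    proof
      fix k
      have "(f \<otimes>\<^bsub>R\<^esub> \<one>\<^bsub>R\<^esub>) k = (\<Oplus>i\<in>{..k}. if k = i then f i else \<zero>)"
        unfolding mult_R using f by (intro finsum_cong') (auto simp: one_R)
      also have "\<dots> = f k" using f by (intro add.finprod_singleton) auto
      finally show "(f \<otimes>\<^bsub>R\<^esub> \<one>\<^bsub>R\<^esub>) k = f k" .
    qed
  qed (auto simp: mult_closed_R, auto simp: carrier_R one_R)
  fix f g h assume fgh: "f \<in> carrier R" "g \<in> carrier R" "h \<in> carrier R"
  show "(f \<oplus>\<^bsub>R\<^esub> g) \<otimes>\<^bsub>R\<^esub> h = f \<otimes>\<^bsub>R\<^esub> h \<oplus>\<^bsub>R\<^esub> g \<otimes>\<^bsub>R\<^esub> h"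
  proof
    fix k
    have "((f \<oplus>\<^bsub>R\<^esub> g) \<otimes>\<^bsub>R\<^esub> h) k =
      (\<Oplus>i\<in>{..k}. f i \<otimes> (\<sigma> ^^ i) (h (k - i)) \<oplus> g i \<otimes> (\<sigma> ^^ i) (h (k - i)))"
      unfolding mult_R using fgh by (intro finsum_cong') (auto simp: add_R l_distr)
    also have "\<dots> = (f \<otimes>\<^bsub>R\<^esub> h \<oplus>\<^bsub>R\<^esub> g \<otimes>\<^bsub>R\<^esub> h) k"
      unfolding add_R mult_R using fgh by (intro finsum_addf) auto
    finally show "((f \<oplus>\<^bsub>R\<^esub> g) \<otimes>\<^bsub>R\<^esub> h) k = (f \<otimes>\<^bsub>R\<^esub> h \<oplus>\<^bsub>R\<^esub> g \<otimes>\<^bsub>R\<^esub> h) k" .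
  qed
  show "h \<otimes>\<^bsub>R\<^esub> (f \<oplus>\<^bsub>R\<^esub> g) = h \<otimes>\<^bsub>R\<^esub> f \<oplus>\<^bsub>R\<^esub> h \<otimes>\<^bsub>R\<^esub> g"
  proof
    fix k
    have "(h \<otimes>\<^bsub>R\<^esub> (f \<oplus>\<^bsub>R\<^esub> g)) k =
      (\<Oplus>i\<in>{..k}. h i \<otimes> (\<sigma> ^^ i) (f (k - i)) \<oplus> h i \<otimes> (\<sigma> ^^ i) (g (k - i)))"
      unfolding mult_R using fgh by (intro finsum_cong') (auto simp: add_R r_distr pow_add)
    also have "\<dots> = (h \<otimes>\<^bsub>R\<^esub> f \<oplus>\<^bsub>R\<^esub> h \<otimes>\<^bsub>R\<^esub> g) k"
      unfolding add_R mult_R using fgh by (intro finsum_addf) auto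
    finally show "(h \<otimes>\<^bsub>R\<^esub> (f \<oplus>\<^bsub>R\<^esub> g)) k = (h \<otimes>\<^bsub>R\<^esub> f \<oplus>\<^bsub>R\<^esub> h \<otimes>\<^bsub>R\<^esub> g) k" .
  qed
qed

sublocale R: ring R by (rule ring_R)

lemma finsum_R:
  assumes "finite I" "\<And>x. x \<in> I \<Longrightarrow> f x \<in> carrier R"
  shows "(\<Oplus>\<^bsub>R\<^esub>x\<in>I. f x) k = (\<Oplus>x\<in>I. f x k)"
  using assms by (induction I rule: finite_induct) (auto simp: add_R)

lemma minus_R: "f \<in> carrier R \<Longrightarrow> (\<ominus>\<^bsub>R\<^esub> f) k = \<ominus> f k"
  using R.l_neg[of f] add_R[of "\<ominus>\<^bsub>R\<^esub> f" f k] by (metis R.add.inv_closed coeff_closed minus_equality zero_R)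

lemma monom_closed [simp]: "a \<in> carrier A \<Longrightarrow> skew_monom A a k \<in> carrier R"
  by (auto simp: carrier_R skew_monom_def)

lemma mult_monom:
  assumes f: "f \<in> carrier R" and a: "a \<in> carrier A"
  shows "(f \<otimes>\<^bsub>R\<^esub> skew_monom A a j) k = (if j \<le> k then f (k - j) \<otimes> (\<sigma> ^^ (k - j)) a else \<zero>)"
proof (cases "j \<le> k")
  case True
  have "(f \<otimes>\<^bsub>R\<^esub> skew_monom A a j) k = (\<Oplus>i\<in>{..k}. if k - j = i then f i \<otimes> (\<sigma> ^^ i) a else \<zero>)"
    unfolding mult_R using f a True by (intro finsum_cong') (auto simp: skew_monom_def)
  also have "\<dots> = f (k - j) \<otimes> (\<sigma> ^^ (k - j)) a"
    using f a by (intro add.finprod_singleton) auto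
  finally show ?thesis using True by simp
next
  case False
  have "(f \<otimes>\<^bsub>R\<^esub> skew_monom A a j) k = (\<Oplus>i\<in>{..k}. \<zero>)"
    unfolding mult_R using f a False by (intro finsum_cong') (auto simp: skew_monom_def)
  then show ?thesis using False by simp
qed

lemma monom_mult:
  assumes f: "f \<in> carrier R" and a: "a \<in> carrier A"
  shows "(skew_monom A a j \<otimes>\<^bsub>R\<^esub> f) k = (if j \<le> k then a \<otimes> (\<sigma> ^^ j) (f (k - j)) else \<zero>)"
proof (cases "j \<le> k")
  case True
  have "(skew_monom A a j \<otimes>\<^bsub>R\<^esub> f) k = (\<Oplus>i\<in>{..k}. if j = i then a \<otimes> (\<sigma> ^^ i) (f (k - i)) else \<zero>)"
    unfolding mult_R using f a True by (intro finsum_cong') (auto simp: skew_monom_def)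
  also have "\<dots> = a \<otimes> (\<sigma> ^^ j) (f (k - j))"
    using f a True by (intro add.finprod_singleton) auto
  finally show ?thesis using True by simp
next
  case False
  have "(skew_monom A a j \<otimes>\<^bsub>R\<^esub> f) k = (\<Oplus>i\<in>{..k}. \<zero>)"
    unfolding mult_R using f a False by (intro finsum_cong') (auto simp: skew_monom_def)
  then show ?thesis using False by simp
qed

lemma monom_mult_monom:
  assumes "a \<in> carrier A" "b \<in> carrier A"
  shows "skew_monom A a i \<otimes>\<^bsub>R\<^esub> skew_monom A b j = skew_monom A (a \<otimes> (\<sigma> ^^ i) b) (i + j)"
  using assms by (auto simp: fun_eq_iff monom_mult) (auto simp: skew_monom_def)

lemma one_R_monom: "\<one>\<^bsub>R\<^esub> = skew_monom A \<one> 0"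
  by (auto simp: fun_eq_iff one_R skew_monom_def)

end

text \<open>The indices \<open>k = i n + j\<close> with fixed \<open>j\<close> are those of the
  basis elements which carry the same power \<open>t^j\<close>.\<close>

lemma (in abelian_monoid) finsum_residue_class:
  fixes n N j :: nat
  assumes "j < n" "\<And>i. i < N \<Longrightarrow> g i \<in> carrier G"
  shows "(\<Oplus>k\<in>{..<N * n}. if k mod n = j then g (k div n) else \<zero>) = (\<Oplus>i\<in>{..<N}. g i)"
proof -
  have inj: "inj_on (\<lambda>i. i * n + j) {..<N}" using assms(1) by (auto simp: inj_on_def)
  have lt: "i * n + j < N * n" if "i < N" for i
  proof -
    have "i * n + j < Suc i * n" using assms(1) by simp
    also have "\<dots> \<le> N * n" using that by (intro mult_le_mono1) simp
    finally show ?thesis .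
  qed
  have "(\<Oplus>k\<in>{..<N * n}. if k mod n = j then g (k div n) else \<zero>) =
    (\<Oplus>k\<in>(\<lambda>i. i * n + j) ` {..<N}. g (k div n))"
  proof (rule add.finprod_mono_neutral_cong_right)
    show "(\<lambda>i. i * n + j) ` {..<N} \<subseteq> {..<N * n}" using lt by auto
    {
      fix k assume k: "k \<in> {..<N * n} - (\<lambda>i. i * n + j) ` {..<N}"
      have "k mod n \<noteq> j"
      proof
        assume "k mod n = j"
        then have "k = (k div n) * n + j" by (metis div_mult_mod_eq)
        moreover have "k div n < N" using k by (simp add: less_mult_imp_div_less)
        ultimately show False using k by blast
      qed
      then show "(if k mod n = j then g (k div n) else \<zero>) = \<zero>" by simp
    }
  qed (use assms less_mult_imp_div_less in auto)
  also have "\<dots> = (\<Oplus>i\<in>{..<N}. g ((i * n + j) div n))"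
    using assms inj by (intro add.finprod_reindex) auto
  also have "\<dots> = (\<Oplus>i\<in>{..<N}. g i)"
    using assms by (intro add.finprod_cong') auto
  finally show ?thesis .
qed

section \<open>The element x and expansions over A[x]\<close>

locale skew_x = skew_poly A \<sigma> for A (structure) and \<sigma> +
  fixes u :: 'a and n :: nat
  assumes n: "0 < n" and u: "u \<in> Units A"
    and \<sigma>_n: "z \<in> carrier A \<Longrightarrow> (\<sigma> ^^ n) z = u \<otimes> z \<otimes> inv u"
    and \<sigma>_u: "\<sigma> u = u"
begin

abbreviation "U q \<equiv> u [^] (q :: nat)"
abbreviation "V q \<equiv> inv u [^] (q :: nat)"

lemma u_closed [simp]: "u \<in> carrier A" "inv u \<in> carrier A"
  using u by auto

lemma UV [simp]: "U q \<otimes> V q = \<one>" "V q \<otimes> U q = \<one>"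
proof -
  show "U q \<otimes> V q = \<one>"
  proof (induction q)
    case (Suc q)
    have "U (Suc q) \<otimes> V (Suc q) = u \<otimes> (U q \<otimes> V q) \<otimes> inv u"
      unfolding nat_pow_Suc2[OF u_closed(1)] nat_pow_Suc[of "inv u"] by (simp add: m_assoc)
    then show ?case using Suc u by simp
  qed simp
  show "V q \<otimes> U q = \<one>"
  proof (induction q)
    case (Suc q)
    have "V (Suc q) \<otimes> U (Suc q) = inv u \<otimes> (V q \<otimes> U q) \<otimes> u"
      unfolding nat_pow_Suc2[OF u_closed(2)] nat_pow_Suc[of u] by (simp add: m_assoc)
    then show ?case using Suc u by simp
  qed simp
qed

lemma UV_cancel [simp]:
  "a \<in> carrier A \<Longrightarrow> a \<otimes> U q \<otimes> V q = a" "a \<in> carrier A \<Longrightarrow> a \<otimes> V q \<otimes> U q = a"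
  by (simp_all add: m_assoc)

lemma pow_nq:
  assumes z: "z \<in> carrier A"
  shows "(\<sigma> ^^ (n * q)) z = U q \<otimes> z \<otimes> V q"
proof (induction q)
  case (Suc q)
  have "(\<sigma> ^^ (n * Suc q)) z = (\<sigma> ^^ n) ((\<sigma> ^^ (n * q)) z)"
    by (simp add: funpow_add)
  also have "\<dots> = u \<otimes> (U q \<otimes> z \<otimes> V q) \<otimes> inv u"
    using z by (simp add: Suc \<sigma>_n)
  also have "\<dots> = U (Suc q) \<otimes> z \<otimes> V (Suc q)"
    unfolding nat_pow_Suc2[OF u_closed(1)] nat_pow_Suc[of "inv u"] using z by (simp add: m_assoc)
  finally show ?case .
qed (use z in simp)

lemma pow_inv_u [simp]: "(\<sigma> ^^ i) (inv u) = inv u"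
proof -
  have "\<sigma> (inv u) \<otimes> u = \<one>"
    using ring_hom_mult[OF \<sigma>, of "inv u" u] ring_hom_one[OF \<sigma>] u by (simp add: \<sigma>_u)
  moreover have "\<sigma> (inv u) = \<sigma> (inv u) \<otimes> u \<otimes> inv u"
    using u ring_hom_closed[OF \<sigma>, of "inv u"] by (simp add: m_assoc)
  ultimately have "\<sigma> (inv u) = inv u" by simp
  then show ?thesis by (induction i) auto
qed

text \<open>
  Every \<open>f\<close> in \<open>R\<close> is the sum of the terms \<open>cf f j q x^q t^j\<close> with \<open>j < n\<close>, where
  \<open>x^q = u^(-q) t^(nq)\<close>.
\<close>

definition cf :: "(nat \<Rightarrow> 'a) \<Rightarrow> nat \<Rightarrow> nat \<Rightarrow> 'a" where
  "cf f j q = f (n * q + j) \<otimes> U q"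

lemma cf_closed [simp]: "f \<in> carrier R \<Longrightarrow> cf f j q \<in> carrier A"
  by (simp add: cf_def)

lemma coeff_cf: "f \<in> carrier R \<Longrightarrow> f (n * q + j) = cf f j q \<otimes> V q"
  by (simp add: cf_def)

lemma cf_eqI:
  assumes f: "f \<in> carrier R" and g: "g \<in> carrier R"
    and eq: "\<And>j q. j < n \<Longrightarrow> cf f j q = cf g j q"
  shows "f = g"
proof
  fix i
  show "f i = g i"
    using eq[of "i mod n" "i div n"] n
      coeff_cf[OF f, of "i div n" "i mod n"] coeff_cf[OF g, of "i div n" "i mod n"] by simp
qed

lemma cf_add:
  "f \<in> carrier R \<Longrightarrow> g \<in> carrier R \<Longrightarrow> cf (f \<oplus>\<^bsub>R\<^esub> g) j q = cf f j q \<oplus> cf g j q"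
  by (simp add: cf_def add_R l_distr)

lemma cf_zero [simp]: "cf \<zero>\<^bsub>R\<^esub> j q = \<zero>"
  by (simp add: cf_def)

lemma cf_minus: "f \<in> carrier R \<Longrightarrow> cf (\<ominus>\<^bsub>R\<^esub> f) j q = \<ominus> cf f j q"
  by (simp add: cf_def minus_R l_minus)

lemma cf_finsum:
  assumes "finite I" "\<And>x. x \<in> I \<Longrightarrow> f x \<in> carrier R"
  shows "cf (\<Oplus>\<^bsub>R\<^esub>x\<in>I. f x) j q = (\<Oplus>x\<in>I. cf (f x) j q)"
  using assms by (induction I rule: finite_induct) (auto simp: cf_add)

lemma cf_monom:
  assumes "a \<in> carrier A" "j < n" "l < n"
  shows "cf (skew_monom A a l) j q = (if j = l \<and> q = 0 then a else \<zero>)"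
proof -
  have "n * q + j = l \<longleftrightarrow> j = l \<and> q = 0"
    using assms by (cases q) auto
  then show ?thesis using assms by (auto simp: cf_def skew_monom_def)
qed

text \<open>Since \<open>a t^(nq) = a u^q x^q\<close>, these are the polynomials in \<open>x\<close>
  with coefficients in \<open>A\<close>.\<close>

definition xsupp :: "(nat \<Rightarrow> 'a) \<Rightarrow> bool" where
  "xsupp p \<longleftrightarrow> (\<forall>i. \<not> n dvd i \<longrightarrow> p i = \<zero>)"

text \<open>Powers of \<open>x\<close> are central, so multiplication by an element of
  \<open>A[x]\<close> is an untwisted convolution. In coefficients: the twist
  \<open>\<sigma>^(nq)\<close> is conjugation by \<open>u^q\<close>, and the factor
  \<open>u^q\<close> in \<open>cf\<close> absorbs it.\<close>

lemma cf_mult: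
  assumes e: "e \<in> carrier R" "xsupp e" and f: "f \<in> carrier R" and j: "j < n"
  shows "cf (e \<otimes>\<^bsub>R\<^esub> f) j k = (\<Oplus>q\<in>{..k}. cf e 0 q \<otimes> cf f j (k - q))"
proof -
  have inj: "inj_on (\<lambda>q. n * q) {..k}" using n by (auto simp: inj_on_def)
  have sub: "(\<lambda>q. n * q) ` {..k} \<subseteq> {..n * k + j}"
    by (auto intro: order_trans[OF mult_le_mono2])
  have "(e \<otimes>\<^bsub>R\<^esub> f) (n * k + j) = (\<Oplus>i\<in>(\<lambda>q. n * q) ` {..k}. e i \<otimes> (\<sigma> ^^ i) (f (n * k + j - i)))"
    unfolding mult_R
  proof (rule add.finprod_mono_neutral_cong_right[OF _ sub])
    {
      fix i assume i: "i \<in> {..n * k + j} - (\<lambda>q. n * q) ` {..k}"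
      have "\<not> n dvd i"
      proof
        assume "n dvd i"
        then obtain q where q: "i = n * q" by auto
        have "n * q \<le> n * k + j" using i q by simp
        also have "\<dots> < n * Suc k" using j by simp
        finally have "q \<le> k" by (simp only: mult_less_cancel1) simp
        then show False using i q by auto
      qed
      then show "e i \<otimes> (\<sigma> ^^ i) (f (n * k + j - i)) = \<zero>"
        using e f by (simp add: xsupp_def)
    }
  qed (use e f in auto)
  also have "\<dots> = (\<Oplus>q\<in>{..k}. e (n * q) \<otimes> (\<sigma> ^^ (n * q)) (f (n * k + j - n * q)))"
    using e f inj by (intro add.finprod_reindex) auto
  finally have "cf (e \<otimes>\<^bsub>R\<^esub> f) j k =
      (\<Oplus>q\<in>{..k}. e (n * q) \<otimes> (\<sigma> ^^ (n * q)) (f (n * k + j - n * q))) \<otimes> U k"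
    by (simp add: cf_def)
  also have "\<dots> = (\<Oplus>q\<in>{..k}. e (n * q) \<otimes> (\<sigma> ^^ (n * q)) (f (n * k + j - n * q)) \<otimes> U k)"
    using e f by (intro finsum_ldistr) auto
  also have "\<dots> = (\<Oplus>q\<in>{..k}. cf e 0 q \<otimes> cf f j (k - q))"
  proof (rule finsum_cong')
    fix q assume "q \<in> {..k}"
    then have q: "n * k + j - n * q = n * (k - q) + j" "U k = U q \<otimes> U (k - q)"
      by (simp_all add: diff_mult_distrib2 nat_pow_mult)
    have "e (n * q) \<otimes> (U q \<otimes> f (n * (k - q) + j) \<otimes> V q) \<otimes> (U q \<otimes> U (k - q)) =
        e (n * q) \<otimes> U q \<otimes> (f (n * (k - q) + j) \<otimes> (V q \<otimes> U q) \<otimes> U (k - q))"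
      using e f by (simp add: m_assoc del: UV UV_cancel)
    then show "e (n * q) \<otimes> (\<sigma> ^^ (n * q)) (f (n * k + j - n * q)) \<otimes> U k = cf e 0 q \<otimes> cf f j (k - q)"
      using e f unfolding q by (simp add: pow_nq cf_def)
  qed (use e f in auto)
  finally show ?thesis .
qed

text \<open>The polynomial with terms \<open>c q x^q\<close>; the factor \<open>V\<close> comes from
  \<open>x^q = u^(-q) t^(nq)\<close>.\<close>

definition xpoly :: "(nat \<Rightarrow> 'a) \<Rightarrow> nat \<Rightarrow> 'a" where
  "xpoly c = (\<lambda>i. if n dvd i then c (i div n) \<otimes> V (i div n) else \<zero>)"

lemma xpoly:
  assumes c: "\<And>q. c q \<in> carrier A" and fin: "\<And>q. q > b \<Longrightarrow> c q = \<zero>"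
  shows "xpoly c \<in> carrier R" "xsupp (xpoly c)" "cf (xpoly c) 0 q = c q"
proof -
  have "xpoly c i = \<zero>" if "i > n * b" for i
  proof (cases "n dvd i")
    case True
    then obtain q where "i = n * q" by auto
    then show ?thesis using that fin[of q] n by (simp add: xpoly_def)
  qed (simp add: xpoly_def)
  moreover have "xpoly c i \<in> carrier A" for i using c by (simp add: xpoly_def)
  ultimately show "xpoly c \<in> carrier R" by (auto simp: carrier_R)
  show "xsupp (xpoly c)" by (simp add: xsupp_def xpoly_def)
  show "cf (xpoly c) 0 q = c q" using c n by (simp add: cf_def xpoly_def)
qed

lemma cf_bounded:
  assumes f: "f \<in> carrier R"
  shows "\<exists>b. \<forall>j. \<forall>q>b. cf f j q = \<zero>"
proof -
  obtain b where b: "\<And>i. i > b \<Longrightarrow> f i = \<zero>" using f by (auto simp: carrier_R)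
  have "cf f j q = \<zero>" if "q > b" for j q
  proof -
    have "q \<le> n * q" using n by simp
    then have "n * q + j > b" using that by linarith
    then show ?thesis by (simp add: cf_def b)
  qed
  then show ?thesis by blast
qed

lemma xsupp_cf: "xsupp p \<Longrightarrow> 0 < j \<Longrightarrow> j < n \<Longrightarrow> cf p j q = \<zero>"
proof -
  assume "xsupp p" "0 < j" "j < n"
  moreover from this have "\<not> n dvd n * q + j" by (auto simp: dvd_add_right_iff dest: dvd_imp_le)
  ultimately show ?thesis by (simp add: cf_def xsupp_def)
qed

lemma xsupp_iff: "p \<in> carrier R \<Longrightarrow> xsupp p \<longleftrightarrow> (\<forall>j q. 0 < j \<longrightarrow> j < n \<longrightarrow> cf p j q = \<zero>)"
proof
  assume p: "p \<in> carrier R" and z: "\<forall>j q. 0 < j \<longrightarrow> j < n \<longrightarrow> cf p j q = \<zero>"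
  show "xsupp p"
    unfolding xsupp_def
  proof (intro allI impI)
    fix i assume "\<not> n dvd i"
    then have "0 < i mod n" "i mod n < n" using n by (auto simp: dvd_eq_mod_eq_0)
    then have "p (n * (i div n) + i mod n) = \<zero>" using z p by (subst coeff_cf) auto
    then show "p i = \<zero>" by simp
  qed
qed (use xsupp_cf in blast)

text \<open>\<open>DX D\<close> is \<open>D[x]\<close>.\<close>

definition DX :: "'a set \<Rightarrow> (nat \<Rightarrow> 'a) set" where
  "DX D = {p \<in> carrier R. xsupp p \<and> (\<forall>q. cf p 0 q \<in> D)}"

lemma DX_eqI:
  assumes "p \<in> DX D" "p' \<in> DX D'" "\<And>q. cf p 0 q = cf p' 0 q"
  shows "p = p'"
  using assms xsupp_cf by (intro cf_eqI) (auto simp: DX_def, metis gr0I)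

lemma DX_mono: "D \<subseteq> D' \<Longrightarrow> DX D \<subseteq> DX D'"
  by (auto simp: DX_def)

lemma DX_subring:
  assumes D: "subring D A"
  shows "subring (DX D) R"
proof (rule R.subringI)
  show "DX D \<subseteq> carrier R" by (auto simp: DX_def)
  show "\<one>\<^bsub>R\<^esub> \<in> DX D"
    using subringE(2,3)[OF D] n
    by (auto simp: DX_def xsupp_iff one_R_monom cf_monom)
next
  fix p assume "p \<in> DX D"
  then show "\<ominus>\<^bsub>R\<^esub> p \<in> DX D"
    using subringE(5)[OF D] by (auto simp: DX_def xsupp_iff cf_minus)
next
  fix p q assume p: "p \<in> DX D" and q: "q \<in> DX D"
  then show "p \<oplus>\<^bsub>R\<^esub> q \<in> DX D"
    using subringE(7)[OF D] by (auto simp: DX_def xsupp_iff cf_add)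
  have "cf (p \<otimes>\<^bsub>R\<^esub> q) j k = \<zero>" if "0 < j" "j < n" for j k
    using p q that by (simp add: DX_def cf_mult xsupp_cf)
  moreover have "cf (p \<otimes>\<^bsub>R\<^esub> q) 0 k \<in> D" for k
    using p q n subringE(6)[OF D] by (auto simp: DX_def cf_mult intro!: finsum_subring(2)[OF D])
  ultimately show "p \<otimes>\<^bsub>R\<^esub> q \<in> DX D"
    using p q by (auto simp: DX_def xsupp_iff)
qed

lemma cf_mult_monom:
  assumes e: "e \<in> carrier R" "xsupp e" and w: "w \<in> carrier A" and j: "j < n" "l < n"
  shows "cf (e \<otimes>\<^bsub>R\<^esub> skew_monom A w l) j k = (if l = j then cf e 0 k \<otimes> w else \<zero>)"
proof -
  have "cf (e \<otimes>\<^bsub>R\<^esub> skew_monom A w l) j k =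
    (\<Oplus>q\<in>{..k}. if k = q then (if l = j then cf e 0 q \<otimes> w else \<zero>) else \<zero>)"
    using e w j by (subst cf_mult) (auto simp: cf_monom intro!: finsum_cong')
  also have "\<dots> = (if l = j then cf e 0 k \<otimes> w else \<zero>)"
    using e w by (intro add.finprod_singleton) auto
  finally show ?thesis .
qed

text \<open>Powers of \<open>t^n\<close> are absorbed by powers of \<open>x\<close>, so only
  \<open>t^j\<close> with \<open>j < n\<close> occur, and \<open>k = i n + j\<close> stands for
  \<open>w_i t^j\<close>. With \<open>D = E\<close> this gives the module on which the algebra acts,
  with \<open>D = F\<close> a basis over the central subring.\<close>

lemma R_left_basis:
  assumes w: "left_basis A D w N"
  shows "left_basis R (DX D) (\<lambda>k. skew_monom A (w (k div n)) (k mod n)) (N * n)"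
proof -
  interpret w: left_basis A D w N by fact
  have wc: "w (k div n) \<in> carrier A" if "k < N * n" for k
    using that n by (intro w.v_closed) (simp add: less_mult_imp_div_less)
  \<comment> \<open>The coefficient of \<open>x^q t^j\<close> sees only the basis elements with
    \<open>k mod n = j\<close>, which leaves a combination of the \<open>w i\<close> inside
    \<open>A\<close>.\<close>
  have comb: "cf (\<Oplus>\<^bsub>R\<^esub>k\<in>{..<N * n}. e k \<otimes>\<^bsub>R\<^esub> skew_monom A (w (k div n)) (k mod n)) j q =
      (\<Oplus>i\<in>{..<N}. cf (e (i * n + j)) 0 q \<otimes> w i)"
    if e: "\<And>k. k < N * n \<Longrightarrow> e k \<in> DX D" and j: "j < n" for e j q
  proof -
    have eR: "e k \<in> carrier R" "xsupp (e k)" if "k < N * n" for k using e[OF that] by (auto simp: DX_def)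
    have lt: "i * n + j < N * n" if "i < N" for i
    proof -
      have "i * n + j < Suc i * n" using j by simp
      also have "\<dots> \<le> N * n" using that by (intro mult_le_mono1) simp
      finally show ?thesis .
    qed
    have "cf (\<Oplus>\<^bsub>R\<^esub>k\<in>{..<N * n}. e k \<otimes>\<^bsub>R\<^esub> skew_monom A (w (k div n)) (k mod n)) j q =
      (\<Oplus>k\<in>{..<N * n}. cf (e k \<otimes>\<^bsub>R\<^esub> skew_monom A (w (k div n)) (k mod n)) j q)"
      using eR wc by (intro cf_finsum) auto
    also have "\<dots> = (\<Oplus>k\<in>{..<N * n}. if k mod n = j then cf (e (k div n * n + j)) 0 q \<otimes> w (k div n) else \<zero>)"
    proof (rule finsum_cong')
      fix k assume "k \<in> {..<N * n}"
      then show "cf (e k \<otimes>\<^bsub>R\<^esub> skew_monom A (w (k div n)) (k mod n)) j q =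
          (if k mod n = j then cf (e (k div n * n + j)) 0 q \<otimes> w (k div n) else \<zero>)"
        using eR[of k] wc[of k] j n by (subst cf_mult_monom) auto
    next
      show "(\<lambda>k. if k mod n = j then cf (e (k div n * n + j)) 0 q \<otimes> w (k div n) else \<zero>) \<in> {..<N * n} \<rightarrow> carrier A"
        using eR wc by (auto simp: div_mult_mod_eq)
    qed simp
    also have "\<dots> = (\<Oplus>i\<in>{..<N}. cf (e (i * n + j)) 0 q \<otimes> w i)"
      using j eR lt w.v_closed by (intro finsum_residue_class) auto
    finally show ?thesis .
  qed
  show ?thesis
  proof (rule R.left_basisI)
    show "subring (DX D) R" by (rule DX_subring[OF w.LC])
    show "skew_monom A (w (k div n)) (k mod n) \<in> carrier R" if "k < N * n" for k
      using wc[OF that] by simp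
  next
    fix f assume f: "f \<in> carrier R"
    obtain b where b: "\<And>j q. q > b \<Longrightarrow> cf f j q = \<zero>" using cf_bounded[OF f] by blast
    \<comment> \<open>Zero coefficients of \<open>f\<close> must have zero coordinates, so that for
      each \<open>k\<close> the coordinates form a polynomial in \<open>x\<close>, of bounded
      degree.\<close>
    have c0: "w.coord \<zero> i = \<zero>" if "i < N" for i
    proof (rule w.coord_eqI)
      have "(\<Oplus>j\<in>{..<N}. \<zero> \<otimes> w j) = (\<Oplus>j\<in>{..<N}. \<zero>)"
        using w.v_closed by (intro finsum_cong') auto
      then show "\<zero> = (\<Oplus>j\<in>{..<N}. \<zero> \<otimes> w j)" by simp
    qed (use that subringE(2)[OF w.LC] in auto)
    define c where "c k q = (if k div n < N then w.coord (cf f (k mod n) q) (k div n) else \<zero>)" for k q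
    have cD: "c k q \<in> D" for k q
      using w.coord(1)[OF cf_closed[OF f]] subringE(2)[OF w.LC] by (simp add: c_def)
    have cz: "c k q = \<zero>" if "q > b" for k q using b[OF that] c0 by (simp add: c_def)
    note X = xpoly[of "c k" b for k, OF w.LC_closed[OF cD] cz]
    have XD: "xpoly (c k) \<in> DX D" for k using X cD by (simp add: DX_def)
    have "f = (\<Oplus>\<^bsub>R\<^esub>k\<in>{..<N * n}. xpoly (c k) \<otimes>\<^bsub>R\<^esub> skew_monom A (w (k div n)) (k mod n))"
    proof (rule cf_eqI[OF f])
      show "(\<Oplus>\<^bsub>R\<^esub>k\<in>{..<N * n}. xpoly (c k) \<otimes>\<^bsub>R\<^esub> skew_monom A (w (k div n)) (k mod n)) \<in> carrier R"
        using X(1) wc by (intro R.finsum_closed) auto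
      fix j q assume j: "j < n"
      have "(\<Oplus>i\<in>{..<N}. cf (xpoly (c (i * n + j))) 0 q \<otimes> w i) = (\<Oplus>i\<in>{..<N}. w.coord (cf f j q) i \<otimes> w i)"
        using w.coord(1)[OF cf_closed[OF f]] w.v_closed w.LC_closed j
        by (intro finsum_cong') (auto simp: X(3) c_def)
      also have "\<dots> = cf f j q" using w.coord(2)[OF cf_closed[OF f]] ..
      finally show "cf f j q = cf (\<Oplus>\<^bsub>R\<^esub>k\<in>{..<N * n}. xpoly (c k) \<otimes>\<^bsub>R\<^esub> skew_monom A (w (k div n)) (k mod n)) j q"
        using comb[of "\<lambda>k. xpoly (c k)" j q] XD j by simp
    qed
    then show "\<exists>e. (\<forall>k<N * n. e k \<in> DX D) \<and>
        f = (\<Oplus>\<^bsub>R\<^esub>k\<in>{..<N * n}. e k \<otimes>\<^bsub>R\<^esub> skew_monom A (w (k div n)) (k mod n))"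
      by - (intro exI[of _ "\<lambda>k. xpoly (c k)"] conjI allI impI XD, assumption)
  next
    fix e k assume e: "\<And>k. k < N * n \<Longrightarrow> e k \<in> DX D" and k: "k < N * n"
      and z: "(\<Oplus>\<^bsub>R\<^esub>k\<in>{..<N * n}. e k \<otimes>\<^bsub>R\<^esub> skew_monom A (w (k div n)) (k mod n)) = \<zero>\<^bsub>R\<^esub>"
    have "cf (e k) 0 q = \<zero>" for q
    proof -
      have lt: "i * n + k mod n < N * n" if "i < N" for i
      proof -
        have "i * n + k mod n < Suc i * n" using n by simp
        also have "\<dots> \<le> N * n" using that by (intro mult_le_mono1) simp
        finally show ?thesis .
      qed
      have "(\<Oplus>i\<in>{..<N}. cf (e (i * n + k mod n)) 0 q \<otimes> w i) = \<zero>"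
        using comb[of e "k mod n" q] e z n by simp
      then have "cf (e (k div n * n + k mod n)) 0 q = \<zero>"
        using w.indep[of "\<lambda>i. cf (e (i * n + k mod n)) 0 q" "k div n"] e lt k
        by (auto simp: DX_def less_mult_imp_div_less)
      then show ?thesis by simp
    qed
    moreover have "\<zero>\<^bsub>R\<^esub> \<in> DX D" using subringE(2)[OF DX_subring[OF w.LC]] .
    ultimately show "e k = \<zero>\<^bsub>R\<^esub>" by (intro DX_eqI[OF e[OF k]]) auto
  qed
qed

abbreviation "x \<equiv> skew_monom A (inv u) n"

lemma mult_x:
  assumes "f \<in> carrier R"
  shows "(f \<otimes>\<^bsub>R\<^esub> x) k = (if n \<le> k then f (k - n) \<otimes> inv u else \<zero>)"
  using assms by (simp add: mult_monom)

text \<open>Moving \<open>t^n\<close> past a coefficient conjugates it by \<open>u\<close>, and the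
  factor \<open>u^(-1)\<close> of \<open>x\<close> turns this into multiplication by
  \<open>u^(-1)\<close> on the right. On the other side \<open>\<sigma>\<close> fixes
  \<open>u^(-1)\<close>, which gives the same.\<close>

lemma x_mult:
  assumes f: "f \<in> carrier R"
  shows "x \<otimes>\<^bsub>R\<^esub> f = f \<otimes>\<^bsub>R\<^esub> x"
proof
  fix k
  have "inv u \<otimes> (u \<otimes> a \<otimes> inv u) = a \<otimes> inv u" if "a \<in> carrier A" for a
    using that u by (simp flip: m_assoc)
  then show "(x \<otimes>\<^bsub>R\<^esub> f) k = (f \<otimes>\<^bsub>R\<^esub> x) k"
    using f by (simp add: mult_x monom_mult \<sigma>_n)
qed

lemma x_in_DX:
  assumes D: "subring D A"
  shows "x \<in> DX D"
proof -
  have "cf x j q = (if j = 0 \<and> q = 1 then \<one> else \<zero>)" if "j < n" for j q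
  proof -
    have "n * q + j = n \<longleftrightarrow> j = 0 \<and> q = 1"
    proof
      assume eq: "n * q + j = n"
      have "q \<noteq> 0" using eq that by (intro notI) simp
      moreover have "q < 2"
      proof (rule ccontr)
        assume "\<not> q < 2"
        then have "n * 2 \<le> n * q" by (intro mult_le_mono2) simp
        then show False using eq n by linarith
      qed
      ultimately show "j = 0 \<and> q = 1" using eq by (cases q) auto
    qed auto
    then show ?thesis using u by (auto simp: cf_def skew_monom_def)
  qed
  then show ?thesis using subringE(2,3)[OF D] n by (auto simp: DX_def xsupp_iff)
qed

lemma constant_in_DX:
  assumes D: "subring D A" and c: "c \<in> D"
  shows "skew_monom A c 0 \<in> DX D"
proof -
  have "c \<in> carrier A" using c subringE(1)[OF D] by auto
  then show ?thesis using c subringE(2)[OF D] n by (auto simp: DX_def xsupp_iff cf_monom)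
qed

text \<open>Horner's rule: without its constant coefficient, a polynomial is a multiple of
  \<open>x\<close> by one of smaller degree, and \<open>simple_extension\<close> is generated by
  exactly such steps. This identifies the ring \<open>F[x]\<close> of the statement with its
  description by coefficients.\<close>

lemma simple_extension_eq_DX:
  assumes D: "subring D A"
  shows "R.simple_extension ((\<lambda>c. skew_monom A c 0) ` D) x = DX D"
proof
  note sub = DX_subring[OF D]
  show "R.simple_extension ((\<lambda>c. skew_monom A c 0) ` D) x \<subseteq> DX D"
  proof
    fix p assume "p \<in> R.simple_extension ((\<lambda>c. skew_monom A c 0) ` D) x"
    then show "p \<in> DX D"
      using subringE(2,6,7)[OF sub] x_in_DX[OF D] constant_in_DX[OF D]
      by (induction rule: R.simple_extension.induct) auto
  qed
  have "p \<in> R.simple_extension ((\<lambda>c. skew_monom A c 0) ` D) x"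
    if "p \<in> DX D" "\<And>q. q \<ge> b \<Longrightarrow> cf p 0 q = \<zero>" for b p
    using that
  proof (induction b arbitrary: p)
    case 0
    then have "p = \<zero>\<^bsub>R\<^esub>" using subringE(2)[OF sub] by (intro DX_eqI[of p D _ D]) auto
    then show ?case by (metis R.simple_extension.zero)
  next
    case (Suc b)
    have pR: "p \<in> carrier R" "xsupp p" "\<And>q. cf p 0 q \<in> D" using Suc.prems by (auto simp: DX_def)
    \<comment> \<open>\<open>p'\<close> drops the constant coefficient of \<open>p\<close> and
      shifts the others down by one power of \<open>x\<close>, so the bound \<open>b\<close> on the
      degree decreases.\<close>
    define p' where "p' = xpoly (\<lambda>q. cf p 0 (Suc q))"
    have X: "p' \<in> carrier R" "xsupp p'" "cf p' 0 q = cf p 0 (Suc q)" for q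
      using xpoly[of "\<lambda>q. cf p 0 (Suc q)" b] pR Suc.prems(2) by (auto simp: p'_def)
    have "p' \<in> R.simple_extension ((\<lambda>c. skew_monom A c 0) ` D) x"
      using Suc.IH[of p'] Suc.prems(2) pR X by (simp add: DX_def)
    moreover have "p = p' \<otimes>\<^bsub>R\<^esub> x \<oplus>\<^bsub>R\<^esub> skew_monom A (cf p 0 0) 0"
    proof
      fix i
      have sm: "skew_monom A (cf p 0 0) 0 i = (if i = 0 then p 0 else \<zero>)"
        using pR by (simp add: cf_def skew_monom_def)
      show "p i = (p' \<otimes>\<^bsub>R\<^esub> x \<oplus>\<^bsub>R\<^esub> skew_monom A (cf p 0 0) 0) i"
      proof (cases "n \<le> i")
        case False
        then have "i = 0 \<or> \<not> n dvd i" by (auto dest: dvd_imp_le)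
        then show ?thesis using False pR X n
          by (auto simp: add_R mult_x sm xsupp_def)
      next
        case True
        then have i: "i \<noteq> 0" using n by auto
        show ?thesis
        proof (cases "n dvd i")
          case False
          then have "\<not> n dvd i - n" using True by (simp add: dvd_minus_self)
          then show ?thesis using False True i pR X by (simp add: add_R mult_x xsupp_def sm)
        next
          case dvd: True
          then obtain k where "i = n * k" by auto
          then obtain q where q: "i = n * Suc q" using i by (cases k) auto
          have "p' (n * q) \<otimes> inv u = cf p 0 (Suc q) \<otimes> V q \<otimes> inv u"
            using coeff_cf[OF X(1), of q 0] X(3) by simp
          also have "\<dots> = cf p 0 (Suc q) \<otimes> V (Suc q)"
            using pR by (simp add: m_assoc)
          also have "\<dots> = p i" using coeff_cf[OF pR(1), of "Suc q" 0] q by simp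
          finally have "p i = p' (n * q) \<otimes> inv u" ..
          moreover have "(p' \<otimes>\<^bsub>R\<^esub> x \<oplus>\<^bsub>R\<^esub> skew_monom A (cf p 0 0) 0) i = p' (i - n) \<otimes> inv u"
            using True i X by (simp add: add_R mult_x sm)
          moreover have "i - n = n * q" using q by simp
          ultimately show ?thesis by simp
        qed
      qed
    qed
    ultimately show ?case
      using R.simple_extension.lin[of p' "(\<lambda>c. skew_monom A c 0) ` D" x "skew_monom A (cf p 0 0) 0"]
        imageI[OF pR(3)[of 0], of "\<lambda>c. skew_monom A c 0"] by metis
  qed
  then show "DX D \<subseteq> R.simple_extension ((\<lambda>c. skew_monom A c 0) ` D) x"
  proof (intro subsetI)
    fix p assume p: "p \<in> DX D"
    then obtain b where "\<And>j q. q > b \<Longrightarrow> cf p j q = \<zero>" using cf_bounded[of p] by (auto simp: DX_def)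
    then show "p \<in> R.simple_extension ((\<lambda>c. skew_monom A c 0) ` D) x"
      using p \<open>\<And>p b. p \<in> DX D \<Longrightarrow> (\<And>q. b \<le> q \<Longrightarrow> cf p 0 q = \<zero>) \<Longrightarrow> p \<in> R.simple_extension ((\<lambda>c. skew_monom A c 0) ` D) x\<close>[of p "Suc b"]
      by (simp add: Suc_le_eq)
  qed
qed

text \<open>Lowest terms: for a fixed \<open>t^j\<close>, the first nonzero coefficient of
  \<open>e\<close>, at \<open>x^p0\<close>, meets the first nonzero one of \<open>r\<close>, at
  \<open>x^k0\<close>, and nothing else contributes to \<open>x^(p0+k0) t^j\<close>. The product of
  the two is nonzero by the hypothesis on \<open>D\<close>.\<close>

lemma DX_regular:
  assumes D: "\<And>c a. c \<in> D \<Longrightarrow> c \<noteq> \<zero> \<Longrightarrow> a \<in> carrier A \<Longrightarrow> c \<otimes> a = \<zero> \<Longrightarrow> a = \<zero>"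
    and e: "e \<in> DX D" "e \<noteq> \<zero>\<^bsub>R\<^esub>" and r: "r \<in> carrier R" "e \<otimes>\<^bsub>R\<^esub> r = \<zero>\<^bsub>R\<^esub>"
  shows "r = \<zero>\<^bsub>R\<^esub>"
proof (rule ccontr)
  assume "r \<noteq> \<zero>\<^bsub>R\<^esub>"
  then obtain j q where j: "j < n" and q: "cf r j q \<noteq> \<zero>"
    using cf_eqI[OF r(1) R.zero_closed] by auto
  have eR: "e \<in> carrier R" "xsupp e" "\<And>q. cf e 0 q \<in> D" using e by (auto simp: DX_def)
  obtain p where p: "cf e 0 p \<noteq> \<zero>"
  proof -
    have "\<exists>p. cf e 0 p \<noteq> \<zero>"
    proof (rule ccontr)
      assume "\<not> ?thesis"
      then have "cf e j q = cf \<zero>\<^bsub>R\<^esub> j q" if "j < n" for j q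
        using xsupp_cf[OF eR(2)] that by (cases "j = 0") auto
      then show False using cf_eqI[OF eR(1) R.zero_closed] e(2) by auto
    qed
    then show ?thesis using that by blast
  qed
  define p0 where "p0 = (LEAST p. cf e 0 p \<noteq> \<zero>)"
  define k0 where "k0 = (LEAST q. cf r j q \<noteq> \<zero>)"
  have p0: "cf e 0 p0 \<noteq> \<zero>" "\<And>p. p < p0 \<Longrightarrow> cf e 0 p = \<zero>"
    unfolding p0_def using LeastI[of "\<lambda>p. cf e 0 p \<noteq> \<zero>", OF p] not_less_Least by blast+
  have k0: "cf r j k0 \<noteq> \<zero>" "\<And>k. k < k0 \<Longrightarrow> cf r j k = \<zero>"
    unfolding k0_def using LeastI[of "\<lambda>q. cf r j q \<noteq> \<zero>", OF q] not_less_Least by blast+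
  have "\<zero> = (\<Oplus>q\<in>{..p0 + k0}. cf e 0 q \<otimes> cf r j (p0 + k0 - q))"
    using cf_mult[OF eR(1,2) r(1) j, of "p0 + k0"] r(2) by simp
  also have "\<dots> = (\<Oplus>q\<in>{..p0 + k0}. if p0 = q then cf e 0 q \<otimes> cf r j (p0 + k0 - q) else \<zero>)"
  proof (rule finsum_cong')
    fix q assume q: "q \<in> {..p0 + k0}"
    consider "q < p0" | "q = p0" | "p0 < q" by linarith
    then show "cf e 0 q \<otimes> cf r j (p0 + k0 - q) = (if p0 = q then cf e 0 q \<otimes> cf r j (p0 + k0 - q) else \<zero>)"
    proof cases
      case 3
      then have "p0 + k0 - q < k0" using q by auto
      then show ?thesis using 3 k0(2) eR by simp
    qed (use p0 r in auto)
  qed (use eR r in auto)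
  also have "\<dots> = cf e 0 p0 \<otimes> cf r j (p0 + k0 - p0)"
    using eR r by (intro add.finprod_singleton) auto
  finally have "cf e 0 p0 \<otimes> cf r j k0 = \<zero>" by simp
  then show False using D[OF eR(3) p0(1) cf_closed[OF r(1)]] k0(1) by blast
qed

text \<open>\<open>D[x]\<close> is generated by its constants and by \<open>x\<close>, which
  commutes with all of \<open>R\<close>.\<close>

lemma DX_commutes:
  assumes D: "subring D A" and f: "f \<in> carrier R"
    and const: "\<And>c. c \<in> D \<Longrightarrow> skew_monom A c 0 \<otimes>\<^bsub>R\<^esub> f = f \<otimes>\<^bsub>R\<^esub> skew_monom A c 0"
    and p: "p \<in> DX D"
  shows "p \<otimes>\<^bsub>R\<^esub> f = f \<otimes>\<^bsub>R\<^esub> p"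
proof -
  have DA: "c \<in> D \<Longrightarrow> c \<in> carrier A" for c using subringE(1)[OF D] by auto
  have "p \<in> R.simple_extension ((\<lambda>c. skew_monom A c 0) ` D) x"
    using p simple_extension_eq_DX[OF D] by simp
  then have "p \<in> carrier R \<and> p \<otimes>\<^bsub>R\<^esub> f = f \<otimes>\<^bsub>R\<^esub> p"
  proof (induction rule: R.simple_extension.induct)
    case (lin k1 k2)
    then obtain c where k2: "k2 = skew_monom A c 0" "c \<in> D" by auto
    have k: "k1 \<in> carrier R" "k2 \<in> carrier R" "k1 \<otimes>\<^bsub>R\<^esub> f = f \<otimes>\<^bsub>R\<^esub> k1" "k2 \<otimes>\<^bsub>R\<^esub> f = f \<otimes>\<^bsub>R\<^esub> k2"
      using lin k2 DA const by auto
    have "k1 \<otimes>\<^bsub>R\<^esub> x \<otimes>\<^bsub>R\<^esub> f = k1 \<otimes>\<^bsub>R\<^esub> (f \<otimes>\<^bsub>R\<^esub> x)"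
      using k f x_mult[OF f] by (simp add: R.m_assoc)
    also have "\<dots> = f \<otimes>\<^bsub>R\<^esub> (k1 \<otimes>\<^bsub>R\<^esub> x)"
      using k f by (simp flip: R.m_assoc)
    finally show ?case using k f by (simp add: R.l_distr R.r_distr)
  qed (use f in \<open>simp del: zero_R\<close>)
  then show ?thesis by simp
qed

lemma DX_central:
  assumes D: "subring D A" and c: "\<And>c a. c \<in> D \<Longrightarrow> a \<in> carrier A \<Longrightarrow> c \<otimes> a = a \<otimes> c"
    "\<And>c. c \<in> D \<Longrightarrow> \<sigma> c = c"
    and p: "p \<in> DX D" and f: "f \<in> carrier R"
  shows "p \<otimes>\<^bsub>R\<^esub> f = f \<otimes>\<^bsub>R\<^esub> p"
proof (rule DX_commutes[OF D f _ p])
  fix b assume b: "b \<in> D"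
  then have bA: "b \<in> carrier A" using subringE(1)[OF D] by auto
  show "skew_monom A b 0 \<otimes>\<^bsub>R\<^esub> f = f \<otimes>\<^bsub>R\<^esub> skew_monom A b 0"
  proof
    fix k
    have "(\<sigma> ^^ i) b = b" for i using c(2)[OF b] by (induction i) auto
    then show "(skew_monom A b 0 \<otimes>\<^bsub>R\<^esub> f) k = (f \<otimes>\<^bsub>R\<^esub> skew_monom A b 0) k"
      using c(1)[OF b] bA f by (simp add: monom_mult mult_monom)
  qed
qed

lemma DX_comm:
  assumes D: "subring D A" and c: "\<And>c a. c \<in> D \<Longrightarrow> a \<in> D \<Longrightarrow> c \<otimes> a = a \<otimes> c"
    and p: "p \<in> DX D" and f: "f \<in> DX D"
  shows "p \<otimes>\<^bsub>R\<^esub> f = f \<otimes>\<^bsub>R\<^esub> p"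
proof (rule DX_commutes[OF D _ _ p])
  have fR: "f \<in> carrier R" "xsupp f" "\<And>q. cf f 0 q \<in> D" using f by (auto simp: DX_def)
  then show "f \<in> carrier R" by simp
  fix b assume b: "b \<in> D"
  then have bA: "b \<in> carrier A" using subringE(1)[OF D] by auto
  show "skew_monom A b 0 \<otimes>\<^bsub>R\<^esub> f = f \<otimes>\<^bsub>R\<^esub> skew_monom A b 0"
  proof (rule cf_eqI)
    fix j q assume j: "j < n"
    have "cf (skew_monom A b 0 \<otimes>\<^bsub>R\<^esub> f) j q = b \<otimes> cf f j q"
      using fR bA by (simp add: cf_def monom_mult m_assoc)
    moreover have "cf (f \<otimes>\<^bsub>R\<^esub> skew_monom A b 0) j q = (if 0 = j then cf f 0 q \<otimes> b else \<zero>)"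
      using fR bA j n by (intro cf_mult_monom) auto
    ultimately show "cf (skew_monom A b 0 \<otimes>\<^bsub>R\<^esub> f) j q = cf (f \<otimes>\<^bsub>R\<^esub> skew_monom A b 0) j q"
      using c[OF b fR(3)] xsupp_cf[OF fR(2), of j] j bA by auto
  qed (use fR bA in auto)
qed

text \<open>Commuting with the constants makes the coefficients central in \<open>A\<close>.
  Commuting with \<open>t\<close> makes them fixed by \<open>\<sigma>\<close>, because
  \<open>u\<close> is fixed as well.\<close>

lemma DX_center:
  assumes e: "e \<in> DX D" and comm: "\<And>f. f \<in> carrier R \<Longrightarrow> e \<otimes>\<^bsub>R\<^esub> f = f \<otimes>\<^bsub>R\<^esub> e"
    and D: "subring D A"
  shows "e \<in> DX {c \<in> D. (\<forall>a \<in> carrier A. c \<otimes> a = a \<otimes> c) \<and> \<sigma> c = c}"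
proof -
  have eR: "e \<in> carrier R" "xsupp e" "\<And>q. cf e 0 q \<in> D" using e by (auto simp: DX_def)
  have "cf e 0 q \<otimes> a = a \<otimes> cf e 0 q" if a: "a \<in> carrier A" for a q
  proof -
    have "cf e 0 q \<otimes> a = cf (e \<otimes>\<^bsub>R\<^esub> skew_monom A a 0) 0 q"
      using eR a n by (simp add: cf_mult_monom)
    also have "\<dots> = cf (skew_monom A a 0 \<otimes>\<^bsub>R\<^esub> e) 0 q" using comm a by simp
    also have "\<dots> = a \<otimes> cf e 0 q" using eR a by (simp add: cf_def monom_mult m_assoc)
    finally show ?thesis .
  qed
  moreover have "\<sigma> (cf e 0 q) = cf e 0 q" for q
  proof -
    have "(\<sigma> ^^ 1) (e (n * q)) = (skew_monom A \<one> 1 \<otimes>\<^bsub>R\<^esub> e) (n * q + 1)"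
      using eR ring_hom_closed[OF \<sigma>] by (subst monom_mult) auto
    also have "\<dots> = (e \<otimes>\<^bsub>R\<^esub> skew_monom A \<one> 1) (n * q + 1)" using comm by simp
    also have "\<dots> = e (n * q)" using eR by (subst mult_monom) auto
    finally have 1: "\<sigma> (e (n * q)) = e (n * q)" by simp
    have "\<sigma> (U q) = U q"
      using ring_hom_closed[OF \<sigma>] by (induction q) (auto simp: ring_hom_mult[OF \<sigma>] \<sigma>_u ring_hom_one[OF \<sigma>])
    then show ?thesis using eR 1 by (simp add: cf_def ring_hom_mult[OF \<sigma>])
  qed
  ultimately show ?thesis using eR by (simp add: DX_def)
qed

text \<open>The hypothesis says that a combination of the multiplications by the basis elements
  \<open>w_i t^j\<close> vanishes at \<open>v t^r\<close>. Moving \<open>t^r\<close> past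
  \<open>w_i\<close> applies \<open>\<sigma>^r\<close>, and the coefficient of
  \<open>t^(nq+j+r)\<close> leaves a relation in \<open>A\<close> itself.\<close>

lemma twisted_coefficients:
  assumes e: "\<And>k. k < N * n \<Longrightarrow> e k \<in> carrier R \<and> xsupp (e k)"
    and w: "\<And>i. i < N \<Longrightarrow> w i \<in> carrier A" and v: "v \<in> carrier A"
    and rel: "(\<Oplus>\<^bsub>R\<^esub>k\<in>{..<N * n}. e k \<otimes>\<^bsub>R\<^esub> skew_monom A v r \<otimes>\<^bsub>R\<^esub> skew_monom A (w (k div n)) (k mod n)) = \<zero>\<^bsub>R\<^esub>"
    and j: "j < n"
  shows "(\<Oplus>i\<in>{..<N}. cf (e (i * n + j)) 0 q \<otimes> v \<otimes> (\<sigma> ^^ r) (w i)) = \<zero>"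
proof -
  have wc: "w (k div n) \<in> carrier A" if "k < N * n" for k
    using that n by (intro w) (simp add: less_mult_imp_div_less)
  have lt: "i * n + j < N * n" if "i < N" for i
  proof -
    have "i * n + j < Suc i * n" using j by simp
    also have "\<dots> \<le> N * n" using that by (intro mult_le_mono1) simp
    finally show ?thesis .
  qed
  let ?m = "\<lambda>k. e k \<otimes>\<^bsub>R\<^esub> skew_monom A v r \<otimes>\<^bsub>R\<^esub> skew_monom A (w (k div n)) (k mod n)"
  let ?y = "\<lambda>i. v \<otimes> (\<sigma> ^^ r) (w i)"
  \<comment> \<open>The coefficient \<open>e k\<close> contributes multiples of \<open>n\<close> to
    the exponent and the rest is \<open>k mod n + r\<close>. The exponent \<open>nq + j + r\<close>
    is thus reached only for \<open>k mod n = j\<close>, both residues being below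
    \<open>n\<close>.\<close>
  have coeff: "?m k (n * q + j + r) = (if k mod n = j then cf (e (k div n * n + j)) 0 q \<otimes> ?y (k div n) \<otimes> V q else \<zero>)"
    if k: "k < N * n" for k
  proof -
    have ek: "e k \<in> carrier R" "xsupp (e k)" using e[OF k] by auto
    have yc: "?y (k div n) \<in> carrier A" using wc[OF k] v by simp
    have "?m k = e k \<otimes>\<^bsub>R\<^esub> skew_monom A (?y (k div n)) (r + k mod n)"
      using ek wc[OF k] v by (simp add: R.m_assoc monom_mult_monom)
    then have eq: "?m k (n * q + j + r) = (if k mod n \<le> n * q + j
        then e k (n * q + j - k mod n) \<otimes> (\<sigma> ^^ (n * q + j - k mod n)) (?y (k div n)) else \<zero>)"
      using mult_monom[OF ek(1) yc, of "r + k mod n" "n * q + j + r"] by simp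
    show ?thesis
    proof (cases "k mod n = j")
      case True
      have "e k (n * q) \<otimes> (U q \<otimes> ?y (k div n) \<otimes> V q) = cf (e k) 0 q \<otimes> ?y (k div n) \<otimes> V q"
        using ek yc by (simp add: cf_def m_assoc)
      moreover have "k div n * n + j = k" using True by (metis div_mult_mod_eq)
      ultimately show ?thesis using eq True yc by (simp add: pow_nq)
    next
      case False
      have "\<not> n dvd n * q + j - k mod n" if "k mod n \<le> n * q + j"
      proof
        assume "n dvd n * q + j - k mod n"
        then have "(n * q + j) mod n = k mod n mod n" using that mod_eq_dvd_iff_nat by blast
        then show False using False j by simp
      qed
      then show ?thesis using eq False ek yc by (simp add: xsupp_def)
    qed
  qed
  have "\<zero> = (\<Oplus>k\<in>{..<N * n}. ?m k (n * q + j + r))"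
    using e wc v rel finsum_R[of "{..<N * n}" ?m "n * q + j + r"] by simp
  also have "\<dots> = (\<Oplus>k\<in>{..<N * n}. if k mod n = j then cf (e (k div n * n + j)) 0 q \<otimes> ?y (k div n) \<otimes> V q else \<zero>)"
    using e wc v lt coeff less_mult_imp_div_less by (intro finsum_cong') auto
  also have "\<dots> = (\<Oplus>i\<in>{..<N}. cf (e (i * n + j)) 0 q \<otimes> ?y i \<otimes> V q)"
    using e lt w v by (intro finsum_residue_class j) auto
  also have "\<dots> = (\<Oplus>i\<in>{..<N}. cf (e (i * n + j)) 0 q \<otimes> ?y i) \<otimes> V q"
    using e lt w v by (intro finsum_ldistr[symmetric]) auto
  finally have "(\<Oplus>i\<in>{..<N}. cf (e (i * n + j)) 0 q \<otimes> ?y i) \<otimes> V q \<otimes> U q = \<zero> \<otimes> U q" by simp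
  moreover have sc: "(\<Oplus>i\<in>{..<N}. cf (e (i * n + j)) 0 q \<otimes> ?y i) \<in> carrier A"
    using e lt w v by (intro finsum_closed) auto
  ultimately have "(\<Oplus>i\<in>{..<N}. cf (e (i * n + j)) 0 q \<otimes> ?y i) = \<zero>" by simp
  moreover have "(\<Oplus>i\<in>{..<N}. cf (e (i * n + j)) 0 q \<otimes> v \<otimes> (\<sigma> ^^ r) (w i)) =
      (\<Oplus>i\<in>{..<N}. cf (e (i * n + j)) 0 q \<otimes> ?y i)"
    using e lt w v by (intro finsum_cong') (auto simp: m_assoc)
  ultimately show ?thesis by simp
qed

end

section \<open>Central localization\<close>

locale central_localization = ring R for R (structure) +
  fixes Z :: "'a set"
  assumes Z: "subring Z R"
    and central: "\<And>z r. z \<in> Z \<Longrightarrow> r \<in> carrier R \<Longrightarrow> z \<otimes> r = r \<otimes> z"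
    and regular: "\<And>z r. z \<in> Z \<Longrightarrow> z \<noteq> \<zero> \<Longrightarrow> r \<in> carrier R \<Longrightarrow> z \<otimes> r = \<zero> \<Longrightarrow> r = \<zero>"
    and one_not_zero: "\<one> \<noteq> \<zero>"
begin

abbreviation "Q \<equiv> central_quot_ring R Z"
definition "Z' = Z - {\<zero>}"
abbreviation "qt \<equiv> quot R Z"
abbreviation "emb f \<equiv> quot R Z f \<one>"

lemma Z'_iff: "z \<in> Z' \<longleftrightarrow> z \<in> Z \<and> z \<noteq> \<zero>"
  by (simp add: Z'_def)

lemma Z'_Z [simp]: "z \<in> Z' \<Longrightarrow> z \<in> Z"
  by (simp add: Z'_iff)

lemma Z_closed [simp]: "z \<in> Z' \<Longrightarrow> z \<in> carrier R" "z \<in> Z \<Longrightarrow> z \<in> carrier R"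
  using subringE(1)[OF Z] by (auto simp: Z'_iff simp del: Z'_Z)

lemma Z'_mult [simp]: "y \<in> Z' \<Longrightarrow> z \<in> Z' \<Longrightarrow> y \<otimes> z \<in> Z'"
  using subringE(6)[OF Z] regular[of y z] by (auto simp: Z'_iff simp del: Z'_Z)

lemma Z'_one [simp]: "\<one> \<in> Z'"
  using subringE(3)[OF Z] one_not_zero by (simp add: Z'_iff del: Z'_Z)

lemma cancel:
  assumes "a \<in> carrier R" "b \<in> carrier R" "z \<in> Z'" "a \<otimes> z = b \<otimes> z"
  shows "a = b"
proof -
  have z: "z \<in> Z" "z \<noteq> \<zero>" "z \<in> carrier R" using assms(3) by (simp_all add: Z'_iff del: Z'_Z)
  have "z \<otimes> a = z \<otimes> b"
    using assms(4) central[OF z(1) assms(1)] central[OF z(1) assms(2)] by metis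
  then have "z \<otimes> (a \<ominus> b) = \<zero>" using assms(1,2) z(3) by (simp add: a_minus_def r_distr r_minus r_neg)
  then have "a \<ominus> b = \<zero>" using regular[OF z(1,2)] assms(1,2) by blast
  then show ?thesis using assms(1,2) by simp
qed

lemma interchange:
  assumes "a \<in> carrier R" "b \<in> carrier R" "g \<in> Z" "k \<in> carrier R"
  shows "a \<otimes> b \<otimes> (g \<otimes> k) = a \<otimes> g \<otimes> (b \<otimes> k)"
proof -
  have "a \<otimes> b \<otimes> (g \<otimes> k) = a \<otimes> (b \<otimes> g) \<otimes> k" using assms by (simp add: m_assoc)
  also have "b \<otimes> g = g \<otimes> b" using assms central[of g b] by simp
  finally show ?thesis using assms by (simp add: m_assoc)
qed

lemma qt_mem: "(h, k) \<in> qt f g \<longleftrightarrow> h \<in> carrier R \<and> k \<in> Z' \<and> f \<otimes> k = h \<otimes> g"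
  by (simp add: quot_def Z'_def del: Z'_Z)

lemma qt_self: "f \<in> carrier R \<Longrightarrow> g \<in> Z' \<Longrightarrow> (f, g) \<in> qt f g"
  by (simp add: qt_mem)

text \<open>Transitivity of the equality of fractions: after cross-multiplying, the denominator
  \<open>g\<close> is cancelled by regularity.\<close>

lemma qt_subset:
  assumes c: "f \<in> carrier R" "g \<in> Z'" "h \<in> carrier R" "k \<in> Z'" and eq: "f \<otimes> k = h \<otimes> g"
  shows "qt f g \<subseteq> qt h k"
proof (rule subrelI)
  fix p q assume "(p, q) \<in> qt f g"
  then have pq: "p \<in> carrier R" "q \<in> Z'" "f \<otimes> q = p \<otimes> g" by (simp_all add: qt_mem)
  have "h \<otimes> q \<otimes> g = h \<otimes> g \<otimes> q" using c pq(1,2) central[of q g] by (simp add: m_assoc)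
  also have "\<dots> = f \<otimes> k \<otimes> q" using eq by simp
  also have "\<dots> = f \<otimes> q \<otimes> k" using c pq(1,2) central[of q k] by (simp add: m_assoc)
  also have "\<dots> = p \<otimes> g \<otimes> k" using pq(3) by simp
  also have "\<dots> = p \<otimes> k \<otimes> g" using c pq(1,2) central[of g k] by (simp add: m_assoc)
  finally have "h \<otimes> q = p \<otimes> k" using cancel[of "h \<otimes> q" "p \<otimes> k" g] c pq(1,2) by simp
  then show "(p, q) \<in> qt h k" using pq by (simp add: qt_mem)
qed

lemma qt_eq_iff:
  assumes "f \<in> carrier R" "g \<in> Z'" "h \<in> carrier R" "k \<in> Z'"
  shows "qt f g = qt h k \<longleftrightarrow> f \<otimes> k = h \<otimes> g"
proof
  assume "qt f g = qt h k"
  then have "(h, k) \<in> qt f g" using qt_self[of h k] assms by simp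
  then show "f \<otimes> k = h \<otimes> g" by (simp add: qt_mem)
next
  assume "f \<otimes> k = h \<otimes> g"
  then show "qt f g = qt h k" using assms qt_subset[of f g h k] qt_subset[of h k f g] by auto
qed

lemma Q_carrier: "a \<in> carrier Q \<longleftrightarrow> (\<exists>f g. f \<in> carrier R \<and> g \<in> Z' \<and> a = qt f g)"
  by (auto simp: central_quot_ring_def Z'_def simp del: Z'_Z)

lemma Q_mult:
  assumes f: "f \<in> carrier R" "g \<in> Z'" and h: "h \<in> carrier R" "k \<in> Z'"
  shows "qt f g \<otimes>\<^bsub>Q\<^esub> qt h k = qt (f \<otimes> h) (g \<otimes> k)"
proof -
  have eq: "qt (f' \<otimes> h') (g' \<otimes> k') = qt (f \<otimes> h) (g \<otimes> k)"
    if m: "(f', g') \<in> qt f g" "(h', k') \<in> qt h k" for f' g' h' k'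
  proof -
    have m': "f' \<in> carrier R" "g' \<in> Z'" "f \<otimes> g' = f' \<otimes> g" "h' \<in> carrier R" "k' \<in> Z'" "h \<otimes> k' = h' \<otimes> k"
      using m by (simp_all add: qt_mem)
    then have "f' \<otimes> h' \<otimes> (g \<otimes> k) = f \<otimes> h \<otimes> (g' \<otimes> k')"
      using f h by (simp add: interchange)
    then show ?thesis using m' f h by (intro qt_eq_iff[THEN iffD2]) auto
  qed
  have "qt f g \<otimes>\<^bsub>Q\<^esub> qt h k = (\<Union>(f', g')\<in>qt f g. \<Union>(h', k')\<in>qt h k. qt (f' \<otimes> h') (g' \<otimes> k'))"
    by (simp add: central_quot_ring_def)
  also have "\<dots> = qt (f \<otimes> h) (g \<otimes> k)"
    using eq qt_self[OF f] qt_self[OF h] by fast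
  finally show ?thesis .
qed

lemma Q_add_general:
  assumes f: "f \<in> carrier R" "g \<in> Z'" and h: "h \<in> carrier R" "k \<in> Z'"
  shows "qt f g \<oplus>\<^bsub>Q\<^esub> qt h k = qt (f \<otimes> k \<oplus> h \<otimes> g) (g \<otimes> k)"
proof -
  have eq: "qt (f' \<otimes> k' \<oplus> h' \<otimes> g') (g' \<otimes> k') = qt (f \<otimes> k \<oplus> h \<otimes> g) (g \<otimes> k)"
    if m: "(f', g') \<in> qt f g" "(h', k') \<in> qt h k" for f' g' h' k'
  proof -
    have m': "f' \<in> carrier R" "g' \<in> Z'" "f \<otimes> g' = f' \<otimes> g" "h' \<in> carrier R" "k' \<in> Z'" "h \<otimes> k' = h' \<otimes> k"
      using m by (simp_all add: qt_mem)
    have "f' \<otimes> k' \<otimes> (g \<otimes> k) = f \<otimes> k \<otimes> (g' \<otimes> k')"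
      using m' f h central[of k' k] by (simp add: interchange)
    moreover have "h' \<otimes> g' \<otimes> (g \<otimes> k) = h \<otimes> g \<otimes> (g' \<otimes> k')"
    proof -
      have "h' \<otimes> g' \<otimes> (g \<otimes> k) = h' \<otimes> g' \<otimes> (k \<otimes> g)" using f h central[of g k] by simp
      also have "\<dots> = h' \<otimes> k \<otimes> (g' \<otimes> g)" using m' f h by (intro interchange) auto
      also have "\<dots> = h \<otimes> k' \<otimes> (g' \<otimes> g)" using m' by simp
      also have "\<dots> = h \<otimes> g' \<otimes> (k' \<otimes> g)" using m' f h by (intro interchange) auto
      also have "\<dots> = h \<otimes> g' \<otimes> (g \<otimes> k')" using m' f central[of g k'] by simp
      also have "\<dots> = h \<otimes> g \<otimes> (g' \<otimes> k')" using m' f h by (intro interchange) auto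
      finally show ?thesis .
    qed
    ultimately have "(f' \<otimes> k' \<oplus> h' \<otimes> g') \<otimes> (g \<otimes> k) = (f \<otimes> k \<oplus> h \<otimes> g) \<otimes> (g' \<otimes> k')"
      using m' f h by (simp add: l_distr)
    then show ?thesis using m' f h by (intro qt_eq_iff[THEN iffD2]) auto
  qed
  have "qt f g \<oplus>\<^bsub>Q\<^esub> qt h k = (\<Union>(f', g')\<in>qt f g. \<Union>(h', k')\<in>qt h k. qt (f' \<otimes> k' \<oplus> h' \<otimes> g') (g' \<otimes> k'))"
    by (simp add: central_quot_ring_def)
  also have "\<dots> = qt (f \<otimes> k \<oplus> h \<otimes> g) (g \<otimes> k)"
    using eq qt_self[OF f] qt_self[OF h] by fast
  finally show ?thesis .
qed

lemma qt_expand: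
  assumes "f \<in> carrier R" "g \<in> Z'" "k \<in> Z'"
  shows "qt (f \<otimes> k) (g \<otimes> k) = qt f g" "qt (f \<otimes> k) (k \<otimes> g) = qt f g"
proof -
  have 1: "f \<otimes> k \<otimes> g = f \<otimes> (g \<otimes> k)" "f \<otimes> k \<otimes> g = f \<otimes> (k \<otimes> g)"
    using assms central[of g k] by (simp_all add: m_assoc)
  show "qt (f \<otimes> k) (g \<otimes> k) = qt f g" "qt (f \<otimes> k) (k \<otimes> g) = qt f g"
    using assms by (subst qt_eq_iff; use 1 in auto)+
qed

lemma Q_add:
  assumes "f \<in> carrier R" "h \<in> carrier R" "z \<in> Z'"
  shows "qt f z \<oplus>\<^bsub>Q\<^esub> qt h z = qt (f \<oplus> h) z"
proof -
  have "qt f z \<oplus>\<^bsub>Q\<^esub> qt h z = qt ((f \<oplus> h) \<otimes> z) (z \<otimes> z)"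
    using assms by (simp add: Q_add_general l_distr)
  then show ?thesis using assms by (simp add: qt_expand)
qed

text \<open>Over a common denominator, addition is addition of numerators, and the ring axioms
  reduce to those of \<open>R\<close>.\<close>

lemma common2:
  assumes "a \<in> carrier Q" "b \<in> carrier Q"
  obtains f h z where "f \<in> carrier R" "h \<in> carrier R" "z \<in> Z'" "a = qt f z" "b = qt h z"
proof -
  obtain f g h k where "f \<in> carrier R" "g \<in> Z'" "a = qt f g" "h \<in> carrier R" "k \<in> Z'" "b = qt h k"
    using assms unfolding Q_carrier by blast
  then show ?thesis using that[of "f \<otimes> k" "h \<otimes> g" "g \<otimes> k"] by (simp add: qt_expand)
qed

lemma common3:
  assumes "a \<in> carrier Q" "b \<in> carrier Q" "c \<in> carrier Q"
  obtains f h p z where "f \<in> carrier R" "h \<in> carrier R" "p \<in> carrier R" "z \<in> Z'"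
    "a = qt f z" "b = qt h z" "c = qt p z"
proof -
  obtain f h z where 1: "f \<in> carrier R" "h \<in> carrier R" "z \<in> Z'" "a = qt f z" "b = qt h z"
    by (rule common2[OF assms(1,2)])
  obtain p k where 2: "p \<in> carrier R" "k \<in> Z'" "c = qt p k"
    using assms(3) unfolding Q_carrier by blast
  show ?thesis using that[of "f \<otimes> k" "h \<otimes> k" "p \<otimes> z" "z \<otimes> k"] 1 2 by (simp add: qt_expand)
qed

lemma qt_carrier [simp]: "f \<in> carrier R \<Longrightarrow> g \<in> Z' \<Longrightarrow> qt f g \<in> carrier Q"
  unfolding Q_carrier by blast

lemma Q_zero: "z \<in> Z' \<Longrightarrow> \<zero>\<^bsub>Q\<^esub> = qt \<zero> z"
  using qt_eq_iff[of \<zero> \<one> \<zero> z] by (simp add: central_quot_ring_def)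

lemma Q_one: "z \<in> Z' \<Longrightarrow> \<one>\<^bsub>Q\<^esub> = qt z z"
  using qt_eq_iff[of \<one> \<one> z z] by (simp add: central_quot_ring_def)

lemma Q_ring: "ring Q"
proof (rule ringI)
  show "abelian_group Q"
  proof (rule abelian_groupI)
    fix a b assume "a \<in> carrier Q" "b \<in> carrier Q"
    then obtain f h z where "f \<in> carrier R" "h \<in> carrier R" "z \<in> Z'" "a = qt f z" "b = qt h z"
      by (rule common2)
    then show "a \<oplus>\<^bsub>Q\<^esub> b \<in> carrier Q" "a \<oplus>\<^bsub>Q\<^esub> b = b \<oplus>\<^bsub>Q\<^esub> a"
      by (simp_all add: Q_add a_comm)
  next
    fix a b c assume "a \<in> carrier Q" "b \<in> carrier Q" "c \<in> carrier Q"
    then obtain f h p z where "f \<in> carrier R" "h \<in> carrier R" "p \<in> carrier R" "z \<in> Z'"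
      "a = qt f z" "b = qt h z" "c = qt p z"
      by (rule common3)
    then show "a \<oplus>\<^bsub>Q\<^esub> b \<oplus>\<^bsub>Q\<^esub> c = a \<oplus>\<^bsub>Q\<^esub> (b \<oplus>\<^bsub>Q\<^esub> c)"
      by (simp add: Q_add a_assoc)
  next
    fix a assume "a \<in> carrier Q"
    then obtain f g where fg: "f \<in> carrier R" "g \<in> Z'" "a = qt f g" unfolding Q_carrier by blast
    then show "\<zero>\<^bsub>Q\<^esub> \<oplus>\<^bsub>Q\<^esub> a = a" by (simp add: Q_zero[of g] Q_add)
    show "\<exists>b\<in>carrier Q. b \<oplus>\<^bsub>Q\<^esub> a = \<zero>\<^bsub>Q\<^esub>"
      using fg by (intro bexI[of _ "qt (\<ominus> f) g"]) (simp_all add: Q_zero[of g] Q_add l_neg)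
  qed (use Q_zero[of \<one>] in simp)
  show "monoid Q"
  proof (rule monoidI)
    fix a b assume "a \<in> carrier Q" "b \<in> carrier Q"
    then obtain f h z where "f \<in> carrier R" "h \<in> carrier R" "z \<in> Z'" "a = qt f z" "b = qt h z"
      by (rule common2)
    then show "a \<otimes>\<^bsub>Q\<^esub> b \<in> carrier Q"
      using Z'_mult by (simp only: Q_mult qt_carrier m_closed)
  next
    fix a b c assume "a \<in> carrier Q" "b \<in> carrier Q" "c \<in> carrier Q"
    then obtain f h p z where "f \<in> carrier R" "h \<in> carrier R" "p \<in> carrier R" "z \<in> Z'"
      "a = qt f z" "b = qt h z" "c = qt p z"
      by (rule common3)
    then show "a \<otimes>\<^bsub>Q\<^esub> b \<otimes>\<^bsub>Q\<^esub> c = a \<otimes>\<^bsub>Q\<^esub> (b \<otimes>\<^bsub>Q\<^esub> c)"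
      using Z'_mult Z_closed by (simp only: Q_mult m_closed m_assoc)
  next
    fix a assume "a \<in> carrier Q"
    then obtain f g where fg: "f \<in> carrier R" "g \<in> Z'" "a = qt f g" unfolding Q_carrier by blast
    show "\<one>\<^bsub>Q\<^esub> \<otimes>\<^bsub>Q\<^esub> a = a" "a \<otimes>\<^bsub>Q\<^esub> \<one>\<^bsub>Q\<^esub> = a"
      unfolding Q_one[OF Z'_one] fg(3) using fg(1,2) by (subst Q_mult; simp)+
  qed (use Q_one[of \<one>] in simp)
  fix a b c assume "a \<in> carrier Q" "b \<in> carrier Q" "c \<in> carrier Q"
  then obtain f h p z where abc: "f \<in> carrier R" "h \<in> carrier R" "p \<in> carrier R" "z \<in> Z'"
    "a = qt f z" "b = qt h z" "c = qt p z"
    by (rule common3)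
  show "(a \<oplus>\<^bsub>Q\<^esub> b) \<otimes>\<^bsub>Q\<^esub> c = a \<otimes>\<^bsub>Q\<^esub> c \<oplus>\<^bsub>Q\<^esub> b \<otimes>\<^bsub>Q\<^esub> c"
    "c \<otimes>\<^bsub>Q\<^esub> (a \<oplus>\<^bsub>Q\<^esub> b) = c \<otimes>\<^bsub>Q\<^esub> a \<oplus>\<^bsub>Q\<^esub> c \<otimes>\<^bsub>Q\<^esub> b"
    using abc(1-4) Z'_mult unfolding abc(5-7)
    by (simp_all only: Q_add Q_mult l_distr r_distr m_closed a_closed)
qed

sublocale Q: ring Q by (rule Q_ring)

lemma emb_hom: "(\<lambda>f. emb f) \<in> ring_hom R Q"
proof (rule ring_hom_memI)
  fix f h assume fh: "f \<in> carrier R" "h \<in> carrier R"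
  show "emb (f \<otimes> h) = emb f \<otimes>\<^bsub>Q\<^esub> emb h"
    using fh by (subst Q_mult) auto
  show "emb (f \<oplus> h) = emb f \<oplus>\<^bsub>Q\<^esub> emb h"
    using fh by (subst Q_add) auto
qed (auto simp: Q_one[OF Z'_one])

lemmas emb_closed = ring_hom_closed[OF emb_hom]
  and emb_mult = ring_hom_mult[OF emb_hom]
  and emb_add = ring_hom_add[OF emb_hom]

lemma emb_inj: "f \<in> carrier R \<Longrightarrow> h \<in> carrier R \<Longrightarrow> emb f = emb h \<longleftrightarrow> f = h"
  by (subst qt_eq_iff) auto

lemma qt_zero_iff: "f \<in> carrier R \<Longrightarrow> g \<in> Z' \<Longrightarrow> qt f g = \<zero>\<^bsub>Q\<^esub> \<longleftrightarrow> f = \<zero>"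
  using Q_zero[of \<one>] qt_eq_iff[of f g \<zero> \<one>] by simp

lemma Q_central:
  assumes "z \<in> Z" "g \<in> Z'" "a \<in> carrier Q"
  shows "qt z g \<otimes>\<^bsub>Q\<^esub> a = a \<otimes>\<^bsub>Q\<^esub> qt z g"
proof -
  obtain f h where a: "f \<in> carrier R" "h \<in> Z'" "a = qt f h" using assms unfolding Q_carrier by blast
  then show ?thesis
    using assms central[of z f] central[of g h] by (simp add: Q_mult)
qed

text \<open>The numerators range over \<open>D\<close> while the denominators stay in
  \<open>Z\<close>. For \<open>D = E[x]\<close> and \<open>Z = F[x]\<close> this is already all of
  \<open>E(x)\<close>, since it turns out to be a field.\<close>

definition frac :: "'a set \<Rightarrow> ('a \<times> 'a) set set" where
  "frac D = {qt e g | e g. e \<in> D \<and> g \<in> Z'}"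

lemma central_quot_field_eq: "central_quot_field R Z = frac Z"
  by (simp add: central_quot_field_def frac_def Z'_def del: Z'_Z)

lemma frac_mono: "D \<subseteq> D' \<Longrightarrow> frac D \<subseteq> frac D'"
  by (auto simp: frac_def)

lemma frac_subring:
  assumes D: "subring D R" and ZD: "Z \<subseteq> D"
  shows "subring (frac D) Q"
proof (rule Q.subringI)
  have DR: "e \<in> D \<Longrightarrow> e \<in> carrier R" for e using subringE(1)[OF D] by auto
  show "frac D \<subseteq> carrier Q" by (auto simp: frac_def intro!: qt_carrier DR)
  show "\<one>\<^bsub>Q\<^esub> \<in> frac D"
    using Q_one[OF Z'_one] subringE(3)[OF D] Z'_one unfolding frac_def by blast
  fix a assume "a \<in> frac D"
  then obtain e g where a: "e \<in> D" "g \<in> Z'" "a = qt e g" by (auto simp: frac_def)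
  have "qt (\<ominus> e) g \<oplus>\<^bsub>Q\<^esub> a = \<zero>\<^bsub>Q\<^esub>"
    using a DR by (simp add: Q_add l_neg Q_zero[of g])
  then have "\<ominus>\<^bsub>Q\<^esub> a = qt (\<ominus> e) g"
    using a DR by (intro Q.minus_equality) auto
  then show "\<ominus>\<^bsub>Q\<^esub> a \<in> frac D" using a subringE(5)[OF D] unfolding frac_def by blast
  fix b assume "b \<in> frac D"
  then obtain e' g' where b: "e' \<in> D" "g' \<in> Z'" "b = qt e' g'" by (auto simp: frac_def)
  have "a \<otimes>\<^bsub>Q\<^esub> b = qt (e \<otimes> e') (g \<otimes> g')" using a b DR by (simp only: Q_mult)
  then show "a \<otimes>\<^bsub>Q\<^esub> b \<in> frac D"
    using a b subringE(6)[OF D] Z'_mult unfolding frac_def by blast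
  have "a \<oplus>\<^bsub>Q\<^esub> b = qt (e \<otimes> g' \<oplus> e' \<otimes> g) (g \<otimes> g')" using a b DR by (simp only: Q_add_general)
  moreover have "e \<otimes> g' \<oplus> e' \<otimes> g \<in> D"
    using a b ZD subringE(6,7)[OF D] by (metis Z'_Z subsetD)
  ultimately show "a \<oplus>\<^bsub>Q\<^esub> b \<in> frac D"
    using a b Z'_mult unfolding frac_def by blast
qed

lemma frac_Z_subfield: "subfield (frac Z) Q"
proof (rule Q.subfieldI)
  have sub: "subring (frac Z) Q" by (rule frac_subring[OF Z subset_refl])
  show sc: "subcring (frac Z) Q"
  proof (rule Q.subcringI[OF sub])
    fix a b assume a: "a \<in> frac Z" and b: "b \<in> frac Z"
    obtain p q where "p \<in> Z" "q \<in> Z'" "a = qt p q" using a by (auto simp: frac_def)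
    then show "a \<otimes>\<^bsub>Q\<^esub> b = b \<otimes>\<^bsub>Q\<^esub> a"
      using subringE(1)[OF sub] b Q_central[of p q b] by blast
  qed
  have ne: "\<one>\<^bsub>Q\<^esub> \<noteq> \<zero>\<^bsub>Q\<^esub>"
    using qt_zero_iff[of \<one> \<one>] one_not_zero Q_one[OF Z'_one] by simp
  show "Units (Q\<lparr>carrier := frac Z\<rparr>) = frac Z - {\<zero>\<^bsub>Q\<^esub>}"
  proof
    show "Units (Q\<lparr>carrier := frac Z\<rparr>) \<subseteq> frac Z - {\<zero>\<^bsub>Q\<^esub>}"
    proof
      fix a assume "a \<in> Units (Q\<lparr>carrier := frac Z\<rparr>)"
      then obtain b where ab: "a \<in> frac Z" "b \<in> frac Z" "a \<otimes>\<^bsub>Q\<^esub> b = \<one>\<^bsub>Q\<^esub>" by (auto simp: Units_def)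
      have "a \<noteq> \<zero>\<^bsub>Q\<^esub>"
      proof
        assume "a = \<zero>\<^bsub>Q\<^esub>"
        then show False using ab ne subringE(1)[OF sub] by (metis Q.l_null subsetD)
      qed
      then show "a \<in> frac Z - {\<zero>\<^bsub>Q\<^esub>}" using ab by simp
    qed
    show "frac Z - {\<zero>\<^bsub>Q\<^esub>} \<subseteq> Units (Q\<lparr>carrier := frac Z\<rparr>)"
    proof
      fix a assume a: "a \<in> frac Z - {\<zero>\<^bsub>Q\<^esub>}"
      then obtain p q where pq: "p \<in> Z" "q \<in> Z'" "a = qt p q" by (auto simp: frac_def)
      then have p: "p \<in> Z'" using a qt_zero_iff[of p q] by (auto simp: Z'_iff simp del: Z'_Z)
      have "a \<otimes>\<^bsub>Q\<^esub> qt q p = \<one>\<^bsub>Q\<^esub>" "qt q p \<otimes>\<^bsub>Q\<^esub> a = \<one>\<^bsub>Q\<^esub>"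
        unfolding pq(3) Q_one[OF Z'_mult[OF p pq(2)]] using pq(2) p central[OF pq(1), of q]
        by (simp_all add: Q_mult)
      moreover have "qt q p \<in> frac Z" using Z'_Z[OF pq(2)] p unfolding frac_def by blast
      moreover have "a \<in> frac Z" using a by simp
      ultimately show "a \<in> Units (Q\<lparr>carrier := frac Z\<rparr>)" unfolding Units_def by simp blast
    qed
  qed
qed

lemma common_denominator:
  assumes D: "subring D R" and ZD: "Z \<subseteq> D" and c: "\<And>i. i < m \<Longrightarrow> c i \<in> frac D"
  shows "\<exists>e z. z \<in> Z' \<and> (\<forall>i<m::nat. e i \<in> D \<and> c i = qt (e i) z)"
  using c
proof (induction m)
  case 0
  show ?case using Z'_one by blast
next
  case (Suc m)
  have DR: "e \<in> D \<Longrightarrow> e \<in> carrier R" for e using subringE(1)[OF D] by auto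
  obtain e z where e: "z \<in> Z'" "\<And>i. i < m \<Longrightarrow> e i \<in> D \<and> c i = qt (e i) z"
    using Suc.IH Suc.prems by auto
  obtain f g where f: "f \<in> D" "g \<in> Z'" "c m = qt f g" using Suc.prems[of m] by (auto simp: frac_def)
  define e' where "e' i = (if i = m then f \<otimes> z else e i \<otimes> g)" for i
  have "e' i \<in> D \<and> c i = qt (e' i) (z \<otimes> g)" if "i < Suc m" for i
  proof (cases "i = m")
    case True
    have "f \<otimes> z \<in> D" using e(1) f(1) ZD by (intro subringE(6)[OF D]) auto
    then show ?thesis using True e(1) f DR by (simp add: e'_def qt_expand)
  next
    case False
    then have i: "i < m" using that by simp
    have "e i \<otimes> g \<in> D" using e(2)[OF i] f(2) ZD by (intro subringE(6)[OF D]) auto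
    then show ?thesis using False e(1) e(2)[OF i] f DR by (simp add: e'_def qt_expand)
  qed
  then show ?case using Z'_mult[OF e(1) f(2)] by blast
qed

lemma finsum_qt:
  assumes z: "z \<in> Z'" and "finite I" "\<And>i. i \<in> I \<Longrightarrow> f i \<in> carrier R"
  shows "(\<Oplus>\<^bsub>Q\<^esub>i\<in>I. qt (f i) z) = qt (\<Oplus>i\<in>I. f i) z"
  using assms(2,3)
proof (induction I rule: finite_induct)
  case empty
  then show ?case using Q_zero[OF z] by simp
next
  case (insert i I)
  have 1: "(\<lambda>i. qt (f i) z) \<in> I \<rightarrow> carrier Q" "qt (f i) z \<in> carrier Q"
    using insert.prems z qt_carrier by auto
  have 2: "f \<in> I \<rightarrow> carrier R" "f i \<in> carrier R" using insert.prems by auto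
  show ?case
    using 1 2 insert z Q_add[OF 2(2) finsum_closed[OF 2(1)] z] by simp
qed

text \<open>Clearing denominators: the coefficients of a relation are brought over one central
  denominator, and the numerators then satisfy a relation in \<open>R\<close>.\<close>

lemma frac_left_basis:
  assumes b: "left_basis R D v m" and ZD: "Z \<subseteq> D"
  shows "left_basis Q (frac D) (\<lambda>i. emb (v i)) m"
proof -
  interpret b: left_basis R D v m by fact
  have trm: "qt e z \<otimes>\<^bsub>Q\<^esub> emb (v i) = qt (e \<otimes> v i) z" if "e \<in> D" "z \<in> Z'" "i < m" for e z i
    using that b.LC_closed b.v_closed by (subst Q_mult) auto
  have comb: "(\<Oplus>\<^bsub>Q\<^esub>i\<in>{..<m}. c i \<otimes>\<^bsub>Q\<^esub> emb (v i)) = qt (\<Oplus>i\<in>{..<m}. e i \<otimes> v i) z"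
    if z: "z \<in> Z'" and e: "\<And>i. i < m \<Longrightarrow> e i \<in> D \<and> c i = qt (e i) z" for c e z
  proof -
    have ev: "e i \<otimes> v i \<in> carrier R" if "i < m" for i using e[OF that] that b.LC_closed b.v_closed by simp
    have "(\<Oplus>\<^bsub>Q\<^esub>i\<in>{..<m}. c i \<otimes>\<^bsub>Q\<^esub> emb (v i)) = (\<Oplus>\<^bsub>Q\<^esub>i\<in>{..<m}. qt (e i \<otimes> v i) z)"
      using e z ev by (intro Q.finsum_cong') (auto simp: trm qt_carrier)
    also have "\<dots> = qt (\<Oplus>i\<in>{..<m}. e i \<otimes> v i) z" using z ev by (intro finsum_qt) auto
    finally show ?thesis .
  qed
  show ?thesis
  proof (rule Q.left_basisI)
    show "subring (frac D) Q" by (rule frac_subring[OF b.LC ZD])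
    show "emb (v i) \<in> carrier Q" if "i < m" for i using b.v_closed[OF that] by (rule emb_closed)
  next
    fix a assume "a \<in> carrier Q"
    then obtain f z where f: "f \<in> carrier R" "z \<in> Z'" "a = qt f z" unfolding Q_carrier by blast
    have "(\<Oplus>\<^bsub>Q\<^esub>i\<in>{..<m}. qt (b.coord f i) z \<otimes>\<^bsub>Q\<^esub> emb (v i)) = qt (\<Oplus>i\<in>{..<m}. b.coord f i \<otimes> v i) z"
      using b.coord(1)[OF f(1)] f(2) by (intro comb) auto
    also have "\<dots> = a" using b.coord(2)[OF f(1)] f(3) by simp
    finally have "a = (\<Oplus>\<^bsub>Q\<^esub>i\<in>{..<m}. qt (b.coord f i) z \<otimes>\<^bsub>Q\<^esub> emb (v i))" ..
    moreover have "\<forall>i<m. qt (b.coord f i) z \<in> frac D"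
      using b.coord(1)[OF f(1)] f(2) unfolding frac_def by blast
    ultimately show "\<exists>c. (\<forall>i<m. c i \<in> frac D) \<and> a = (\<Oplus>\<^bsub>Q\<^esub>i\<in>{..<m}. c i \<otimes>\<^bsub>Q\<^esub> emb (v i))"
      by (intro exI[of _ "\<lambda>i. qt (b.coord f i) z"]) simp
  next
    fix c k assume c: "\<And>i. i < m \<Longrightarrow> c i \<in> frac D"
      and s: "(\<Oplus>\<^bsub>Q\<^esub>i\<in>{..<m}. c i \<otimes>\<^bsub>Q\<^esub> emb (v i)) = \<zero>\<^bsub>Q\<^esub>" and k: "k < m"
    obtain e z where e: "z \<in> Z'" "\<And>i. i < m \<Longrightarrow> e i \<in> D \<and> c i = qt (e i) z"
      using common_denominator[OF b.LC ZD, of m c] c by blast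
    have ev: "(\<Oplus>i\<in>{..<m}. e i \<otimes> v i) \<in> carrier R"
      using e(2) b.term_closed[of e] by (intro finsum_closed) auto
    have "(\<Oplus>i\<in>{..<m}. e i \<otimes> v i) = \<zero>"
      using trans[OF comb[of z e c, OF e, symmetric] s] qt_zero_iff[OF ev e(1)] by blast
    then have "e k = \<zero>" using b.indep[of e k] e(2) k by simp
    then show "c k = \<zero>\<^bsub>Q\<^esub>" using e k Q_zero[OF e(1)] by simp
  qed
qed

end

section \<open>Independence and bases\<close>

text \<open>
  The shortest-relation argument: simplicity allows a nonzero coefficient of a shortest relation to
  be normalised to \<open>1\<close>, and then all coefficients are central because commutators are shorter.
\<close>

lemma simple_ring_multiplications_independent:
  assumes A: "simple_ring A"
    and a: "\<And>i. i < N \<Longrightarrow> a i \<in> carrier A"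
    and ind: "\<And>\<gamma> i. (\<And>i. i < N \<Longrightarrow> \<gamma> i \<in> ring_center A) \<Longrightarrow>
      (\<Oplus>\<^bsub>A\<^esub>i\<in>{..<N}. \<gamma> i \<otimes>\<^bsub>A\<^esub> a i) = \<zero>\<^bsub>A\<^esub> \<Longrightarrow> i < N \<Longrightarrow> \<gamma> i = \<zero>\<^bsub>A\<^esub>"
    and p: "\<And>i. i < N \<Longrightarrow> p i \<in> carrier A"
    and rel: "\<And>v. v \<in> carrier A \<Longrightarrow> (\<Oplus>\<^bsub>A\<^esub>i\<in>{..<N}. p i \<otimes>\<^bsub>A\<^esub> v \<otimes>\<^bsub>A\<^esub> a i) = \<zero>\<^bsub>A\<^esub>"
    and k: "k < (N :: nat)"
  shows "p k = \<zero>\<^bsub>A\<^esub>"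
proof -
  interpret A: ring A using A by (simp add: simple_ring_def)
  define rels where "rels p \<longleftrightarrow> (\<forall>i<N. p i \<in> carrier A) \<and>
    (\<forall>v\<in>carrier A. (\<Oplus>\<^bsub>A\<^esub>i\<in>{..<N}. p i \<otimes>\<^bsub>A\<^esub> v \<otimes>\<^bsub>A\<^esub> a i) = \<zero>\<^bsub>A\<^esub>)" for p
  define supp where "supp p = {i. i < N \<and> p i \<noteq> \<zero>\<^bsub>A\<^esub>}" for p :: "nat \<Rightarrow> 'a"
  have fin: "finite (supp p)" for p by (simp add: supp_def)
  \<comment> \<open>One closure rule with two summands covers negation, sums, products from either
    side and commutators below.\<close>
  have lin: "rels (\<lambda>i. x \<otimes>\<^bsub>A\<^esub> p i \<otimes>\<^bsub>A\<^esub> y \<oplus>\<^bsub>A\<^esub> x' \<otimes>\<^bsub>A\<^esub> q i \<otimes>\<^bsub>A\<^esub> y')"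
    if pq: "rels p" "rels q" and xy: "x \<in> carrier A" "y \<in> carrier A" "x' \<in> carrier A" "y' \<in> carrier A"
    for p q x y x' y'
  proof -
    have c: "p i \<in> carrier A" "q i \<in> carrier A" if "i < N" for i using pq that by (auto simp: rels_def)
    have "(\<Oplus>\<^bsub>A\<^esub>i\<in>{..<N}. (x \<otimes>\<^bsub>A\<^esub> p i \<otimes>\<^bsub>A\<^esub> y \<oplus>\<^bsub>A\<^esub> x' \<otimes>\<^bsub>A\<^esub> q i \<otimes>\<^bsub>A\<^esub> y') \<otimes>\<^bsub>A\<^esub> v \<otimes>\<^bsub>A\<^esub> a i) = \<zero>\<^bsub>A\<^esub>"
      if v: "v \<in> carrier A" for v
    proof -
      have "(\<Oplus>\<^bsub>A\<^esub>i\<in>{..<N}. (x \<otimes>\<^bsub>A\<^esub> p i \<otimes>\<^bsub>A\<^esub> y \<oplus>\<^bsub>A\<^esub> x' \<otimes>\<^bsub>A\<^esub> q i \<otimes>\<^bsub>A\<^esub> y') \<otimes>\<^bsub>A\<^esub> v \<otimes>\<^bsub>A\<^esub> a i) =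
        (\<Oplus>\<^bsub>A\<^esub>i\<in>{..<N}. x \<otimes>\<^bsub>A\<^esub> (p i \<otimes>\<^bsub>A\<^esub> (y \<otimes>\<^bsub>A\<^esub> v) \<otimes>\<^bsub>A\<^esub> a i) \<oplus>\<^bsub>A\<^esub> x' \<otimes>\<^bsub>A\<^esub> (q i \<otimes>\<^bsub>A\<^esub> (y' \<otimes>\<^bsub>A\<^esub> v) \<otimes>\<^bsub>A\<^esub> a i))"
        using c a v xy by (intro A.finsum_cong') (auto simp: A.l_distr A.m_assoc)
      also have "\<dots> = (\<Oplus>\<^bsub>A\<^esub>i\<in>{..<N}. x \<otimes>\<^bsub>A\<^esub> (p i \<otimes>\<^bsub>A\<^esub> (y \<otimes>\<^bsub>A\<^esub> v) \<otimes>\<^bsub>A\<^esub> a i)) \<oplus>\<^bsub>A\<^esub>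
          (\<Oplus>\<^bsub>A\<^esub>i\<in>{..<N}. x' \<otimes>\<^bsub>A\<^esub> (q i \<otimes>\<^bsub>A\<^esub> (y' \<otimes>\<^bsub>A\<^esub> v) \<otimes>\<^bsub>A\<^esub> a i))"
        using c a v xy by (intro A.finsum_addf) auto
      also have "(\<Oplus>\<^bsub>A\<^esub>i\<in>{..<N}. x \<otimes>\<^bsub>A\<^esub> (p i \<otimes>\<^bsub>A\<^esub> (y \<otimes>\<^bsub>A\<^esub> v) \<otimes>\<^bsub>A\<^esub> a i)) =
          x \<otimes>\<^bsub>A\<^esub> (\<Oplus>\<^bsub>A\<^esub>i\<in>{..<N}. p i \<otimes>\<^bsub>A\<^esub> (y \<otimes>\<^bsub>A\<^esub> v) \<otimes>\<^bsub>A\<^esub> a i)"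
        using c a v xy by (intro A.finsum_rdistr[symmetric]) auto
      also have "(\<Oplus>\<^bsub>A\<^esub>i\<in>{..<N}. x' \<otimes>\<^bsub>A\<^esub> (q i \<otimes>\<^bsub>A\<^esub> (y' \<otimes>\<^bsub>A\<^esub> v) \<otimes>\<^bsub>A\<^esub> a i)) =
          x' \<otimes>\<^bsub>A\<^esub> (\<Oplus>\<^bsub>A\<^esub>i\<in>{..<N}. q i \<otimes>\<^bsub>A\<^esub> (y' \<otimes>\<^bsub>A\<^esub> v) \<otimes>\<^bsub>A\<^esub> a i)"
        using c a v xy by (intro A.finsum_rdistr[symmetric]) auto
      finally show ?thesis using pq v xy by (simp add: rels_def)
    qed
    then show ?thesis using c xy by (simp add: rels_def)
  qed
  have "p i = \<zero>\<^bsub>A\<^esub>" if "rels p" "i < N" for p i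
    using that
  proof (induction "card (supp p)" arbitrary: p i rule: less_induct)
    case less
    show ?case
    proof (rule ccontr)
      assume nz: "p i \<noteq> \<zero>\<^bsub>A\<^esub>"
      \<comment> \<open>The \<open>i\<close>-th coefficients of all relations supported where
        \<open>p\<close> is form a two-sided ideal. It contains \<open>p i\<close>, which is not
        zero, hence also one.\<close>
      define J where "J = {q i | q. rels q \<and> supp q \<subseteq> supp p}"
      have inJ: "z \<in> J" if "rels q" "supp q \<subseteq> supp p" "z = q i" for q z using that by (auto simp: J_def)
      have Jc: "J \<subseteq> carrier A" using less.prems by (auto simp: J_def rels_def)
      have "ideal J A"
      proof (rule idealI[OF A.ring_axioms])
        show "subgroup J (add_monoid A)"
        proof (rule A.add.subgroupI)
          show "J \<noteq> {}" using inJ[of p] less.prems by auto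
          fix y assume "y \<in> J"
          then obtain q where q: "rels q" "supp q \<subseteq> supp p" "y = q i" by (auto simp: J_def)
          have qc: "q j \<in> carrier A" if "j < N" for j using q that by (auto simp: rels_def)
          let ?q = "\<lambda>j. \<ominus>\<^bsub>A\<^esub> \<one>\<^bsub>A\<^esub> \<otimes>\<^bsub>A\<^esub> q j \<otimes>\<^bsub>A\<^esub> \<one>\<^bsub>A\<^esub> \<oplus>\<^bsub>A\<^esub> \<zero>\<^bsub>A\<^esub> \<otimes>\<^bsub>A\<^esub> q j \<otimes>\<^bsub>A\<^esub> \<one>\<^bsub>A\<^esub>"
          have "supp ?q \<subseteq> supp q" using qc by (auto simp: supp_def)
          then show "\<ominus>\<^bsub>A\<^esub> y \<in> J"
            using lin[OF q(1) q(1), of "\<ominus>\<^bsub>A\<^esub> \<one>\<^bsub>A\<^esub>" "\<one>\<^bsub>A\<^esub>" "\<zero>\<^bsub>A\<^esub>" "\<one>\<^bsub>A\<^esub>"] q qc[OF less.prems(2)]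
            by (intro inJ[of ?q]) (auto simp: A.l_minus)
          fix z assume "z \<in> J"
          then obtain r where r: "rels r" "supp r \<subseteq> supp p" "z = r i" by (auto simp: J_def)
          have rc: "r j \<in> carrier A" if "j < N" for j using r that by (auto simp: rels_def)
          let ?r = "\<lambda>j. \<one>\<^bsub>A\<^esub> \<otimes>\<^bsub>A\<^esub> q j \<otimes>\<^bsub>A\<^esub> \<one>\<^bsub>A\<^esub> \<oplus>\<^bsub>A\<^esub> \<one>\<^bsub>A\<^esub> \<otimes>\<^bsub>A\<^esub> r j \<otimes>\<^bsub>A\<^esub> \<one>\<^bsub>A\<^esub>"
          have "supp ?r \<subseteq> supp q \<union> supp r" using qc rc by (auto simp: supp_def)
          then show "y \<oplus>\<^bsub>A\<^esub> z \<in> J"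
            using lin[OF q(1) r(1), of "\<one>\<^bsub>A\<^esub>" "\<one>\<^bsub>A\<^esub>" "\<one>\<^bsub>A\<^esub>" "\<one>\<^bsub>A\<^esub>"] q r qc[OF less.prems(2)] rc[OF less.prems(2)]
            by (intro inJ[of ?r]) auto
        qed (use Jc in auto)
        fix y z assume "y \<in> J" and z: "z \<in> carrier A"
        then obtain q where q: "rels q" "supp q \<subseteq> supp p" "y = q i" by (auto simp: J_def)
        have qc: "q j \<in> carrier A" if "j < N" for j using q that by (auto simp: rels_def)
        let ?q = "\<lambda>j. z \<otimes>\<^bsub>A\<^esub> q j \<otimes>\<^bsub>A\<^esub> \<one>\<^bsub>A\<^esub> \<oplus>\<^bsub>A\<^esub> \<zero>\<^bsub>A\<^esub> \<otimes>\<^bsub>A\<^esub> q j \<otimes>\<^bsub>A\<^esub> \<one>\<^bsub>A\<^esub>"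
        have "supp ?q \<subseteq> supp q" using qc z by (auto simp: supp_def)
        then show "z \<otimes>\<^bsub>A\<^esub> y \<in> J"
          using lin[OF q(1) q(1), of z "\<one>\<^bsub>A\<^esub>" "\<zero>\<^bsub>A\<^esub>" "\<one>\<^bsub>A\<^esub>"] q qc[OF less.prems(2)] z
          by (intro inJ[of ?q]) auto
        let ?r = "\<lambda>j. \<one>\<^bsub>A\<^esub> \<otimes>\<^bsub>A\<^esub> q j \<otimes>\<^bsub>A\<^esub> z \<oplus>\<^bsub>A\<^esub> \<zero>\<^bsub>A\<^esub> \<otimes>\<^bsub>A\<^esub> q j \<otimes>\<^bsub>A\<^esub> \<one>\<^bsub>A\<^esub>"
        have "supp ?r \<subseteq> supp q" using qc z by (auto simp: supp_def)
        then show "y \<otimes>\<^bsub>A\<^esub> z \<in> J"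
          using lin[OF q(1) q(1), of "\<one>\<^bsub>A\<^esub>" z "\<zero>\<^bsub>A\<^esub>" "\<one>\<^bsub>A\<^esub>"] q qc[OF less.prems(2)] z
          by (intro inJ[of ?r]) auto
      qed
      moreover have "p i \<in> J" using inJ[of p] less.prems by auto
      ultimately have "J = carrier A" using A nz by (auto simp: simple_ring_def)
      then have "\<one>\<^bsub>A\<^esub> \<in> J" by simp
      then obtain q where q: "rels q" "supp q \<subseteq> supp p" "q i = \<one>\<^bsub>A\<^esub>" by (auto simp: J_def)
      have qc: "q j \<in> carrier A" if "j < N" for j using q that by (auto simp: rels_def)
      have "q j \<in> ring_center A" if j: "j < N" for j
      proof -
        have "q j \<otimes>\<^bsub>A\<^esub> y = y \<otimes>\<^bsub>A\<^esub> q j" if y: "y \<in> carrier A" for y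
        proof -
          \<comment> \<open>The commutator with \<open>y\<close> vanishes at \<open>i\<close>, where
            the coefficient is one, and has no new support; so the induction hypothesis kills
            it.\<close>
          let ?q = "\<lambda>j. y \<otimes>\<^bsub>A\<^esub> q j \<otimes>\<^bsub>A\<^esub> \<one>\<^bsub>A\<^esub> \<oplus>\<^bsub>A\<^esub> \<ominus>\<^bsub>A\<^esub> \<one>\<^bsub>A\<^esub> \<otimes>\<^bsub>A\<^esub> q j \<otimes>\<^bsub>A\<^esub> y"
          have r: "rels ?q" by (rule lin[OF q(1) q(1)]) (use y in auto)
          have "supp ?q \<subseteq> supp q" using qc y by (auto simp: supp_def)
          moreover have "i \<notin> supp ?q" using q(3) y by (simp add: supp_def A.l_minus A.r_neg)
          moreover have "i \<in> supp q" using q(3) less.prems A by (simp add: supp_def simple_ring_def)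
          ultimately have "supp ?q \<subset> supp q" by blast
          then have "card (supp ?q) < card (supp p)"
            using q(2) fin psubset_card_mono[of "supp p" "supp ?q"] by blast
          then have "?q j = \<zero>\<^bsub>A\<^esub>" using less.hyps r j by blast
          then have "y \<otimes>\<^bsub>A\<^esub> q j \<ominus>\<^bsub>A\<^esub> q j \<otimes>\<^bsub>A\<^esub> y = \<zero>\<^bsub>A\<^esub>"
            using qc[OF j] y by (simp add: A.l_minus A.minus_eq)
          then show ?thesis using qc[OF j] y by simp
        qed
        then show ?thesis using qc[OF j] by (simp add: ring_center_def)
      qed
      \<comment> \<open>At \<open>v = 1\<close> the relation becomes an ordinary linear relation
        with central coefficients, to which \<open>ind\<close> applies.\<close>
      moreover have "(\<Oplus>\<^bsub>A\<^esub>i\<in>{..<N}. q i \<otimes>\<^bsub>A\<^esub> a i) = \<zero>\<^bsub>A\<^esub>"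
      proof -
        have "(\<Oplus>\<^bsub>A\<^esub>i\<in>{..<N}. q i \<otimes>\<^bsub>A\<^esub> \<one>\<^bsub>A\<^esub> \<otimes>\<^bsub>A\<^esub> a i) = \<zero>\<^bsub>A\<^esub>" using q(1) by (simp add: rels_def)
        moreover have "(\<Oplus>\<^bsub>A\<^esub>i\<in>{..<N}. q i \<otimes>\<^bsub>A\<^esub> \<one>\<^bsub>A\<^esub> \<otimes>\<^bsub>A\<^esub> a i) = (\<Oplus>\<^bsub>A\<^esub>i\<in>{..<N}. q i \<otimes>\<^bsub>A\<^esub> a i)"
          using qc a by (intro A.finsum_cong') auto
        ultimately show ?thesis by simp
      qed
      ultimately have "q i = \<zero>\<^bsub>A\<^esub>" using ind[of q i] less.prems(2) by blast
      then show False using q(3) A by (simp add: simple_ring_def)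
    qed
  qed
  moreover have "rels p" using p rel by (simp add: rels_def)
  ultimately show ?thesis using k by blast
qed

section \<open>Dedekind independence, conjugates and Galois bases\<close>

lemma (in field) dedekind_independence:
  fixes \<sigma> :: "'a \<Rightarrow> 'a"
  assumes \<sigma>: "\<sigma> \<in> ring_hom R R"
    and distinct: "\<And>r s. r < n \<Longrightarrow> s < n \<Longrightarrow> r \<noteq> s \<Longrightarrow> \<exists>c\<in>carrier R. (\<sigma> ^^ r) c \<noteq> (\<sigma> ^^ s) c"
    and J: "finite J" "J \<subseteq> {..<n}"
    and \<alpha>: "\<And>r. r \<in> J \<Longrightarrow> \<alpha> r \<in> carrier R"
    and rel: "\<And>c. c \<in> carrier R \<Longrightarrow> (\<Oplus>r\<in>J. \<alpha> r \<otimes> (\<sigma> ^^ r) c) = \<zero>"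
    and r: "r \<in> J"
  shows "\<alpha> r = \<zero>"
proof -
  interpret skew_poly R \<sigma> by unfold_locales (rule \<sigma>)
  show ?thesis
    using J \<alpha> rel r
  proof (induction J arbitrary: \<alpha> r rule: finite_induct)
    case (insert s J)
    have c: "\<alpha> r \<in> carrier R" if "r \<in> insert s J" for r using insert.prems that by blast
    have J0: "\<alpha> r = \<zero>" if r: "r \<in> J" for r
    proof -
      have "r < n" "s < n" "r \<noteq> s" using insert.prems insert.hyps r by auto
      then obtain c0 where c0: "c0 \<in> carrier R" "(\<sigma> ^^ r) c0 \<noteq> (\<sigma> ^^ s) c0" using distinct by blast
      \<comment> \<open>From the relation at \<open>c0 y\<close>, \<open>\<sigma>^s(c0)\<close>
        times the relation at \<open>y\<close> is subtracted: the term of \<open>s\<close> drops out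
        and each other term acquires the factor seen here, which is not zero for the chosen
        \<open>r\<close>.\<close>
      define \<beta> where "\<beta> r = \<alpha> r \<otimes> ((\<sigma> ^^ r) c0 \<ominus> (\<sigma> ^^ s) c0)" for r
      have \<beta>: "\<beta> r \<in> carrier R" if "r \<in> insert s J" for r using c[OF that] c0 by (simp add: \<beta>_def)
      have "(\<Oplus>r\<in>J. \<beta> r \<otimes> (\<sigma> ^^ r) y) = \<zero>" if y: "y \<in> carrier R" for y
      proof -
        let ?f = "\<lambda>r. \<alpha> r \<otimes> (\<sigma> ^^ r) (c0 \<otimes> y)" and ?g = "\<lambda>r. \<ominus> (\<sigma> ^^ s) c0 \<otimes> (\<alpha> r \<otimes> (\<sigma> ^^ r) y)"
        have "(\<Oplus>r\<in>insert s J. \<beta> r \<otimes> (\<sigma> ^^ r) y) = (\<Oplus>r\<in>insert s J. ?f r \<oplus> ?g r)"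
        proof (rule finsum_cong')
          fix r assume "r \<in> insert s J"
          then have cr: "\<alpha> r \<in> carrier R" by (rule c)
          show "\<beta> r \<otimes> (\<sigma> ^^ r) y = ?f r \<oplus> ?g r"
            using cr c0 y by (simp add: \<beta>_def a_minus_def pow_mult r_distr l_distr l_minus r_minus m_ac)
        qed (use c c0 y in auto)
        also have "\<dots> = (\<Oplus>r\<in>insert s J. ?f r) \<oplus> (\<Oplus>r\<in>insert s J. ?g r)"
          using c c0 y by (intro finsum_addf) auto
        also have "(\<Oplus>r\<in>insert s J. ?f r) = \<zero>"
          using insert.prems(3)[of "c0 \<otimes> y"] c0 y by simp
        also have "(\<Oplus>r\<in>insert s J. ?g r) = \<ominus> (\<sigma> ^^ s) c0 \<otimes> (\<Oplus>r\<in>insert s J. \<alpha> r \<otimes> (\<sigma> ^^ r) y)"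
          using c c0 y insert.hyps by (intro finsum_rdistr[symmetric]) auto
        also have "(\<Oplus>r\<in>insert s J. \<alpha> r \<otimes> (\<sigma> ^^ r) y) = \<zero>"
          using insert.prems(3)[OF y] .
        finally have "(\<Oplus>r\<in>insert s J. \<beta> r \<otimes> (\<sigma> ^^ r) y) = \<zero>" using c0 by simp
        moreover have "\<beta> s = \<zero>" using c[of s] c0 by (simp add: \<beta>_def a_minus_def r_neg)
        moreover have "(\<Oplus>r\<in>insert s J. \<beta> r \<otimes> (\<sigma> ^^ r) y) = \<beta> s \<otimes> (\<sigma> ^^ s) y \<oplus> (\<Oplus>r\<in>J. \<beta> r \<otimes> (\<sigma> ^^ r) y)"
          using \<beta> y insert.hyps by (intro finsum_insert) auto
        moreover have "(\<Oplus>r\<in>J. \<beta> r \<otimes> (\<sigma> ^^ r) y) \<in> carrier R"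
          using \<beta> y by (intro finsum_closed) auto
        ultimately show ?thesis using y by simp
      qed
      then have "\<beta> r = \<zero>" using insert.IH[of \<beta> r] \<beta> r insert.prems(1) by auto
      then have "\<alpha> r = \<zero> \<or> (\<sigma> ^^ r) c0 \<ominus> (\<sigma> ^^ s) c0 = \<zero>"
        using integral[of "\<alpha> r" "(\<sigma> ^^ r) c0 \<ominus> (\<sigma> ^^ s) c0"] c[of r] c0 r by (simp add: \<beta>_def)
      then show ?thesis using c0 by simp
    qed
    have "\<alpha> s = \<zero>"
    proof -
      have "(\<Oplus>r\<in>J. \<alpha> r \<otimes> (\<sigma> ^^ r) \<one>) = (\<Oplus>r\<in>J. \<zero>)"
        using J0 by (intro finsum_cong') auto
      moreover have "(\<Oplus>r\<in>insert s J. \<alpha> r \<otimes> (\<sigma> ^^ r) \<one>) = \<alpha> s \<otimes> (\<sigma> ^^ s) \<one> \<oplus> (\<Oplus>r\<in>J. \<alpha> r \<otimes> (\<sigma> ^^ r) \<one>)"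
        using c insert.hyps by (intro finsum_insert) auto
      ultimately show ?thesis using insert.prems(3)[of \<one>] c[of s] by simp
    qed
    then show ?case using J0 insert.prems(4) by blast
  qed simp
qed

text \<open>The elements are found one at a time. Along a last row of conjugates of an unknown
  \<open>b\<close>, the determinant is the sum of the \<open>\<gamma>_j \<sigma>^j(b)\<close>, where
  \<open>\<gamma>_k\<close> is the previous, nonzero determinant; so Dedekind independence provides
  a \<open>b\<close> at which the sum does not vanish.\<close>

lemma (in field) conjugate_matrix_invertible:
  fixes \<sigma> :: "'a \<Rightarrow> 'a"
  assumes \<sigma>: "\<sigma> \<in> ring_hom R R"
    and distinct: "\<And>r s. r < n \<Longrightarrow> s < n \<Longrightarrow> r \<noteq> s \<Longrightarrow> \<exists>c\<in>carrier R. (\<sigma> ^^ r) c \<noteq> (\<sigma> ^^ s) c"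
  shows "\<exists>c. (\<forall>i<n. c i \<in> carrier R) \<and> determinant R n (mat n n (\<lambda>(i, r). (\<sigma> ^^ r) (c i))) \<noteq> \<zero>"
proof -
  interpret skew_poly R \<sigma> by unfold_locales (rule \<sigma>)
  have "\<exists>c. (\<forall>i<k. c i \<in> carrier R) \<and> determinant R k (mat k k (\<lambda>(i, r). (\<sigma> ^^ r) (c i))) \<noteq> \<zero>"
    if "k \<le> n" for k
    using that
  proof (induction k)
    case 0
    have "{p. p permutes ({} :: nat set)} = {id}" by auto
    then have "determinant R 0 M = \<one>" for M by (simp add: determinant_def)
    then show ?case by simp
  next
    case (Suc k)
    then obtain c where c: "\<And>i. i < k \<Longrightarrow> c i \<in> carrier R"
      "determinant R k (mat k k (\<lambda>(i, r). (\<sigma> ^^ r) (c i))) \<noteq> \<zero>" by auto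
    \<comment> \<open>Row \<open>k\<close> is about to be replaced by conjugates of
      \<open>b\<close>; zero is a placeholder that keeps its entries in the carrier.\<close>
    define c' where "c' i = (if i < k then c i else \<zero>)" for i
    obtain \<gamma> where \<gamma>: "\<And>j. \<gamma> j \<in> carrier R"
      "\<gamma> k = determinant R k (mat k k (\<lambda>(i, j). (\<sigma> ^^ j) (c' i)))"
      "\<And>r. (\<And>j. j \<le> k \<Longrightarrow> r j \<in> carrier R) \<Longrightarrow>
         determinant R (Suc k) (mat (Suc k) (Suc k) (\<lambda>(i, j). if i = k then r j else (\<sigma> ^^ j) (c' i))) =
         (\<Oplus>j\<in>{..k}. r j \<otimes> \<gamma> j)"
      using laplace_last_row[of k "\<lambda>i j. (\<sigma> ^^ j) (c' i)"] c(1) by (auto simp: c'_def)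
    have "mat k k (\<lambda>(i, j). (\<sigma> ^^ j) (c' i)) = mat k k (\<lambda>(i, r). (\<sigma> ^^ r) (c i))"
      by (intro eq_matI) (auto simp: c'_def)
    then have \<gamma>k: "\<gamma> k \<noteq> \<zero>" using \<gamma>(2) c(2) by simp
    have "\<exists>b\<in>carrier R. (\<Oplus>j\<in>{..k}. \<gamma> j \<otimes> (\<sigma> ^^ j) b) \<noteq> \<zero>"
    proof (rule ccontr)
      assume "\<not> ?thesis"
      then have "\<gamma> k = \<zero>"
        using \<gamma>(1) Suc.prems
        by (intro dedekind_independence[where n = n and J = "{..k}" and \<alpha> = \<gamma>, OF \<sigma> distinct]) auto
      then show False using \<gamma>k by simp
    qed
    then obtain b where b: "b \<in> carrier R" "(\<Oplus>j\<in>{..k}. \<gamma> j \<otimes> (\<sigma> ^^ j) b) \<noteq> \<zero>" by blast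
    have "(\<Oplus>j\<in>{..k}. (\<sigma> ^^ j) b \<otimes> \<gamma> j) = (\<Oplus>j\<in>{..k}. \<gamma> j \<otimes> (\<sigma> ^^ j) b)"
      using \<gamma>(1) b by (intro finsum_cong') (auto simp: m_comm)
    then have "determinant R (Suc k) (mat (Suc k) (Suc k) (\<lambda>(i, j). if i = k then (\<sigma> ^^ j) b else (\<sigma> ^^ j) (c' i))) \<noteq> \<zero>"
      using \<gamma>(3)[of "\<lambda>j. (\<sigma> ^^ j) b"] b by simp
    moreover have "mat (Suc k) (Suc k) (\<lambda>(i, j). if i = k then (\<sigma> ^^ j) b else (\<sigma> ^^ j) (c' i)) =
       mat (Suc k) (Suc k) (\<lambda>(i, r). (\<sigma> ^^ r) ((c(k := b)) i))"
      by (intro eq_matI) (auto simp: c'_def)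
    ultimately show ?case using c(1) b(1) by (intro exI[of _ "c(k := b)"]) auto
  qed
  then show ?thesis by blast
qed

lemma (in abelian_monoid) finsum_div_mod:
  fixes n N :: nat
  assumes f: "\<And>i j. i < N \<Longrightarrow> j < n \<Longrightarrow> f i j \<in> carrier G"
  shows "(\<Oplus>k\<in>{..<N * n}. f (k div n) (k mod n)) = (\<Oplus>i\<in>{..<N}. \<Oplus>j\<in>{..<n}. f i j)"
  using f
proof (induction N)
  case (Suc N)
  have closed: "f (k div n) (k mod n) \<in> carrier G" if "k < Suc N * n" for k
  proof -
    have "0 < n" using that by (cases n) auto
    then show ?thesis using that less_mult_imp_div_less[of k "Suc N" n] by (intro Suc.prems) auto
  qed
  have split: "{..<Suc N * n} = {..<N * n} \<union> (\<lambda>j. N * n + j) ` {..<n}"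
  proof (intro equalityI subsetI)
    fix k assume "k \<in> {..<Suc N * n}"
    then have "k < N * n \<or> (k - N * n < n \<and> k = N * n + (k - N * n))" by auto
    then show "k \<in> {..<N * n} \<union> (\<lambda>j. N * n + j) ` {..<n}" by blast
  qed auto
  have "(\<Oplus>k\<in>{..<Suc N * n}. f (k div n) (k mod n)) =
    (\<Oplus>k\<in>{..<N * n}. f (k div n) (k mod n)) \<oplus> (\<Oplus>k\<in>(\<lambda>j. N * n + j) ` {..<n}. f (k div n) (k mod n))"
    unfolding split using closed split by (intro finsum_Un_disjoint) auto
  also have "(\<Oplus>k\<in>(\<lambda>j. N * n + j) ` {..<n}. f (k div n) (k mod n)) =
      (\<Oplus>j\<in>{..<n}. f ((N * n + j) div n) ((N * n + j) mod n))"
    using closed Suc.prems[of N] by (intro finsum_reindex) auto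
  also have "\<dots> = (\<Oplus>j\<in>{..<n}. f N j)"
    using Suc.prems by (intro finsum_cong') auto
  also have "(\<Oplus>k\<in>{..<N * n}. f (k div n) (k mod n)) = (\<Oplus>i\<in>{..<N}. \<Oplus>j\<in>{..<n}. f i j)"
    using Suc by simp
  also have "(\<Oplus>i\<in>{..<N}. \<Oplus>j\<in>{..<n}. f i j) \<oplus> (\<Oplus>j\<in>{..<n}. f N j) = (\<Oplus>i\<in>{..<Suc N}. \<Oplus>j\<in>{..<n}. f i j)"
    using Suc.prems by (simp add: lessThan_Suc a_comm)
  finally show ?case .
qed simp

text \<open>
  If the coefficient row of \<open>1\<close> is multiplied by the adjugate of the matrix of \<open>f\<close>, the result is
  the coefficient row of the complementary divisor.
\<close>

lemma (in left_basis) divides_determinant: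
  assumes L: "cring L"
    and domain: "\<And>x y. x \<in> LC \<Longrightarrow> y \<in> LC \<Longrightarrow> x \<otimes> y = \<zero> \<Longrightarrow> x = \<zero> \<or> y = \<zero>"
    and f: "f \<in> carrier B" and \<delta>_def: "\<delta> = determinant L m (row_rep f)"
    and central: "\<And>z. z \<in> carrier B \<Longrightarrow> \<delta> \<otimes> z = z \<otimes> \<delta>"
  shows "\<exists>g\<in>carrier B. g \<otimes> f = \<delta> \<and> f \<otimes> g = \<delta>"
proof -
  interpret L: cring L by fact
  have \<delta>: "\<delta> \<in> LC" using L.determinant_closed[OF row_rep_closed[OF f]] by (simp add: \<delta>_def)
  have \<delta>B: "\<delta> \<in> carrier B" using \<delta> by (rule LC_closed)
  show ?thesis
  \<comment> \<open>The identity \<open>f g = \<delta>\<close> will need that \<open>r f = 0\<close>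
    forces \<open>r = 0\<close>, which a nonzero \<open>\<delta>\<close> guarantees. For
    \<open>\<delta> = 0\<close> the choice \<open>g = 0\<close> serves.\<close>
  proof (cases "\<delta> = \<zero>")
    case True
    then show ?thesis using f by (intro bexI[of _ \<zero>]) auto
  next
    case False
    obtain M where M: "M \<in> carrier (matrix_ring L m)"
      "row_rep f \<otimes>\<^bsub>matrix_ring L m\<^esub> M = scalar_matrix L m \<delta>"
      "M \<otimes>\<^bsub>matrix_ring L m\<^esub> row_rep f = scalar_matrix L m \<delta>"
      using L.adjugate_exists[OF row_rep_closed[OF f]] unfolding \<delta>_def by blast
    interpret MM: ring "matrix_ring L m" by (rule L.matrix_ring_is_ring)
    have Me: "M $$ (i, j) \<in> LC" if "i < m" "j < m" for i j
      using M(1) that by (simp add: matrix_ring_carrier)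
    \<comment> \<open>Row \<open>i\<close> of the adjugate, read as an element of the module:
      multiplication by \<open>f\<close> on the right takes it to
      \<open>\<delta> v_i\<close>.\<close>
    define \<mu> where "\<mu> i = (\<Oplus>j\<in>{..<m}. M $$ (i, j) \<otimes> v j)" for i
    have \<mu>c: "\<mu> i \<in> carrier B" if "i < m" for i
      unfolding \<mu>_def using Me that LC_closed v_closed by (intro finsum_closed) auto
    have \<mu>f: "\<mu> i \<otimes> f = \<delta> \<otimes> v i" if i: "i < m" for i
    proof -
      have "\<mu> i \<otimes> f = (\<Oplus>j\<in>{..<m}. M $$ (i, j) \<otimes> v j \<otimes> f)"
        unfolding \<mu>_def using Me i LC_closed v_closed f by (intro finsum_ldistr) auto
      also have "\<dots> = (\<Oplus>j\<in>{..<m}. M $$ (i, j) \<otimes> (\<Oplus>k\<in>{..<m}. row_rep f $$ (j, k) \<otimes> v k))"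
        using Me i LC_closed v_closed f row_rep_entry[OF f]
        by (intro finsum_cong') (auto simp: m_assoc row_rep intro!: finsum_closed m_closed)
      also have "\<dots> = (\<Oplus>k\<in>{..<m}. (\<Oplus>j\<in>{..<m}. M $$ (i, j) \<otimes> row_rep f $$ (j, k)) \<otimes> v k)"
        using Me i row_rep_closed[OF f] by (intro combination_swap) auto
      also have "\<dots> = (\<Oplus>k\<in>{..<m}. if i = k then \<delta> \<otimes> v k else \<zero>)"
      proof (rule finsum_cong')
        fix k assume "k \<in> {..<m}"
        then have k: "k < m" by simp
        have "(\<Oplus>j\<in>{..<m}. M $$ (i, j) \<otimes> row_rep f $$ (j, k)) = (M \<otimes>\<^bsub>matrix_ring L m\<^esub> row_rep f) $$ (i, k)"
          using i k Me row_rep_entry[OF f] subringE(6)[OF LC]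
          by (simp add: matrix_ring_mult_entry) (subst finsum_subring(1)[OF LC], auto)
        also have "\<dots> = (if i = k then \<delta> else \<zero>)"
          using i k by (simp add: M(3) scalar_matrix_entry)
        finally show "(\<Oplus>j\<in>{..<m}. M $$ (i, j) \<otimes> row_rep f $$ (j, k)) \<otimes> v k = (if i = k then \<delta> \<otimes> v k else \<zero>)"
          using v_closed[OF k] by simp
      qed (use \<delta>B v_closed in auto)
      also have "\<dots> = \<delta> \<otimes> v i" using i \<delta>B v_closed by (intro add.finprod_singleton) auto
      finally show ?thesis .
    qed
    define l where "l = coord \<one>"
    have l1: "\<And>i. i < m \<Longrightarrow> l i \<in> LC" "\<And>i. i < m \<Longrightarrow> l i \<in> carrier B" "\<one> = (\<Oplus>i\<in>{..<m}. l i \<otimes> v i)"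
      using coord[OF one_closed] LC_closed by (auto simp: l_def)
    define g where "g = (\<Oplus>i\<in>{..<m}. l i \<otimes> \<mu> i)"
    have g: "g \<in> carrier B" unfolding g_def using l1 \<mu>c by (intro finsum_closed) auto
    have "g \<otimes> f = (\<Oplus>i\<in>{..<m}. l i \<otimes> \<mu> i \<otimes> f)"
      unfolding g_def using l1(2) \<mu>c f by (intro finsum_ldistr) auto
    also have "\<dots> = (\<Oplus>i\<in>{..<m}. \<delta> \<otimes> (l i \<otimes> v i))"
    proof (rule finsum_cong')
      fix i assume "i \<in> {..<m}"
      then have i: "i < m" by simp
      have "l i \<otimes> \<mu> i \<otimes> f = l i \<otimes> (\<delta> \<otimes> v i)" using l1(2)[OF i] \<mu>c[OF i] f by (simp add: m_assoc \<mu>f[OF i])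
      also have "\<dots> = \<delta> \<otimes> l i \<otimes> v i"
        using l1(2)[OF i] v_closed[OF i] \<delta>B central[OF l1(2)[OF i]] by (simp flip: m_assoc)
      finally show "l i \<otimes> \<mu> i \<otimes> f = \<delta> \<otimes> (l i \<otimes> v i)"
        using l1(2)[OF i] v_closed[OF i] \<delta>B by (simp add: m_assoc)
    qed (use l1(2) v_closed \<delta>B in auto)
    also have "\<dots> = \<delta> \<otimes> (\<Oplus>i\<in>{..<m}. l i \<otimes> v i)"
      using l1(2) v_closed \<delta>B by (intro finsum_rdistr[symmetric]) auto
    finally have "g \<otimes> f = \<delta> \<otimes> (\<Oplus>i\<in>{..<m}. l i \<otimes> v i)" .
    then have gf: "g \<otimes> f = \<delta>" unfolding l1(3)[symmetric] using \<delta>B by simp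
    \<comment> \<open>The adjugate yields \<open>g f = \<delta>\<close>. For the other side,
      \<open>(f g - \<delta>) f = 0\<close> because \<open>\<delta>\<close> is central, so
      \<open>f\<close> has to be cancelled on the right. This is possible since its matrix times
      \<open>M\<close> is a nonzero scalar over a domain.\<close>
    have regular: "r = \<zero>" if r: "r \<in> carrier B" "r \<otimes> f = \<zero>" for r
    proof -
      have z: "row_rep \<zero> = \<zero>\<^bsub>matrix_ring L m\<^esub>"
        by (rule ring_hom_zero[OF row_rep_hom ring_axioms MM.ring_axioms])
      have "row_rep r \<otimes>\<^bsub>matrix_ring L m\<^esub> row_rep f = \<zero>\<^bsub>matrix_ring L m\<^esub>"
        using ring_hom_mult[OF row_rep_hom r(1) f] r(2) z by simp
      then have "row_rep r \<otimes>\<^bsub>matrix_ring L m\<^esub> row_rep f \<otimes>\<^bsub>matrix_ring L m\<^esub> M = \<zero>\<^bsub>matrix_ring L m\<^esub>"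
        using M(1) by simp
      then have r0: "row_rep r \<otimes>\<^bsub>matrix_ring L m\<^esub> scalar_matrix L m \<delta> = \<zero>\<^bsub>matrix_ring L m\<^esub>"
        using M row_rep_closed[OF r(1)] row_rep_closed[OF f] by (simp add: MM.m_assoc)
      have "row_rep r $$ (i, j) = \<zero>" if ij: "i < m" "j < m" for i j
      proof -
        have "row_rep r $$ (i, j) \<otimes> \<delta> = \<zero>"
          using L.scalar_matrix_mult_entry(2)[OF row_rep_closed[OF r(1)] ij, of \<delta>] \<delta> r0 ij
          by (simp add: matrix_ring_zero_entry)
        then show ?thesis using domain[OF row_rep_entry[OF r(1) ij] \<delta>] False by simp
      qed
      then have "v i \<otimes> r = \<zero>" if "i < m" for i
      proof -
        have "(\<Oplus>j\<in>{..<m}. row_rep r $$ (i, j) \<otimes> v j) = (\<Oplus>j\<in>{..<m}. \<zero>)"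
          using \<open>\<And>j i. i < m \<Longrightarrow> j < m \<Longrightarrow> row_rep r $$ (i, j) = \<zero>\<close> that v_closed
          by (intro finsum_cong') auto
        then show ?thesis using row_rep[OF r(1) that] by simp
      qed
      then have "(\<Oplus>i\<in>{..<m}. l i \<otimes> v i \<otimes> r) = (\<Oplus>i\<in>{..<m}. \<zero>)"
        using l1(2) v_closed r(1) by (intro finsum_cong') (auto simp: m_assoc)
      moreover have "(\<Oplus>i\<in>{..<m}. l i \<otimes> v i \<otimes> r) = (\<Oplus>i\<in>{..<m}. l i \<otimes> v i) \<otimes> r"
        using l1(2) v_closed r(1) by (intro finsum_ldistr[symmetric]) auto
      ultimately have "(\<Oplus>i\<in>{..<m}. l i \<otimes> v i) \<otimes> r = \<zero>" by simp
      then show ?thesis unfolding l1(3)[symmetric] using r(1) by simp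
    qed
    have "(f \<otimes> g \<ominus> \<delta>) \<otimes> f = f \<otimes> (g \<otimes> f) \<ominus> \<delta> \<otimes> f"
      using f g \<delta>B by (simp add: a_minus_def l_distr l_minus m_assoc)
    also have "\<dots> = \<zero>" using f gf central[OF f] \<delta>B by (simp add: a_minus_def r_neg)
    finally have "f \<otimes> g \<ominus> \<delta> = \<zero>" using regular[of "f \<otimes> g \<ominus> \<delta>"] f g \<delta>B by simp
    then have "f \<otimes> g = \<delta>" using f g \<delta>B by simp
    then show ?thesis using gf g by blast
  qed
qed

text \<open>The product \<open>c_j a_i\<close> carries the index \<open>k = i n + j\<close>. The
  \<open>c_j\<close> form a basis of \<open>C\<close> over \<open>F\<close>, expressed by sums in
  \<open>R\<close> so that \<open>C\<close> need not be viewed as a ring of its own.\<close>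

lemma (in ring) tower_left_basis:
  assumes a: "left_basis R C a N" and F: "subring F R" and FC: "F \<subseteq> C"
    and c: "\<And>i. i < n \<Longrightarrow> c i \<in> C"
    and cspan: "\<And>z. z \<in> C \<Longrightarrow> \<exists>f. (\<forall>i<n. f i \<in> F) \<and> z = (\<Oplus>i\<in>{..<n}. f i \<otimes> c i)"
    and cindep: "\<And>f i. (\<And>i. i < n \<Longrightarrow> f i \<in> F) \<Longrightarrow> (\<Oplus>i\<in>{..<n}. f i \<otimes> c i) = \<zero> \<Longrightarrow> i < (n::nat) \<Longrightarrow> f i = \<zero>"
  shows "left_basis R F (\<lambda>k. c (k mod n) \<otimes> a (k div n)) (N * n)"
proof -
  interpret a: left_basis R C a N by fact
  have cR: "c i \<in> carrier R" if "i < n" for i using c[OF that] a.LC_closed by blast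
  have FR: "z \<in> F \<Longrightarrow> z \<in> carrier R" for z using subringE(1)[OF F] by blast
  have idx: "k div n < N" "k mod n < n" if "k < N * n" for k
    using that less_mult_imp_div_less[of k N n] by (cases "n = 0"; simp)+
  have lt: "i * n + j < N * n" if "i < N" "j < n" for i j
  proof -
    have "i * n + j < Suc i * n" using that by simp
    also have "\<dots> \<le> N * n" using that by (intro mult_le_mono1) simp
    finally show ?thesis .
  qed
  have comb: "(\<Oplus>k\<in>{..<N * n}. f k \<otimes> (c (k mod n) \<otimes> a (k div n))) =
      (\<Oplus>i\<in>{..<N}. (\<Oplus>j\<in>{..<n}. f (i * n + j) \<otimes> c j) \<otimes> a i)"
    if f: "\<And>k. k < N * n \<Longrightarrow> f k \<in> F" for f
  proof -
    have fR: "f (i * n + j) \<in> carrier R" if "i < N" "j < n" for i j using f[OF lt[OF that]] FR by blast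
    have "(\<Oplus>k\<in>{..<N * n}. f k \<otimes> (c (k mod n) \<otimes> a (k div n))) =
      (\<Oplus>k\<in>{..<N * n}. f (k div n * n + k mod n) \<otimes> (c (k mod n) \<otimes> a (k div n)))"
      by simp
    also have "\<dots> = (\<Oplus>i\<in>{..<N}. \<Oplus>j\<in>{..<n}. f (i * n + j) \<otimes> (c j \<otimes> a i))"
      using fR cR a.v_closed
      by (intro finsum_div_mod[where f = "\<lambda>i j. f (i * n + j) \<otimes> (c j \<otimes> a i)"]) auto
    also have "\<dots> = (\<Oplus>i\<in>{..<N}. (\<Oplus>j\<in>{..<n}. f (i * n + j) \<otimes> c j) \<otimes> a i)"
    proof (rule finsum_cong')
      fix i assume "i \<in> {..<N}"
      then have i: "i < N" by simp
      have "(\<Oplus>j\<in>{..<n}. f (i * n + j) \<otimes> c j) \<otimes> a i = (\<Oplus>j\<in>{..<n}. f (i * n + j) \<otimes> c j \<otimes> a i)"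
        using fR cR a.v_closed i by (intro finsum_ldistr) auto
      also have "\<dots> = (\<Oplus>j\<in>{..<n}. f (i * n + j) \<otimes> (c j \<otimes> a i))"
        using fR cR a.v_closed i by (intro finsum_cong') (auto simp: m_assoc)
      finally show "(\<Oplus>j\<in>{..<n}. f (i * n + j) \<otimes> (c j \<otimes> a i)) = (\<Oplus>j\<in>{..<n}. f (i * n + j) \<otimes> c j) \<otimes> a i" ..
    qed (use fR cR a.v_closed in \<open>auto intro!: finsum_closed m_closed\<close>)
    finally show ?thesis .
  qed
  show ?thesis
  proof (rule left_basisI[OF F])
    show "c (k mod n) \<otimes> a (k div n) \<in> carrier R" if "k < N * n" for k
      using idx[OF that] cR a.v_closed by blast
  next
    fix z assume z: "z \<in> carrier R"
    have "\<forall>i. \<exists>f. i < N \<longrightarrow> (\<forall>j<n. f j \<in> F) \<and> a.coord z i = (\<Oplus>j\<in>{..<n}. f j \<otimes> c j)"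
      using cspan[OF a.coord(1)[OF z]] by blast
    then obtain f where f: "\<And>i. i < N \<Longrightarrow> (\<forall>j<n. f i j \<in> F) \<and> a.coord z i = (\<Oplus>j\<in>{..<n}. f i j \<otimes> c j)"
      by metis
    have fF: "f (k div n) (k mod n) \<in> F" if "k < N * n" for k using f idx[OF that] by blast
    have "(\<Oplus>k\<in>{..<N * n}. f (k div n) (k mod n) \<otimes> (c (k mod n) \<otimes> a (k div n))) =
      (\<Oplus>i\<in>{..<N}. (\<Oplus>j\<in>{..<n}. f ((i * n + j) div n) ((i * n + j) mod n) \<otimes> c j) \<otimes> a i)"
      using fF by (rule comb)
    also have "\<dots> = (\<Oplus>i\<in>{..<N}. a.coord z i \<otimes> a i)"
    proof (rule finsum_cong')
      fix i assume i: "i \<in> {..<N}"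
      have "(\<Oplus>j\<in>{..<n}. f ((i * n + j) div n) ((i * n + j) mod n) \<otimes> c j) = (\<Oplus>j\<in>{..<n}. f i j \<otimes> c j)"
        using f i cR FR by (intro finsum_cong') auto
      then show "(\<Oplus>j\<in>{..<n}. f ((i * n + j) div n) ((i * n + j) mod n) \<otimes> c j) \<otimes> a i = a.coord z i \<otimes> a i"
        using f i by simp
    qed (use a.coord(1)[OF z] a.LC_closed a.v_closed in auto)
    also have "\<dots> = z" using a.coord(2)[OF z] ..
    finally have "z = (\<Oplus>k\<in>{..<N * n}. f (k div n) (k mod n) \<otimes> (c (k mod n) \<otimes> a (k div n)))" ..
    then show "\<exists>f. (\<forall>k<N * n. f k \<in> F) \<and> z = (\<Oplus>k\<in>{..<N * n}. f k \<otimes> (c (k mod n) \<otimes> a (k div n)))"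
      using fF by (intro exI[of _ "\<lambda>k. f (k div n) (k mod n)"] conjI allI impI; blast)
  next
    fix f k assume f: "\<And>k. k < N * n \<Longrightarrow> f k \<in> F" and k: "k < N * n"
      and z: "(\<Oplus>k\<in>{..<N * n}. f k \<otimes> (c (k mod n) \<otimes> a (k div n))) = \<zero>"
    define s where "s i = (\<Oplus>j\<in>{..<n}. f (i * n + j) \<otimes> c j)" for i
    have "s i \<in> C" if "i < N" for i
      unfolding s_def using subsetD[OF FC f[OF lt[OF that]]] c
      by (intro finsum_subring(2)[OF a.LC] subringE(6)[OF a.LC]) auto
    moreover have "(\<Oplus>i\<in>{..<N}. s i \<otimes> a i) = \<zero>"
      using z comb[OF f] by (simp add: s_def)
    ultimately have "s (k div n) = \<zero>" using a.indep[of s] idx[OF k] by blast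
    then have "f (k div n * n + k mod n) = \<zero>"
      using cindep[of "\<lambda>j. f (k div n * n + j)" "k mod n"] f[OF lt[OF idx(1)[OF k]]] idx[OF k]
      by (simp add: s_def)
    then show "f k = \<zero>" by simp
  qed
qed

text \<open>
  The conclusions say that the \<open>c i\<close> span \<open>C\<close> over the fixed field of \<open>\<sigma>\<close>, and that the matrix
  of their conjugates is regular.
\<close>

lemma galois_basis:
  fixes A :: "('a, 'm) ring_scheme"
  assumes A: "ring A" and C: "subfield C A"
    and central: "\<And>c a. c \<in> C \<Longrightarrow> a \<in> carrier A \<Longrightarrow> c \<otimes>\<^bsub>A\<^esub> a = a \<otimes>\<^bsub>A\<^esub> c"
    and hom: "\<sigma> \<in> ring_hom A A" "inj_on \<sigma> (carrier A)" and \<sigma>C: "\<And>c. c \<in> C \<Longrightarrow> \<sigma> c \<in> C"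
    and ord: "order_on C \<sigma> n"
  obtains c where "\<And>i. i < n \<Longrightarrow> c i \<in> C"
    "\<And>z. z \<in> C \<Longrightarrow> \<exists>f. (\<forall>i<n. f i \<in> C \<inter> Fix A \<sigma>) \<and> z = (\<Oplus>\<^bsub>A\<^esub>i\<in>{..<n}. f i \<otimes>\<^bsub>A\<^esub> c i)"
    "\<And>e k. (\<And>i. i < n \<Longrightarrow> e i \<in> carrier A) \<Longrightarrow>
       (\<And>r. r < n \<Longrightarrow> (\<Oplus>\<^bsub>A\<^esub>i\<in>{..<n}. e i \<otimes>\<^bsub>A\<^esub> (\<sigma> ^^ r) (c i)) = \<zero>\<^bsub>A\<^esub>) \<Longrightarrow> k < n \<Longrightarrow> e k = \<zero>\<^bsub>A\<^esub>"
proof -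
  interpret skew_poly A \<sigma> using A hom(1) by (simp add: skew_poly_def skew_poly_axioms_def)
  have Csub: "subring C A" by (rule subfieldE(1)[OF C])
  have CA: "c \<in> C \<Longrightarrow> c \<in> carrier A" for c using subfieldE(3)[OF C] by blast
  define L where "L = A\<lparr>carrier := C\<rparr>"
  interpret L: field L unfolding L_def by (rule subfield_iff(2)[OF C])
  have Lc [simp]: "carrier L = C" and Lz: "\<zero>\<^bsub>L\<^esub> = \<zero>\<^bsub>A\<^esub>" and Lm: "x \<otimes>\<^bsub>L\<^esub> y = x \<otimes>\<^bsub>A\<^esub> y" for x y
    by (simp_all add: L_def)
  have \<sigma>L: "\<sigma> \<in> ring_hom L L"
    using \<sigma>C CA by (intro ring_hom_memI)
      (auto simp: L_def ring_hom_mult[OF hom(1)] ring_hom_add[OF hom(1)] ring_hom_one[OF hom(1)])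
  have powC: "(\<sigma> ^^ r) c \<in> C" if "c \<in> C" for r c using that \<sigma>C by (induction r) auto
  have powinj: "inj_on (\<sigma> ^^ r) (carrier A)" for r
  proof (induction r)
    case (Suc r)
    have "(\<sigma> ^^ r) ` carrier A \<subseteq> carrier A" using pow_closed by blast
    then have "inj_on (\<sigma> \<circ> \<sigma> ^^ r) (carrier A)"
      by (intro comp_inj_on Suc inj_on_subset[OF hom(2)])
    then show ?case by (simp add: comp_def)
  qed (simp add: inj_on_def)
  have least: "0 < n" "\<And>c. c \<in> C \<Longrightarrow> (\<sigma> ^^ n) c = c"
    "\<And>k. 0 < k \<Longrightarrow> k < n \<Longrightarrow> \<exists>c\<in>C. (\<sigma> ^^ k) c \<noteq> c"
    using ord unfolding order_on_def least_positive_def by blast+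
  \<comment> \<open>Powers of \<open>\<sigma>\<close> are injective, so if \<open>\<sigma>^r\<close>
    and \<open>\<sigma>^s\<close> agreed on \<open>C\<close>, then \<open>\<sigma>^(s-r)\<close>
    would be trivial there, against the minimality of \<open>n\<close>.\<close>
  have dist: "\<exists>c\<in>C. (\<sigma> ^^ r) c \<noteq> (\<sigma> ^^ s) c" if rs: "r < s" "s < n" for r s
  proof -
    have "0 < s - r" "s - r < n" using rs by linarith+
    then obtain c where c: "c \<in> C" "(\<sigma> ^^ (s - r)) c \<noteq> c" using least(3) by blast
    have "(\<sigma> ^^ s) c = (\<sigma> ^^ r) ((\<sigma> ^^ (s - r)) c)" using rs by (simp add: pow_pow)
    then have "(\<sigma> ^^ s) c \<noteq> (\<sigma> ^^ r) c"
      using c CA inj_onD[OF powinj[of r]] pow_closed by metis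
    then show ?thesis using c by metis
  qed
  have "\<exists>c\<in>carrier L. (\<sigma> ^^ r) c \<noteq> (\<sigma> ^^ s) c" if "r < n" "s < n" "r \<noteq> s" for r s
    using that dist[of r s] dist[of s r] by (cases "r < s") force+
  then obtain c where c: "\<And>i. i < n \<Longrightarrow> c i \<in> C"
    "determinant L n (mat n n (\<lambda>(i, r). (\<sigma> ^^ r) (c i))) \<noteq> \<zero>\<^bsub>A\<^esub>"
    using L.conjugate_matrix_invertible[OF \<sigma>L, of n] Lz by auto
  have cA: "c i \<in> carrier A" if "i < n" for i using c(1)[OF that] by (rule CA)
  define M where "M = mat n n (\<lambda>(i, r). (\<sigma> ^^ r) (c i))"
  define \<delta> where "\<delta> = determinant L n M"
  have MM: "M \<in> carrier (matrix_ring L n)" using c powC by (simp add: matrix_ring_carrier M_def)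
  have Me: "M $$ (i, r) = (\<sigma> ^^ r) (c i)" if "i < n" "r < n" for i r using that by (simp add: M_def)
  obtain N where N: "N \<in> carrier (matrix_ring L n)"
    "M \<otimes>\<^bsub>matrix_ring L n\<^esub> N = scalar_matrix L n \<delta>" "N \<otimes>\<^bsub>matrix_ring L n\<^esub> M = scalar_matrix L n \<delta>"
    using L.adjugate_exists[OF MM] unfolding \<delta>_def by blast
  have NC: "N $$ (r, k) \<in> C" if "r < n" "k < n" for r k using N(1) that by (simp add: matrix_ring_carrier)
  have NA: "N $$ (r, k) \<in> carrier A" if "r < n" "k < n" for r k using NC[OF that] by (rule CA)
  have \<delta>: "\<delta> \<in> C" "\<delta> \<noteq> \<zero>\<^bsub>A\<^esub>"
    using L.determinant_closed[OF MM] c(2) by (simp_all add: \<delta>_def M_def)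
  have \<delta>A: "\<delta> \<in> carrier A" using \<delta>(1) by (rule CA)
  define \<epsilon> where "\<epsilon> = inv\<^bsub>A\<^esub> \<delta>"
  have \<epsilon>: "\<epsilon> \<in> C" "\<epsilon> \<in> carrier A" "\<delta> \<otimes>\<^bsub>A\<^esub> \<epsilon> = \<one>\<^bsub>A\<^esub>"
    using subfield_m_inv[OF C, of \<delta>] \<delta> CA by (auto simp: \<epsilon>_def)
  have MN: "(\<Oplus>\<^bsub>A\<^esub>r\<in>{..<n}. (\<sigma> ^^ r) (c i) \<otimes>\<^bsub>A\<^esub> N $$ (r, k)) = (if i = k then \<delta> else \<zero>\<^bsub>A\<^esub>)"
    if ik: "i < n" "k < n" for i k
  proof -
    have "(\<Oplus>\<^bsub>A\<^esub>r\<in>{..<n}. (\<sigma> ^^ r) (c i) \<otimes>\<^bsub>A\<^esub> N $$ (r, k)) = (\<Oplus>\<^bsub>L\<^esub>r\<in>{..<n}. (\<sigma> ^^ r) (c i) \<otimes>\<^bsub>A\<^esub> N $$ (r, k))"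
      unfolding L_def using c powC NC ik subringE(6)[OF Csub] by (intro finsum_subring(1)[OF Csub, symmetric]) auto
    also have "\<dots> = (\<Oplus>\<^bsub>L\<^esub>r\<in>{..<n}. M $$ (i, r) \<otimes>\<^bsub>L\<^esub> N $$ (r, k))"
      using c powC NC ik subringE(6)[OF Csub] by (intro L.finsum_cong') (auto simp: Me Lm)
    also have "\<dots> = (M \<otimes>\<^bsub>matrix_ring L n\<^esub> N) $$ (i, k)" using ik by (simp add: matrix_ring_mult_entry)
    also have "\<dots> = (if i = k then \<delta> else \<zero>\<^bsub>A\<^esub>)" using ik by (simp add: N(2) scalar_matrix_entry Lz)
    finally show ?thesis .
  qed
  have NM: "(\<Oplus>\<^bsub>A\<^esub>k\<in>{..<n}. N $$ (r, k) \<otimes>\<^bsub>A\<^esub> (\<sigma> ^^ s) (c k)) = (if r = s then \<delta> else \<zero>\<^bsub>A\<^esub>)"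
    if rs: "r < n" "s < n" for r s
  proof -
    have "(\<Oplus>\<^bsub>A\<^esub>k\<in>{..<n}. N $$ (r, k) \<otimes>\<^bsub>A\<^esub> (\<sigma> ^^ s) (c k)) = (\<Oplus>\<^bsub>L\<^esub>k\<in>{..<n}. N $$ (r, k) \<otimes>\<^bsub>A\<^esub> (\<sigma> ^^ s) (c k))"
      unfolding L_def using c powC NC rs subringE(6)[OF Csub] by (intro finsum_subring(1)[OF Csub, symmetric]) auto
    also have "\<dots> = (\<Oplus>\<^bsub>L\<^esub>k\<in>{..<n}. N $$ (r, k) \<otimes>\<^bsub>L\<^esub> M $$ (k, s))"
      using c powC NC rs subringE(6)[OF Csub] by (intro L.finsum_cong') (auto simp: Me Lm)
    also have "\<dots> = (N \<otimes>\<^bsub>matrix_ring L n\<^esub> M) $$ (r, s)" using rs by (simp add: matrix_ring_mult_entry)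
    also have "\<dots> = (if r = s then \<delta> else \<zero>\<^bsub>A\<^esub>)" using rs by (simp add: N(3) scalar_matrix_entry Lz)
    finally show ?thesis .
  qed
  \<comment> \<open>The \<open>n\<close> relations are multiplied by the entries of column
    \<open>k\<close> of the adjugate and added, which isolates \<open>e k\<close> times
    \<open>\<delta>\<close>. The \<open>e i\<close> range over \<open>A\<close> and not just over
    \<open>C\<close>, as the separation of tensors in \<open>K_basis\<close> requires.\<close>
  have sep: "e k = \<zero>\<^bsub>A\<^esub>"
    if e: "\<And>i. i < n \<Longrightarrow> e i \<in> carrier A"
      and z: "\<And>r. r < n \<Longrightarrow> (\<Oplus>\<^bsub>A\<^esub>i\<in>{..<n}. e i \<otimes>\<^bsub>A\<^esub> (\<sigma> ^^ r) (c i)) = \<zero>\<^bsub>A\<^esub>" and k: "k < n" for e k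
  proof -
    have "e k \<otimes>\<^bsub>A\<^esub> \<delta> = (\<Oplus>\<^bsub>A\<^esub>i\<in>{..<n}. if k = i then e i \<otimes>\<^bsub>A\<^esub> \<delta> else \<zero>\<^bsub>A\<^esub>)"
      using e k \<delta>A by (intro add.finprod_singleton[symmetric]) auto
    also have "\<dots> = (\<Oplus>\<^bsub>A\<^esub>i\<in>{..<n}. \<Oplus>\<^bsub>A\<^esub>r\<in>{..<n}. e i \<otimes>\<^bsub>A\<^esub> (\<sigma> ^^ r) (c i) \<otimes>\<^bsub>A\<^esub> N $$ (r, k))"
    proof (rule finsum_cong')
      fix i assume "i \<in> {..<n}"
      then have i: "i < n" by simp
      have "(\<Oplus>\<^bsub>A\<^esub>r\<in>{..<n}. e i \<otimes>\<^bsub>A\<^esub> (\<sigma> ^^ r) (c i) \<otimes>\<^bsub>A\<^esub> N $$ (r, k)) =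
          (\<Oplus>\<^bsub>A\<^esub>r\<in>{..<n}. e i \<otimes>\<^bsub>A\<^esub> ((\<sigma> ^^ r) (c i) \<otimes>\<^bsub>A\<^esub> N $$ (r, k)))"
        using e i k cA NA by (intro finsum_cong') (auto simp: m_assoc)
      also have "\<dots> = e i \<otimes>\<^bsub>A\<^esub> (\<Oplus>\<^bsub>A\<^esub>r\<in>{..<n}. (\<sigma> ^^ r) (c i) \<otimes>\<^bsub>A\<^esub> N $$ (r, k))"
        using e i k cA NA by (intro finsum_rdistr[symmetric]) auto
      also have "\<dots> = (if k = i then e i \<otimes>\<^bsub>A\<^esub> \<delta> else \<zero>\<^bsub>A\<^esub>)"
        using MN[OF i k] e[OF i] by auto
      finally show "(if k = i then e i \<otimes>\<^bsub>A\<^esub> \<delta> else \<zero>\<^bsub>A\<^esub>) =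
         (\<Oplus>\<^bsub>A\<^esub>r\<in>{..<n}. e i \<otimes>\<^bsub>A\<^esub> (\<sigma> ^^ r) (c i) \<otimes>\<^bsub>A\<^esub> N $$ (r, k))" ..
    qed (use e cA NA k in \<open>auto intro!: finsum_closed m_closed\<close>)
    also have "\<dots> = (\<Oplus>\<^bsub>A\<^esub>r\<in>{..<n}. \<Oplus>\<^bsub>A\<^esub>i\<in>{..<n}. e i \<otimes>\<^bsub>A\<^esub> (\<sigma> ^^ r) (c i) \<otimes>\<^bsub>A\<^esub> N $$ (r, k))"
      using e cA NA k by (intro finsum_swap) auto
    also have "\<dots> = (\<Oplus>\<^bsub>A\<^esub>r\<in>{..<n}. \<zero>\<^bsub>A\<^esub>)"
    proof (rule finsum_cong')
      fix r assume "r \<in> {..<n}"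
      then have r: "r < n" by simp
      have "(\<Oplus>\<^bsub>A\<^esub>i\<in>{..<n}. e i \<otimes>\<^bsub>A\<^esub> (\<sigma> ^^ r) (c i) \<otimes>\<^bsub>A\<^esub> N $$ (r, k)) =
        (\<Oplus>\<^bsub>A\<^esub>i\<in>{..<n}. e i \<otimes>\<^bsub>A\<^esub> (\<sigma> ^^ r) (c i)) \<otimes>\<^bsub>A\<^esub> N $$ (r, k)"
        using e cA NA r k by (intro finsum_ldistr[symmetric]) auto
      then show "(\<Oplus>\<^bsub>A\<^esub>i\<in>{..<n}. e i \<otimes>\<^bsub>A\<^esub> (\<sigma> ^^ r) (c i) \<otimes>\<^bsub>A\<^esub> N $$ (r, k)) = \<zero>\<^bsub>A\<^esub>"
        using z[OF r] NA[OF r k] by simp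
    qed auto
    finally have "e k \<otimes>\<^bsub>A\<^esub> \<delta> = \<zero>\<^bsub>A\<^esub>" by simp
    then have "e k \<otimes>\<^bsub>A\<^esub> (\<delta> \<otimes>\<^bsub>A\<^esub> \<epsilon>) = \<zero>\<^bsub>A\<^esub>"
      using e[OF k] \<delta>A \<epsilon>(2) by (simp flip: m_assoc)
    then show ?thesis using \<epsilon>(3) e[OF k] by simp
  qed
  have span: "\<exists>f. (\<forall>i<n. f i \<in> C \<inter> Fix A \<sigma>) \<and> z = (\<Oplus>\<^bsub>A\<^esub>i\<in>{..<n}. f i \<otimes>\<^bsub>A\<^esub> c i)" if z: "z \<in> C" for z
  proof -
    have zA: "z \<in> carrier A" using z by (rule CA)
    \<comment> \<open>Cramer's rule for the system whose equation number \<open>s\<close> demands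
      that the products of \<open>f k\<close> and \<open>\<sigma>^s(c k)\<close> add up to
      \<open>\<sigma>^s(z)\<close>.\<close>
    define f where "f k = (\<Oplus>\<^bsub>A\<^esub>r\<in>{..<n}. (\<sigma> ^^ r) z \<otimes>\<^bsub>A\<^esub> \<epsilon> \<otimes>\<^bsub>A\<^esub> N $$ (r, k))" for k
    have fC: "f k \<in> C" if "k < n" for k
      unfolding f_def using powC[OF z] \<epsilon>(1) NC that subringE(6)[OF Csub]
      by (intro finsum_subring(2)[OF Csub]) auto
    have fA: "f k \<in> carrier A" if "k < n" for k using fC[OF that] by (rule CA)
    have conj: "(\<Oplus>\<^bsub>A\<^esub>k\<in>{..<n}. f k \<otimes>\<^bsub>A\<^esub> (\<sigma> ^^ s) (c k)) = (\<sigma> ^^ s) z" if s: "s < n" for s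
    proof -
      have "(\<Oplus>\<^bsub>A\<^esub>k\<in>{..<n}. f k \<otimes>\<^bsub>A\<^esub> (\<sigma> ^^ s) (c k)) =
        (\<Oplus>\<^bsub>A\<^esub>k\<in>{..<n}. \<Oplus>\<^bsub>A\<^esub>r\<in>{..<n}. (\<sigma> ^^ r) z \<otimes>\<^bsub>A\<^esub> \<epsilon> \<otimes>\<^bsub>A\<^esub> N $$ (r, k) \<otimes>\<^bsub>A\<^esub> (\<sigma> ^^ s) (c k))"
        unfolding f_def using zA \<epsilon>(2) NA cA
        by (intro finsum_cong' finsum_ldistr) (auto intro!: finsum_closed m_closed)
      also have "\<dots> = (\<Oplus>\<^bsub>A\<^esub>r\<in>{..<n}. \<Oplus>\<^bsub>A\<^esub>k\<in>{..<n}. (\<sigma> ^^ r) z \<otimes>\<^bsub>A\<^esub> \<epsilon> \<otimes>\<^bsub>A\<^esub> N $$ (r, k) \<otimes>\<^bsub>A\<^esub> (\<sigma> ^^ s) (c k))"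
        using zA \<epsilon>(2) NA cA by (intro finsum_swap) auto
      also have "\<dots> = (\<Oplus>\<^bsub>A\<^esub>r\<in>{..<n}. if s = r then (\<sigma> ^^ r) z else \<zero>\<^bsub>A\<^esub>)"
      proof (rule finsum_cong')
        fix r assume "r \<in> {..<n}"
        then have r: "r < n" by simp
        have "(\<Oplus>\<^bsub>A\<^esub>k\<in>{..<n}. (\<sigma> ^^ r) z \<otimes>\<^bsub>A\<^esub> \<epsilon> \<otimes>\<^bsub>A\<^esub> N $$ (r, k) \<otimes>\<^bsub>A\<^esub> (\<sigma> ^^ s) (c k)) =
          (\<Oplus>\<^bsub>A\<^esub>k\<in>{..<n}. (\<sigma> ^^ r) z \<otimes>\<^bsub>A\<^esub> \<epsilon> \<otimes>\<^bsub>A\<^esub> (N $$ (r, k) \<otimes>\<^bsub>A\<^esub> (\<sigma> ^^ s) (c k)))"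
          using zA \<epsilon>(2) NA cA r by (intro finsum_cong') (auto simp: m_assoc)
        also have "\<dots> = (\<sigma> ^^ r) z \<otimes>\<^bsub>A\<^esub> \<epsilon> \<otimes>\<^bsub>A\<^esub> (\<Oplus>\<^bsub>A\<^esub>k\<in>{..<n}. N $$ (r, k) \<otimes>\<^bsub>A\<^esub> (\<sigma> ^^ s) (c k))"
          using zA \<epsilon>(2) NA cA r by (intro finsum_rdistr[symmetric]) auto
        also have "\<dots> = (if s = r then (\<sigma> ^^ r) z else \<zero>\<^bsub>A\<^esub>)"
        proof -
          have "(\<sigma> ^^ r) z \<otimes>\<^bsub>A\<^esub> \<epsilon> \<otimes>\<^bsub>A\<^esub> \<delta> = (\<sigma> ^^ r) z"
            using zA \<epsilon> \<delta>A central[OF \<delta>(1) \<epsilon>(2)] by (simp add: m_assoc)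
          then show ?thesis using NM[OF r s] zA \<epsilon>(2) by auto
        qed
        finally show "(\<Oplus>\<^bsub>A\<^esub>k\<in>{..<n}. (\<sigma> ^^ r) z \<otimes>\<^bsub>A\<^esub> \<epsilon> \<otimes>\<^bsub>A\<^esub> N $$ (r, k) \<otimes>\<^bsub>A\<^esub> (\<sigma> ^^ s) (c k)) =
          (if s = r then (\<sigma> ^^ r) z else \<zero>\<^bsub>A\<^esub>)" .
      qed (use zA in auto)
      also have "\<dots> = (\<sigma> ^^ s) z" using s zA by (intro add.finprod_singleton) auto
      finally show ?thesis .
    qed
    \<comment> \<open>Applying \<open>\<sigma>\<close> permutes the equations cyclically, so the
      \<open>\<sigma> (f k)\<close> solve the same system. Uniqueness of the solution then makes the
      \<open>f k\<close> fixed.\<close>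
    have \<sigma>conj: "(\<Oplus>\<^bsub>A\<^esub>k\<in>{..<n}. \<sigma> (f k) \<otimes>\<^bsub>A\<^esub> (\<sigma> ^^ s) (c k)) = (\<sigma> ^^ s) z" if s: "s < n" for s
    proof -
      \<comment> \<open>The predecessor of \<open>s\<close> modulo \<open>n\<close>; wrapping around
        is correct because \<open>\<sigma>^n\<close> is the identity on \<open>C\<close>.\<close>
      define r where "r = (if s = 0 then n - 1 else s - 1)"
      have r: "r < n" "\<And>y. y \<in> C \<Longrightarrow> (\<sigma> ^^ Suc r) y = (\<sigma> ^^ s) y"
        using s least(1,2) by (auto simp: r_def simp del: funpow.simps)
      have "\<sigma> (\<Oplus>\<^bsub>A\<^esub>k\<in>{..<n}. f k \<otimes>\<^bsub>A\<^esub> (\<sigma> ^^ r) (c k)) = (\<Oplus>\<^bsub>A\<^esub>k\<in>{..<n}. \<sigma> (f k \<otimes>\<^bsub>A\<^esub> (\<sigma> ^^ r) (c k)))"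
        using fA cA by (intro ring_hom_finsum[OF A A hom(1)]) auto
      also have "\<dots> = (\<Oplus>\<^bsub>A\<^esub>k\<in>{..<n}. \<sigma> (f k) \<otimes>\<^bsub>A\<^esub> (\<sigma> ^^ s) (c k))"
        using fA cA r(2)[OF c(1)] ring_hom_closed[OF hom(1)]
        by (intro finsum_cong') (auto simp: ring_hom_mult[OF hom(1)])
      finally show ?thesis using conj[OF r(1)] r(2)[OF z] by simp
    qed
    have "\<sigma> (f k) = f k" if k: "k < n" for k
    proof -
      let ?e = "\<lambda>k. \<sigma> (f k) \<ominus>\<^bsub>A\<^esub> f k"
      have \<sigma>f: "\<sigma> (f k) \<in> carrier A" if "k < n" for k using fA[OF that] ring_hom_closed[OF hom(1)] by blast
      have "(\<Oplus>\<^bsub>A\<^esub>k\<in>{..<n}. ?e k \<otimes>\<^bsub>A\<^esub> (\<sigma> ^^ s) (c k)) = \<zero>\<^bsub>A\<^esub>" if s: "s < n" for s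
      proof -
        have "(\<Oplus>\<^bsub>A\<^esub>k\<in>{..<n}. ?e k \<otimes>\<^bsub>A\<^esub> (\<sigma> ^^ s) (c k)) \<oplus>\<^bsub>A\<^esub> (\<Oplus>\<^bsub>A\<^esub>k\<in>{..<n}. f k \<otimes>\<^bsub>A\<^esub> (\<sigma> ^^ s) (c k)) =
          (\<Oplus>\<^bsub>A\<^esub>k\<in>{..<n}. ?e k \<otimes>\<^bsub>A\<^esub> (\<sigma> ^^ s) (c k) \<oplus>\<^bsub>A\<^esub> f k \<otimes>\<^bsub>A\<^esub> (\<sigma> ^^ s) (c k))"
          using fA \<sigma>f cA by (intro finsum_addf[symmetric]) auto
        also have "\<dots> = (\<Oplus>\<^bsub>A\<^esub>k\<in>{..<n}. \<sigma> (f k) \<otimes>\<^bsub>A\<^esub> (\<sigma> ^^ s) (c k))"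
          using fA \<sigma>f cA by (intro finsum_cong') (auto simp: a_minus_def a_assoc l_neg simp flip: l_distr)
        finally have "(\<Oplus>\<^bsub>A\<^esub>k\<in>{..<n}. ?e k \<otimes>\<^bsub>A\<^esub> (\<sigma> ^^ s) (c k)) \<oplus>\<^bsub>A\<^esub> (\<sigma> ^^ s) z = (\<sigma> ^^ s) z"
          using conj[OF s] \<sigma>conj[OF s] by simp
        moreover have "(\<Oplus>\<^bsub>A\<^esub>k\<in>{..<n}. ?e k \<otimes>\<^bsub>A\<^esub> (\<sigma> ^^ s) (c k)) \<in> carrier A"
          using fA \<sigma>f cA by (intro finsum_closed) auto
        ultimately show ?thesis using zA by simp
      qed
      then have "?e k = \<zero>\<^bsub>A\<^esub>" using sep[of ?e k] fA \<sigma>f k by auto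
      then show ?thesis using fA[OF k] \<sigma>f[OF k] by simp
    qed
    then have "f k \<in> C \<inter> Fix A \<sigma>" if "k < n" for k
      using fC[OF that] fA[OF that] that by (simp add: Fix_def)
    moreover have "z = (\<Oplus>\<^bsub>A\<^esub>k\<in>{..<n}. f k \<otimes>\<^bsub>A\<^esub> c k)" using conj[OF least(1)] by simp
    ultimately show ?thesis by blast
  qed
  show ?thesis
  proof (rule that[of c])
    fix e k assume "\<And>i. i < n \<Longrightarrow> e i \<in> carrier A"
      "\<And>r. r < n \<Longrightarrow> (\<Oplus>\<^bsub>A\<^esub>i\<in>{..<n}. e i \<otimes>\<^bsub>A\<^esub> (\<sigma> ^^ r) (c i)) = \<zero>\<^bsub>A\<^esub>" "k < n"
    then show "e k = \<zero>\<^bsub>A\<^esub>" by (intro sep[of e k])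
  qed (use c(1) span in auto)
qed

section \<open>Dimension over subfields and finite-dimensional domains\<close>

lemma (in ring) dimension_left_basis:
  assumes K: "subfield K R" and dim: "dimension n K (carrier R)"
  obtains v where "left_basis R K v n"
proof -
  obtain Vs where Vs: "set Vs \<subseteq> carrier R" "independent K Vs" "length Vs = n" "Span K Vs = carrier R"
    using exists_base[OF K dim] by blast
  then have "ring_basis R K Vs" by (simp add: ring_basis_def)
  then show ?thesis using that ring_basis_iff_left_basis[OF K Vs(3)] by blast
qed

text \<open>A list that spans over \<open>C\<close> spans over \<open>E\<close> as well, so some
  finite dimension over \<open>E\<close> exists; the tower law determines it after cancelling
  \<open>d\<close>.\<close>

lemma (in ring) dimension_over_intermediate:
  assumes C: "subfield C R" and E: "subfield E R" "C \<subseteq> E"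
    and dim: "dimension d C E" "dimension (d * e) C (carrier R)" and d: "0 < d"
  shows "dimension e E (carrier R)"
proof -
  obtain Vs where Vs: "set Vs \<subseteq> carrier R" "Span C Vs = carrier R"
    using exists_base[OF C dim(2)] by blast
  have "Span E Vs = carrier R"
  proof
    show "Span E Vs \<subseteq> carrier R" using Span_in_carrier[OF subfieldE(3)[OF E(1)] Vs(1)] .
    show "carrier R \<subseteq> Span E Vs"
      using Vs(2) Span_mem_iff_length_version[OF C Vs(1)] Span_mem_iff_length_version[OF E(1) Vs(1)] E(2)
      by blast
  qed
  then obtain Ws where Ws: "independent E Ws" "Span E Ws = carrier R"
    using filter_base[OF E(1) Vs(1)] by metis
  have e': "dimension (length Ws) E (carrier R)"
    using dimension_independent[OF Ws(1)] unfolding Ws(2) .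
  have "d * length Ws = d * e"
    using dimension_is_inj[OF C telescopic_base[OF C E(1) dim(1) e'] dim(2)] .
  then show ?thesis using e' d by simp
qed

text \<open>Multiplication by a nonzero element is injective, hence surjective in finite dimension.\<close>

lemma (in ring) finite_dimensional_subring_is_subfield:
  assumes K: "subfield K R" and fin: "finite_dimension K (carrier R)"
    and L: "subring L R" and KL: "K \<subseteq> L"
    and comm: "\<And>x y. x \<in> L \<Longrightarrow> y \<in> L \<Longrightarrow> x \<otimes> y = y \<otimes> x"
    and regular: "\<And>x y. x \<in> L \<Longrightarrow> x \<noteq> \<zero> \<Longrightarrow> y \<in> L \<Longrightarrow> x \<otimes> y = \<zero> \<Longrightarrow> y = \<zero>"
  shows "subfield L R"
proof (rule subfieldI)
  have LR: "x \<in> L \<Longrightarrow> x \<in> carrier R" for x using subringE(1)[OF L] by blast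
  show "subcring L R" using L comm by (rule subcringI)
  have "subalgebra K L R"
    unfolding subalgebra_def subalgebra_axioms_def
    using subring.axioms(1)[OF L] KL subringE(6)[OF L] by blast
  then have "finite_dimension K L"
    using subalbegra_incl_imp_finite_dimension[OF K fin _ subringE(1)[OF L]] by blast
  then obtain N where N: "dimension N K L" by (auto simp: finite_dimension_def)
  obtain Us where Us: "set Us \<subseteq> carrier R" "independent K Us" "length Us = N" "Span K Us = L"
    using exists_base[OF K N] by blast
  have UsL: "set Us \<subseteq> L" using Span_base_incl[OF K Us(1)] Us(4) by simp
  have ne: "\<one> \<noteq> \<zero>" by (rule subfieldE(6)[OF K])
  have inverse: "\<exists>y\<in>L. x \<otimes> y = \<one>" if x: "x \<in> L" "x \<noteq> \<zero>" for x
  proof -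
    have xR: "x \<in> carrier R" using x LR by blast
    \<comment> \<open>\<open>x\<close> passes the coefficients because both lie in the commutative
      ring \<open>L\<close>.\<close>
    have comb: "combine Ks (map ((\<otimes>) x) Vs) = x \<otimes> combine Ks Vs" if "set Ks \<subseteq> K" "set Vs \<subseteq> L" for Ks Vs
      using that
    proof (induction Ks Vs rule: combine.induct)
      case (1 k Ks u Us)
      have c: "k \<in> L" "u \<in> L" "k \<in> carrier R" "u \<in> carrier R" using 1 KL LR by auto
      have "set Ks \<subseteq> carrier R" "set Us \<subseteq> carrier R" using 1 KL LR by auto
      then have t: "combine Ks Us \<in> carrier R" by simp
      have "k \<otimes> (x \<otimes> u) = x \<otimes> (k \<otimes> u)"
        using comm[OF c(1) x(1)] c xR by (simp flip: m_assoc)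
      then show ?case using 1 c xR t by (simp add: r_distr)
    qed (use xR in auto)
    have ind: "independent K (map ((\<otimes>) x) Us)"
    proof (rule trivial_combine_imp_independent[OF K])
      show "set (map ((\<otimes>) x) Us) \<subseteq> carrier R" using xR Us(1) by auto
      fix Ks assume Ks: "set Ks \<subseteq> K" "combine Ks (map ((\<otimes>) x) Us) = \<zero>"
      have "combine (take (length Us) Ks) Us = combine Ks Us" by (rule combine_take)
      moreover have "combine Ks Us \<in> L"
      proof -
        define Ks' where "Ks' = take (length Us) Ks @ replicate (length Us - length Ks) \<zero>"
        have "combine Ks' Us = combine (take (length Us) Ks) Us"
          unfolding Ks'_def by (rule combine_append_replicate[OF Us(1)])
        moreover have "set Ks' \<subseteq> K" "length Ks' = length Us"
          using Ks subringE(2)[OF subfieldE(1)[OF K]] by (auto simp: Ks'_def dest: in_set_takeD)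
        ultimately show ?thesis
          using Span_mem_iff_length_version[OF K Us(1), of "combine Ks Us"] Us(4) combine_take[of Us Ks] by metis
      qed
      ultimately have "combine Ks Us = \<zero>" using regular[OF x] comb[OF Ks(1) UsL] Ks(2) by simp
      then show "set (take (length (map ((\<otimes>) x) Us)) Ks) \<subseteq> {\<zero>}"
        using independent_imp_trivial_combine[OF K Us(2) Ks(1)] by simp
    qed
    have "set (map ((\<otimes>) x) Us) \<subseteq> L" using x UsL subringE(6)[OF L] by auto
    then have "Span K (map ((\<otimes>) x) Us) = L"
      using independent_length_eq_dimension[OF K N ind] Us(3) by simp
    then have one: "\<one> \<in> Span K (map ((\<otimes>) x) Us)" using subringE(3)[OF L] by simp
    have "set (map ((\<otimes>) x) Us) \<subseteq> carrier R" using xR Us(1) by auto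
    from Span_mem_iff_length_version[OF K this, THEN iffD1, OF one]
    obtain Ks where Ks: "set Ks \<subseteq> K" "length Ks = length Us" "\<one> = combine Ks (map ((\<otimes>) x) Us)"
      by (auto simp del: Span.simps)
    have "combine Ks Us \<in> L"
      using Span_mem_iff_length_version[OF K Us(1)] Us(4) Ks by blast
    then show ?thesis using comb[OF Ks(1) UsL] Ks(3) by auto
  qed
  show "Units (R\<lparr>carrier := L\<rparr>) = L - {\<zero>}"
  proof
    show "Units (R\<lparr>carrier := L\<rparr>) \<subseteq> L - {\<zero>}"
    proof
      fix x assume "x \<in> Units (R\<lparr>carrier := L\<rparr>)"
      then obtain y where xy: "x \<in> L" "y \<in> L" "x \<otimes> y = \<one>" by (auto simp: Units_def)
      then have "x \<noteq> \<zero>" using ne LR by auto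
      then show "x \<in> L - {\<zero>}" using xy by simp
    qed
    show "L - {\<zero>} \<subseteq> Units (R\<lparr>carrier := L\<rparr>)"
    proof
      fix x assume x: "x \<in> L - {\<zero>}"
      then obtain y where y: "y \<in> L" "x \<otimes> y = \<one>" using inverse by auto
      moreover have "y \<otimes> x = \<one>" using x y comm by auto
      ultimately show "x \<in> Units (R\<lparr>carrier := L\<rparr>)" using x unfolding Units_def by simp blast
    qed
  qed
qed

text \<open>A relation between the matrices says that \<open>y \<mapsto> \<Sum> l_k y b_k\<close>
  vanishes on the basis \<open>v\<close>. Commutativity of \<open>LC\<close> makes this map linear
  over \<open>LC\<close>, so it vanishes at every \<open>y\<close>.\<close>

lemma (in left_basis) row_rep_relation:
  assumes L: "cring L" and l: "\<And>k. k < N \<Longrightarrow> l k \<in> LC" and b: "\<And>k. k < N \<Longrightarrow> b k \<in> carrier B"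
    and rel: "(\<Oplus>\<^bsub>matrix_ring L m\<^esub>k\<in>{..<N}. scalar_matrix L m (l k) \<otimes>\<^bsub>matrix_ring L m\<^esub> row_rep (b k)) = \<zero>\<^bsub>matrix_ring L m\<^esub>"
    and y: "y \<in> carrier B"
  shows "(\<Oplus>k\<in>{..<N::nat}. l k \<otimes> (y \<otimes> b k)) = \<zero>"
proof -
  interpret L: cring L by fact
  interpret MM: ring "matrix_ring L m" by (rule L.matrix_ring_is_ring)
  have lB: "l k \<in> carrier B" if "k < N" for k using l[OF that] by (rule LC_closed)
  note \<phi>e = row_rep_entry[OF b]
  have \<phi>B: "row_rep (b k) $$ (i, j) \<in> carrier B" if "k < N" "i < m" "j < m" for k i j
    using \<phi>e[OF that] by (rule LC_closed)
  have comm: "s \<otimes> t = t \<otimes> s" if "s \<in> LC" "t \<in> LC" for s t using L.m_comm[of s t] that by simp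
  have entry: "(\<Oplus>k\<in>{..<N}. l k \<otimes> row_rep (b k) $$ (i, j)) = \<zero>" if ij: "i < m" "j < m" for i j
  proof -
    have "(\<Oplus>k\<in>{..<N}. l k \<otimes> row_rep (b k) $$ (i, j)) = (\<Oplus>\<^bsub>L\<^esub>k\<in>{..<N}. l k \<otimes> row_rep (b k) $$ (i, j))"
      using l \<phi>e ij subringE(6)[OF LC] by (intro finsum_subring(1)[OF LC, symmetric]) auto
    also have "\<dots> = (\<Oplus>\<^bsub>L\<^esub>k\<in>{..<N}. (scalar_matrix L m (l k) \<otimes>\<^bsub>matrix_ring L m\<^esub> row_rep (b k)) $$ (i, j))"
      using l ij \<phi>e subringE(6)[OF LC] row_rep_closed[OF b]
      by (intro L.finsum_cong') (auto simp: L.scalar_matrix_mult_entry)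
    also have "\<dots> = (\<Oplus>\<^bsub>matrix_ring L m\<^esub>k\<in>{..<N}. scalar_matrix L m (l k) \<otimes>\<^bsub>matrix_ring L m\<^esub> row_rep (b k)) $$ (i, j)"
      using l ij row_rep_closed[OF b] L.scalar_matrix_closed[of _ m]
      by (intro L.matrix_finsum_entry[symmetric]) auto
    also have "\<dots> = \<zero>" using ij by (simp add: rel matrix_ring_zero_entry)
    finally show ?thesis .
  qed
  have row: "(\<Oplus>k\<in>{..<N}. l k \<otimes> (v i \<otimes> b k)) = \<zero>" if i: "i < m" for i
  proof -
    have "(\<Oplus>k\<in>{..<N}. l k \<otimes> (v i \<otimes> b k)) = (\<Oplus>k\<in>{..<N}. \<Oplus>j\<in>{..<m}. l k \<otimes> row_rep (b k) $$ (i, j) \<otimes> v j)"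
    proof (rule finsum_cong')
      fix k assume "k \<in> {..<N}"
      then have k: "k < N" by simp
      have "l k \<otimes> (v i \<otimes> b k) = l k \<otimes> (\<Oplus>j\<in>{..<m}. row_rep (b k) $$ (i, j) \<otimes> v j)"
        using row_rep[OF b[OF k] i] by simp
      also have "\<dots> = (\<Oplus>j\<in>{..<m}. l k \<otimes> (row_rep (b k) $$ (i, j) \<otimes> v j))"
        using lB[OF k] \<phi>B[OF k i] v_closed by (intro finsum_rdistr) auto
      also have "\<dots> = (\<Oplus>j\<in>{..<m}. l k \<otimes> row_rep (b k) $$ (i, j) \<otimes> v j)"
        using lB[OF k] \<phi>B[OF k i] v_closed by (intro finsum_cong') (auto simp: m_assoc)
      finally show "l k \<otimes> (v i \<otimes> b k) = (\<Oplus>j\<in>{..<m}. l k \<otimes> row_rep (b k) $$ (i, j) \<otimes> v j)" .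
    qed (use lB \<phi>B v_closed i in \<open>auto intro!: finsum_closed m_closed\<close>)
    also have "\<dots> = (\<Oplus>j\<in>{..<m}. \<Oplus>k\<in>{..<N}. l k \<otimes> row_rep (b k) $$ (i, j) \<otimes> v j)"
      using lB \<phi>B v_closed i by (intro finsum_swap) auto
    also have "\<dots> = (\<Oplus>j\<in>{..<m}. \<zero>)"
    proof (rule finsum_cong')
      fix j assume "j \<in> {..<m}"
      then have j: "j < m" by simp
      have "(\<Oplus>k\<in>{..<N}. l k \<otimes> row_rep (b k) $$ (i, j) \<otimes> v j) = (\<Oplus>k\<in>{..<N}. l k \<otimes> row_rep (b k) $$ (i, j)) \<otimes> v j"
        using lB \<phi>B v_closed i j by (intro finsum_ldistr[symmetric]) auto
      then show "(\<Oplus>k\<in>{..<N}. l k \<otimes> row_rep (b k) $$ (i, j) \<otimes> v j) = \<zero>"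
        using entry[OF i j] v_closed[OF j] by simp
    qed auto
    finally show ?thesis by simp
  qed
  note c = coord(1)[OF y]
  have cB: "coord y i \<in> carrier B" if "i < m" for i using c[OF that] by (rule LC_closed)
  have "(\<Oplus>k\<in>{..<N}. l k \<otimes> (y \<otimes> b k)) = (\<Oplus>k\<in>{..<N}. \<Oplus>i\<in>{..<m}. coord y i \<otimes> (l k \<otimes> (v i \<otimes> b k)))"
  proof (rule finsum_cong')
    fix k assume "k \<in> {..<N}"
    then have k: "k < N" by simp
    have "l k \<otimes> (y \<otimes> b k) = l k \<otimes> ((\<Oplus>i\<in>{..<m}. coord y i \<otimes> v i) \<otimes> b k)"
      using coord(2)[OF y] by simp
    also have "(\<Oplus>i\<in>{..<m}. coord y i \<otimes> v i) \<otimes> b k = (\<Oplus>i\<in>{..<m}. coord y i \<otimes> v i \<otimes> b k)"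
      using cB v_closed b[OF k] by (intro finsum_ldistr) auto
    also have "l k \<otimes> \<dots> = (\<Oplus>i\<in>{..<m}. l k \<otimes> (coord y i \<otimes> v i \<otimes> b k))"
      using cB v_closed b[OF k] lB[OF k] by (intro finsum_rdistr) auto
    also have "\<dots> = (\<Oplus>i\<in>{..<m}. coord y i \<otimes> (l k \<otimes> (v i \<otimes> b k)))"
    proof (rule finsum_cong')
      fix i assume "i \<in> {..<m}"
      then have i: "i < m" by simp
      have "l k \<otimes> (coord y i \<otimes> v i \<otimes> b k) = (l k \<otimes> coord y i) \<otimes> (v i \<otimes> b k)"
        using cB[OF i] v_closed[OF i] b[OF k] lB[OF k] by (simp add: m_assoc)
      also have "l k \<otimes> coord y i = coord y i \<otimes> l k" by (rule comm[OF l[OF k] c[OF i]])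
      finally show "l k \<otimes> (coord y i \<otimes> v i \<otimes> b k) = coord y i \<otimes> (l k \<otimes> (v i \<otimes> b k))"
        using cB[OF i] v_closed[OF i] b[OF k] lB[OF k] by (simp add: m_assoc)
    qed (use cB v_closed b[OF k] lB[OF k] in auto)
    finally show "l k \<otimes> (y \<otimes> b k) = (\<Oplus>i\<in>{..<m}. coord y i \<otimes> (l k \<otimes> (v i \<otimes> b k)))" .
  qed (use cB v_closed b lB in \<open>auto intro!: finsum_closed m_closed\<close>)
  also have "\<dots> = (\<Oplus>i\<in>{..<m}. \<Oplus>k\<in>{..<N}. coord y i \<otimes> (l k \<otimes> (v i \<otimes> b k)))"
    using cB v_closed b lB by (intro finsum_swap) auto
  also have "\<dots> = (\<Oplus>i\<in>{..<m}. \<zero>)"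
  proof (rule finsum_cong')
    fix i assume "i \<in> {..<m}"
    then have i: "i < m" by simp
    have "(\<Oplus>k\<in>{..<N}. coord y i \<otimes> (l k \<otimes> (v i \<otimes> b k))) = coord y i \<otimes> (\<Oplus>k\<in>{..<N}. l k \<otimes> (v i \<otimes> b k))"
      using cB[OF i] v_closed[OF i] b lB by (intro finsum_rdistr[symmetric]) auto
    then show "(\<Oplus>k\<in>{..<N}. coord y i \<otimes> (l k \<otimes> (v i \<otimes> b k))) = \<zero>"
      using row[OF i] cB[OF i] by simp
  qed auto
  finally show ?thesis by simp
qed

section \<open>Central simple coefficients\<close>

locale skew_csa = skew_x A \<sigma> u n for A (structure) and \<sigma> and u and n +
  fixes C E :: "'a set" and d :: nat
  assumes csa: "central_simple_algebra A C d"
    and iso: "\<sigma> \<in> ring_iso A A"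
    and ord: "order_on C \<sigma> n"
    and E: "subfield E A" "C \<subseteq> E" "dimension d C E"
begin

definition F where "F = C \<inter> Fix A \<sigma>"

lemma simple: "simple_ring A"
  and center: "C = ring_center A"
  and C: "subfield C A"
  and dim: "dimension (d ^ 2) C (carrier A)"
  using csa unfolding central_simple_algebra_def by blast+

lemma one_neq_zero: "\<one> \<noteq> \<zero>"
  using simple by (simp add: simple_ring_def)

lemma C_central: "c \<in> C \<Longrightarrow> a \<in> carrier A \<Longrightarrow> c \<otimes> a = a \<otimes> c"
  unfolding center ring_center_def by blast

lemma C_iff: "c \<in> C \<longleftrightarrow> c \<in> carrier A \<and> (\<forall>a\<in>carrier A. c \<otimes> a = a \<otimes> c)"
  unfolding center ring_center_def by blast

lemma \<sigma>_bij: "bij_betw \<sigma> (carrier A) (carrier A)"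
  using iso by (auto simp: ring_iso_def)

lemma pow_bij: "bij_betw (\<sigma> ^^ r) (carrier A) (carrier A)"
  by (rule bij_betw_funpow[OF \<sigma>_bij])

lemma pow_inj: "(\<sigma> ^^ r) a = (\<sigma> ^^ r) b \<Longrightarrow> a \<in> carrier A \<Longrightarrow> b \<in> carrier A \<Longrightarrow> a = b"
  using pow_bij[of r] unfolding bij_betw_def by (blast dest: inj_onD)

lemma pow_surj: "a \<in> carrier A \<Longrightarrow> \<exists>b\<in>carrier A. a = (\<sigma> ^^ r) b"
  using pow_bij[of r] unfolding bij_betw_def by blast

lemma pow_center:
  assumes c: "c \<in> carrier A"
  shows "(\<sigma> ^^ r) c \<in> C \<longleftrightarrow> c \<in> C"
proof
  assume h: "(\<sigma> ^^ r) c \<in> C"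
  have "c \<otimes> a = a \<otimes> c" if a: "a \<in> carrier A" for a
  proof -
    have "(\<sigma> ^^ r) (c \<otimes> a) = (\<sigma> ^^ r) (a \<otimes> c)"
      using C_central[OF h, of "(\<sigma> ^^ r) a"] a c by (simp add: pow_mult)
    then show ?thesis by (rule pow_inj) (use a c in auto)
  qed
  then show "c \<in> C" using c by (simp add: C_iff)
next
  assume h: "c \<in> C"
  have "(\<sigma> ^^ r) c \<otimes> a = a \<otimes> (\<sigma> ^^ r) c" if a: "a \<in> carrier A" for a
  proof -
    obtain a' where a': "a' \<in> carrier A" "a = (\<sigma> ^^ r) a'" using pow_surj[OF a] by blast
    then show ?thesis using C_central[OF h a'(1)] c pow_mult[of c a' r] pow_mult[of a' c r] by simp
  qed
  then show "(\<sigma> ^^ r) c \<in> C" using c by (simp add: C_iff)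
qed

lemma C_closed: "c \<in> C \<Longrightarrow> c \<in> carrier A"
  by (simp add: C_iff)

lemma F_subring: "subring F A"
proof (rule subringI)
  note s = subringE[OF subfieldE(1)[OF C]]
  show "F \<subseteq> carrier A" using s(1) by (auto simp: F_def)
  show "\<one> \<in> F" using s(3) ring_hom_one[OF \<sigma>] by (simp add: F_def Fix_def)
  fix x assume "x \<in> F"
  then have x: "x \<in> C" "x \<in> carrier A" "\<sigma> x = x" by (auto simp: F_def Fix_def)
  show "\<ominus> x \<in> F" using x s(5) ring_hom_a_inv[OF ring_axioms ring_axioms \<sigma> x(2)] by (simp add: F_def Fix_def)
  fix y assume "y \<in> F"
  then have y: "y \<in> C" "y \<in> carrier A" "\<sigma> y = y" by (auto simp: F_def Fix_def)
  show "x \<otimes> y \<in> F" "x \<oplus> y \<in> F"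
    using x y s(6,7) ring_hom_mult[OF \<sigma> x(2) y(2)] ring_hom_add[OF \<sigma> x(2) y(2)] by (auto simp: F_def Fix_def)
qed

lemma E_subring: "subring E A" by (rule subfieldE(1)[OF E(1)])

lemma FE: "F \<subseteq> E" using E(2) by (auto simp: F_def)

lemma E_regular:
  assumes c: "c \<in> E" "c \<noteq> \<zero>" and a: "a \<in> carrier A" "c \<otimes> a = \<zero>"
  shows "a = \<zero>"
proof -
  have i: "inv c \<in> E" "inv c \<otimes> c = \<one>" using subfield_m_inv[OF E(1), of c] c by auto
  have cA: "c \<in> carrier A" "inv c \<in> carrier A" using c(1) i(1) subfieldE(3)[OF E(1)] by blast+
  have "inv c \<otimes> c \<otimes> a = inv c \<otimes> (c \<otimes> a)" using cA a(1) by (simp add: m_assoc)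
  then show ?thesis using i(2) a cA by simp
qed

lemma EX_regular:
  "e \<in> DX E \<Longrightarrow> e \<noteq> \<zero>\<^bsub>R\<^esub> \<Longrightarrow> r \<in> carrier R \<Longrightarrow> e \<otimes>\<^bsub>R\<^esub> r = \<zero>\<^bsub>R\<^esub> \<Longrightarrow> r = \<zero>\<^bsub>R\<^esub>"
  by (rule DX_regular[OF E_regular])

lemma FX_EX: "DX F \<subseteq> DX E" by (rule DX_mono[OF FE])

lemma FX_central: "p \<in> DX F \<Longrightarrow> f \<in> carrier R \<Longrightarrow> p \<otimes>\<^bsub>R\<^esub> f = f \<otimes>\<^bsub>R\<^esub> p"
  by (rule DX_central[OF F_subring]) (auto simp: F_def Fix_def intro: C_central)

text \<open>This turns centrality into membership in \<open>F[x]\<close>, both for the numerator of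
  a central element of \<open>E(x)\<close> and for the determinant of \<open>f\<close>.\<close>

lemma FX_iff:
  assumes e: "e \<in> DX E"
  shows "e \<in> DX F \<longleftrightarrow> (\<forall>f\<in>carrier R. e \<otimes>\<^bsub>R\<^esub> f = f \<otimes>\<^bsub>R\<^esub> e)"
proof
  assume "\<forall>f\<in>carrier R. e \<otimes>\<^bsub>R\<^esub> f = f \<otimes>\<^bsub>R\<^esub> e"
  then have "e \<in> DX {c \<in> E. (\<forall>a\<in>carrier A. c \<otimes> a = a \<otimes> c) \<and> \<sigma> c = c}"
    using DX_center[OF e _ E_subring] by blast
  moreover have "{c \<in> E. (\<forall>a\<in>carrier A. c \<otimes> a = a \<otimes> c) \<and> \<sigma> c = c} \<subseteq> F"
    using subfieldE(3)[OF E(1)] by (auto simp: F_def Fix_def C_iff)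
  ultimately show "e \<in> DX F" using DX_mono by blast
qed (use FX_central in blast)

section \<open>Localization at F[x] and the splitting over E(x)\<close>

sublocale loc: central_localization R "DX F"
proof (rule central_localization.intro[OF ring_R], rule central_localization_axioms.intro)
  show "subring (DX F) R" by (rule DX_subring[OF F_subring])
  show "z \<otimes>\<^bsub>R\<^esub> r = r \<otimes>\<^bsub>R\<^esub> z" if "z \<in> DX F" "r \<in> carrier R" for z r using FX_central that .
  show "r = \<zero>\<^bsub>R\<^esub>" if "z \<in> DX F" "z \<noteq> \<zero>\<^bsub>R\<^esub>" "r \<in> carrier R" "z \<otimes>\<^bsub>R\<^esub> r = \<zero>\<^bsub>R\<^esub>" for z r
    using EX_regular[of z r] that FX_EX by blast
  show "\<one>\<^bsub>R\<^esub> \<noteq> \<zero>\<^bsub>R\<^esub>" using one_neq_zero one_R[of 0] by (metis zero_R)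
qed

abbreviation "K \<equiv> loc.frac (DX F)"
abbreviation "EL \<equiv> loc.frac (DX E)"
abbreviation "LL \<equiv> loc.Q\<lparr>carrier := EL\<rparr>"

lemma EX_subring: "subring (DX E) R" by (rule DX_subring[OF E_subring])

lemma EX_comm: "p \<in> DX E \<Longrightarrow> q \<in> DX E \<Longrightarrow> p \<otimes>\<^bsub>R\<^esub> q = q \<otimes>\<^bsub>R\<^esub> p"
  by (rule DX_comm[OF E_subring subfieldE(4)[OF E(1)]])

lemma EL_subring: "subring EL loc.Q"
  by (rule loc.frac_subring[OF EX_subring FX_EX])

lemma d_pos: "0 < d"
proof (rule ccontr)
  assume "\<not> 0 < d"
  then have "dimension 0 C (carrier A)" using dim by simp
  then have "carrier A = {\<zero>}" by (rule dimension_zero[OF C])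
  then show False using one_neq_zero one_closed by blast
qed

lemma E_basis: obtains e where "left_basis A E e d"
proof -
  have "dimension d E (carrier A)"
    using dimension_over_intermediate[OF C E(1,2,3) _ d_pos] dim by (simp add: power2_eq_square)
  then show ?thesis using dimension_left_basis[OF E(1)] that by blast
qed

lemma R_basis:
  obtains v where "left_basis R (DX E) v (d * n)" "left_basis loc.Q EL (\<lambda>i. loc.emb (v i)) (d * n)"
proof -
  obtain e where "left_basis A E e d" by (rule E_basis)
  from R_left_basis[OF this] show ?thesis using that loc.frac_left_basis[OF _ FX_EX] by blast
qed

text \<open>
  The second property says that the maps \<open>v \<mapsto> a v \<sigma>^r(b)\<close>, for \<open>r < n\<close>, separate the
  elements of the tensor product of \<open>A\<close> with itself over \<open>F\<close>.
\<close>

lemma K_basis: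
  obtains w where "left_basis A F w (d ^ 2 * n)"
    "\<And>\<epsilon> k. (\<And>i. i < d ^ 2 * n \<Longrightarrow> \<epsilon> i \<in> carrier A) \<Longrightarrow>
      (\<And>v r. v \<in> carrier A \<Longrightarrow> r < n \<Longrightarrow> (\<Oplus>i\<in>{..<d ^ 2 * n}. \<epsilon> i \<otimes> v \<otimes> (\<sigma> ^^ r) (w i)) = \<zero>) \<Longrightarrow>
      k < d ^ 2 * n \<Longrightarrow> \<epsilon> k = \<zero>"
proof -
  obtain a where a: "left_basis A C a (d ^ 2)"
    using dimension_left_basis[OF C dim] .
  interpret a: left_basis A C a "d ^ 2" by fact
  have \<sigma>C: "\<sigma> c \<in> C" if "c \<in> C" for c using pow_center[of c 1] that C_closed by simp
  have inj: "inj_on \<sigma> (carrier A)" using \<sigma>_bij by (simp add: bij_betw_def)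
  obtain c where c: "\<And>i. i < n \<Longrightarrow> c i \<in> C"
    "\<And>z. z \<in> C \<Longrightarrow> \<exists>f. (\<forall>i<n. f i \<in> F) \<and> z = (\<Oplus>i\<in>{..<n}. f i \<otimes> c i)"
    "\<And>e k. (\<And>i. i < n \<Longrightarrow> e i \<in> carrier A) \<Longrightarrow>
       (\<And>r. r < n \<Longrightarrow> (\<Oplus>i\<in>{..<n}. e i \<otimes> (\<sigma> ^^ r) (c i)) = \<zero>) \<Longrightarrow> k < n \<Longrightarrow> e k = \<zero>"
    using galois_basis[OF ring_axioms C C_central \<sigma> inj \<sigma>C ord] unfolding F_def by blast
  have cA: "c i \<in> carrier A" if "i < n" for i using c(1)[OF that] by (rule C_closed)
  have FA: "f \<in> carrier A" "\<sigma> f = f" if "f \<in> F" for f using that by (auto simp: F_def Fix_def)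
  define w where "w k = c (k mod n) \<otimes> a (k div n)" for k
  have "left_basis A F w (d ^ 2 * n)"
    unfolding w_def
  proof (rule tower_left_basis[OF a F_subring _ c(1,2)])
    show "F \<subseteq> C" by (auto simp: F_def)
    fix f i assume f: "\<And>i. i < n \<Longrightarrow> f i \<in> F" and z: "(\<Oplus>i\<in>{..<n}. f i \<otimes> c i) = \<zero>" and i: "i < n"
    \<comment> \<open>A relation with coefficients in \<open>F\<close> may be conjugated:
      \<open>\<sigma>^r\<close> fixes the coefficients, so it gives the \<open>n\<close> relations
      which the matrix of conjugates separates.\<close>
    show "f i = \<zero>"
    proof (rule c(3)[OF _ _ i])
      show "f i \<in> carrier A" if "i < n" for i using FA(1)[OF f[OF that]] .
      fix r assume "r < n"
      have fr: "(\<sigma> ^^ r) (f i) = f i" if "i < n" for i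
        using FA(2)[OF f[OF that]] by (induction r) auto
      have "(\<Oplus>i\<in>{..<n}. f i \<otimes> (\<sigma> ^^ r) (c i)) = (\<Oplus>i\<in>{..<n}. (\<sigma> ^^ r) (f i \<otimes> c i))"
        using FA(1)[OF f] cA by (intro finsum_cong') (auto simp: pow_mult fr)
      also have "\<dots> = (\<sigma> ^^ r) (\<Oplus>i\<in>{..<n}. f i \<otimes> c i)"
        using FA(1)[OF f] cA by (intro ring_hom_finsum[OF ring_axioms ring_axioms pow_hom, symmetric]) auto
      finally show "(\<Oplus>i\<in>{..<n}. f i \<otimes> (\<sigma> ^^ r) (c i)) = \<zero>" using z by simp
    qed
  qed
  moreover have "\<epsilon> k = \<zero>"
    if \<epsilon>: "\<And>i. i < d ^ 2 * n \<Longrightarrow> \<epsilon> i \<in> carrier A"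
      and rel: "\<And>v r. v \<in> carrier A \<Longrightarrow> r < n \<Longrightarrow> (\<Oplus>i\<in>{..<d ^ 2 * n}. \<epsilon> i \<otimes> v \<otimes> (\<sigma> ^^ r) (w i)) = \<zero>"
      and k: "k < d ^ 2 * n" for \<epsilon> k
  proof -
    have lt: "i * n + j < d ^ 2 * n" if "i < d ^ 2" "j < n" for i j
    proof -
      have "i * n + j < Suc i * n" using that by simp
      also have "\<dots> \<le> d ^ 2 * n" using that by (intro mult_le_mono1) simp
      finally show ?thesis .
    qed
    have \<epsilon>': "\<epsilon> (i * n + j) \<in> carrier A" if "i < d ^ 2" "j < n" for i j using \<epsilon>[OF lt[OF that]] .
    have ki: "k div n < d ^ 2" "k mod n < n" using k n less_mult_imp_div_less by auto
    \<comment> \<open>The conjugates of the \<open>c j\<close> are central, so they pass through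
      \<open>v\<close> and gather with the \<open>\<epsilon>\<close> into a single coefficient in
      front of \<open>v\<close> for each \<open>a i\<close>.\<close>
    define p where "p r i = (\<Oplus>j\<in>{..<n}. \<epsilon> (i * n + j) \<otimes> (\<sigma> ^^ r) (c j))" for r i
    have pA: "p r i \<in> carrier A" if "i < d ^ 2" for r i
      unfolding p_def using \<epsilon>'[OF that] cA by (intro finsum_closed) auto
    have prel: "(\<Oplus>i\<in>{..<d ^ 2}. p r i \<otimes> v \<otimes> (\<sigma> ^^ r) (a i)) = \<zero>" if v: "v \<in> carrier A" and r: "r < n" for v r
    proof -
      have "(\<Oplus>i\<in>{..<d ^ 2}. p r i \<otimes> v \<otimes> (\<sigma> ^^ r) (a i)) =
        (\<Oplus>i\<in>{..<d ^ 2}. \<Oplus>j\<in>{..<n}. \<epsilon> (i * n + j) \<otimes> v \<otimes> (\<sigma> ^^ r) (c j \<otimes> a i))"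
      proof (rule finsum_cong')
        fix i assume "i \<in> {..<d ^ 2}"
        then have i: "i < d ^ 2" by simp
        have "p r i \<otimes> v \<otimes> (\<sigma> ^^ r) (a i) = p r i \<otimes> (v \<otimes> (\<sigma> ^^ r) (a i))"
          using pA[OF i] v a.v_closed[OF i] by (simp add: m_assoc)
        also have "\<dots> = (\<Oplus>j\<in>{..<n}. \<epsilon> (i * n + j) \<otimes> (\<sigma> ^^ r) (c j) \<otimes> (v \<otimes> (\<sigma> ^^ r) (a i)))"
          unfolding p_def using \<epsilon>'[OF i] cA v a.v_closed[OF i] by (intro finsum_ldistr) auto
        also have "\<dots> = (\<Oplus>j\<in>{..<n}. \<epsilon> (i * n + j) \<otimes> v \<otimes> (\<sigma> ^^ r) (c j \<otimes> a i))"
        proof (rule finsum_cong')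
          fix j assume "j \<in> {..<n}"
          then have j: "j < n" by simp
          have cc: "(\<sigma> ^^ r) (c j) \<in> C" using pow_center[OF cA[OF j]] c(1)[OF j] by simp
          have "\<epsilon> (i * n + j) \<otimes> (\<sigma> ^^ r) (c j) \<otimes> (v \<otimes> (\<sigma> ^^ r) (a i)) =
            \<epsilon> (i * n + j) \<otimes> ((\<sigma> ^^ r) (c j) \<otimes> v) \<otimes> (\<sigma> ^^ r) (a i)"
            using \<epsilon>'[OF i j] cA[OF j] v a.v_closed[OF i] by (simp add: m_assoc)
          also have "(\<sigma> ^^ r) (c j) \<otimes> v = v \<otimes> (\<sigma> ^^ r) (c j)" by (rule C_central[OF cc v])
          finally show "\<epsilon> (i * n + j) \<otimes> (\<sigma> ^^ r) (c j) \<otimes> (v \<otimes> (\<sigma> ^^ r) (a i)) =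
            \<epsilon> (i * n + j) \<otimes> v \<otimes> (\<sigma> ^^ r) (c j \<otimes> a i)"
            using \<epsilon>'[OF i j] cA[OF j] v a.v_closed[OF i] by (simp add: m_assoc pow_mult)
        qed (use \<epsilon>'[OF i] cA v a.v_closed[OF i] in auto)
        finally show "p r i \<otimes> v \<otimes> (\<sigma> ^^ r) (a i) = (\<Oplus>j\<in>{..<n}. \<epsilon> (i * n + j) \<otimes> v \<otimes> (\<sigma> ^^ r) (c j \<otimes> a i))" .
      qed (use \<epsilon>' cA v a.v_closed in \<open>auto intro!: finsum_closed m_closed\<close>)
      also have "\<dots> = (\<Oplus>k\<in>{..<d ^ 2 * n}. \<epsilon> (k div n * n + k mod n) \<otimes> v \<otimes> (\<sigma> ^^ r) (c (k mod n) \<otimes> a (k div n)))"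
        using \<epsilon>' cA v a.v_closed
        by (intro finsum_div_mod[where f = "\<lambda>i j. \<epsilon> (i * n + j) \<otimes> v \<otimes> (\<sigma> ^^ r) (c j \<otimes> a i)", symmetric]) auto
      also have "\<dots> = \<zero>" using rel[OF v r] by (simp add: w_def)
      finally show ?thesis .
    qed
    \<comment> \<open>Simplicity of \<open>A\<close> separates the \<open>a i\<close>, for each
      \<open>r\<close> on its own. The conjugates \<open>\<sigma>^r(a i)\<close> are again
      independent over the centre, because \<open>\<sigma>^r\<close> is an automorphism and maps
      \<open>C\<close> onto itself.\<close>
    have p0: "p r i = \<zero>" if r: "r < n" and i: "i < d ^ 2" for r i
    proof (rule simple_ring_multiplications_independent[OF simple, where N = "d ^ 2" and a = "\<lambda>i. (\<sigma> ^^ r) (a i)" and p = "p r"])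
      show "(\<sigma> ^^ r) (a i) \<in> carrier A" if "i < d ^ 2" for i using a.v_closed[OF that] by simp
      show "p r i \<in> carrier A" if "i < d ^ 2" for i using pA[OF that] .
      show "(\<Oplus>i\<in>{..<d ^ 2}. p r i \<otimes> v \<otimes> (\<sigma> ^^ r) (a i)) = \<zero>" if "v \<in> carrier A" for v using prel[OF that r] .
      fix \<gamma> i assume \<gamma>: "\<And>i. i < d ^ 2 \<Longrightarrow> \<gamma> i \<in> ring_center A"
        and z: "(\<Oplus>i\<in>{..<d ^ 2}. \<gamma> i \<otimes> (\<sigma> ^^ r) (a i)) = \<zero>" and i: "i < d ^ 2"
      have "\<forall>i. \<exists>g. i < d ^ 2 \<longrightarrow> g \<in> carrier A \<and> \<gamma> i = (\<sigma> ^^ r) g"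
        using \<gamma> pow_surj[of _ r] unfolding ring_center_def by blast
      then obtain g where g: "\<And>i. i < d ^ 2 \<Longrightarrow> g i \<in> carrier A \<and> \<gamma> i = (\<sigma> ^^ r) (g i)" by metis
      have gC: "g i \<in> C" if "i < d ^ 2" for i
        using g[OF that] \<gamma>[OF that] pow_center[of "g i" r] by (simp add: center)
      have "(\<sigma> ^^ r) (\<Oplus>i\<in>{..<d ^ 2}. g i \<otimes> a i) = (\<Oplus>i\<in>{..<d ^ 2}. (\<sigma> ^^ r) (g i \<otimes> a i))"
        using g a.v_closed by (intro ring_hom_finsum[OF ring_axioms ring_axioms pow_hom]) auto
      also have "\<dots> = (\<Oplus>i\<in>{..<d ^ 2}. \<gamma> i \<otimes> (\<sigma> ^^ r) (a i))"
        using g a.v_closed by (intro finsum_cong') (auto simp: pow_mult)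
      finally have "(\<sigma> ^^ r) (\<Oplus>i\<in>{..<d ^ 2}. g i \<otimes> a i) = (\<sigma> ^^ r) \<zero>" using z by simp
      moreover have "(\<Oplus>i\<in>{..<d ^ 2}. g i \<otimes> a i) \<in> carrier A"
        using g a.v_closed by (intro finsum_closed) auto
      ultimately have "(\<Oplus>i\<in>{..<d ^ 2}. g i \<otimes> a i) = \<zero>"
        using pow_inj[of r] by blast
      then have "g i = \<zero>" using a.indep[of g i] gC i by blast
      then show "\<gamma> i = \<zero>" using g[OF i] by simp
    qed (rule i)
    \<comment> \<open>For a fixed index \<open>k div n\<close> there remain \<open>n\<close>
      relations, one for each \<open>r\<close>, and the matrix of conjugates of the
      \<open>c j\<close> resolves them.\<close>
    have "\<epsilon> (k div n * n + k mod n) = \<zero>"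
    proof (rule c(3)[of "\<lambda>j. \<epsilon> (k div n * n + j)", OF _ _ ki(2)])
      show "\<epsilon> (k div n * n + j) \<in> carrier A" if "j < n" for j using \<epsilon>'[OF ki(1) that] .
      show "(\<Oplus>j\<in>{..<n}. \<epsilon> (k div n * n + j) \<otimes> (\<sigma> ^^ r) (c j)) = \<zero>" if "r < n" for r
        using p0[OF that ki(1)] by (simp add: p_def)
    qed
    then show ?thesis by simp
  qed
  ultimately show ?thesis by (rule that)
qed

text \<open>The quotient ring has finite dimension over \<open>F(x)\<close>, so its commutative
  subring \<open>E(x)\<close> is a field as soon as it has no zero divisors; these are excluded
  because nonzero elements of \<open>E[x]\<close> are regular in \<open>R\<close>.\<close>

lemma EL_subfield: "subfield EL loc.Q"
proof -
  obtain w where w: "left_basis A F w (d ^ 2 * n)" by (rule K_basis) (rule that)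
  have dim: "loc.Q.dimension (d ^ 2 * n * n) K (carrier loc.Q)"
    by (rule loc.Q.left_basis_dimension[OF loc.frac_Z_subfield loc.frac_left_basis[OF R_left_basis[OF w] subset_refl]])
  have EXR: "e \<in> DX E \<Longrightarrow> e \<in> carrier R" for e using subringE(1)[OF EX_subring] by blast
  show ?thesis
  proof (rule loc.Q.finite_dimensional_subring_is_subfield[OF loc.frac_Z_subfield loc.Q.finite_dimensionI[OF dim]
        EL_subring loc.frac_mono[OF FX_EX]])
    fix x y assume "x \<in> EL" "y \<in> EL"
    then obtain e g e' g' where xy: "e \<in> DX E" "g \<in> loc.Z'" "x = loc.qt e g"
      "e' \<in> DX E" "g' \<in> loc.Z'" "y = loc.qt e' g'" unfolding loc.frac_def by blast
    have m: "x \<otimes>\<^bsub>loc.Q\<^esub> y = loc.qt (e \<otimes>\<^bsub>R\<^esub> e') (g \<otimes>\<^bsub>R\<^esub> g')"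
      "y \<otimes>\<^bsub>loc.Q\<^esub> x = loc.qt (e' \<otimes>\<^bsub>R\<^esub> e) (g' \<otimes>\<^bsub>R\<^esub> g)"
      unfolding xy(3,6) using xy(1,2,4,5) EXR by (simp_all only: loc.Q_mult)
    show "x \<otimes>\<^bsub>loc.Q\<^esub> y = y \<otimes>\<^bsub>loc.Q\<^esub> x"
      unfolding m using EX_comm[OF xy(1,4)] loc.central[OF loc.Z'_Z[OF xy(2)], of g'] xy(5) by simp
    assume x: "x \<noteq> \<zero>\<^bsub>loc.Q\<^esub>" and z: "x \<otimes>\<^bsub>loc.Q\<^esub> y = \<zero>\<^bsub>loc.Q\<^esub>"
    have "e \<noteq> \<zero>\<^bsub>R\<^esub>" using x xy(1-3) loc.qt_zero_iff[OF EXR[OF xy(1)] xy(2)] by blast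
    moreover have "e \<otimes>\<^bsub>R\<^esub> e' = \<zero>\<^bsub>R\<^esub>"
      using z m(1) loc.qt_zero_iff[OF R.m_closed[OF EXR[OF xy(1)] EXR[OF xy(4)]] loc.Z'_mult[OF xy(2,5)]] by simp
    ultimately have "e' = \<zero>\<^bsub>R\<^esub>" using EX_regular[OF xy(1) _ EXR[OF xy(4)]] by blast
    then show "y = \<zero>\<^bsub>loc.Q\<^esub>" using xy(6) loc.Q_zero[OF xy(5)] by simp
  qed
qed

lemma LL_field: "field LL"
  by (rule loc.Q.subfield_iff(2)[OF EL_subfield])

text \<open>A basis of the quotient ring over \<open>F(x)\<close> has \<open>d^2 n^2\<close>
  elements, which is the dimension of the matrix ring over its scalars. Independence of the images
  over \<open>E(x)\<close> therefore suffices.\<close>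

lemma splitting:
  assumes v: "left_basis R (DX E) v (d * n)"
  shows "is_splitting loc.Q K LL (d * n) (\<lambda>k. k) (left_basis.row_rep loc.Q EL (\<lambda>i. loc.emb (v i)) (d * n))"
proof -
  define m where "m = d * n"
  have m: "0 < m" using d_pos n by (simp add: m_def)
  interpret q: left_basis loc.Q EL "\<lambda>i. loc.emb (v i)" m
    unfolding m_def by (rule loc.frac_left_basis[OF v FX_EX])
  interpret LL: field LL by (rule LL_field)
  define MM where "MM = matrix_ring LL m"
  interpret MM: ring MM unfolding MM_def by (rule LL.matrix_ring_is_ring)
  define S where "S = scalar_matrix LL m ` carrier LL"
  have S: "subfield S MM" unfolding S_def MM_def by (rule LL.scalar_matrix_subfield(1)[OF m])
  obtain w where w: "left_basis A F w (d ^ 2 * n)"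
    and sep: "\<And>\<epsilon> k. (\<And>i. i < d ^ 2 * n \<Longrightarrow> \<epsilon> i \<in> carrier A) \<Longrightarrow>
      (\<And>v r. v \<in> carrier A \<Longrightarrow> r < n \<Longrightarrow> (\<Oplus>i\<in>{..<d ^ 2 * n}. \<epsilon> i \<otimes> v \<otimes> (\<sigma> ^^ r) (w i)) = \<zero>) \<Longrightarrow>
      k < d ^ 2 * n \<Longrightarrow> \<epsilon> k = \<zero>"
    using K_basis by blast
  interpret w: left_basis A F w "d ^ 2 * n" by fact
  define N where "N = d ^ 2 * n * n"
  have N: "N = m * m" by (simp add: N_def m_def power2_eq_square)
  define b where "b k = skew_monom A (w (k div n)) (k mod n)" for k
  have b: "left_basis loc.Q K (\<lambda>k. loc.emb (b k)) N"
    unfolding b_def N_def by (rule loc.frac_left_basis[OF R_left_basis[OF w] subset_refl])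
  interpret b: left_basis loc.Q K "\<lambda>k. loc.emb (b k)" N by (rule b)
  have wA: "w (k div n) \<in> carrier A" if "k < N" for k
    using that less_mult_imp_div_less[of k "d ^ 2 * n" n] by (intro w.v_closed) (simp add: N_def)
  have bR: "b k \<in> carrier R" if "k < N" for k using wA[OF that] by (simp add: b_def)
  define bs where "bs = map (\<lambda>k. loc.emb (b k)) [0..<N]"
  have len: "length bs = N" by (simp add: bs_def)
  have bsk: "bs ! k = loc.emb (b k)" if "k < N" for k using that by (simp add: bs_def)
  have EXR: "e \<in> DX E \<Longrightarrow> e \<in> carrier R" for e using subringE(1)[OF EX_subring] by blast
  have indep: "l k = \<zero>\<^bsub>loc.Q\<^esub>"
    if l: "\<And>k. k < N \<Longrightarrow> l k \<in> EL"
      and z: "(\<Oplus>\<^bsub>MM\<^esub>k\<in>{..<N}. scalar_matrix LL m (l k) \<otimes>\<^bsub>MM\<^esub> q.row_rep (loc.emb (b k))) = \<zero>\<^bsub>MM\<^esub>"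
      and k: "k < N" for l k
  proof -
    obtain e g where g: "g \<in> loc.Z'" and e: "\<And>k. k < N \<Longrightarrow> e k \<in> DX E \<and> l k = loc.qt (e k) g"
      using loc.common_denominator[OF EX_subring FX_EX, of N l] l by blast
    have eR: "e k \<in> carrier R" "xsupp (e k)" if "k < N" for k using e[OF that] unfolding DX_def by blast+
    \<comment> \<open>The relation between the matrices, applied to an element \<open>y\<close> of
      \<open>R\<close> and freed of its common denominator.\<close>
    have R0: "(\<Oplus>\<^bsub>R\<^esub>k\<in>{..<N}. e k \<otimes>\<^bsub>R\<^esub> (y \<otimes>\<^bsub>R\<^esub> b k)) = \<zero>\<^bsub>R\<^esub>" if y: "y \<in> carrier R" for y
    proof -
      have tc: "e k \<otimes>\<^bsub>R\<^esub> (y \<otimes>\<^bsub>R\<^esub> b k) \<in> carrier R" if "k < N" for k using eR[OF that] bR[OF that] y by simp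
      have "loc.qt (\<Oplus>\<^bsub>R\<^esub>k\<in>{..<N}. e k \<otimes>\<^bsub>R\<^esub> (y \<otimes>\<^bsub>R\<^esub> b k)) g =
        (\<Oplus>\<^bsub>loc.Q\<^esub>k\<in>{..<N}. loc.qt (e k \<otimes>\<^bsub>R\<^esub> (y \<otimes>\<^bsub>R\<^esub> b k)) g)"
        using tc g by (intro loc.finsum_qt[symmetric]) auto
      also have "\<dots> = (\<Oplus>\<^bsub>loc.Q\<^esub>k\<in>{..<N}. l k \<otimes>\<^bsub>loc.Q\<^esub> (loc.emb y \<otimes>\<^bsub>loc.Q\<^esub> loc.emb (b k)))"
      proof (rule loc.Q.finsum_cong')
        fix k assume "k \<in> {..<N}"
        then have k: "k < N" by simp
        have "loc.qt (e k) g \<otimes>\<^bsub>loc.Q\<^esub> loc.emb (y \<otimes>\<^bsub>R\<^esub> b k) = loc.qt (e k \<otimes>\<^bsub>R\<^esub> (y \<otimes>\<^bsub>R\<^esub> b k)) (g \<otimes>\<^bsub>R\<^esub> \<one>\<^bsub>R\<^esub>)"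
          using eR[OF k] g y bR[OF k] by (intro loc.Q_mult) auto
        then show "loc.qt (e k \<otimes>\<^bsub>R\<^esub> (y \<otimes>\<^bsub>R\<^esub> b k)) g = l k \<otimes>\<^bsub>loc.Q\<^esub> (loc.emb y \<otimes>\<^bsub>loc.Q\<^esub> loc.emb (b k))"
          using e[OF k] g loc.emb_mult[OF y bR[OF k]] by simp
      qed (use l q.LC_closed y bR loc.emb_closed in auto)
      also have "\<dots> = \<zero>\<^bsub>loc.Q\<^esub>"
        by (rule q.row_rep_relation[OF LL.is_cring l b.v_closed z[unfolded MM_def] loc.emb_closed[OF y]])
      finally show ?thesis using tc g loc.qt_zero_iff[OF _ g] by (auto intro: R.finsum_closed)
    qed
    \<comment> \<open>The choice of the monomial \<open>y t^r\<close>, with \<open>y\<close> now in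
      \<open>A\<close>, supplies for each power \<open>x^q\<close> the relations required by
      \<open>sep\<close>.\<close>
    have cf0: "cf (e (i * n + j)) 0 q = \<zero>" if i: "i < d ^ 2 * n" and j: "j < n" for i j q
    proof (rule sep[OF _ _ i, of "\<lambda>i. cf (e (i * n + j)) 0 q"])
      have lt: "i * n + j < N" if "i < d ^ 2 * n" for i
      proof -
        have "i * n + j < Suc i * n" using j by simp
        also have "\<dots> \<le> N" unfolding N_def using that by (intro mult_le_mono1) simp
        finally show ?thesis .
      qed
      then show "cf (e (i * n + j)) 0 q \<in> carrier A" if "i < d ^ 2 * n" for i using eR(1)[OF lt[OF that]] by simp
      fix y r assume y: "y \<in> carrier A" and r: "r < n"
      show "(\<Oplus>i\<in>{..<d ^ 2 * n}. cf (e (i * n + j)) 0 q \<otimes> y \<otimes> (\<sigma> ^^ r) (w i)) = \<zero>"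
      proof (rule twisted_coefficients[OF _ w.v_closed y _ j])
        show "e k \<in> carrier R \<and> xsupp (e k)" if "k < d ^ 2 * n * n" for k using eR[of k] that by (simp add: N_def)
        have "(\<Oplus>\<^bsub>R\<^esub>k\<in>{..<N}. e k \<otimes>\<^bsub>R\<^esub> skew_monom A y r \<otimes>\<^bsub>R\<^esub> b k) =
          (\<Oplus>\<^bsub>R\<^esub>k\<in>{..<N}. e k \<otimes>\<^bsub>R\<^esub> (skew_monom A y r \<otimes>\<^bsub>R\<^esub> b k))"
          using eR bR y by (intro R.finsum_cong') (auto simp: R.m_assoc)
        then show "(\<Oplus>\<^bsub>R\<^esub>k\<in>{..<d ^ 2 * n * n}. e k \<otimes>\<^bsub>R\<^esub> skew_monom A y r \<otimes>\<^bsub>R\<^esub>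
            skew_monom A (w (k div n)) (k mod n)) = \<zero>\<^bsub>R\<^esub>"
          using R0[OF monom_closed[OF y]] by (simp only: b_def N_def)
      qed
    qed
    have "e k = \<zero>\<^bsub>R\<^esub>"
    proof (rule DX_eqI)
      show "e k \<in> DX E" using e[OF k] by simp
      show "\<zero>\<^bsub>R\<^esub> \<in> DX E" by (rule subringE(2)[OF EX_subring])
      fix q
      have "k div n < d ^ 2 * n" "k mod n < n" using k n by (auto simp: N_def less_mult_imp_div_less)
      from cf0[OF this] show "cf (e k) 0 q = cf \<zero>\<^bsub>R\<^esub> 0 q" by simp
    qed
    then show ?thesis using e[OF k] loc.Q_zero[OF g] by simp
  qed
  have rrc: "q.row_rep z \<in> carrier MM" if "z \<in> carrier loc.Q" for z
    unfolding MM_def by (rule q.row_rep_closed[OF that])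
  have sc: "scalar_matrix LL m x \<in> carrier MM" if "x \<in> EL" for x
    unfolding MM_def using that by (intro LL.scalar_matrix_closed) simp
  have set: "set (map q.row_rep bs) \<subseteq> carrier MM"
    using rrc loc.emb_closed[OF bR] by (auto simp: bs_def)
  have "MM.independent S (map q.row_rep bs)"
  proof (rule MM.independentI[OF S set])
    show "length (map q.row_rep bs) = N" using len by simp
    fix s k assume s: "\<And>j. j < N \<Longrightarrow> s j \<in> S" and k: "k < N"
      and z: "(\<Oplus>\<^bsub>MM\<^esub>j\<in>{..<N}. s j \<otimes>\<^bsub>MM\<^esub> map q.row_rep bs ! j) = \<zero>\<^bsub>MM\<^esub>"
    have "\<forall>j. \<exists>x. j < N \<longrightarrow> x \<in> EL \<and> s j = scalar_matrix LL m x"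
      using s unfolding S_def by force
    then obtain l where l: "\<And>j. j < N \<Longrightarrow> l j \<in> EL \<and> s j = scalar_matrix LL m (l j)" by metis
    have "(\<Oplus>\<^bsub>MM\<^esub>j\<in>{..<N}. s j \<otimes>\<^bsub>MM\<^esub> map q.row_rep bs ! j) =
      (\<Oplus>\<^bsub>MM\<^esub>j\<in>{..<N}. scalar_matrix LL m (l j) \<otimes>\<^bsub>MM\<^esub> q.row_rep (loc.emb (b j)))"
      using l len bsk sc rrc loc.emb_closed[OF bR] by (intro MM.finsum_cong') auto
    then have "l k = \<zero>\<^bsub>loc.Q\<^esub>" using indep[of l k] l k z by simp
    then show "s k = \<zero>\<^bsub>MM\<^esub>" using l[OF k] by (simp add: MM_def scalar_matrix_def matrix_ring_def cong: if_cong)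
  qed
  moreover have "MM.Span S (map q.row_rep bs) = carrier MM"
  proof -
    have "MM.dimension N S (carrier MM)"
      unfolding MM_def S_def N by (rule LL.matrix_ring_dimension[OF m])
    from MM.independent_length_eq_dimension[OF S this \<open>MM.independent S (map q.row_rep bs)\<close> set]
    show ?thesis using len by simp
  qed
  ultimately have "ring_basis MM S (map q.row_rep bs)" using set by (simp add: ring_basis_def)
  moreover have "ring_basis loc.Q K bs"
    unfolding loc.Q.ring_basis_iff_left_basis[OF loc.frac_Z_subfield len]
  proof (rule loc.Q.left_basisI[OF b.LC])
    have eq: "(\<Oplus>\<^bsub>loc.Q\<^esub>j\<in>{..<N}. c j \<otimes>\<^bsub>loc.Q\<^esub> bs ! j) = (\<Oplus>\<^bsub>loc.Q\<^esub>j\<in>{..<N}. c j \<otimes>\<^bsub>loc.Q\<^esub> loc.emb (b j))"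
      if "\<And>j. j < N \<Longrightarrow> c j \<in> K" for c
      using that b.LC_closed b.v_closed bsk by (intro loc.Q.finsum_cong') auto
    show "bs ! j \<in> carrier loc.Q" if "j < N" for j using b.v_closed[OF that] bsk[OF that] by simp
    show "\<exists>c. (\<forall>j<N. c j \<in> K) \<and> z = (\<Oplus>\<^bsub>loc.Q\<^esub>j\<in>{..<N}. c j \<otimes>\<^bsub>loc.Q\<^esub> bs ! j)" if "z \<in> carrier loc.Q" for z
      using b.coord[OF that] eq[of "b.coord z"] by (intro exI[of _ "b.coord z"]) simp
    show "c k = \<zero>\<^bsub>loc.Q\<^esub>" if "\<And>j. j < N \<Longrightarrow> c j \<in> K" "(\<Oplus>\<^bsub>loc.Q\<^esub>j\<in>{..<N}. c j \<otimes>\<^bsub>loc.Q\<^esub> bs ! j) = \<zero>\<^bsub>loc.Q\<^esub>" "k < N" for c k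
      using b.indep[of c k] eq[of c] that by simp
  qed
  moreover have "(\<lambda>k. k) \<in> ring_hom (loc.Q\<lparr>carrier := K\<rparr>) LL"
    using loc.frac_mono[OF FX_EX] by (intro ring_hom_memI) auto
  moreover have "q.row_rep k = scalar_matrix LL m k" if k: "k \<in> K" for k
  proof (rule q.row_rep_central)
    show "k \<in> EL" using k loc.frac_mono[OF FX_EX] by blast
    show "k \<otimes>\<^bsub>loc.Q\<^esub> z = z \<otimes>\<^bsub>loc.Q\<^esub> k" if "z \<in> carrier loc.Q" for z
      using k that loc.Q_central unfolding loc.frac_def by blast
  qed
  ultimately show ?thesis
    unfolding is_splitting_def m_def[symmetric] MM_def S_def using LL_field q.row_rep_hom by blast
qed

theorem reduced_norm_integral_and_divisible:
  assumes f: "f \<in> carrier R"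
  shows "\<exists>\<delta>\<in>DX F. reduced_norm loc.Q K (loc.emb f) = loc.emb \<delta> \<and>
    (\<exists>g\<in>carrier R. g \<otimes>\<^bsub>R\<^esub> f = \<delta> \<and> f \<otimes>\<^bsub>R\<^esub> g = \<delta>)"
proof -
  define m where "m = d * n"
  obtain v where v: "left_basis R (DX E) v m" "left_basis loc.Q EL (\<lambda>i. loc.emb (v i)) m"
    unfolding m_def by (rule R_basis)
  interpret p: left_basis R "DX E" v m by (rule v(1))
  interpret q: left_basis loc.Q EL "\<lambda>i. loc.emb (v i)" m by (rule v(2))
  interpret LL: field LL by (rule LL_field)
  interpret EX: cring p.L
    using EX_subring EX_comm by (intro R.subcring_iff[THEN iffD1] R.subcringI) (auto dest: p.LC_closed)
  have EXR: "e \<in> DX E \<Longrightarrow> e \<in> carrier R" for e by (rule p.LC_closed)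
  define \<delta> where "\<delta> = determinant p.L m (p.row_rep f)"
  have \<delta>E: "\<delta> \<in> DX E" using EX.determinant_closed[OF p.row_rep_closed[OF f]] by (simp add: \<delta>_def)
  have embL: "(\<lambda>e. loc.emb e) \<in> ring_hom p.L LL"
  proof (rule ring_hom_memI)
    fix e assume "e \<in> carrier p.L"
    then have "e \<in> DX E" by simp
    then have "loc.emb e \<in> EL" unfolding loc.frac_def using loc.Z'_one by blast
    then show "loc.emb e \<in> carrier LL" by simp
  qed (auto simp: loc.emb_mult loc.emb_add EXR ring_hom_one[OF loc.emb_hom])
  \<comment> \<open>Coordinates over \<open>E(x)\<close> are unique, and the equations over
    \<open>E[x]\<close> that define the matrix of \<open>f\<close> map to equations over
    \<open>E(x)\<close>.\<close>
  have "q.row_rep (loc.emb f) = map_mat (\<lambda>e. loc.emb e) (p.row_rep f)"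
  proof (rule q.row_rep_eqI)
    show "map_mat (\<lambda>e. loc.emb e) (p.row_rep f) \<in> carrier (matrix_ring LL m)"
      by (rule ring_hom_closed[OF matrix_ring_hom[OF EX.ring_axioms LL.ring_axioms embL] p.row_rep_closed[OF f]])
    show "loc.emb f \<in> carrier loc.Q" using f by (rule loc.emb_closed)
    fix i assume i: "i < m"
    have fe: "p.row_rep f $$ (i, j) \<in> carrier R" if "j < m" for j using EXR[OF p.row_rep_entry[OF f i that]] .
    have "loc.emb (v i) \<otimes>\<^bsub>loc.Q\<^esub> loc.emb f = loc.emb (v i \<otimes>\<^bsub>R\<^esub> f)"
      using p.v_closed[OF i] f by (simp add: loc.emb_mult)
    also have "\<dots> = loc.emb (\<Oplus>\<^bsub>R\<^esub>j\<in>{..<m}. p.row_rep f $$ (i, j) \<otimes>\<^bsub>R\<^esub> v j)"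
      using p.row_rep[OF f i] by simp
    also have "\<dots> = (\<Oplus>\<^bsub>loc.Q\<^esub>j\<in>{..<m}. loc.emb (p.row_rep f $$ (i, j) \<otimes>\<^bsub>R\<^esub> v j))"
      using fe p.v_closed by (intro ring_hom_finsum[OF R.ring_axioms loc.Q.ring_axioms loc.emb_hom]) auto
    also have "\<dots> = (\<Oplus>\<^bsub>loc.Q\<^esub>j\<in>{..<m}. map_mat (\<lambda>e. loc.emb e) (p.row_rep f) $$ (i, j) \<otimes>\<^bsub>loc.Q\<^esub> loc.emb (v j))"
      using fe p.v_closed i p.row_rep_closed[OF f] loc.emb_closed
      by (intro loc.Q.finsum_cong') (auto simp: loc.emb_mult matrix_ring_carrier)
    finally show "loc.emb (v i) \<otimes>\<^bsub>loc.Q\<^esub> loc.emb f =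
      (\<Oplus>\<^bsub>loc.Q\<^esub>j\<in>{..<m}. map_mat (\<lambda>e. loc.emb e) (p.row_rep f) $$ (i, j) \<otimes>\<^bsub>loc.Q\<^esub> loc.emb (v j))" .
  qed
  then have det: "determinant LL m (q.row_rep (loc.emb f)) = loc.emb \<delta>"
    using determinant_hom[OF EX.is_cring LL.is_cring embL p.row_rep_closed[OF f]] by (simp add: \<delta>_def)
  have "is_splitting loc.Q K LL m (\<lambda>k. k) q.row_rep"
    using splitting v(1) unfolding m_def by blast
  note rn = reduced_norm_eq[OF loc.Q.ring_axioms loc.frac_Z_subfield EL_subring refl loc.frac_mono[OF FX_EX] this
      _ loc.emb_closed[OF f], unfolded det]
  \<comment> \<open>The denominator is central and can be cancelled, so the numerator alone commutes
    with \<open>R\<close>.\<close>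
  have center: "l \<in> K" if l: "l \<in> EL" and c: "\<And>y. y \<in> carrier loc.Q \<Longrightarrow> l \<otimes>\<^bsub>loc.Q\<^esub> y = y \<otimes>\<^bsub>loc.Q\<^esub> l" for l
  proof -
    obtain e g where e: "e \<in> DX E" "g \<in> loc.Z'" "l = loc.qt e g" using l unfolding loc.frac_def by blast
    have "e \<otimes>\<^bsub>R\<^esub> h = h \<otimes>\<^bsub>R\<^esub> e" if h: "h \<in> carrier R" for h
    proof -
      have "loc.qt (e \<otimes>\<^bsub>R\<^esub> h) g = loc.qt (h \<otimes>\<^bsub>R\<^esub> e) g"
        using c[OF loc.emb_closed[OF h]] e(1,2) EXR[OF e(1)] h unfolding e(3) by (simp add: loc.Q_mult)
      then show ?thesis
        using e(2) EXR[OF e(1)] h loc.cancel[of "e \<otimes>\<^bsub>R\<^esub> h" "h \<otimes>\<^bsub>R\<^esub> e" g] by (simp add: loc.qt_eq_iff)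
    qed
    then have "e \<in> DX F" using FX_iff[OF e(1)] by blast
    then show ?thesis using e(2,3) unfolding loc.frac_def by blast
  qed
  \<comment> \<open>That \<open>emb \<delta>\<close> lies in \<open>F(x)\<close> yields a fraction
    only. Instead of clearing its denominator, centrality is pulled back along the embedding, and a
    central element of \<open>E[x]\<close> lies in \<open>F[x]\<close>.\<close>
  have \<delta>c: "\<delta> \<otimes>\<^bsub>R\<^esub> h = h \<otimes>\<^bsub>R\<^esub> \<delta>" if h: "h \<in> carrier R" for h
  proof -
    obtain p0 q0 where pq: "p0 \<in> DX F" "q0 \<in> loc.Z'" "loc.emb \<delta> = loc.qt p0 q0"
      using rn(2)[OF center] unfolding loc.frac_def by blast
    have "loc.emb \<delta> \<otimes>\<^bsub>loc.Q\<^esub> loc.emb h = loc.emb h \<otimes>\<^bsub>loc.Q\<^esub> loc.emb \<delta>"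
      unfolding pq(3) by (rule loc.Q_central[OF pq(1,2) loc.emb_closed[OF h]])
    then show ?thesis
      using h EXR[OF \<delta>E] loc.emb_inj[of "\<delta> \<otimes>\<^bsub>R\<^esub> h" "h \<otimes>\<^bsub>R\<^esub> \<delta>"] by (simp add: loc.emb_mult)
  qed
  then have "\<delta> \<in> DX F" using FX_iff[OF \<delta>E] by blast
  moreover have "\<exists>g\<in>carrier R. g \<otimes>\<^bsub>R\<^esub> f = \<delta> \<and> f \<otimes>\<^bsub>R\<^esub> g = \<delta>"
    using EX_regular EXR \<delta>c by (intro p.divides_determinant[OF EX.is_cring _ f \<delta>_def]) blast+
  ultimately show ?thesis using rn(1)[OF center] by blast
qed

end

section \<open>Translation into the rings and maps of the statement\<close>

theorem theorem9:
  fixes A :: "('a, 'm) ring_scheme"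
    and C E F :: "'a set"
    and \<sigma> :: "'a \<Rightarrow> 'a"
    and u :: 'a
    and d n :: nat
    and R :: "(nat \<Rightarrow> 'a) ring"
    and x :: "nat \<Rightarrow> 'a"
    and Fx :: "(nat \<Rightarrow> 'a) set"
    and Q :: "((nat \<Rightarrow> 'a) \<times> (nat \<Rightarrow> 'a)) set ring"
    and emb :: "(nat \<Rightarrow> 'a) \<Rightarrow> ((nat \<Rightarrow> 'a) \<times> (nat \<Rightarrow> 'a)) set"
    and N :: "(nat \<Rightarrow> 'a) \<Rightarrow> ((nat \<Rightarrow> 'a) \<times> (nat \<Rightarrow> 'a)) set"
  assumes "central_simple_algebra A C d"
    and "\<sigma> \<in> ring_iso A A"
    and "order_mod_inner A \<sigma> n"
    and "order_on C \<sigma> n"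
    and "F = C \<inter> Fix A \<sigma>"
    and "u \<in> Units A"
    and "\<forall>z \<in> carrier A. (\<sigma> ^^ n) z = u \<otimes>\<^bsub>A\<^esub> z \<otimes>\<^bsub>A\<^esub> inv\<^bsub>A\<^esub> u"
    and "\<sigma> u = u"
    and "R = skew_poly_ring A \<sigma>"
    and "x = skew_monom A (inv\<^bsub>A\<^esub> u) n"
    and "Fx = ring.simple_extension R ((\<lambda>c. skew_monom A c 0) ` F) x"
    and "Q = central_quot_ring R Fx"
    and "emb = (\<lambda>f. quot R Fx f \<one>\<^bsub>R\<^esub>)"
    and "N = (\<lambda>f. reduced_norm Q (central_quot_field R Fx) (emb f))"
    and "subfield E A"
    and "C \<subseteq> E"
    and "ring.dimension A d C E"
  shows "\<forall>f \<in> carrier R.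
           N f \<in> emb ` Fx \<and>
           (\<exists>g \<in> carrier R. N f = emb (g \<otimes>\<^bsub>R\<^esub> f) \<and> N f = emb (f \<otimes>\<^bsub>R\<^esub> g))"
proof -
  have A: "ring A" using assms(1) by (simp add: central_simple_algebra_def simple_ring_def)
  have "\<sigma> \<in> ring_hom A A" using assms(2) by (simp add: ring_iso_def)
  moreover have "0 < n" using assms(4) by (simp add: order_on_def least_positive_def)
  ultimately interpret S: skew_csa A \<sigma> u n C E d
    using A assms(1,2,4,6-8,15-17)
    by (intro skew_csa.intro skew_x.intro skew_poly.intro skew_poly_axioms.intro skew_x_axioms.intro skew_csa_axioms.intro) auto
  have F: "F = S.F" by (simp add: assms(5) S.F_def)
  have Fx: "Fx = S.DX S.F"
    unfolding assms(9-11) F by (rule S.simple_extension_eq_DX[OF S.F_subring])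
  show ?thesis
  proof
    fix f assume "f \<in> carrier R"
    then have f: "f \<in> carrier S.R" by (simp only: assms(9))
    obtain \<delta> g where \<delta>: "\<delta> \<in> S.DX S.F" "reduced_norm S.loc.Q S.K (S.loc.emb f) = S.loc.emb \<delta>"
      and g: "g \<in> carrier S.R" "g \<otimes>\<^bsub>S.R\<^esub> f = \<delta>" "f \<otimes>\<^bsub>S.R\<^esub> g = \<delta>"
      using S.reduced_norm_integral_and_divisible[OF f] by blast
    have emb: "emb h = S.loc.emb h" for h
      unfolding assms(13) assms(9)[symmetric] Fx by simp
    have "N f = reduced_norm S.loc.Q S.K (S.loc.emb f)"
      unfolding assms(14) assms(12) emb S.loc.central_quot_field_eq[symmetric] Fx assms(9) ..
    then have N: "N f = emb \<delta>"
      unfolding emb by (rule trans[OF _ \<delta>(2)])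
    have "g \<in> carrier R" "N f = emb (g \<otimes>\<^bsub>R\<^esub> f)" "N f = emb (f \<otimes>\<^bsub>R\<^esub> g)"
      using g(1) unfolding assms(9) g(2,3) by - (assumption, rule N, rule N)
    then show "N f \<in> emb ` Fx \<and>
           (\<exists>g \<in> carrier R. N f = emb (g \<otimes>\<^bsub>R\<^esub> f) \<and> N f = emb (f \<otimes>\<^bsub>R\<^esub> g))"
      using N \<delta>(1) unfolding Fx by (intro conjI image_eqI bexI)
  qed
qed

end
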